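(* Let $k$ be a field of characteristic zero, $R = k[x_1,\ldots,x_n]$ with its standard grading, and $\mathscr{D} = \mathscr{D}(R,k)$ the ring of $k$-linear differential operators on $R$. Let $E = H^n_{(x_1,\ldots,x_n)}(R)$, and let $M$ be a graded $\mathscr{D}$-module with graded Matlis dual $\mathrm{D}(M)={}^*\mathrm{Hom}_R(M,E)$. (a) For all $i\ge 0$, $H^i_{dR}(\mathrm{D}(M))\cong {}^*\mathrm{Ext}^i_{\mathscr{D}}(M,E)$ as $k$-spaces. (b) If $M$ is finitely generated as a $\mathscr{D}$-module and has finite-dimensional de Rham cohomology (i.e. $\dim_k H^j_{dR}(M)<\infty$ for all $j$; for instance, if $M$ is holonomic), then $\dim_k(H^{n-i}_{dR}(M)) = \dim_k(\mathrm{Ext}^i_{\mathscr{D}}(M,E))$ for all $i\ge 0$.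
   Context: $\mathscr{D} = R\langle\partial_1,\ldots,\partial_n\rangle$ with $\partial_i = \partial/\partial x_i$; $\mathscr{D}$-modules are left modules. All gradings are $\mathbb{Z}$-gradings, with $\deg x_i = 1$, $\deg c=0$ for $c\in k$, and $\deg\partial_i=-1$. A graded $\mathscr{D}$-module is a left $\mathscr{D}$-module $M$ whose underlying $R$-module is graded, $M=\bigoplus_{l\in\mathbb{Z}}M_l$, with $\partial_i(M_l)\subseteq M_{l-1}$ for all $l$ and all $1\le i\le n$. $E$ has $k$-basis the inverse monomials $x_1^{i_1}\cdots x_n^{i_n}$ with all $i_j\le -1$. Multiplication by $x_j$ raises the exponent $i_j$ by one (giving $0$ if the exponent becomes $0$), $\partial_j$ acts by formal differentiation, and $\deg(x_1^{i_1}\cdots x_n^{i_n}) = i_1+\cdots+i_n$. With this structure $E$ is a graded $\mathscr{D}$-module. For $A=R$ or $A=\mathscr{D}$ and graded $A$-modules $M,N$, ${}^*\mathrm{Hom}_A(M,N)=\bigoplus_{d\in\mathbb{Z}}\mathrm{Hom}_A(M,N)_d$, where $\mathrm{Hom}_A(M,N)_d$ is the group of $A$-linear maps $f$ with $f(M_l)\subseteq N_{l+d}$ for all $l$. ${}^*\mathrm{Ext}^i_A$ denotes the right derived functors of ${}^*\mathrm{Hom}_A$ on the category of graded $A$-modules with degree-preserving $A$-linear maps (an abelian category with enough projectives and injectives). $\mathrm{Ext}^i_{\mathscr{D}}$ is the usual ungraded Ext. The graded Matlis dual $\mathrm{D}(M)={}^*\mathrm{Hom}_R(M,E)$ is a graded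 $\mathscr{D}$-module via its $R$-module structure and $(\partial_i\cdot\varphi)(m)=\partial_i\cdot\varphi(m)-\varphi(\partial_i\cdot m)$. The de Rham complex $M\otimes\Omega_R^\bullet$ of a $\mathscr{D}$-module $M$ has $M\otimes\Omega_R^i=\bigoplus_{1\le j_1<\cdots<j_i\le n} M\,dx_{j_1}\wedge\cdots\wedge dx_{j_i}$ for $0\le i\le n$, with $k$-linear differential $d^i(m\,dx_{j_1}\wedge\cdots\wedge dx_{j_i})=\sum_{s=1}^n\partial_s(m)\,dx_s\wedge dx_{j_1}\wedge\cdots\wedge dx_{j_i}$; $H^i_{dR}(M)$ is its $i$-th cohomology (zero for indices outside $0,\ldots,n$). *)

theory Defs
  imports "HOL-Library.Poly_Mapping" "HOL-Library.Function_Algebras" "HOL-Library.Cardinality"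
begin

section \<open>Polynomials and differential operators\<close>

type_synonym ('n, 'k) mpoly = "('n \<Rightarrow>\<^sub>0 nat) \<Rightarrow>\<^sub>0 'k"

definition pconst :: "'k \<Rightarrow> ('n, 'k::comm_ring_1) mpoly" where
  "pconst c = Poly_Mapping.single 0 c"

definition pvar :: "'n \<Rightarrow> ('n, 'k::comm_ring_1) mpoly" where
  "pvar i = Poly_Mapping.single (Poly_Mapping.single i 1) 1"

text \<open>If the exponent of \<open>x\<^sub>i\<close> is \<open>0\<close>, the truncated subtraction below is harmless: the coefficient
  vanishes.\<close>

definition pdiff :: "'n \<Rightarrow> ('n, 'k::comm_ring_1) mpoly \<Rightarrow> ('n, 'k) mpoly" where
  "pdiff i p = (\<Sum>a\<in>Poly_Mapping.keys p. Poly_Mapping.single (a - Poly_Mapping.single i 1)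
     (of_nat (Poly_Mapping.lookup a i) * Poly_Mapping.lookup p a))"

definition hom_poly :: "nat \<Rightarrow> ('n::finite, 'k::comm_ring_1) mpoly set" where
  "hom_poly j = {p. \<forall>a\<in>Poly_Mapping.keys p. (\<Sum>i\<in>UNIV. Poly_Mapping.lookup a i) = j}"

text \<open>The ring of differential operators is the subring of the \<open>k\<close>-linear endomorphisms of the
  polynomial ring generated by the multiplication operators and the partial derivatives; in
  characteristic zero this is the full ring of differential operators.\<close>

inductive_set diffops :: "(('n, 'k::comm_ring_1) mpoly \<Rightarrow> ('n, 'k) mpoly) set" where
  mult: "(\<lambda>f. p * f) \<in> diffops"
| diff: "pdiff i \<in> diffops"
| add: "P \<in> diffops \<Longrightarrow> Q \<in> diffops \<Longrightarrow> (\<lambda>f. P f + Q f) \<in> diffops"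
| comp: "P \<in> diffops \<Longrightarrow> Q \<in> diffops \<Longrightarrow> (\<lambda>f. P (Q f)) \<in> diffops"

typedef (overloaded) ('n, 'k) dop =
  "diffops :: (('n, 'k::comm_ring_1) mpoly \<Rightarrow> ('n, 'k) mpoly) set"
  using diffops.mult by blast

setup_lifting type_definition_dop

lemma sum_keys_add:
  fixes f :: "'a \<Rightarrow> 'b::comm_monoid_add \<Rightarrow> 'c::comm_monoid_add"
  assumes "\<And>a. f a 0 = 0" and "\<And>a x y. f a (x + y) = f a x + f a y"
  shows "(\<Sum>a\<in>Poly_Mapping.keys (p + q). f a (Poly_Mapping.lookup (p + q) a)) =
    (\<Sum>a\<in>Poly_Mapping.keys p. f a (Poly_Mapping.lookup p a)) +
    (\<Sum>a\<in>Poly_Mapping.keys q. f a (Poly_Mapping.lookup q a))"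
  by (rule setsum_keys_plus_distrib) (simp_all add: assms)

lemma pdiff_add: "pdiff i (p + q) = pdiff i p + pdiff i q"
  unfolding pdiff_def
  by (rule sum_keys_add) (simp_all add: distrib_left single_add)

lemma pdiff_single: "pdiff i (Poly_Mapping.single a c) =
    Poly_Mapping.single (a - Poly_Mapping.single i 1) (of_nat (Poly_Mapping.lookup a i) * c)"
  by (simp add: pdiff_def)

lemma pdiff_zero [simp]: "pdiff i 0 = 0"
  by (simp add: pdiff_def)

lemma pdiff_sum: "pdiff i (\<Sum>a\<in>A. f a) = (\<Sum>a\<in>A. pdiff i (f a))"
  by (induction A rule: infinite_finite_induct) (simp_all add: pdiff_add)

lemma mapping_eq_sum:
  "p = (\<Sum>a\<in>Poly_Mapping.keys p. Poly_Mapping.single a (Poly_Mapping.lookup p a))"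
proof (rule poly_mapping_eqI)
  fix k
  show "Poly_Mapping.lookup p k = Poly_Mapping.lookup
    (\<Sum>a\<in>Poly_Mapping.keys p. Poly_Mapping.single a (Poly_Mapping.lookup p a)) k"
    by (simp add: lookup_sum lookup_single when_def in_keys_iff)
qed

lemma mapping_induct [case_names zero add single]:
  fixes p :: "'a \<Rightarrow>\<^sub>0 'b::comm_monoid_add"
  assumes "P 0" and "\<And>p q. P p \<Longrightarrow> P q \<Longrightarrow> P (p + q)" and "\<And>a c. P (Poly_Mapping.single a c)"
  shows "P p"
proof -
  have "P (\<Sum>a\<in>A. Poly_Mapping.single a (Poly_Mapping.lookup p a))" for A
    by (induction A rule: infinite_finite_induct) (simp_all add: assms)
  then show ?thesis using mapping_eq_sum[of p] by metis
qed

lemma pdiff_mult_single: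
  fixes c d :: "'k::comm_ring_1"
  shows "pdiff i (Poly_Mapping.single a c * Poly_Mapping.single b d) =
    pdiff i (Poly_Mapping.single a c) * Poly_Mapping.single b d +
    Poly_Mapping.single a c * pdiff i (Poly_Mapping.single b d)"
proof -
  let ?e = "Poly_Mapping.single i (1::nat)"
  have sub: "u - ?e + v = u + v - ?e" if "Poly_Mapping.lookup u i \<noteq> 0" for u v :: "'a \<Rightarrow>\<^sub>0 nat"
    using that
    by (intro poly_mapping_eqI) (auto simp: lookup_add lookup_minus lookup_single when_def)
  have t1: "Poly_Mapping.single (a - ?e + b) (of_nat (Poly_Mapping.lookup a i) * (c * d)) =
      Poly_Mapping.single (a + b - ?e) (of_nat (Poly_Mapping.lookup a i) * (c * d))"
    using sub[of a b] by (cases "Poly_Mapping.lookup a i = 0") simp_all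
  have t2: "Poly_Mapping.single (a + (b - ?e)) (of_nat (Poly_Mapping.lookup b i) * (c * d)) =
      Poly_Mapping.single (a + b - ?e) (of_nat (Poly_Mapping.lookup b i) * (c * d))"
    using sub[of b a] by (cases "Poly_Mapping.lookup b i = 0") (simp_all add: add.commute)
  show ?thesis
    using t1 t2 by (simp add: mult_single pdiff_single lookup_add single_add[symmetric]
        algebra_simps)
qed

lemma pdiff_mult: "pdiff i (p * q) = pdiff i p * q + p * pdiff i q"
proof (induction p rule: mapping_induct)
  case (single a c)
  show ?case
    by (induction q rule: mapping_induct) (simp_all add: pdiff_add pdiff_mult_single algebra_simps)
qed (simp_all add: pdiff_add algebra_simps)

lemma pdiff_commute: "pdiff i (pdiff j p) = pdiff j (pdiff i p)"
proof (induction p rule: mapping_induct)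
  case (single a c)
  have "a - Poly_Mapping.single i 1 - Poly_Mapping.single j 1 =
      a - Poly_Mapping.single j 1 - Poly_Mapping.single i (1::nat)"
    by (intro poly_mapping_eqI) (auto simp: lookup_minus)
  then show ?case
    by (cases "i = j") (simp_all add: pdiff_single lookup_minus lookup_single when_def mult.left_commute)
qed (simp_all add: pdiff_add)

lemma pdiff_pconst [simp]: "pdiff i (pconst c) = 0"
  by (simp add: pconst_def pdiff_single)

lemma pdiff_pvar: "pdiff i (pvar j) = (if i = j then 1 else 0)"
  by (auto simp: pvar_def pdiff_single lookup_single when_def)

lemma diffops_add: "P \<in> diffops \<Longrightarrow> P (f + g) = P f + P g"
  by (induction P arbitrary: f g rule: diffops.induct) (simp_all add: pdiff_add algebra_simps)

instantiation dop :: (type, comm_ring_1) ring_1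
begin

lift_definition zero_dop :: "('a, 'b) dop" is "\<lambda>f. 0"
  using diffops.mult[of 0] by (simp add: lambda_zero)

lift_definition one_dop :: "('a, 'b) dop" is "\<lambda>f. f"
  using diffops.mult[of 1] by (simp add: lambda_one)

lift_definition plus_dop :: "('a, 'b) dop \<Rightarrow> ('a, 'b) dop \<Rightarrow> ('a, 'b) dop" is "\<lambda>P Q f. P f + Q f"
  by (rule diffops.add)

lift_definition uminus_dop :: "('a, 'b) dop \<Rightarrow> ('a, 'b) dop" is "\<lambda>P f. - P f"
  using diffops.comp[OF diffops.mult[of "-1"]] by simp

lift_definition minus_dop :: "('a, 'b) dop \<Rightarrow> ('a, 'b) dop \<Rightarrow> ('a, 'b) dop" is "\<lambda>P Q f. P f - Q f"
  subgoal for P Q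
    using diffops.add[OF _ diffops.comp[OF diffops.mult[of "-1"]], of P Q] by simp
  done

lift_definition times_dop :: "('a, 'b) dop \<Rightarrow> ('a, 'b) dop \<Rightarrow> ('a, 'b) dop" is "\<lambda>P Q f. P (Q f)"
  by (rule diffops.comp)

instance
proof
  show "(0::('a, 'b) dop) \<noteq> 1"
    by (transfer) (metis zero_neq_one)
qed (transfer; auto simp: diffops_add algebra_simps)+

end

definition dmult :: "('n, 'k::comm_ring_1) mpoly \<Rightarrow> ('n, 'k) dop" where
  "dmult p = Abs_dop (\<lambda>f. p * f)"

definition dpart :: "'n \<Rightarrow> ('n, 'k::comm_ring_1) dop" where
  "dpart i = Abs_dop (pdiff i)"

lemma Rep_dmult: "Rep_dop (dmult p) = (\<lambda>f. p * f)" and Rep_dpart: "Rep_dop (dpart i) = pdiff i"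
  by (simp_all add: dmult_def dpart_def Abs_dop_inverse diffops.mult diffops.diff)

abbreviation dconst :: "'k \<Rightarrow> ('n, 'k::comm_ring_1) dop" where
  "dconst c \<equiv> dmult (pconst c)"

inductive dop_homog :: "int \<Rightarrow> ('n, 'k::comm_ring_1) dop \<Rightarrow> bool" where
  const: "dop_homog 0 (dconst c)"
| var: "dop_homog 1 (dmult (pvar i))"
| part: "dop_homog (-1) (dpart i)"
| add: "dop_homog l P \<Longrightarrow> dop_homog l Q \<Longrightarrow> dop_homog l (P + Q)"
| mult: "dop_homog l P \<Longrightarrow> dop_homog l' Q \<Longrightarrow> dop_homog (l + l') (P * Q)"

definition dop_piece :: "int \<Rightarrow> ('n, 'k::comm_ring_1) dop set" where
  "dop_piece l = {P. dop_homog l P}"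


section \<open>Left modules, graded modules and homomorphisms\<close>

record ('a, 'm) lmod =
  mcar :: "'m set"
  mact :: "'a \<Rightarrow> 'm \<Rightarrow> 'm"

record ('a, 'm) grmod = "('a, 'm) lmod" +
  piece :: "int \<Rightarrow> 'm set"

definition add_subgroup :: "'m::ab_group_add set \<Rightarrow> bool" where
  "add_subgroup S \<longleftrightarrow> 0 \<in> S \<and> (\<forall>x\<in>S. \<forall>y\<in>S. x + y \<in> S) \<and> (\<forall>x\<in>S. - x \<in> S)"

definition left_module :: "('a::ring_1, 'm::ab_group_add, 'z) lmod_scheme \<Rightarrow> bool" where
  "left_module M \<longleftrightarrow> add_subgroup (mcar M) \<and>
    (\<forall>a. \<forall>x\<in>mcar M. mact M a x \<in> mcar M) \<and>
    (\<forall>a. \<forall>x\<in>mcar M. \<forall>y\<in>mcar M. mact M a (x + y) = mact M a x + mact M a y) \<and>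
    (\<forall>a b. \<forall>x\<in>mcar M. mact M (a + b) x = mact M a x + mact M b x) \<and>
    (\<forall>a b. \<forall>x\<in>mcar M. mact M (a * b) x = mact M a (mact M b x)) \<and>
    (\<forall>x\<in>mcar M. mact M 1 x = x)"

definition finitely_generated :: "('a::ring_1, 'm::ab_group_add, 'z) lmod_scheme \<Rightarrow> bool" where
  "finitely_generated M \<longleftrightarrow>
    (\<exists>G. finite G \<and> G \<subseteq> mcar M \<and> (\<forall>m\<in>mcar M. \<exists>a. m = (\<Sum>g\<in>G. mact M (a g) g)))"

definition internal_direct_sum :: "(int \<Rightarrow> 'm::ab_group_add set) \<Rightarrow> 'm set \<Rightarrow> bool" where
  "internal_direct_sum p S \<longleftrightarrow> (\<forall>l. add_subgroup (p l) \<and> p l \<subseteq> S) \<and>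
    (\<forall>m\<in>S. \<exists>!c. (\<forall>l. c l \<in> p l) \<and> finite {l. c l \<noteq> 0} \<and> m = (\<Sum>l | c l \<noteq> 0. c l))"

definition graded_dmodule ::
    "(('n::finite, 'k::field_char_0) dop, 'm::ab_group_add) grmod \<Rightarrow> bool" where
  "graded_dmodule M \<longleftrightarrow> left_module M \<and> internal_direct_sum (piece M) (mcar M) \<and>
    (\<forall>j l. \<forall>p\<in>hom_poly j. \<forall>m\<in>piece M l. mact M (dmult p) m \<in> piece M (l + int j)) \<and>
    (\<forall>i l. \<forall>m\<in>piece M l. mact M (dpart i) m \<in> piece M (l - 1))"

definition restrict_scalars :: "('b \<Rightarrow> 'a) \<Rightarrow> ('a, 'm) grmod \<Rightarrow> ('b, 'm) grmod" where
  "restrict_scalars h M = \<lparr>mcar = mcar M, mact = (\<lambda>b. mact M (h b)), piece = piece M\<rparr>"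

text \<open>Homomorphisms are normalised to vanish outside the carrier, so that equality of
  homomorphisms is equality of functions.\<close>

definition lhom :: "('a, 'm::ab_group_add, 'y) lmod_scheme \<Rightarrow>
    ('a, 'n::ab_group_add, 'z) lmod_scheme \<Rightarrow> ('m \<Rightarrow> 'n) set" where
  "lhom M N = {f. (\<forall>x\<in>mcar M. f x \<in> mcar N) \<and>
    (\<forall>x\<in>mcar M. \<forall>y\<in>mcar M. f (x + y) = f x + f y) \<and>
    (\<forall>a. \<forall>x\<in>mcar M. f (mact M a x) = mact N a (f x)) \<and>
    (\<forall>x. x \<notin> mcar M \<longrightarrow> f x = 0)}"

definition grhom :: "int \<Rightarrow> ('a, 'm::ab_group_add) grmod \<Rightarrow>
    ('a, 'n::ab_group_add) grmod \<Rightarrow> ('m \<Rightarrow> 'n) set" where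
  "grhom d M N = {f \<in> lhom M N. \<forall>l. f ` piece M l \<subseteq> piece N (l + d)}"

definition star_hom :: "('a, 'm::ab_group_add) grmod \<Rightarrow>
    ('a, 'n::ab_group_add) grmod \<Rightarrow> ('m \<Rightarrow> 'n) set" where
  "star_hom M N = {f. \<exists>g. (\<forall>d. g d \<in> grhom d M N) \<and> finite {d. g d \<noteq> 0} \<and>
    f = (\<Sum>d | g d \<noteq> 0. g d)}"


section \<open>\<open>\<D>\<close>-modules given by an \<open>R\<close>-action and derivations\<close>

definition dmodule_structure :: "'m::ab_group_add set \<Rightarrow>
    (('n, 'k::comm_ring_1) mpoly \<Rightarrow> 'm \<Rightarrow> 'm) \<Rightarrow> ('n \<Rightarrow> 'm \<Rightarrow> 'm) \<Rightarrow>
    (('n, 'k) dop \<Rightarrow> 'm \<Rightarrow> 'm) \<Rightarrow> bool" where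
  "dmodule_structure S r d act \<longleftrightarrow> left_module \<lparr>mcar = S, mact = act\<rparr> \<and>
    (\<forall>p. \<forall>m\<in>S. act (dmult p) m = r p m) \<and> (\<forall>i. \<forall>m\<in>S. act (dpart i) m = d i m) \<and>
    (\<forall>P m. m \<notin> S \<longrightarrow> act P m = 0)"

definition dmodule_of :: "'m::ab_group_add set \<Rightarrow>
    (('n, 'k::comm_ring_1) mpoly \<Rightarrow> 'm \<Rightarrow> 'm) \<Rightarrow> ('n \<Rightarrow> 'm \<Rightarrow> 'm) \<Rightarrow> (int \<Rightarrow> 'm set) \<Rightarrow>
    (('n, 'k) dop, 'm) grmod" where
  "dmodule_of S r d p = \<lparr>mcar = S, mact = (THE act. dmodule_structure S r d act), piece = p\<rparr>"

text \<open>The definite description in \<^const>\<open>dmodule_of\<close> is meaningful: in characteristic zero, an \<open>R\<close>-module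
  with pairwise commuting operators satisfying the Leibniz rule carries exactly one compatible
  \<open>\<D>\<close>-module structure.  This is proved in the rest of this section.\<close>

locale weyl_data =
  fixes S :: "'m::ab_group_add set"
    and r :: "('n, 'k::field_char_0) mpoly \<Rightarrow> 'm \<Rightarrow> 'm"
    and d :: "'n \<Rightarrow> 'm \<Rightarrow> 'm"
  assumes mod: "left_module \<lparr>mcar = S, mact = r\<rparr>"
    and d_closed: "m \<in> S \<Longrightarrow> d i m \<in> S"
    and d_add: "m \<in> S \<Longrightarrow> m' \<in> S \<Longrightarrow> d i (m + m') = d i m + d i m'"
    and d_leibniz: "m \<in> S \<Longrightarrow> d i (r p m) = r (pdiff i p) m + r p (d i m)"
    and d_commute: "m \<in> S \<Longrightarrow> d i (d j m) = d j (d i m)"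
begin

lemma S0: "0 \<in> S" and Sadd: "x \<in> S \<Longrightarrow> y \<in> S \<Longrightarrow> x + y \<in> S" and Sneg: "x \<in> S \<Longrightarrow> - x \<in> S"
  and r_closed: "x \<in> S \<Longrightarrow> r p x \<in> S"
  and r_add: "x \<in> S \<Longrightarrow> y \<in> S \<Longrightarrow> r p (x + y) = r p x + r p y"
  and r_add2: "x \<in> S \<Longrightarrow> r (p + q) x = r p x + r q x"
  and r_mult: "x \<in> S \<Longrightarrow> r (p * q) x = r p (r q x)"
  and r_one: "x \<in> S \<Longrightarrow> r 1 x = x"
  using mod by (auto simp: left_module_def add_subgroup_def)

lemma r_0: "r p 0 = 0"
  using r_add[of 0 0 p] S0 by simp

lemma r_02: "x \<in> S \<Longrightarrow> r 0 x = 0"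
  using r_add2[of x 0 0] by simp

lemma r_neg2: "x \<in> S \<Longrightarrow> r (- p) x = - r p x"
  using r_add2[of x p "- p"] r_02[of x] by (simp add: eq_neg_iff_add_eq_0 add.commute)

lemma d_0: "d i 0 = 0"
  using d_add[of 0 0 i] S0 by simp

definition dw :: "'n list \<Rightarrow> 'm \<Rightarrow> 'm" where "dw w m = foldr d w m"

lemma dw_simps [simp]: "dw [] m = m" "dw (i # w) m = d i (dw w m)"
  by (simp_all add: dw_def)

lemma dw_closed: "m \<in> S \<Longrightarrow> dw w m \<in> S"
  by (induction w) (auto simp: d_closed)

lemma dw_add: "m \<in> S \<Longrightarrow> m' \<in> S \<Longrightarrow> dw w (m + m') = dw w m + dw w m'"
  by (induction w) (auto simp: d_add dw_closed)

lemma dw_d: "m \<in> S \<Longrightarrow> dw w (d i m) = d i (dw w m)"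
  by (induction w) (auto simp: d_commute dw_closed)

definition ev :: "(('n, 'k) mpoly \<times> 'n list) list \<Rightarrow> 'm \<Rightarrow> 'm" where
  "ev xs m = (\<Sum>(p, w)\<leftarrow>xs. r p (dw w m))"

lemma ev_simps [simp]: "ev [] m = 0" "ev ((p, w) # xs) m = r p (dw w m) + ev xs m"
  "ev (xs @ ys) m = ev xs m + ev ys m"
  by (simp_all add: ev_def)

lemma ev_closed: "m \<in> S \<Longrightarrow> ev xs m \<in> S"
  by (induction xs) (auto simp: S0 Sadd r_closed dw_closed)

lemma ev_add: "m \<in> S \<Longrightarrow> m' \<in> S \<Longrightarrow> ev xs (m + m') = ev xs m + ev xs m'"
  by (induction xs) (auto simp: dw_add r_add r_closed dw_closed)

end

primrec removals :: "'n \<Rightarrow> 'n list \<Rightarrow> 'n list list" where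
  "removals i [] = []"
| "removals i (j # w) = map ((#) j) (removals i w) @ (if i = j then [w] else [])"

lemma length_removals: "v \<in> set (removals i w) \<Longrightarrow> Suc (length v) = length w"
  by (induction w arbitrary: v) (auto split: if_splits)

definition scale_list :: "('n, 'k::comm_ring_1) mpoly \<Rightarrow> (('n, 'k) mpoly \<times> 'n list) list \<Rightarrow>
    (('n, 'k) mpoly \<times> 'n list) list" where
  "scale_list p xs = map (\<lambda>(q, v). (p * q, v)) xs"

definition comm_list :: "'n \<Rightarrow> (('n, 'k::comm_ring_1) mpoly \<times> 'n list) list \<Rightarrow>
    (('n, 'k) mpoly \<times> 'n list) list" where
  "comm_list i xs = concat (map (\<lambda>(p, w). map (\<lambda>v. (p, v)) (removals i w)) xs)"

definition euler_list :: "nat \<Rightarrow> (('n, 'k::comm_ring_1) mpoly \<times> 'n list) list \<Rightarrow>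
    (('n, 'k) mpoly \<times> 'n list) list" where
  "euler_list n xs = map (\<lambda>(p, w). (of_nat (n - length w) * p, w))
     (filter (\<lambda>(p, w). length w < n) xs)"

definition dmul_list :: "'n \<Rightarrow> (('n, 'k::comm_ring_1) mpoly \<times> 'n list) list \<Rightarrow>
    (('n, 'k) mpoly \<times> 'n list) list" where
  "dmul_list i xs = concat (map (\<lambda>(p, w). [(p, i # w), (pdiff i p, w)]) xs)"

definition comp_list :: "(('n, 'k::comm_ring_1) mpoly \<times> 'n list) list \<Rightarrow>
    (('n, 'k) mpoly \<times> 'n list) list \<Rightarrow> (('n, 'k) mpoly \<times> 'n list) list" where
  "comp_list xs ys = concat (map (\<lambda>(p, w). scale_list p (foldr dmul_list w ys)) xs)"

context weyl_data
begin

lemma ev_scale_list: "m \<in> S \<Longrightarrow> ev (scale_list p xs) m = r p (ev xs m)"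
  by (induction xs)
    (auto simp: scale_list_def r_0 r_add r_closed ev_closed dw_closed r_mult)

lemma ev_dmul_list: "m \<in> S \<Longrightarrow> ev (dmul_list i xs) m = d i (ev xs m)"
  by (induction xs)
    (auto simp: dmul_list_def d_0 d_add r_closed ev_closed dw_closed d_leibniz add_ac)

lemma ev_foldr_dmul: "m \<in> S \<Longrightarrow> ev (foldr dmul_list w ys) m = dw w (ev ys m)"
  by (induction w) (auto simp: ev_dmul_list)

lemma ev_comp_list: "m \<in> S \<Longrightarrow> ev (comp_list xs ys) m = ev xs (ev ys m)"
  by (induction xs) (auto simp: comp_list_def ev_scale_list ev_foldr_dmul)

lemma sum_list_closed: "(\<And>v. v \<in> set vs \<Longrightarrow> f v \<in> S) \<Longrightarrow> (\<Sum>v\<leftarrow>vs. f v) \<in> S"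
  by (induction vs) (auto simp: S0 Sadd)

lemma d_sum_list: "(\<And>v. v \<in> set vs \<Longrightarrow> f v \<in> S) \<Longrightarrow> d i (\<Sum>v\<leftarrow>vs. f v) = (\<Sum>v\<leftarrow>vs. d i (f v))"
  by (induction vs) (auto simp: d_0 d_add sum_list_closed)

lemma r_sum_list: "(\<And>v. v \<in> set vs \<Longrightarrow> f v \<in> S) \<Longrightarrow> r p (\<Sum>v\<leftarrow>vs. f v) = (\<Sum>v\<leftarrow>vs. r p (f v))"
  by (induction vs) (auto simp: r_0 r_add sum_list_closed)

lemma dw_var:
  assumes "m \<in> S"
  shows "dw w (r (pvar i) m) = r (pvar i) (dw w m) + (\<Sum>v\<leftarrow>removals i w. dw v m)"
proof (induction w)
  case (Cons j w)
  have "dw (j # w) (r (pvar i) m) = d j (r (pvar i) (dw w m)) + d j (\<Sum>v\<leftarrow>removals i w. dw v m)"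
    using assms by (simp add: Cons d_add r_closed dw_closed sum_list_closed)
  also have "d j (\<Sum>v\<leftarrow>removals i w. dw v m) = (\<Sum>v\<leftarrow>removals i w. d j (dw v m))"
    using assms by (intro d_sum_list) (auto simp: dw_closed)
  also have "d j (r (pvar i) (dw w m)) = (if i = j then dw w m else 0) + r (pvar i) (d j (dw w m))"
    using assms by (auto simp: d_leibniz dw_closed pdiff_pvar r_one r_02)
  finally show ?case by (auto simp: o_def add_ac)
qed simp

lemma ev_comm_list:
  assumes "m \<in> S"
  shows "ev (comm_list i xs) m + r (pvar i) (ev xs m) = ev xs (r (pvar i) m)"
proof (induction xs)
  case (Cons x xs)
  obtain p w where x: "x = (p, w)" by (cases x)
  have c: "ev (map (\<lambda>v. (p, v)) vs) m = r p (\<Sum>v\<leftarrow>vs. dw v m)" for vs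
    using assms by (induction vs) (auto simp: r_0 r_add dw_closed sum_list_closed)
  have e: "r p (r (pvar i) (dw w m)) = r (pvar i) (r p (dw w m))"
    using assms r_mult[of "dw w m"] by (metis dw_closed mult.commute)
  have "r p (dw w (r (pvar i) m)) = r p (r (pvar i) (dw w m)) + r p (\<Sum>v\<leftarrow>removals i w. dw v m)"
    using assms by (simp add: dw_var r_add r_closed dw_closed sum_list_closed)
  with Cons show ?case using assms
    by (simp add: x comm_list_def c e r_add r_closed dw_closed ev_closed add_ac)
qed (simp add: comm_list_def r_0)

end

lemma sum_list_if_eq:
  "(\<Sum>i\<in>(A::'i set). (if i = j then x else (0::'b::comm_monoid_add))) = (if j \<in> A then x else 0)"
  if "finite A"
  using that by simp

context weyl_data
begin

lemma euler_word:
  assumes "m \<in> S" "finite A" "set w \<subseteq> A"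
  shows "(\<Sum>i\<in>A. \<Sum>v\<leftarrow>removals i w. dw v (d i m)) = r (of_nat (length w)) (dw w m)"
  using assms(3)
proof (induction w)
  case (Cons j w)
  have fin: "d j (sum f A) = (\<Sum>i\<in>A. d j (f i)) \<and> sum f A \<in> S" if "\<And>i. f i \<in> S" for f
    using assms(2) by (induction A) (auto simp: d_0 S0 d_add Sadd that)
  have cl: "(\<Sum>v\<leftarrow>removals i w. dw v (d i m)) \<in> S" for i
    using assms by (intro sum_list_closed dw_closed d_closed)
  have "(\<Sum>i\<in>A. \<Sum>v\<leftarrow>removals i (j # w). dw v (d i m)) =
      (\<Sum>i\<in>A. (\<Sum>v\<leftarrow>removals i w. d j (dw v (d i m))) + (if i = j then dw w (d j m) else 0))"
    by (intro sum.cong) (auto simp: o_def)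
  also have "\<dots> = (\<Sum>i\<in>A. d j (\<Sum>v\<leftarrow>removals i w. dw v (d i m))) + dw w (d j m)"
    using assms Cons.prems
    by (simp add: sum.distrib d_sum_list dw_closed d_closed)
  also have "(\<Sum>i\<in>A. d j (\<Sum>v\<leftarrow>removals i w. dw v (d i m))) =
      d j (r (of_nat (length w)) (dw w m))"
    using fin[of "\<lambda>i. \<Sum>v\<leftarrow>removals i w. dw v (d i m)"] cl Cons by simp
  also have "d j (r (of_nat (length w)) (dw w m)) = r (of_nat (length w)) (d j (dw w m))"
  proof -
    have "pdiff j (of_nat (length w) :: ('n, 'k) mpoly) = 0"
      by (metis pconst_def pdiff_pconst single_of_nat)
    then show ?thesis using assms by (simp add: d_leibniz dw_closed r_02)
  qed
  also have "dw w (d j m) = r 1 (d j (dw w m))"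
    using assms by (simp add: dw_d r_one d_closed dw_closed)
  finally show ?case
    using assms r_add2[of "d j (dw w m)" 1 "of_nat (length w)"]
    by (simp add: d_closed dw_closed add.commute)
qed (simp add: r_02 assms)

lemma ev_euler_list:
  assumes "m \<in> S" "finite A" "\<And>p w. (p, w) \<in> set xs \<Longrightarrow> set w \<subseteq> A \<and> length w \<le> n"
  shows "ev (euler_list n xs) m + (\<Sum>i\<in>A. ev (comm_list i xs) (d i m)) = r (of_nat n) (ev xs m)"
  using assms(3)
proof (induction xs)
  case (Cons x xs)
  obtain p w where x: "x = (p, w)" by (cases x)
  have w: "set w \<subseteq> A" "length w \<le> n" using Cons.prems[of p w] by (auto simp: x)
  have IH: "ev (euler_list n xs) m + (\<Sum>i\<in>A. ev (comm_list i xs) (d i m)) = r (of_nat n) (ev xs m)"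
    using Cons.prems by (intro Cons.IH) auto
  have c: "ev (map (\<lambda>v. (p, v)) vs) m' = r p (\<Sum>v\<leftarrow>vs. dw v m')" if "m' \<in> S" for vs m'
    using that by (induction vs) (auto simp: r_0 r_add dw_closed sum_list_closed)
  have rs: "r p (sum f A) = (\<Sum>i\<in>A. r p (f i)) \<and> sum f A \<in> S" if "\<And>i. f i \<in> S" for f
    using assms(2) by (induction A) (auto simp: r_0 S0 r_add Sadd that)
  have "(\<Sum>i\<in>A. ev (comm_list i [x]) (d i m)) = r p (\<Sum>i\<in>A. \<Sum>v\<leftarrow>removals i w. dw v (d i m))"
    using rs[of "\<lambda>i. \<Sum>v\<leftarrow>removals i w. dw v (d i m)"] assms
    by (simp add: comm_list_def x c d_closed sum_list_closed dw_closed)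
  also have "\<dots> = r (p * of_nat (length w)) (dw w m)"
    using euler_word[OF assms(1,2) w(1)] assms by (simp add: r_mult dw_closed)
  finally have s: "(\<Sum>i\<in>A. ev (comm_list i [x]) (d i m)) = r (p * of_nat (length w)) (dw w m)" .
  have t: "ev (euler_list n [x]) m = r (p * of_nat (n - length w)) (dw w m)"
    using assms w by (auto simp: euler_list_def x r_02 dw_closed mult.commute)
  have "r (p * of_nat (n - length w)) (dw w m) + r (p * of_nat (length w)) (dw w m) =
      r (of_nat n * p) (dw w m)"
    using assms w r_add2[of "dw w m" "p * of_nat (n - length w)" "p * of_nat (length w)"]
    by (simp add: dw_closed distrib_left[symmetric] of_nat_add[symmetric] mult.commute
        del: of_nat_add)
  with s t have one: "ev (euler_list n [x]) m + (\<Sum>i\<in>A. ev (comm_list i [x]) (d i m)) =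
      r (of_nat n) (r p (dw w m))"
    using assms by (simp add: r_mult dw_closed)
  have sp: "ev (euler_list n (x # xs)) m = ev (euler_list n [x]) m + ev (euler_list n xs) m"
    "ev (comm_list i (x # xs)) m' = ev (comm_list i [x]) m' + ev (comm_list i xs) m'" for i m'
    by (auto simp: euler_list_def comm_list_def x)
  show ?case
    using one IH assms unfolding sp sum.distrib
    by (simp add: x r_add r_closed dw_closed ev_closed add_ac)
qed (simp add: euler_list_def comm_list_def r_0)

end

interpretation poly_weyl: weyl_data UNIV "(*)" "pdiff :: 'n \<Rightarrow> ('n, 'k::field_char_0) mpoly \<Rightarrow> _"
  by unfold_locales
    (simp_all add: left_module_def add_subgroup_def algebra_simps pdiff_add pdiff_mult pdiff_commute)

context weyl_data
begin

lemma ev_eq_0: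
  assumes "\<And>p w. (p, w) \<in> set xs \<Longrightarrow> length w \<le> n" and "\<And>f. poly_weyl.ev xs f = 0" and "m \<in> S"
  shows "ev xs m = 0"
  using assms
proof (induction n arbitrary: xs m)
  case 0
  have nil: "w = []" if "(p, w) \<in> set xs" for p w
    using "0.prems"(1)[OF that] by simp
  have "ev xs m = r (poly_weyl.ev xs 1) m" if "\<And>p w. (p, w) \<in> set xs \<Longrightarrow> w = []" for xs
    using that
  proof (induction xs)
    case (Cons x xs)
    obtain p w where x: "x = (p, w)" by (cases x)
    have "w = []" using Cons.prems x by auto
    then show ?case using Cons "0.prems"(3) by (auto simp: x r_add2)
  qed (simp add: r_02 "0.prems"(3))
  with nil "0.prems" show ?case by (metis r_02)
next
  case (Suc n)
  define A where "A = (\<Union>(p, w)\<in>set xs. set w)"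
  have A: "finite A" "\<And>p w. (p, w) \<in> set xs \<Longrightarrow> set w \<subseteq> A \<and> length w \<le> Suc n"
    using Suc.prems(1) by (auto simp: A_def)
  have c0: "poly_weyl.ev (comm_list i xs) f = 0" for i f
    using poly_weyl.ev_comm_list[of f i xs] Suc.prems(2) by simp
  have cl: "length w \<le> n" if pw: "(p, w) \<in> set (comm_list i xs)" for p w i
  proof -
    from pw obtain u where u: "(p, u) \<in> set xs" "w \<in> set (removals i u)"
      unfolding comm_list_def by auto
    with Suc.prems(1)[OF u(1)] length_removals[OF u(2)] show ?thesis by simp
  qed
  have c: "ev (comm_list i xs) m' = 0" if "m' \<in> S" for i m'
    using Suc.IH[OF _ c0 that] cl by blast
  have e0: "poly_weyl.ev (euler_list (Suc n) xs) f = 0" for f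
    using poly_weyl.ev_euler_list[OF _ A(1), of f xs "Suc n"] A(2) c0 Suc.prems(2) by simp
  have "ev (euler_list (Suc n) xs) m = 0"
    by (rule Suc.IH[OF _ e0 Suc.prems(3)]) (auto simp: euler_list_def)
  then have z: "r (of_nat (Suc n)) (ev xs m) = 0"
    using ev_euler_list[OF Suc.prems(3) A(1), of xs "Suc n"] A(2) c d_closed[OF Suc.prems(3)]
    by simp
  have inv: "pconst (1 / of_nat (Suc n)) * of_nat (Suc n) = (1 :: ('n, 'k) mpoly)"
  proof -
    have "(of_nat (Suc n) :: ('n, 'k) mpoly) = pconst (of_nat (Suc n))"
      by (simp only: pconst_def single_of_nat)
    then show ?thesis
      by (simp only: pconst_def mult_single) (simp del: of_nat_Suc)
  qed
  have "ev xs m = r (pconst (1 / of_nat (Suc n)) * of_nat (Suc n)) (ev xs m)"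
    unfolding inv using Suc.prems(3) by (simp add: r_one ev_closed)
  also have "\<dots> = 0"
    using z Suc.prems(3) r_mult[of "ev xs m" "pconst (1 / of_nat (Suc n))" "of_nat (Suc n)"]
    by (simp add: r_0 ev_closed del: of_nat_Suc)
  finally show ?case .
qed

lemma ev_unique:
  assumes "poly_weyl.ev xs = poly_weyl.ev ys" "m \<in> S"
  shows "ev xs m = ev ys m"
proof -
  let ?zs = "xs @ scale_list (- 1) ys"
  obtain n where n: "\<And>p w. (p, w) \<in> set ?zs \<Longrightarrow> length w \<le> n"
    using finite_imageI[OF List.finite_set, of "length \<circ> snd" ?zs] 
    by (metis (no_types, lifting) Max_ge comp_apply image_eqI snd_conv)
  have "ev ?zs m = 0"
    by (rule ev_eq_0[OF n _ assms(2)])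
      (simp_all add: poly_weyl.ev_scale_list assms(1))
  then show ?thesis using assms(2)
    by (simp add: ev_scale_list r_neg2 r_one ev_closed)
qed

end

lemma dop_ev: "\<exists>xs. Rep_dop (P :: ('n, 'k::field_char_0) dop) = poly_weyl.ev xs"
proof -
  have "\<exists>xs. Q = poly_weyl.ev xs" if "Q \<in> diffops" for Q :: "('n, 'k) mpoly \<Rightarrow> ('n, 'k) mpoly"
    using that
  proof (induction Q rule: diffops.induct)
    case (mult p)
    have "(\<lambda>f. p * f) = poly_weyl.ev [(p, [])]" by auto
    then show ?case by blast
  next
    case (diff i)
    have "pdiff i = poly_weyl.ev [(1, [i])]" by auto
    then show ?case by blast
  next
    case (add P Q)
    then obtain xs ys where "P = poly_weyl.ev xs" "Q = poly_weyl.ev ys" by blast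
    then have "(\<lambda>f. P f + Q f) = poly_weyl.ev (xs @ ys)" by auto
    then show ?case by blast
  next
    case (comp P Q)
    then obtain xs ys where "P = poly_weyl.ev xs" "Q = poly_weyl.ev ys" by blast
    then have "(\<lambda>f. P (Q f)) = poly_weyl.ev (comp_list xs ys)"
      by (auto simp: poly_weyl.ev_comp_list)
    then show ?case by blast
  qed
  then show ?thesis using Rep_dop by blast
qed

context weyl_data
begin

definition dact :: "('n, 'k) dop \<Rightarrow> 'm \<Rightarrow> 'm" where
  "dact P m = (if m \<in> S then ev (SOME xs. Rep_dop P = poly_weyl.ev xs) m else 0)"

lemma dact_eq: "Rep_dop P = poly_weyl.ev xs \<Longrightarrow> m \<in> S \<Longrightarrow> dact P m = ev xs m"
  unfolding dact_def by (simp, rule ev_unique) (metis (mono_tags, lifting) someI)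

lemma dmodule_structure_dact: "dmodule_structure S r d dact"
proof -
  have add: "dact (P + Q) m = dact P m + dact Q m" if "m \<in> S" for P Q m
  proof -
    obtain xs ys where "Rep_dop P = poly_weyl.ev xs" "Rep_dop Q = poly_weyl.ev ys"
      using dop_ev by meson
    moreover from this have "Rep_dop (P + Q) = poly_weyl.ev (xs @ ys)"
      by (auto simp: plus_dop.rep_eq)
    ultimately show ?thesis using dact_eq that by simp
  qed
  have mult: "dact (P * Q) m = dact P (dact Q m)" if "m \<in> S" for P Q m
  proof -
    obtain xs ys where "Rep_dop P = poly_weyl.ev xs" "Rep_dop Q = poly_weyl.ev ys"
      using dop_ev by meson
    moreover from this have "Rep_dop (P * Q) = poly_weyl.ev (comp_list xs ys)"
      by (auto simp: times_dop.rep_eq poly_weyl.ev_comp_list)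
    ultimately show ?thesis using dact_eq that by (simp add: ev_comp_list ev_closed)
  qed
  have base: "dact (dmult p) m = r p m" "dact (dpart i) m = d i m" if "m \<in> S" for p i m
  proof -
    have "Rep_dop (dmult p) = poly_weyl.ev [(p, [])]" "Rep_dop (dpart i) = poly_weyl.ev [(1, [i])]"
      by (auto simp: Rep_dmult Rep_dpart)
    from this[THEN dact_eq, OF that] show "dact (dmult p) m = r p m" "dact (dpart i) m = d i m"
      using that by (simp_all add: r_one d_closed)
  qed
  have "dmult 1 = (1 :: ('n, 'k) dop)" by (simp add: dmult_def one_dop_def)
  then have one: "dact 1 m = m" if "m \<in> S" for m
    using base(1)[of m 1] that by (simp add: r_one)
  have "left_module \<lparr>mcar = S, mact = dact\<rparr>"
    unfolding left_module_def using mod add mult one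
    by (auto simp: left_module_def dact_def ev_closed ev_add Sadd)
  then show ?thesis
    unfolding dmodule_structure_def using base by (simp add: dact_def)
qed

theorem ex1_dmodule_structure: "\<exists>!act. dmodule_structure S r d act"
proof (rule ex1I[of _ dact], rule dmodule_structure_dact)
  fix act assume a: "dmodule_structure S r d act"
  have "\<forall>m\<in>S. act (Abs_dop Q) m = dact (Abs_dop Q) m" if "Q \<in> diffops" for Q
    using that
  proof (induction Q rule: diffops.induct)
    case (mult p)
    have "Abs_dop (\<lambda>f. p * f) = dmult p" by (simp add: dmult_def)
    then show ?case using a dmodule_structure_dact by (simp add: dmodule_structure_def)
  next
    case (diff i)
    have "Abs_dop (pdiff i) = (dpart i :: ('n, 'k) dop)" by (simp add: dpart_def)
    then show ?case using a dmodule_structure_dact by (simp add: dmodule_structure_def)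
  next
    case (add P Q)
    have "Abs_dop (\<lambda>f. P f + Q f) = Abs_dop P + Abs_dop Q"
      using add.hyps by (simp add: plus_dop.abs_eq eq_onp_same_args)
    then show ?case using a dmodule_structure_dact add.IH
      by (simp add: dmodule_structure_def left_module_def)
  next
    case (comp P Q)
    have "Abs_dop (\<lambda>f. P (Q f)) = Abs_dop P * Abs_dop Q"
      using comp.hyps by (simp add: times_dop.abs_eq eq_onp_same_args)
    then show ?case using a dmodule_structure_dact comp.IH
      by (simp add: dmodule_structure_def left_module_def)
  qed
  then have "act P m = dact P m" if "m \<in> S" for P m
    using that by (metis Rep_dop Rep_dop_inverse)
  moreover have "act P m = dact P m" if "m \<notin> S" for P m
    using that a by (simp add: dmodule_structure_def dact_def)
  ultimately show "act = dact" by blast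
qed

end


section \<open>The module of inverse monomials and the graded Matlis dual\<close>

type_synonym ('n, 'k) inv_poly = "('n \<Rightarrow>\<^sub>0 int) \<Rightarrow>\<^sub>0 'k"

definition inv_exponent :: "('n \<Rightarrow>\<^sub>0 int) \<Rightarrow> bool" where
  "inv_exponent b \<longleftrightarrow> (\<forall>j. Poly_Mapping.lookup b j \<le> -1)"

definition inv_mult :: "('n, 'k::comm_ring_1) mpoly \<Rightarrow> ('n, 'k) inv_poly \<Rightarrow> ('n, 'k) inv_poly" where
  "inv_mult p e = (\<Sum>a\<in>Poly_Mapping.keys p. \<Sum>b\<in>Poly_Mapping.keys e.
     let c = Poly_Mapping.map int a + b in
     if inv_exponent c
     then Poly_Mapping.single c (Poly_Mapping.lookup p a * Poly_Mapping.lookup e b) else 0)"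

definition inv_diff :: "'n \<Rightarrow> ('n, 'k::comm_ring_1) inv_poly \<Rightarrow> ('n, 'k) inv_poly" where
  "inv_diff i e = (\<Sum>b\<in>Poly_Mapping.keys e. Poly_Mapping.single (b - Poly_Mapping.single i 1)
     (of_int (Poly_Mapping.lookup b i) * Poly_Mapping.lookup e b))"

definition inv_carrier :: "('n, 'k::comm_ring_1) inv_poly set" where
  "inv_carrier = {e. \<forall>b\<in>Poly_Mapping.keys e. inv_exponent b}"

text \<open>The top local cohomology module \<open>E\<close> of the polynomial ring with support in the ideal of the
  variables, on its \<open>k\<close>-basis of inverse monomials: a product of monomials with some exponent
  \<open>\<ge> 0\<close> is \<open>0\<close>.\<close>

definition inv_module :: "(('n::finite, 'k::field_char_0) dop, ('n, 'k) inv_poly) grmod" where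
  "inv_module = dmodule_of inv_carrier inv_mult inv_diff
     (\<lambda>l. {e \<in> inv_carrier. \<forall>b\<in>Poly_Mapping.keys e. (\<Sum>i\<in>UNIV. Poly_Mapping.lookup b i) = l})"

lemma lookup_map_int: "Poly_Mapping.lookup (Poly_Mapping.map int a) j = int (Poly_Mapping.lookup a j)"
  by (simp add: Poly_Mapping.map.rep_eq when_def)

lemma map_int_0 [simp]: "Poly_Mapping.map int 0 = 0"
  by (rule poly_mapping_eqI) (simp add: lookup_map_int)

lemma map_int_add: "Poly_Mapping.map int (a + a') = Poly_Mapping.map int a + Poly_Mapping.map int a'"
  by (intro poly_mapping_eqI) (simp add: lookup_add lookup_map_int)

lemma inv_mult_add1: "inv_mult (p + q) e = inv_mult p e + inv_mult q e"
  unfolding inv_mult_def Let_def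
  by (rule sum_keys_add) (auto simp: distrib_right single_add sum.distrib[symmetric]
      intro!: sum.cong sum.neutral)

lemma inv_mult_add2: "inv_mult p (e + e') = inv_mult p e + inv_mult p e'"
  unfolding inv_mult_def Let_def sum.distrib[symmetric]
  by (intro sum.cong refl, rule sum_keys_add) (auto simp: distrib_left single_add)

lemma inv_mult_0 [simp]: "inv_mult 0 e = 0" "inv_mult p 0 = 0"
  by (simp_all add: inv_mult_def)

lemma inv_mult_single: "inv_mult (Poly_Mapping.single a x) (Poly_Mapping.single b y) =
    (if inv_exponent (Poly_Mapping.map int a + b)
     then Poly_Mapping.single (Poly_Mapping.map int a + b) (x * y) else 0)"
  by (cases "x = 0"; cases "y = 0") (simp_all add: inv_mult_def Let_def)

lemma inv_diff_add: "inv_diff i (e + e') = inv_diff i e + inv_diff i e'"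
  unfolding inv_diff_def by (rule sum_keys_add) (simp_all add: distrib_left single_add)

lemma inv_diff_0 [simp]: "inv_diff i 0 = 0"
  by (simp add: inv_diff_def)

lemma inv_diff_single: "inv_diff i (Poly_Mapping.single b y) =
    Poly_Mapping.single (b - Poly_Mapping.single i 1) (of_int (Poly_Mapping.lookup b i) * y)"
  by (simp add: inv_diff_def)

lemma inv_mult_mult: "inv_mult (p * q) e = inv_mult p (inv_mult q e)"
proof (induction p rule: mapping_induct)
  case (single a x)
  show ?case
  proof (induction q rule: mapping_induct)
    case (single a' x')
    have "inv_exponent (Poly_Mapping.map int a' + b)"
      if "inv_exponent (Poly_Mapping.map int (a + a') + b)" for b
      unfolding inv_exponent_def
    proof
      fix j
      show "Poly_Mapping.lookup (Poly_Mapping.map int a' + b) j \<le> - 1"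
        using that[unfolded inv_exponent_def, rule_format, of j]
        by (simp add: lookup_add lookup_map_int)
    qed
    then show ?case
      by (induction e rule: mapping_induct)
        (auto simp: inv_mult_add2 mult_single inv_mult_single map_int_add add_ac mult_ac)
  qed (simp_all add: distrib_left inv_mult_add1 inv_mult_add2)
qed (simp_all add: distrib_right inv_mult_add1)

lemma inv_mult_1:
  assumes "e \<in> inv_carrier"
  shows "inv_mult 1 e = e"
proof -
  have "inv_mult 1 e =
      (\<Sum>b\<in>Poly_Mapping.keys e. Poly_Mapping.single b (Poly_Mapping.lookup e b))"
    using assms by (simp add: inv_mult_def inv_carrier_def lookup_one)
  then show ?thesis using mapping_eq_sum[of e] by simp
qed

lemma inv_leibniz: "inv_diff i (inv_mult p e) = inv_mult (pdiff i p) e + inv_mult p (inv_diff i e)"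
proof (induction p rule: mapping_induct)
  case (single a x)
  show ?case
  proof (induction e rule: mapping_induct)
    case (single b y)
    let ?c = "Poly_Mapping.map int a + b" and ?e = "Poly_Mapping.single i (1::int)"
    have e1: "Poly_Mapping.map int a + (b - ?e) = ?c - ?e" by (simp add: algebra_simps)
    have e2: "Poly_Mapping.map int (a - Poly_Mapping.single i 1) + b = ?c - ?e"
      if "Poly_Mapping.lookup a i \<noteq> 0"
      using that by (intro poly_mapping_eqI)
        (auto simp: lookup_add lookup_minus lookup_map_int lookup_single when_def)
    have t1: "inv_mult (pdiff i (Poly_Mapping.single a x)) (Poly_Mapping.single b y) =
        (if inv_exponent (?c - ?e)
         then Poly_Mapping.single (?c - ?e) (of_nat (Poly_Mapping.lookup a i) * x * y) else 0)"
    proof (cases "Poly_Mapping.lookup a i = 0")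
      case False
      show ?thesis by (simp only: pdiff_single inv_mult_single e2[OF False])
    qed (simp add: pdiff_single)
    have t2: "inv_mult (Poly_Mapping.single a x) (inv_diff i (Poly_Mapping.single b y)) =
        (if inv_exponent (?c - ?e)
         then Poly_Mapping.single (?c - ?e) (x * (of_int (Poly_Mapping.lookup b i) * y)) else 0)"
      by (simp only: inv_diff_single inv_mult_single e1)
    have c: "Poly_Mapping.lookup ?c i = int (Poly_Mapping.lookup a i) + Poly_Mapping.lookup b i"
      by (simp add: lookup_add lookup_map_int)
    have i1: "inv_exponent (?c - ?e)" if "inv_exponent ?c"
      using that unfolding inv_exponent_def
      by (metis (no_types, opaque_lifting) lookup_minus lookup_single_eq lookup_single_not_eq
          diff_0_right diff_left_mono diff_zero le_diff_eq order_trans zero_le_one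
          add.right_neutral add_le_cancel_left)
    have i2: "Poly_Mapping.lookup ?c i = 0" if nc: "\<not> inv_exponent ?c" and ic: "inv_exponent (?c - ?e)"
    proof -
      obtain j where j: "Poly_Mapping.lookup ?c j \<ge> 0" using nc unfolding inv_exponent_def by (metis int_one_le_iff_zero_less linorder_not_less zless_imp_add1_zle add.left_inverse zle_add1_eq_le)
      have k: "Poly_Mapping.lookup ?c j - Poly_Mapping.lookup ?e j \<le> - 1"
        using ic unfolding inv_exponent_def lookup_minus by blast
      show ?thesis using j k by (cases "i = j") (simp_all add: lookup_single)
    qed
    show ?case
    proof (cases "inv_exponent ?c")
      case True
      then have "inv_diff i (inv_mult (Poly_Mapping.single a x) (Poly_Mapping.single b y)) =
          Poly_Mapping.single (?c - ?e) (of_int (Poly_Mapping.lookup ?c i) * (x * y))"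
        by (simp only: inv_mult_single if_True inv_diff_single)
      also have "of_int (Poly_Mapping.lookup ?c i) * (x * y) =
          of_nat (Poly_Mapping.lookup a i) * x * y + x * (of_int (Poly_Mapping.lookup b i) * y)"
        unfolding c of_int_add of_int_of_nat_eq distrib_right mult.assoc
        by (simp only: mult.left_commute)
      finally show ?thesis unfolding t1 t2 using i1[OF True]
        by (simp only: if_True single_add)
    next
      case False
      show ?thesis
      proof (cases "inv_exponent (?c - ?e)")
        case True
        have "of_nat (Poly_Mapping.lookup a i) * x * y +
            x * (of_int (Poly_Mapping.lookup b i) * y) = of_int (Poly_Mapping.lookup ?c i) * (x * y)"
          unfolding c of_int_add of_int_of_nat_eq distrib_right mult.assoc
          by (simp only: mult.left_commute)
        also have "\<dots> = 0" by (simp only: i2[OF False True]) simp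
        finally have "of_nat (Poly_Mapping.lookup a i) * x * y +
            x * (of_int (Poly_Mapping.lookup b i) * y) = 0" .
        then show ?thesis unfolding t1 t2 using False True
          by (simp add: inv_mult_single single_add[symmetric])
      qed (simp only: t1 t2 False inv_mult_single if_False inv_diff_0 add_0)
    qed
  qed (simp_all add: inv_mult_add2 inv_diff_add algebra_simps)
qed (simp_all add: inv_mult_add1 inv_diff_add pdiff_add algebra_simps)

lemma inv_diff_commute: "inv_diff i (inv_diff j e) = inv_diff j (inv_diff i e)"
proof (induction e rule: mapping_induct)
  case (single b y)
  show ?case
    by (cases "i = j")
      (simp_all add: inv_diff_single lookup_minus lookup_single when_def mult.left_commute
        diff_right_commute[of b "Poly_Mapping.single i 1"])
qed (simp_all add: inv_diff_add)

lemma inv_carrier_0: "0 \<in> inv_carrier"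
  and inv_carrier_add: "e \<in> inv_carrier \<Longrightarrow> e' \<in> inv_carrier \<Longrightarrow> e + e' \<in> inv_carrier"
  and inv_carrier_neg: "e \<in> inv_carrier \<Longrightarrow> - e \<in> inv_carrier"
  using Poly_Mapping.keys_add[of e e'] by (auto simp: inv_carrier_def in_keys_iff)

lemma inv_carrier_sum: "(\<And>x. x \<in> A \<Longrightarrow> f x \<in> inv_carrier) \<Longrightarrow> sum f A \<in> inv_carrier"
  by (induction A rule: infinite_finite_induct) (auto simp: inv_carrier_0 inv_carrier_add)

lemma inv_mult_closed: "inv_mult p e \<in> inv_carrier"
  unfolding inv_mult_def Let_def
  by (intro inv_carrier_sum) (auto simp: inv_carrier_def)

lemma inv_diff_closed:
  assumes "e \<in> inv_carrier"
  shows "inv_diff i e \<in> inv_carrier"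
  unfolding inv_diff_def
proof (rule inv_carrier_sum)
  fix b assume "b \<in> Poly_Mapping.keys e"
  with assms have b: "inv_exponent b" by (simp add: inv_carrier_def)
  have "inv_exponent (b - Poly_Mapping.single i 1)"
    unfolding inv_exponent_def
  proof
    fix j
    have "Poly_Mapping.lookup b j \<le> -1" using b by (simp add: inv_exponent_def)
    then show "Poly_Mapping.lookup (b - Poly_Mapping.single i 1) j \<le> -1"
      by (auto simp: lookup_minus lookup_single when_def)
  qed
  then show "Poly_Mapping.single (b - Poly_Mapping.single i 1)
      (of_int (Poly_Mapping.lookup b i) * Poly_Mapping.lookup e b) \<in> inv_carrier"
    by (simp add: inv_carrier_def)
qed

interpretation inv_weyl: weyl_data inv_carrier inv_mult
    "inv_diff :: 'n \<Rightarrow> ('n, 'k::field_char_0) inv_poly \<Rightarrow> _"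
  by unfold_locales
    (simp_all add: left_module_def add_subgroup_def inv_carrier_0 inv_carrier_add inv_carrier_neg
      inv_mult_closed inv_mult_add1 inv_mult_add2 inv_mult_mult inv_mult_1 inv_diff_closed
      inv_diff_add inv_leibniz inv_diff_commute)

definition matlis_dual :: "(('n::finite, 'k::field_char_0) dop, 'm::ab_group_add) grmod \<Rightarrow>
    (('n, 'k) dop, 'm \<Rightarrow> ('n, 'k) inv_poly) grmod" where
  "matlis_dual M =
    (let M\<^sub>R = restrict_scalars dmult M; E\<^sub>R = restrict_scalars dmult inv_module in
     dmodule_of (star_hom M\<^sub>R E\<^sub>R)
       (\<lambda>p \<phi> m. mact E\<^sub>R p (\<phi> m))
       (\<lambda>i \<phi> m. if m \<in> mcar M
          then mact inv_module (dpart i) (\<phi> m) - \<phi> (mact M (dpart i) m) else 0)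
       (\<lambda>d. grhom d M\<^sub>R E\<^sub>R))"


lemma dmodule_of_structure:
  assumes "weyl_data S r d"
  shows "dmodule_structure S r d (mact (dmodule_of S r d p))"
  unfolding dmodule_of_def using theI'[OF weyl_data.ex1_dmodule_structure[OF assms]] by simp

lemma dmodule_of_simps:
  assumes "weyl_data S r d"
  shows "left_module (dmodule_of S r d p)" "mcar (dmodule_of S r d p) = S"
    "piece (dmodule_of S r d p) = p"
    "m \<in> S \<Longrightarrow> mact (dmodule_of S r d p) (dmult q) m = r q m"
    "m \<in> S \<Longrightarrow> mact (dmodule_of S r d p) (dpart i) m = d i m"
proof -
  note st = dmodule_of_structure[OF assms, of p, unfolded dmodule_structure_def]
  show c: "mcar (dmodule_of S r d p) = S" and "piece (dmodule_of S r d p) = p"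
    by (simp_all add: dmodule_of_def)
  show "left_module (dmodule_of S r d p)"
    using conjunct1[OF st] unfolding left_module_def c by simp
  show "m \<in> S \<Longrightarrow> mact (dmodule_of S r d p) (dmult q) m = r q m"
    and "m \<in> S \<Longrightarrow> mact (dmodule_of S r d p) (dpart i) m = d i m"
    using st by blast+
qed

lemma inv_module_simps:
  "left_module inv_module" "mcar inv_module = inv_carrier"
  "e \<in> inv_carrier \<Longrightarrow> mact inv_module (dmult q) e = inv_mult q e"
  "e \<in> inv_carrier \<Longrightarrow> mact inv_module (dpart i) e = inv_diff i e"
  unfolding inv_module_def
  by (rule dmodule_of_simps[OF inv_weyl.weyl_data_axioms]; assumption?)+

lemma inv_piece_add_subgroup: "add_subgroup (piece inv_module l)"
proof -
  have "x + y \<in> piece inv_module l" if "x \<in> piece inv_module l" "y \<in> piece inv_module l" for x y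
  proof -
    have "b \<in> Poly_Mapping.keys x \<or> b \<in> Poly_Mapping.keys y" if "b \<in> Poly_Mapping.keys (x + y)" for b
      using that Poly_Mapping.keys_add[of x y] by blast
    then show ?thesis using that inv_carrier_add[of x y]
      unfolding inv_module_def dmodule_of_def by (simp, blast)
  qed
  moreover have "- x \<in> piece inv_module l" if "x \<in> piece inv_module l" for x
    using that inv_carrier_neg[of x] by (simp add: inv_module_def dmodule_of_def in_keys_iff)
  moreover have "0 \<in> piece inv_module l"
    by (simp add: inv_module_def dmodule_of_def inv_carrier_0)
  ultimately show ?thesis unfolding add_subgroup_def by blast
qed

lemma inv_piece_subset: "piece inv_module l \<subseteq> inv_carrier"
  by (auto simp: inv_module_def dmodule_of_def)

lemma inv_piece_sum: "(\<And>x. x \<in> A \<Longrightarrow> f x \<in> piece inv_module l) \<Longrightarrow> sum f A \<in> piece inv_module l"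
  using inv_piece_add_subgroup[of l]
  by (induction A rule: infinite_finite_induct) (auto simp: add_subgroup_def)

lemma inv_piece_mult:
  assumes "e \<in> piece inv_module l"
  shows "inv_mult (Poly_Mapping.single a c) e \<in>
    piece inv_module (l + int (\<Sum>i\<in>UNIV. Poly_Mapping.lookup a i))"
  unfolding inv_mult_def Let_def
  by (intro inv_piece_sum)
    (use assms in \<open>auto simp: inv_module_def dmodule_of_def inv_carrier_def lookup_add
      lookup_map_int sum.distrib split: if_splits\<close>)

lemma inv_piece_diff:
  assumes "e \<in> piece inv_module l"
  shows "inv_diff i e \<in> piece inv_module (l - 1)"
proof -
  have "Poly_Mapping.single (b - Poly_Mapping.single i 1) c \<in> piece inv_module (l - 1)"
    if "b \<in> Poly_Mapping.keys e" for b c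
  proof -
    have "Poly_Mapping.single b 1 \<in> inv_carrier" "(\<Sum>j\<in>UNIV. Poly_Mapping.lookup b j) = l"
      using assms that by (auto simp: inv_module_def dmodule_of_def inv_carrier_def)
    moreover have "Poly_Mapping.lookup b j \<le> -1" for j
      using calculation(1) by (simp add: inv_carrier_def inv_exponent_def)
    ultimately show ?thesis
      by (auto simp: inv_module_def dmodule_of_def inv_carrier_def inv_exponent_def lookup_minus
          lookup_single when_def sum_subtractf intro: order_trans[of _ "- 1"])
  qed
  then show ?thesis unfolding inv_diff_def by (intro inv_piece_sum)
qed

lemma grhom_sum_in_star_hom:
  assumes "finite A" "\<And>d. d \<in> A \<Longrightarrow> g d \<in> grhom d M N" "\<And>d. 0 \<in> grhom d M N"
  shows "sum g A \<in> star_hom M N"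
proof -
  let ?g = "\<lambda>d. if d \<in> A then g d else 0"
  have "{d. ?g d \<noteq> 0} \<subseteq> A" by auto
  moreover have "sum g A = (\<Sum>d | ?g d \<noteq> 0. ?g d)"
    using assms(1) by (intro sum.mono_neutral_cong_right) auto
  ultimately show ?thesis
    unfolding star_hom_def using assms finite_subset[OF _ assms(1)]
    by (intro CollectI exI[of _ ?g]) auto
qed

lemma star_hom_induct [consumes 1, case_names zero add hom]:
  assumes "f \<in> star_hom M N" "P 0" "\<And>f g. P f \<Longrightarrow> P g \<Longrightarrow> P (f + g)"
    "\<And>d f. f \<in> grhom d M N \<Longrightarrow> P f"
  shows "P f"
proof -
  obtain g where g: "\<And>d. g d \<in> grhom d M N" "f = (\<Sum>d | g d \<noteq> 0. g d)"
    using assms(1) by (auto simp: star_hom_def)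
  have "P (sum g A)" for A
  proof (induction A rule: infinite_finite_induct)
    case (insert x A)
    show ?case unfolding sum.insert[OF insert.hyps]
      by (rule assms(3)[OF assms(4)[OF g(1)] insert.IH])
  next
    case (infinite A)
    then have "sum g A = 0" by (rule sum.infinite)
    with assms(2) show ?case by metis
  next
    case empty
    with assms(2) show ?case unfolding sum.empty .
  qed
  then show ?thesis unfolding g(2) .
qed

context
  fixes M :: "(('n::finite, 'k::field_char_0) dop, 'm::ab_group_add) grmod"
  assumes M: "graded_dmodule M"
begin

private abbreviation "M\<^sub>R \<equiv> restrict_scalars dmult M"
private abbreviation "E\<^sub>R \<equiv> restrict_scalars dmult (inv_module :: (('n, 'k) dop, _) grmod)"
private definition "r_op p \<phi> m = mact E\<^sub>R p (\<phi> m)" for \<phi> :: "'m \<Rightarrow> ('n, 'k) inv_poly"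
private definition "d_op i \<phi> m = (if m \<in> mcar M
    then mact inv_module (dpart i) (\<phi> m) - \<phi> (mact M (dpart i) m) else 0)"
  for \<phi> :: "'m \<Rightarrow> ('n, 'k) inv_poly"

private lemma M_left: "left_module M"
  using M by (simp add: graded_dmodule_def)

private lemma M_simps:
  "x \<in> mcar M \<Longrightarrow> y \<in> mcar M \<Longrightarrow> x + y \<in> mcar M"
  "x \<in> mcar M \<Longrightarrow> mact M P x \<in> mcar M"
  "x \<in> mcar M \<Longrightarrow> y \<in> mcar M \<Longrightarrow> mact M P (x + y) = mact M P x + mact M P y"
  using M_left by (auto simp: left_module_def add_subgroup_def)

private lemma M_piece: "m \<in> piece M l \<Longrightarrow> m \<in> mcar M"
  using M by (auto simp: graded_dmodule_def internal_direct_sum_def)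

private lemma lhom_iff: "f \<in> lhom M\<^sub>R E\<^sub>R \<longleftrightarrow> (\<forall>x\<in>mcar M. f x \<in> inv_carrier) \<and>
    (\<forall>x\<in>mcar M. \<forall>y\<in>mcar M. f (x + y) = f x + f y) \<and>
    (\<forall>p. \<forall>x\<in>mcar M. f (mact M (dmult p) x) = inv_mult p (f x)) \<and>
    (\<forall>x. x \<notin> mcar M \<longrightarrow> f x = 0)"
  unfolding lhom_def by (auto simp: restrict_scalars_def inv_module_simps)

private lemma grhom_iff: "f \<in> grhom d M\<^sub>R E\<^sub>R \<longleftrightarrow> f \<in> lhom M\<^sub>R E\<^sub>R \<and>
    (\<forall>l. \<forall>m\<in>piece M l. f m \<in> piece inv_module (l + d))"
  unfolding grhom_def by (auto simp: restrict_scalars_def)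

private lemma grhom_0: "0 \<in> grhom d M\<^sub>R E\<^sub>R"
  using inv_piece_add_subgroup
  by (auto simp: grhom_iff lhom_iff inv_carrier_0 add_subgroup_def)

private lemma inv_piece_add: "e \<in> piece inv_module l \<Longrightarrow> e' \<in> piece inv_module l \<Longrightarrow>
    e + e' \<in> piece inv_module l"
  using inv_piece_add_subgroup by (auto simp: add_subgroup_def)

private lemma grhom_add: "f \<in> grhom d M\<^sub>R E\<^sub>R \<Longrightarrow> g \<in> grhom d M\<^sub>R E\<^sub>R \<Longrightarrow> f + g \<in> grhom d M\<^sub>R E\<^sub>R"
  by (auto simp: grhom_iff lhom_iff inv_carrier_add inv_piece_add inv_mult_add2)

private lemma star_sum: "finite A \<Longrightarrow> (\<And>d. d \<in> A \<Longrightarrow> g d \<in> grhom d M\<^sub>R E\<^sub>R) \<Longrightarrow>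
    sum g A \<in> star_hom M\<^sub>R E\<^sub>R"
  by (rule grhom_sum_in_star_hom) (auto simp: grhom_0)

private lemma star_hom_0: "0 \<in> star_hom M\<^sub>R E\<^sub>R"
  using star_sum[of "{}"] by simp

private lemma grhom_star: "f \<in> grhom d M\<^sub>R E\<^sub>R \<Longrightarrow> f \<in> star_hom M\<^sub>R E\<^sub>R"
  using star_sum[of "{d}" "\<lambda>_. f"] by simp

private lemma star_add:
  assumes "f \<in> star_hom M\<^sub>R E\<^sub>R" "f' \<in> star_hom M\<^sub>R E\<^sub>R"
  shows "f + f' \<in> star_hom M\<^sub>R E\<^sub>R"
proof -
  obtain g g' where g: "\<And>d. g d \<in> grhom d M\<^sub>R E\<^sub>R" "finite {d. g d \<noteq> 0}" "f = (\<Sum>d | g d \<noteq> 0. g d)"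
    and g': "\<And>d. g' d \<in> grhom d M\<^sub>R E\<^sub>R" "finite {d. g' d \<noteq> 0}" "f' = (\<Sum>d | g' d \<noteq> 0. g' d)"
    using assms unfolding star_hom_def by blast
  let ?A = "{d. g d \<noteq> 0} \<union> {d. g' d \<noteq> 0}"
  have "f = sum g ?A" "f' = sum g' ?A"
    unfolding g(3) g'(3) using g(2) g'(2) by (auto intro!: sum.mono_neutral_left)
  then have "f + f' = (\<Sum>d\<in>?A. g d + g' d)" by (simp add: sum.distrib)
  also have "\<dots> \<in> star_hom M\<^sub>R E\<^sub>R"
    by (rule star_sum) (use g g' in \<open>auto intro: grhom_add\<close>)
  finally show ?thesis .
qed

private lemma star_sum2: "(\<And>x. x \<in> A \<Longrightarrow> f x \<in> star_hom M\<^sub>R E\<^sub>R) \<Longrightarrow> sum f A \<in> star_hom M\<^sub>R E\<^sub>R"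
  by (induction A rule: infinite_finite_induct) (auto simp: star_hom_0 star_add)

private lemma star_lhom: "f \<in> star_hom M\<^sub>R E\<^sub>R \<Longrightarrow> f \<in> lhom M\<^sub>R E\<^sub>R"
  by (induction rule: star_hom_induct)
    (auto simp: grhom_iff lhom_iff inv_carrier_0 inv_carrier_add inv_mult_add2)

private lemma r_op_eq: "\<phi> \<in> lhom M\<^sub>R E\<^sub>R \<Longrightarrow> r_op p \<phi> = (\<lambda>m. inv_mult p (\<phi> m))"
proof
  fix m assume "\<phi> \<in> lhom M\<^sub>R E\<^sub>R"
  then have "\<phi> m \<in> inv_carrier" by (cases "m \<in> mcar M") (auto simp: lhom_iff inv_carrier_0)
  then show "r_op p \<phi> m = inv_mult p (\<phi> m)"
    by (simp add: r_op_def restrict_scalars_def inv_module_simps)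
qed

private lemma d_op_eq: "\<phi> \<in> lhom M\<^sub>R E\<^sub>R \<Longrightarrow>
    d_op i \<phi> m = (if m \<in> mcar M then inv_diff i (\<phi> m) - \<phi> (mact M (dpart i) m) else 0)"
  by (auto simp: d_op_def lhom_iff inv_module_simps)

private lemma r_lhom: "\<phi> \<in> lhom M\<^sub>R E\<^sub>R \<Longrightarrow> r_op p \<phi> \<in> lhom M\<^sub>R E\<^sub>R"
  unfolding r_op_eq
  by (auto simp: lhom_iff inv_mult_closed inv_mult_add2 inv_mult_mult[symmetric] mult.commute)

private lemma inv_carrier_diff: "e \<in> inv_carrier \<Longrightarrow> e' \<in> inv_carrier \<Longrightarrow> e - e' \<in> inv_carrier"
  using inv_carrier_add[of e "- e'"] inv_carrier_neg[of e'] by simp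

private lemma inv_mult_diff2: "inv_mult p (e - e') = inv_mult p e - inv_mult p e'"
  using inv_mult_add2[of p "e - e'" e'] by simp

private lemma inv_diff_diff: "inv_diff i (e - e') = inv_diff i e - inv_diff i e'"
  using inv_diff_add[of i "e - e'" e'] by simp

lemma dpart_dmult: "dpart i * dmult p = dmult (pdiff i p) + dmult p * (dpart i :: ('n, 'k) dop)"
  unfolding Rep_dop_inject[symmetric] times_dop.rep_eq plus_dop.rep_eq Rep_dmult Rep_dpart
  by (simp add: pdiff_mult)

lemma dpart_commute: "dpart i * dpart j = dpart j * (dpart i :: ('n, 'k) dop)"
  unfolding Rep_dop_inject[symmetric] times_dop.rep_eq Rep_dpart by (simp add: pdiff_commute)

private lemma M_weyl:
  assumes "m \<in> mcar M"
  shows "mact M (dpart i) (mact M (dmult p) m) =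
      mact M (dmult (pdiff i p)) m + mact M (dmult p) (mact M (dpart i) m)"
    "mact M (dpart i) (mact M (dpart j) m) = mact M (dpart j) (mact M (dpart i) m)"
proof -
  have a: "mact M (P * Q) m = mact M P (mact M Q m)" "mact M (P + Q) m = mact M P m + mact M Q m"
    for P Q using M_left assms by (auto simp: left_module_def)
  show "mact M (dpart i) (mact M (dmult p) m) =
      mact M (dmult (pdiff i p)) m + mact M (dmult p) (mact M (dpart i) m)"
    unfolding a(1)[symmetric] dpart_dmult a(2) ..
  show "mact M (dpart i) (mact M (dpart j) m) = mact M (dpart j) (mact M (dpart i) m)"
    unfolding a(1)[symmetric] by (simp add: dpart_commute)
qed

private lemma d_lhom: "\<phi> \<in> lhom M\<^sub>R E\<^sub>R \<Longrightarrow> d_op i \<phi> \<in> lhom M\<^sub>R E\<^sub>R"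
  unfolding lhom_iff[of "d_op i \<phi>"] d_op_eq
  by (auto simp: lhom_iff inv_carrier_diff inv_diff_closed M_simps inv_diff_add inv_leibniz M_weyl
      inv_mult_diff2)

private lemma add_apply: "(\<phi> + \<psi>) m = \<phi> m + (\<psi> m :: ('n, 'k) inv_poly)"
  by (simp add: plus_fun_def)

private lemma lhom_0: "0 \<in> lhom M\<^sub>R E\<^sub>R"
  using grhom_0 by (simp add: grhom_iff)

private lemma lhom_add: "\<phi> \<in> lhom M\<^sub>R E\<^sub>R \<Longrightarrow> \<psi> \<in> lhom M\<^sub>R E\<^sub>R \<Longrightarrow> \<phi> + \<psi> \<in> lhom M\<^sub>R E\<^sub>R"
  by (auto simp: lhom_iff inv_carrier_add inv_mult_add2)

private lemma r_op_add: "\<phi> \<in> lhom M\<^sub>R E\<^sub>R \<Longrightarrow> \<psi> \<in> lhom M\<^sub>R E\<^sub>R \<Longrightarrow>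
    r_op p (\<phi> + \<psi>) = r_op p \<phi> + r_op p \<psi>"
  by (auto simp: r_op_eq lhom_add inv_mult_add2)

private lemma d_op_add: "\<phi> \<in> lhom M\<^sub>R E\<^sub>R \<Longrightarrow> \<psi> \<in> lhom M\<^sub>R E\<^sub>R \<Longrightarrow>
    d_op i (\<phi> + \<psi>) = d_op i \<phi> + d_op i \<psi>"
  by (auto simp: d_op_eq lhom_add inv_diff_add fun_eq_iff)

private lemma r_op_closed:
  assumes "\<phi> \<in> star_hom M\<^sub>R E\<^sub>R"
  shows "r_op p \<phi> \<in> star_hom M\<^sub>R E\<^sub>R"
proof -
  have closed: "r_op p f \<in> star_hom M\<^sub>R E\<^sub>R" if f: "f \<in> grhom d M\<^sub>R E\<^sub>R" for f d
  proof -
    have fl: "f \<in> lhom M\<^sub>R E\<^sub>R" using f by (simp add: grhom_iff)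
    have s: "r_op (Poly_Mapping.single a c) f \<in> star_hom M\<^sub>R E\<^sub>R" for a c
    proof (rule grhom_star)
      show "r_op (Poly_Mapping.single a c) f \<in>
          grhom (d + int (\<Sum>i\<in>UNIV. Poly_Mapping.lookup a i)) M\<^sub>R E\<^sub>R"
        using f r_lhom[OF fl] inv_piece_mult[of _ _ a c]
        by (auto simp: grhom_iff r_op_eq[OF fl] add.assoc[symmetric])
    qed
    show ?thesis
    proof (induction p rule: mapping_induct)
      case zero
      have "r_op 0 f = 0" by (auto simp: r_op_eq[OF fl])
      then show ?case using star_hom_0 by (simp only:)
    next
      case (add p q)
      have "r_op (p + q) f = r_op p f + r_op q f"
        by (auto simp: r_op_eq[OF fl] inv_mult_add1)
      with add show ?case using star_add by metis
    qed (rule s)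
  qed
  have "\<phi> \<in> lhom M\<^sub>R E\<^sub>R \<and> r_op p \<phi> \<in> star_hom M\<^sub>R E\<^sub>R"
    using assms
  proof (induction rule: star_hom_induct)
    case zero
    have "r_op p 0 = 0" by (auto simp: r_op_eq[OF lhom_0])
    then show ?case using star_hom_0 lhom_0 by (simp only: simp_thms)
  next
    case (add f g)
    then show ?case using r_op_add[of f g p] star_add lhom_add by metis
  next
    case (hom d f)
    then show ?case using closed grhom_iff by blast
  qed
  then show ?thesis by simp
qed

private lemma d_op_closed:
  assumes "\<phi> \<in> star_hom M\<^sub>R E\<^sub>R"
  shows "d_op i \<phi> \<in> star_hom M\<^sub>R E\<^sub>R"
proof -
  have "\<phi> \<in> lhom M\<^sub>R E\<^sub>R \<and> d_op i \<phi> \<in> star_hom M\<^sub>R E\<^sub>R"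
    using assms
  proof (induction rule: star_hom_induct)
    case zero
    have "d_op i 0 = 0" by (auto simp: d_op_eq[OF lhom_0])
    then show ?case using star_hom_0 lhom_0 by (simp only: simp_thms)
  next
    case (add f g)
    then show ?case using d_op_add[of f g i] star_add lhom_add by metis
  next
    case (hom d f)
    then have fl: "f \<in> lhom M\<^sub>R E\<^sub>R" by (simp add: grhom_iff)
    have "d_op i f \<in> grhom (d - 1) M\<^sub>R E\<^sub>R"
      unfolding grhom_iff
    proof (intro conjI allI ballI)
      show "d_op i f \<in> lhom M\<^sub>R E\<^sub>R" by (rule d_lhom[OF fl])
      fix l m assume m: "m \<in> piece M l"
      have "mact M (dpart i) m \<in> piece M (l - 1)"
        using M m by (simp add: graded_dmodule_def)
      then have "f (mact M (dpart i) m) \<in> piece inv_module (l - 1 + d)" "f m \<in> piece inv_module (l + d)"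
        using hom m by (auto simp: grhom_iff)
      then have "- f (mact M (dpart i) m) \<in> piece inv_module (l + (d - 1))"
        "inv_diff i (f m) \<in> piece inv_module (l + (d - 1))"
        using inv_piece_add_subgroup inv_piece_diff[of "f m" "l + d" i]
        by (auto simp: add_subgroup_def algebra_simps)
      then have "inv_diff i (f m) + - f (mact M (dpart i) m) \<in> piece inv_module (l + (d - 1))"
        by (intro inv_piece_add)
      then show "d_op i f m \<in> piece inv_module (l + (d - 1))"
        using M_piece[OF m] by (simp add: d_op_eq[OF fl])
    qed
    then show ?case using fl grhom_star by blast
  qed
  then show ?thesis by simp
qed

private lemma star_neg:
  assumes "\<phi> \<in> star_hom M\<^sub>R E\<^sub>R"
  shows "- \<phi> \<in> star_hom M\<^sub>R E\<^sub>R"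
proof -
  have "- \<phi> = r_op (- 1) \<phi>"
  proof
    fix m
    have e: "\<phi> m \<in> inv_carrier"
      using star_lhom[OF assms] by (cases "m \<in> mcar M") (auto simp: lhom_iff inv_carrier_0)
    show "(- \<phi>) m = r_op (- 1) \<phi> m"
      using inv_weyl.r_neg2[OF e, of 1] inv_mult_1[OF e] by (simp add: r_op_eq[OF star_lhom[OF assms]])
  qed
  then show ?thesis using r_op_closed[OF assms] by simp
qed

private lemma matlis_weyl_aux: "weyl_data (star_hom M\<^sub>R E\<^sub>R) r_op d_op"
proof
  have c: "\<phi> m \<in> inv_carrier" if "\<phi> \<in> lhom M\<^sub>R E\<^sub>R" for \<phi> m
    using that by (cases "m \<in> mcar M") (auto simp: lhom_iff inv_carrier_0)
  show "left_module \<lparr>mcar = star_hom M\<^sub>R E\<^sub>R, mact = r_op\<rparr>"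
    unfolding left_module_def add_subgroup_def lmod.simps
  proof (intro conjI allI ballI)
    fix \<phi> \<psi> a b
    assume p: "\<phi> \<in> star_hom M\<^sub>R E\<^sub>R"
    note l = star_lhom[OF p]
    show "r_op a \<phi> \<in> star_hom M\<^sub>R E\<^sub>R" "- \<phi> \<in> star_hom M\<^sub>R E\<^sub>R"
      by (rule r_op_closed[OF p] star_neg[OF p])+
    show "r_op (a + b) \<phi> = r_op a \<phi> + r_op b \<phi>"
      by (rule ext) (simp add: r_op_eq[OF l] inv_mult_add1)
    show "r_op (a * b) \<phi> = r_op a (r_op b \<phi>)"
      by (rule ext) (simp only: r_op_eq[OF r_lhom[OF l]], simp only: r_op_eq[OF l] inv_mult_mult)
    show "r_op 1 \<phi> = \<phi>"
      by (rule ext) (simp add: r_op_eq[OF l] inv_mult_1[OF c[OF l]])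
    assume q: "\<psi> \<in> star_hom M\<^sub>R E\<^sub>R"
    show "\<phi> + \<psi> \<in> star_hom M\<^sub>R E\<^sub>R" by (rule star_add[OF p q])
    show "r_op a (\<phi> + \<psi>) = r_op a \<phi> + r_op a \<psi>" by (rule r_op_add[OF l star_lhom[OF q]])
  qed (rule star_hom_0)
  fix \<phi> \<psi> i j p
  assume "\<phi> \<in> star_hom M\<^sub>R E\<^sub>R"
  note f = this star_lhom[OF this]
  show "d_op i \<phi> \<in> star_hom M\<^sub>R E\<^sub>R" by (rule d_op_closed[OF f(1)])
  show "d_op i (r_op p \<phi>) = r_op (pdiff i p) \<phi> + r_op p (d_op i \<phi>)"
  proof
    fix m
    have "\<phi> (mact M (dmult p) x) = inv_mult p (\<phi> x)" if "x \<in> mcar M" for x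
      using f(2) that by (simp add: lhom_iff)
    then show "d_op i (r_op p \<phi>) m = (r_op (pdiff i p) \<phi> + r_op p (d_op i \<phi>)) m"
      using f(2)[unfolded lhom_iff]
      unfolding plus_fun_apply d_op_eq[OF r_lhom[OF f(2)]] r_op_eq[OF d_lhom[OF f(2)]]
      unfolding r_op_eq[OF f(2)] d_op_eq[OF f(2)]
      by (simp add: inv_leibniz inv_mult_diff2)
  qed
  show "d_op i (d_op j \<phi>) = d_op j (d_op i \<phi>)"
    using f(2)
    by (auto simp: fun_eq_iff d_op_eq d_lhom inv_diff_diff inv_diff_commute[of i j] M_weyl(2)[of _ i j] M_simps)
  show "d_op i (\<phi> + \<psi>) = d_op i \<phi> + d_op i \<psi>" if "\<psi> \<in> star_hom M\<^sub>R E\<^sub>R"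
    using d_op_add[OF f(2) star_lhom[OF that]] .
qed

lemma matlis_weyl:
  "weyl_data (star_hom (restrict_scalars dmult M) (restrict_scalars dmult inv_module))
    (\<lambda>p \<phi> m. mact (restrict_scalars dmult inv_module) p (\<phi> m))
    (\<lambda>i \<phi> m. if m \<in> mcar M
       then mact inv_module (dpart i) (\<phi> m) - \<phi> (mact M (dpart i) m) else 0)"
  using matlis_weyl_aux unfolding r_op_def[abs_def] d_op_def[abs_def] .

lemmas matlis_dual_simps =
  dmodule_of_simps[OF matlis_weyl, where p="\<lambda>d. grhom d (restrict_scalars dmult M) (restrict_scalars dmult inv_module)",
    folded matlis_dual_def[of M, unfolded Let_def]]

end


section \<open>Vector spaces and cohomology\<close>

record ('k, 'v) kspace =
  vcar :: "'v set"
  vadd :: "'v \<Rightarrow> 'v \<Rightarrow> 'v"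
  vscale :: "'k \<Rightarrow> 'v \<Rightarrow> 'v"

definition kspace_iso :: "('k, 'v) kspace \<Rightarrow> ('k, 'w) kspace \<Rightarrow> bool" (infix "\<cong>\<^sub>k" 50) where
  "V \<cong>\<^sub>k W \<longleftrightarrow> (\<exists>f. bij_betw f (vcar V) (vcar W) \<and>
    (\<forall>x\<in>vcar V. \<forall>y\<in>vcar V. f (vadd V x y) = vadd W (f x) (f y)) \<and>
    (\<forall>c. \<forall>x\<in>vcar V. f (vscale V c x) = vscale W c (f x)))"

definition coord_space :: "nat \<Rightarrow> ('k::field, nat \<Rightarrow> 'k) kspace" where
  "coord_space d = \<lparr>vcar = {v. \<forall>i\<ge>d. v i = 0}, vadd = (+), vscale = (\<lambda>c v i. c * v i)\<rparr>"

definition fin_dim :: "('k::field, 'v) kspace \<Rightarrow> bool" where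
  "fin_dim V \<longleftrightarrow> (\<exists>d. coord_space d \<cong>\<^sub>k V)"

text \<open>Only meaningful for finite-dimensional spaces.\<close>

definition kdim :: "('k::field, 'v) kspace \<Rightarrow> nat" where
  "kdim V = (THE d. coord_space d \<cong>\<^sub>k V)"

text \<open>The space \<open>Z / B\<close> of cosets of \<open>B\<close> in \<open>Z\<close>.\<close>

definition quotient_space :: "('k \<Rightarrow> 'v \<Rightarrow> 'v) \<Rightarrow> 'v::ab_group_add set \<Rightarrow> 'v set \<Rightarrow>
    ('k, 'v set) kspace" where
  "quotient_space s Z B = \<lparr>vcar = {(+) z ` B | z. z \<in> Z},
     vadd = (\<lambda>X Y. {x + y | x y. x \<in> X \<and> y \<in> Y}),
     vscale = (\<lambda>c X. {s c x + b | x b. x \<in> X \<and> b \<in> B})\<rparr>"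

definition cohomology :: "('k \<Rightarrow> 'v \<Rightarrow> 'v) \<Rightarrow> (int \<Rightarrow> 'v::ab_group_add set) \<Rightarrow>
    (int \<Rightarrow> 'v \<Rightarrow> 'v) \<Rightarrow> int \<Rightarrow> ('k, 'v set) kspace" where
  "cohomology s C \<delta> i = quotient_space s {x \<in> C i. \<delta> i x = 0} (\<delta> (i - 1) ` C (i - 1))"

text \<open>An \<open>i\<close>-form \<open>\<omega>\<close> is given by its coefficients: \<open>\<omega> J\<close> is the coefficient of the wedge
  product, in increasing order, of the \<open>dx\<^sub>j\<close> with \<open>j \<in> J\<close>.  Reordering
  \<open>dx\<^sub>s \<and> dx\<^sub>J\<close> produces the sign in the differential.\<close>

definition forms :: "('a, 'm::ab_group_add, 'z) lmod_scheme \<Rightarrow> int \<Rightarrow> ('n set \<Rightarrow> 'm) set" where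
  "forms M i = {\<omega>. (\<forall>J. \<omega> J \<in> mcar M) \<and> (\<forall>J. int (card J) \<noteq> i \<longrightarrow> \<omega> J = 0)}"

definition form_diff :: "(('n::{finite, linorder}, 'k::field_char_0) dop, 'm::ab_group_add, 'z) lmod_scheme \<Rightarrow>
    ('n set \<Rightarrow> 'm) \<Rightarrow> ('n set \<Rightarrow> 'm)" where
  "form_diff M \<omega> K = (\<Sum>s\<in>K. let v = mact M (dpart s) (\<omega> (K - {s})) in
     if even (card {j \<in> K. j < s}) then v else - v)"

definition H_dR :: "(('n::{finite, linorder}, 'k::field_char_0) dop, 'm::ab_group_add, 'z) lmod_scheme \<Rightarrow>
    int \<Rightarrow> ('k, ('n set \<Rightarrow> 'm) set) kspace" where
  "H_dR M = cohomology (\<lambda>c \<omega> J. mact M (dconst c) (\<omega> J)) (forms M) (\<lambda>_. form_diff M)"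


section \<open>Free resolutions and Ext\<close>

text \<open>The derived functors are computed from the standard free resolution
  \<open>\<dots> \<rightarrow> F\<^sub>1 \<rightarrow> F\<^sub>0 \<rightarrow> M \<rightarrow> 0\<close>, in which \<open>F\<^sub>0\<close> is free on the (homogeneous) elements of \<open>M\<close> and
  \<open>F\<^sub>i\<^sub>+\<^sub>1\<close> is free on all (homogeneous) linear combinations of basis elements of \<open>F\<^sub>i\<close> that are
  mapped to \<open>0\<close>.  In order for all \<open>F\<^sub>i\<close> to live in one type, the basis elements are the trees
  below: \<^term>\<open>Gen l m\<close> is the generator belonging to \<open>m\<close>, and \<^term>\<open>Syz l xs\<close> the one belonging to
  the linear combination listed in \<open>xs\<close>.  The label \<open>l\<close> is the degree; in the ungraded case it
  is of type \<^typ>\<open>unit\<close>.\<close>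

datatype ('l, 'a, 'm) cell = Gen (cell_deg: 'l) 'm | Syz (cell_deg: 'l) "('a \<times> ('l, 'a, 'm) cell) list"

definition free_act :: "'a::ring_1 \<Rightarrow> ('b \<Rightarrow>\<^sub>0 'a) \<Rightarrow> ('b \<Rightarrow>\<^sub>0 'a)" where
  "free_act a f = Poly_Mapping.map ((*) a) f"

definition free_module :: "'b set \<Rightarrow> ('a::ring_1, 'b \<Rightarrow>\<^sub>0 'a) lmod" where
  "free_module B = \<lparr>mcar = {f. Poly_Mapping.keys f \<subseteq> B}, mact = free_act\<rparr>"

definition gr_free_module :: "(int \<Rightarrow> 'a set) \<Rightarrow> ('b \<Rightarrow> int) \<Rightarrow> 'b set \<Rightarrow>
    ('a::ring_1, 'b \<Rightarrow>\<^sub>0 'a) grmod" where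
  "gr_free_module A deg B = \<lparr>mcar = {f. Poly_Mapping.keys f \<subseteq> B}, mact = free_act,
     piece = (\<lambda>l. {f. Poly_Mapping.keys f \<subseteq> B \<and>
       (\<forall>b\<in>Poly_Mapping.keys f. Poly_Mapping.lookup f b \<in> A (l - deg b))})\<rparr>"

definition lin_comb :: "('a::ring_1 \<times> 'b) list \<Rightarrow> 'b \<Rightarrow>\<^sub>0 'a" where
  "lin_comb xs = (\<Sum>(a, b)\<leftarrow>xs. Poly_Mapping.single b a)"

definition augmentation :: "('a::ring_1, 'm::ab_group_add, 'z) lmod_scheme \<Rightarrow>
    (('l, 'a, 'm) cell \<Rightarrow>\<^sub>0 'a) \<Rightarrow> 'm" where
  "augmentation M f = (\<Sum>b\<in>Poly_Mapping.keys f.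
     case b of Gen l m \<Rightarrow> mact M (Poly_Mapping.lookup f b) m | Syz l xs \<Rightarrow> 0)"

definition boundary :: "(('l, 'a::ring_1, 'm) cell \<Rightarrow>\<^sub>0 'a) \<Rightarrow> (('l, 'a, 'm) cell \<Rightarrow>\<^sub>0 'a)" where
  "boundary f = (\<Sum>b\<in>Poly_Mapping.keys f.
     case b of Gen l m \<Rightarrow> 0 | Syz l xs \<Rightarrow> free_act (Poly_Mapping.lookup f b) (lin_comb xs))"

primrec res_basis :: "('a::ring_1, 'm::ab_group_add, 'z) lmod_scheme \<Rightarrow> nat \<Rightarrow>
    (unit, 'a, 'm) cell set" where
  "res_basis M 0 = {Gen () m | m. m \<in> mcar M}"
| "res_basis M (Suc i) = {Syz () xs | xs. (\<forall>(a, b)\<in>set xs. b \<in> res_basis M i) \<and>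
     (if i = 0 then augmentation M (lin_comb xs) = 0 else boundary (lin_comb xs) = 0)}"

primrec gr_res_basis :: "(int \<Rightarrow> 'a::ring_1 set) \<Rightarrow> ('a, 'm::ab_group_add) grmod \<Rightarrow> nat \<Rightarrow>
    (int, 'a, 'm) cell set" where
  "gr_res_basis A M 0 = {Gen l m | l m. m \<in> piece M l}"
| "gr_res_basis A M (Suc i) = {Syz l xs | l xs.
     (\<forall>(a, b)\<in>set xs. b \<in> gr_res_basis A M i \<and> a \<in> A (l - cell_deg b)) \<and>
     (if i = 0 then augmentation M (lin_comb xs) = 0 else boundary (lin_comb xs) = 0)}"

definition res :: "('a::ring_1, 'm::ab_group_add, 'z) lmod_scheme \<Rightarrow> nat \<Rightarrow>
    ('a, (unit, 'a, 'm) cell \<Rightarrow>\<^sub>0 'a) lmod" where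
  "res M i = free_module (res_basis M i)"

definition gr_res :: "(int \<Rightarrow> 'a::ring_1 set) \<Rightarrow> ('a, 'm::ab_group_add) grmod \<Rightarrow> nat \<Rightarrow>
    ('a, (int, 'a, 'm) cell \<Rightarrow>\<^sub>0 'a) grmod" where
  "gr_res A M i = gr_free_module A cell_deg (gr_res_basis A M i)"

text \<open>Exactness of the standard resolutions, in the graded case degree by degree.\<close>

lemma lookup_free_act: "Poly_Mapping.lookup (free_act a f) b = a * Poly_Mapping.lookup f b"
  by (simp add: free_act_def Poly_Mapping.map.rep_eq when_def)

lemma lin_comb_keys:
  "\<exists>xs. lin_comb xs = f \<and> set xs = (\<lambda>b. (Poly_Mapping.lookup f b, b)) ` Poly_Mapping.keys f"
proof -
  obtain bs where bs: "set bs = Poly_Mapping.keys f" "distinct bs"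
    using finite_distinct_list[of "Poly_Mapping.keys f"] by auto
  have "lin_comb (map (\<lambda>b. (Poly_Mapping.lookup f b, b)) bs) =
      (\<Sum>b\<in>set bs. Poly_Mapping.single b (Poly_Mapping.lookup f b))"
    using bs(2) by (simp add: lin_comb_def o_def sum_list_distinct_conv_sum_set)
  also have "\<dots> = f"
    unfolding bs(1) by (rule mapping_eq_sum[symmetric])
  finally have lc: "lin_comb (map (\<lambda>b. (Poly_Mapping.lookup f b, b)) bs) = f" .
  have st: "set (map (\<lambda>b. (Poly_Mapping.lookup f b, b)) bs) =
      (\<lambda>b. (Poly_Mapping.lookup f b, b)) ` Poly_Mapping.keys f"
    by (simp only: set_map bs(1))
  show ?thesis by (intro exI conjI) (rule lc, rule st)
qed

lemma free_act_simps:
  "free_act a 0 = 0" "free_act 0 f = 0" "free_act 1 f = f"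
  "free_act (a + a') f = free_act a f + free_act a' f"
  "free_act a (f + f') = free_act a f + free_act a f'"
  "free_act (a * a') f = free_act a (free_act a' f)"
  "free_act a (Poly_Mapping.single b a') = Poly_Mapping.single b (a * a')"
  by (auto intro!: poly_mapping_eqI
      simp: lookup_free_act lookup_add lookup_single when_def algebra_simps)

lemma boundary_add: "boundary (f + g) = boundary f + boundary g"
  unfolding boundary_def
  by (rule sum_keys_add) (auto simp: free_act_simps split: cell.split)

lemma boundary_0 [simp]: "boundary 0 = 0"
  by (simp add: boundary_def)

lemma boundary_single: "boundary (Poly_Mapping.single b a) =
    (case b of Gen l m \<Rightarrow> 0 | Syz l xs \<Rightarrow> free_act a (lin_comb xs))"
  by (cases "a = 0") (auto simp: boundary_def free_act_simps split: cell.split)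

lemma boundary_free_act: "boundary (free_act a f) = free_act a (boundary f)"
  by (induction f rule: mapping_induct)
    (auto simp: free_act_simps boundary_add boundary_single split: cell.split)

lemma augmentation_single:
  assumes "left_module M" "m \<in> mcar M"
  shows "augmentation M (Poly_Mapping.single (Gen l m) a) = mact M a m"
proof -
  have "mact M 0 m = mact M 0 m + mact M 0 m"
    using assms by (metis (no_types, lifting) add.right_neutral left_module_def)
  then show ?thesis by (cases "a = 0") (simp_all add: augmentation_def)
qed

lemma gr_res_exact_0:
  assumes "left_module M" "1 \<in> A 0" "piece M l \<subseteq> mcar M" "m \<in> piece M l"
  shows "\<exists>f\<in>piece (gr_res A M 0) l. augmentation M f = m"
  using assms
  by (intro bexI[of _ "Poly_Mapping.single (Gen l m) 1"])
    (auto simp: augmentation_single gr_res_def gr_free_module_def left_module_def)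

lemma gr_res_exact_Suc:
  assumes "1 \<in> A 0" "f \<in> piece (gr_res A M i) l"
    and "if i = 0 then augmentation M f = 0 else boundary f = 0"
  shows "\<exists>g\<in>piece (gr_res A M (Suc i)) l. boundary g = f"
proof -
  obtain xs where xs: "lin_comb xs = f"
    "set xs = (\<lambda>b. (Poly_Mapping.lookup f b, b)) ` Poly_Mapping.keys f"
    using lin_comb_keys[of f] by (elim exE conjE)
  have "\<forall>(a, b)\<in>set xs. b \<in> gr_res_basis A M i \<and> a \<in> A (l - cell_deg b)"
    using assms(2) by (auto simp: xs(2) gr_res_def gr_free_module_def)
  then have "Syz l xs \<in> gr_res_basis A M (Suc i)"
    using assms(3) by (simp add: xs(1))
  then show ?thesis using assms(1) xs(1)
    by (intro bexI[of _ "Poly_Mapping.single (Syz l xs) 1"])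
      (simp_all add: gr_res_def gr_free_module_def boundary_single free_act_simps
        del: gr_res_basis.simps)
qed

lemma res_exact_0:
  assumes "left_module M" "m \<in> mcar M"
  shows "\<exists>f\<in>mcar (res M 0). augmentation M f = m"
  using assms
  by (intro bexI[of _ "Poly_Mapping.single (Gen () m) 1"])
    (auto simp: augmentation_single res_def free_module_def left_module_def)

lemma res_exact_Suc:
  assumes "f \<in> mcar (res M i)" "if i = 0 then augmentation M f = 0 else boundary f = 0"
  shows "\<exists>g\<in>mcar (res M (Suc i)). boundary g = f"
proof -
  obtain xs where xs: "lin_comb xs = f"
    "set xs = (\<lambda>b. (Poly_Mapping.lookup f b, b)) ` Poly_Mapping.keys f"
    using lin_comb_keys[of f] by (elim exE conjE)
  have "\<forall>(a, b)\<in>set xs. b \<in> res_basis M i"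
    using assms(1) by (auto simp: xs(2) res_def free_module_def)
  then have "Syz () xs \<in> res_basis M (Suc i)"
    using assms(2) by (simp add: xs(1))
  then show ?thesis using xs(1)
    by (intro bexI[of _ "Poly_Mapping.single (Syz () xs) 1"])
      (simp_all add: res_def free_module_def boundary_single free_act_simps del: res_basis.simps)
qed

lemma boundary_boundary:
  assumes "\<And>b. b \<in> Poly_Mapping.keys f \<Longrightarrow> \<exists>l xs. b = Syz l xs \<and> boundary (lin_comb xs) = 0"
  shows "boundary (boundary f) = 0"
proof -
  have bs: "boundary (\<Sum>b\<in>A. g b) = (\<Sum>b\<in>A. boundary (g b))" for A
      and g :: "('a, 'b, 'c) cell \<Rightarrow> (('a, 'b, 'c) cell \<Rightarrow>\<^sub>0 'b)"
    by (induction A rule: infinite_finite_induct) (simp_all add: boundary_add)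
  show ?thesis
    unfolding boundary_def[of f] bs
  proof (rule sum.neutral, rule ballI)
    fix b assume "b \<in> Poly_Mapping.keys f"
    then obtain l xs where b: "b = Syz l xs" "boundary (lin_comb xs) = 0" using assms by blast
    show "boundary (case b of Gen l m \<Rightarrow> 0
        | Syz l xs \<Rightarrow> free_act (Poly_Mapping.lookup f b) (lin_comb xs)) = 0"
      by (simp add: b(1), simp only: boundary_free_act b(2) free_act_simps)
  qed
qed

lemma boundary_boundary_res:
  "f \<in> mcar (res M (Suc (Suc i))) \<Longrightarrow> boundary (boundary f) = 0"
  by (rule boundary_boundary) (auto simp: res_def free_module_def)

lemma boundary_boundary_gr_res:
  "f \<in> mcar (gr_res A M (Suc (Suc i))) \<Longrightarrow> boundary (boundary f) = 0"
  by (rule boundary_boundary) (auto simp: gr_res_def gr_free_module_def)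

lemma one_dop_piece: "(1 :: ('n, 'k::comm_ring_1) dop) \<in> dop_piece 0"
proof -
  have one: "(1 :: ('n, 'k) dop) = dconst 1" by (simp add: one_dop_def dmult_def pconst_def)
  show ?thesis unfolding dop_piece_def mem_Collect_eq one by (rule dop_homog.const)
qed

definition Ext_D :: "nat \<Rightarrow> (('n, 'k::field_char_0) dop, 'm::ab_group_add, 'y) lmod_scheme \<Rightarrow>
    (('n, 'k) dop, 'w::ab_group_add, 'z) lmod_scheme \<Rightarrow>
    ('k, (((unit, ('n, 'k) dop, 'm) cell \<Rightarrow>\<^sub>0 ('n, 'k) dop) \<Rightarrow> 'w) set) kspace" where
  "Ext_D i M N = cohomology (\<lambda>c f x. mact N (dconst c) (f x))
     (\<lambda>j. if j < 0 then {0} else lhom (res M (nat j)) N)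
     (\<lambda>j f x. if x \<in> mcar (res M (nat (j + 1))) then f (boundary x) else 0) (int i)"

definition star_Ext_D :: "nat \<Rightarrow> (('n, 'k::field_char_0) dop, 'm::ab_group_add) grmod \<Rightarrow>
    (('n, 'k) dop, 'w::ab_group_add) grmod \<Rightarrow>
    ('k, (((int, ('n, 'k) dop, 'm) cell \<Rightarrow>\<^sub>0 ('n, 'k) dop) \<Rightarrow> 'w) set) kspace" where
  "star_Ext_D i M N = cohomology (\<lambda>c f x. mact N (dconst c) (f x))
     (\<lambda>j. if j < 0 then {0} else star_hom (gr_res dop_piece M (nat j)) N)
     (\<lambda>j f x. if x \<in> mcar (gr_res dop_piece M (nat (j + 1))) then f (boundary x) else 0) (int i)"

end

theory Submission
  imports Defs "HOL.Vector_Spaces" "HOL-Library.Multiset_Order" "HOL-Library.Product_Plus"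
begin

text \<open>
  Taking residues (the coefficient of \<open>x\<^sub>1\<^sup>-\<^sup>1 \<cdots> x\<^sub>n\<^sup>-\<^sup>1\<close>) identifies the graded \<open>R\<close>-linear maps \<open>M \<rightarrow> E\<close>
  with the graded \<open>k\<close>-linear dual of \<open>M\<close>.  Since residues of derivatives vanish, this turns the de Rham
  complex of the Matlis dual, up to signs, into the graded dual of the de Rham complex of \<open>M\<close>, read
  backwards.

  For a free resolution \<open>F\<close> of \<open>M\<close>, the graded duals of the de Rham complexes of the \<open>F\<^sub>p\<close> form a double
  complex.  In the direction of \<open>p\<close> it is a resolution of the dual complex of \<open>M\<close>.  In the other direction
  it is exact except at the top forms, where the cohomology is \<open>*Hom\<^sub>\<D>(F\<^sub>p, E)\<close>: on a free module the
  operators \<open>f \<mapsto> f x\<^sub>t - x\<^sub>t f\<close> commute up to \<open>1\<close> with the action of \<open>\<partial>\<^sub>t\<close> and give a Koszul homotopy, which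
  inverts an Euler operator.  Comparing the two edges gives (a).

  For (b), dualising finite-dimensional cohomology preserves dimension.  Since \<open>\<D>\<close> is
  Noetherian, a finitely generated \<open>M\<close> has a graded resolution by finitely generated free modules, on which every
  \<open>\<D>\<close>-linear map to \<open>E\<close> is a finite sum of graded ones.  Such a resolution can be chosen inside the
  standard ungraded one, and a retraction up to homotopy shows that both compute the same Ext.\<close>

section \<open>Quotient spaces and double complexes\<close>

text \<open>The residue pairing between \<open>R\<close> and \<open>E\<close> is perfect only degree
  by degree. A functional on \<open>M\<close> comes from an \<open>R\<close>-linear map into
  \<open>E\<close> as soon as it vanishes in almost all degrees, because then finitely many
  monomials contribute to each value; hence graded duals throughout. Dualising stays exact: a
  functional extends from a subspace by Zorn's lemma and is then cut off in finitely many degrees.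

  The Koszul argument rests on a second Weyl algebra acting on a free module, with \<partial>_t as
  the variable and the bracket with x_t as the derivative. The de Rham complex becomes the Koszul
  complex of the variables of a polynomial ring, and the Euler operator measures the order in
  \<partial>.

  The obstacle in (b) is that Ext uses all \<D>-linear maps. On a free module of infinite rank these
  need not be finite sums of homogeneous ones, so graded and ungraded Ext are compared on finite
  bases. Taking these bases among the cells of the standard resolution makes the comparison a mere
  restriction of functions.\<close>

definition subquotient :: "('k \<Rightarrow> 'v \<Rightarrow> 'v) \<Rightarrow> 'v::ab_group_add set \<Rightarrow> 'v set \<Rightarrow> bool" where
  "subquotient s Z B \<longleftrightarrow> add_subgroup Z \<and> add_subgroup B \<and> B \<subseteq> Z \<and>
    (\<forall>c. \<forall>x\<in>Z. s c x \<in> Z) \<and> (\<forall>c. \<forall>x\<in>B. s c x \<in> B) \<and>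
    (\<forall>c. \<forall>x\<in>Z. \<forall>y\<in>Z. s c (x + y) = s c x + s c y)"

lemma add_subgroup_diff: "add_subgroup S \<Longrightarrow> x \<in> S \<Longrightarrow> y \<in> S \<Longrightarrow> x - y \<in> S"
  unfolding add_subgroup_def by (metis diff_conv_add_uminus)

lemma add_subgroup_sum:
  "add_subgroup S \<Longrightarrow> (\<And>x. x \<in> A \<Longrightarrow> f x \<in> S) \<Longrightarrow> sum f A \<in> S"
  by (induction A rule: infinite_finite_induct) (auto simp: add_subgroup_def)

lemma coset_eq_iff:
  assumes "add_subgroup B"
  shows "(+) z ` B = (+) w ` B \<longleftrightarrow> z - w \<in> (B :: 'v::ab_group_add set)"
proof
  assume "(+) z ` B = (+) w ` B"
  moreover have "z \<in> (+) z ` B" using assms by (auto simp: add_subgroup_def intro: image_eqI[of _ _ 0])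
  ultimately obtain b where "b \<in> B" "z = w + b" by auto
  then show "z - w \<in> B" by simp
next
  have *: "(+) z ` B \<subseteq> (+) w ` B" if "z - w \<in> B" for z w
  proof
    fix x assume "x \<in> (+) z ` B"
    then obtain b where b: "b \<in> B" "x = z + b" by auto
    then have "x = w + ((z - w) + b)" "(z - w) + b \<in> B"
      using assms that by (auto simp: add_subgroup_def)
    then show "x \<in> (+) w ` B" by blast
  qed
  assume zw: "z - w \<in> B"
  then have "w - z \<in> B" using assms by (metis add_subgroup_def minus_diff_eq)
  with zw * show "(+) z ` B = (+) w ` B" by blast
qed

lemma coset_add:
  assumes "add_subgroup B"
  shows "{x + y | x y. x \<in> (+) z ` B \<and> y \<in> (+) w ` B} = (+) (z + w) ` (B :: 'v::ab_group_add set)"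
proof (intro equalityI subsetI)
  fix x assume "x \<in> {x + y | x y. x \<in> (+) z ` B \<and> y \<in> (+) w ` B}"
  then obtain a b where ab: "a \<in> B" "b \<in> B" "x = (z + a) + (w + b)" by auto
  then have "x = (z + w) + (a + b)" "a + b \<in> B"
    using assms by (auto simp: add_subgroup_def algebra_simps)
  then show "x \<in> (+) (z + w) ` B" by blast
next
  fix x assume "x \<in> (+) (z + w) ` B"
  then obtain b where b: "b \<in> B" "x = (z + 0) + (w + b)" by (auto simp: add.assoc)
  moreover have "0 \<in> B" using assms by (simp add: add_subgroup_def)
  ultimately show "x \<in> {x + y | x y. x \<in> (+) z ` B \<and> y \<in> (+) w ` B}" by blast
qed

lemma coset_scale:
  assumes "subquotient s Z B" "z \<in> Z"
  shows "{s c x + b | x b. x \<in> (+) z ` B \<and> b \<in> B} = (+) (s c z) ` B"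
proof (intro equalityI subsetI)
  fix x assume "x \<in> {s c x + b | x b. x \<in> (+) z ` B \<and> b \<in> B}"
  then obtain a b where ab: "a \<in> B" "b \<in> B" "x = s c (z + a) + b" by auto
  then have "x = s c z + (s c a + b)" using assms by (auto simp: subquotient_def subset_iff add.assoc)
  moreover have "s c a + b \<in> B" using ab assms by (auto simp: subquotient_def add_subgroup_def)
  ultimately show "x \<in> (+) (s c z) ` B" by blast
next
  fix x assume "x \<in> (+) (s c z) ` B"
  then obtain b where b: "b \<in> B" "x = s c (z + 0) + b" by auto
  moreover have "0 \<in> B" using assms by (simp add: subquotient_def add_subgroup_def)
  ultimately show "x \<in> {s c x + b | x b. x \<in> (+) z ` B \<and> b \<in> B}" by blast
qed

text \<open>The isomorphisms needed below are often zig-zags rather than maps, so a correspondence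
  \<open>R\<close> compatible with subtraction and scaling takes the place of a map.
  \<open>dom\<close> and \<open>cod\<close> give partners in both directions. Applied to differences
  of representatives, one half of \<open>null\<close> makes the partner unique up to
  \<open>B'\<close> and the other half gives injectivity.\<close>

lemma quotient_iso_rel:
  fixes R :: "'v::ab_group_add \<Rightarrow> 'w::ab_group_add \<Rightarrow> bool"
  assumes V: "subquotient s Z B" and W: "subquotient s' Z' B'"
    and dom: "\<And>z. z \<in> Z \<Longrightarrow> \<exists>z'\<in>Z'. R z z'" and cod: "\<And>z'. z' \<in> Z' \<Longrightarrow> \<exists>z\<in>Z. R z z'"
    and diff: "\<And>x x' y y'. R x x' \<Longrightarrow> R y y' \<Longrightarrow> R (x - y) (x' - y')"
    and scale: "\<And>c x x'. R x x' \<Longrightarrow> R (s c x) (s' c x')"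
    and null: "\<And>z z'. z \<in> Z \<Longrightarrow> z' \<in> Z' \<Longrightarrow> R z z' \<Longrightarrow> z \<in> B \<longleftrightarrow> z' \<in> B'"
  shows "quotient_space s Z B \<cong>\<^sub>k quotient_space s' Z' B'"
proof -
  have B: "add_subgroup B" "add_subgroup B'" "add_subgroup Z" "add_subgroup Z'"
    using V W by (auto simp: subquotient_def)
  have add: "R (x + y) (x' + y')" if "R x x'" "R y y'" for x x' y y'
    using diff[OF that(1) diff[OF diff[OF that(2) that(2)] that(2)]] by simp
  define r where "r z = (SOME z'. z' \<in> Z' \<and> R z z')" for z
  have r: "r z \<in> Z'" "R z (r z)" if "z \<in> Z" for z
    using someI_ex[of "\<lambda>z'. z' \<in> Z' \<and> R z z'"] dom[OF that] unfolding r_def by blast+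
  \<comment> \<open>\<open>F\<close> picks a representative of the coset and then a partner of it;
    the fact of the same name shows that neither choice matters.\<close>
  define F where "F X = (+) (r (SOME z. z \<in> Z \<and> X = (+) z ` B)) ` B'" for X
  have F: "F ((+) z ` B) = (+) z' ` B'" if z: "z \<in> Z" "z' \<in> Z'" "R z z'" for z z'
  proof -
    define w where "w = (SOME w. w \<in> Z \<and> (+) z ` B = (+) w ` B)"
    have "w \<in> Z \<and> (+) z ` B = (+) w ` B"
      using someI[of "\<lambda>w. w \<in> Z \<and> (+) z ` B = (+) w ` B" z] z(1) unfolding w_def by blast
    then have w: "w \<in> Z" "z - w \<in> B" by (auto simp: coset_eq_iff[OF B(1)])
    have "z' - r w \<in> B'"
      using null[OF add_subgroup_diff[OF B(3) z(1) w(1)]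
          add_subgroup_diff[OF B(4) z(2) r(1)[OF w(1)]] diff[OF z(3) r(2)[OF w(1)]]] w(2) by simp
    then show ?thesis unfolding F_def w_def[symmetric] by (metis coset_eq_iff[OF B(2)])
  qed
  have inj: "X = Y" if XY: "X \<in> vcar (quotient_space s Z B)" "Y \<in> vcar (quotient_space s Z B)" "F X = F Y" for X Y
  proof -
    obtain z w where z: "z \<in> Z" "X = (+) z ` B" "w \<in> Z" "Y = (+) w ` B"
      using XY(1,2) by (simp add: quotient_space_def) blast
    then have "r z - r w \<in> B'"
      using XY(3) F[OF z(1) r[OF z(1)]] F[OF z(3) r[OF z(3)]] by (simp add: coset_eq_iff[OF B(2)])
    then have "z - w \<in> B"
      using null[OF add_subgroup_diff[OF B(3) z(1) z(3)] add_subgroup_diff[OF B(4) r(1)[OF z(1)]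
            r(1)[OF z(3)]] diff[OF r(2)[OF z(1)] r(2)[OF z(3)]]] by simp
    then show ?thesis by (simp add: z coset_eq_iff[OF B(1)])
  qed
  have surj: "F ` vcar (quotient_space s Z B) = vcar (quotient_space s' Z' B')"
  proof (intro equalityI subsetI)
    fix Y assume "Y \<in> F ` vcar (quotient_space s Z B)"
    then obtain z where "z \<in> Z" "Y = F ((+) z ` B)" by (auto simp: quotient_space_def)
    then show "Y \<in> vcar (quotient_space s' Z' B')"
      using F[OF _ r] r(1) by (auto simp: quotient_space_def)
  next
    fix Y assume "Y \<in> vcar (quotient_space s' Z' B')"
    then obtain z' where z': "z' \<in> Z'" "Y = (+) z' ` B'" by (auto simp: quotient_space_def)
    then obtain z where z: "z \<in> Z" "R z z'" using cod by blast
    then have "Y = F ((+) z ` B)" using F z' by simp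
    then show "Y \<in> F ` vcar (quotient_space s Z B)" using z(1) by (auto simp: quotient_space_def)
  qed
  show ?thesis
    unfolding kspace_iso_def
  proof (intro exI[of _ F] conjI ballI allI)
    show "bij_betw F (vcar (quotient_space s Z B)) (vcar (quotient_space s' Z' B'))"
      using inj surj by (auto simp: bij_betw_def inj_on_def)
    fix X assume "X \<in> vcar (quotient_space s Z B)"
    then obtain z where z: "z \<in> Z" "X = (+) z ` B" by (auto simp: quotient_space_def)
    note rz = r[OF z(1)]
    show "F (vscale (quotient_space s Z B) c X) = vscale (quotient_space s' Z' B') c (F X)" for c
    proof -
      have "s c z \<in> Z" "s' c (r z) \<in> Z'" using V W z(1) rz(1) by (auto simp: subquotient_def)
      from F[OF this scale[OF rz(2)]] show ?thesis
        unfolding z(2) F[OF z(1) rz] by (simp add: quotient_space_def coset_scale[OF V z(1)] coset_scale[OF W rz(1)])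
    qed
    fix Y assume "Y \<in> vcar (quotient_space s Z B)"
    then obtain w where w: "w \<in> Z" "Y = (+) w ` B" by (auto simp: quotient_space_def)
    note rw = r[OF w(1)]
    have "z + w \<in> Z" "r z + r w \<in> Z'" using B z(1) w(1) rz(1) rw(1) by (auto simp: add_subgroup_def)
    from F[OF this add[OF rz(2) rw(2)]]
    show "F (vadd (quotient_space s Z B) X Y) = vadd (quotient_space s' Z' B') (F X) (F Y)"
      unfolding z(2) w(2) F[OF z(1) rz] F[OF w(1) rw]
      by (simp add: quotient_space_def coset_add[OF B(1)] coset_add[OF B(2)])
  qed
qed

lemma kspace_iso_trans: "U \<cong>\<^sub>k V \<Longrightarrow> V \<cong>\<^sub>k W \<Longrightarrow> U \<cong>\<^sub>k W"
proof -
  assume "U \<cong>\<^sub>k V" "V \<cong>\<^sub>k W"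
  then obtain f g where f: "bij_betw f (vcar U) (vcar V)" "\<And>x y. x \<in> vcar U \<Longrightarrow> y \<in> vcar U \<Longrightarrow> f (vadd U x y) = vadd V (f x) (f y)"
      "\<And>c x. x \<in> vcar U \<Longrightarrow> f (vscale U c x) = vscale V c (f x)"
    and g: "bij_betw g (vcar V) (vcar W)" "\<And>x y. x \<in> vcar V \<Longrightarrow> y \<in> vcar V \<Longrightarrow> g (vadd V x y) = vadd W (g x) (g y)"
      "\<And>c x. x \<in> vcar V \<Longrightarrow> g (vscale V c x) = vscale W c (g x)"
    unfolding kspace_iso_def by metis
  have "f x \<in> vcar V" if "x \<in> vcar U" for x using f(1) that by (auto simp: bij_betw_def)
  then show "U \<cong>\<^sub>k W" unfolding kspace_iso_def
    by (intro exI[of _ "g \<circ> f"]) (auto simp: f(2,3) g(2,3) intro: bij_betw_trans[OF f(1) g(1)])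
qed

section \<open>Vector spaces of functions and invariance of dimension\<close>

definition fscale :: "'k::field \<Rightarrow> ('w \<Rightarrow> 'k) \<Rightarrow> 'w \<Rightarrow> 'k" where
  "fscale c x = (\<lambda>w. c * x w)"

lemma fscale_apply: "fscale c x w = c * x w"
  by (simp add: fscale_def)

lemma fscale_0 [simp]: "fscale c 0 = 0"
  by (auto simp: fscale_def)

interpretation fun_space: vector_space "fscale :: 'k::field \<Rightarrow> ('w \<Rightarrow> 'k) \<Rightarrow> _"
  by unfold_locales (auto simp: fscale_def algebra_simps)

definition subspace_fun :: "('w \<Rightarrow> 'k::field) set \<Rightarrow> bool" where
  "subspace_fun A \<longleftrightarrow> add_subgroup A \<and> (\<forall>c. \<forall>x\<in>A. fscale c x \<in> A)"

lemma subspace_fun_add: "subspace_fun A \<Longrightarrow> x \<in> A \<Longrightarrow> y \<in> A \<Longrightarrow> x + y \<in> A"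
  by (simp add: subspace_fun_def add_subgroup_def)

lemma subspace_fun_diff: "subspace_fun A \<Longrightarrow> x \<in> A \<Longrightarrow> y \<in> A \<Longrightarrow> x - y \<in> A"
  by (simp add: subspace_fun_def add_subgroup_diff)

lemma subspace_fun_0: "subspace_fun A \<Longrightarrow> 0 \<in> A"
  by (simp add: subspace_fun_def add_subgroup_def)

lemma subspace_fun_scale: "subspace_fun A \<Longrightarrow> x \<in> A \<Longrightarrow> fscale c x \<in> A"
  unfolding subspace_fun_def by blast

lemma subspace_funI:
  assumes "0 \<in> A" "\<And>x y. x \<in> A \<Longrightarrow> y \<in> A \<Longrightarrow> x + y \<in> A" "\<And>c x. x \<in> A \<Longrightarrow> fscale c x \<in> A"
  shows "subspace_fun A"
proof -
  have "- x \<in> A" if "x \<in> A" for x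
  proof -
    have "fscale (-1) x = - x" by (auto simp: fscale_def)
    then show ?thesis using assms(3)[OF that, of "-1"] by simp
  qed
  then show ?thesis using assms by (auto simp: subspace_fun_def add_subgroup_def)
qed

lemma subspace_fun_zero: "subspace_fun {0}"
  by (rule subspace_funI) auto

lemma subspace_fun_image:
  assumes "subspace_fun A" "\<And>x y. f (x - y) = f x - f y" "\<And>c x. f (fscale c x) = fscale c (f x)"
  shows "subspace_fun (f ` A)"
proof -
  have f0: "f 0 = 0" using assms(2)[of 0 0] by simp
  have fadd: "f (x + y) = f x + f y" for x y
    using assms(2)[of "x + y" y] by (simp add: algebra_simps)
  show ?thesis
  proof (rule subspace_funI)
    show "0 \<in> f ` A" using f0 subspace_fun_0[OF assms(1)] by force
    fix x y assume "x \<in> f ` A" "y \<in> f ` A"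
    then obtain a b where ab: "a \<in> A" "b \<in> A" "x = f a" "y = f b" by blast
    show "x + y \<in> f ` A"
      unfolding ab fadd[symmetric] by (rule imageI[OF subspace_fun_add[OF assms(1) ab(1,2)]])
  next
    fix c x assume "x \<in> f ` A"
    then obtain a where a: "a \<in> A" "x = f a" by blast
    show "fscale c x \<in> f ` A"
      unfolding a assms(3)[symmetric] by (rule imageI[OF subspace_fun_scale[OF assms(1) a(1)]])
  qed
qed

lemma subspace_fun_ker:
  assumes "subspace_fun A" "\<And>x y. f (x - y) = f x - f y" "\<And>c x. f (fscale c x) = fscale c (f x)"
  shows "subspace_fun {x \<in> A. f x = 0}"
proof -
  have f0: "f 0 = 0" using assms(2)[of 0 0] by simp
  have fadd: "f (x + y) = f x + f y" for x y
    using assms(2)[of "x + y" y] by (simp add: algebra_simps)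
  show ?thesis
    by (rule subspace_funI) (auto simp: f0 fadd assms(3) subspace_fun_add[OF assms(1)]
      subspace_fun_0[OF assms(1)] subspace_fun_scale[OF assms(1)])
qed

lemma subquotient_fun: "subspace_fun Z \<Longrightarrow> subspace_fun B \<Longrightarrow> B \<subseteq> Z \<Longrightarrow> subquotient fscale Z B"
  unfolding subquotient_def subspace_fun_def by (auto simp: fscale_def algebra_simps)

text \<open>Invariance of dimension, which makes the definite description in \<open>kdim\<close>
  unique. The two isomorphisms compose to a linear injection between coordinate spaces, and
  \<open>d\<close> independent vectors fit into a span of \<open>e\<close> vectors only if
  \<open>d \<le> e\<close>.\<close>

lemma coord_space_le:
  assumes "coord_space d \<cong>\<^sub>k V" "coord_space e \<cong>\<^sub>k (V :: ('k::field, 'v) kspace)"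
  shows "d \<le> e"
proof -
  let ?C = "\<lambda>d. vcar (coord_space d :: ('k, nat \<Rightarrow> 'k) kspace)"
  have vadd: "vadd (coord_space d) = (+)" "vscale (coord_space d) = (fscale :: 'k \<Rightarrow> (nat \<Rightarrow> 'k) \<Rightarrow> _)" for d
    by (auto simp: coord_space_def fscale_def fun_eq_iff)
  have C: "v \<in> ?C d \<longleftrightarrow> (\<forall>i\<ge>d. v i = 0)" for v d by (simp add: coord_space_def)
  obtain f where f: "bij_betw f (?C d) (vcar V)" "\<And>x y. x \<in> ?C d \<Longrightarrow> y \<in> ?C d \<Longrightarrow> f (x + y) = vadd V (f x) (f y)"
      "\<And>c x. x \<in> ?C d \<Longrightarrow> f (fscale c x) = vscale V c (f x)"
    using assms(1) unfolding kspace_iso_def vadd by metis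
  obtain g where g: "bij_betw g (?C e) (vcar V)" "\<And>x y. x \<in> ?C e \<Longrightarrow> y \<in> ?C e \<Longrightarrow> g (x + y) = vadd V (g x) (g y)"
      "\<And>c x. x \<in> ?C e \<Longrightarrow> g (fscale c x) = vscale V c (g x)"
    using assms(2) unfolding kspace_iso_def vadd by metis
  define g' where "g' = inv_into (?C e) g"
  have g': "g' (g x) = x" if "x \<in> ?C e" for x
    using g(1) that unfolding g'_def by (simp add: bij_betw_def)
  have gg: "g (g' y) = y" "g' y \<in> ?C e" if "y \<in> vcar V" for y
    using g(1) that unfolding g'_def by (auto simp: bij_betw_def f_inv_into_f inv_into_into)
  have fV: "f x \<in> vcar V" if "x \<in> ?C d" for x using f(1) that by (auto simp: bij_betw_def)
  \<comment> \<open>A linear map on the whole function type is wanted, so the isomorphism is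
    precomposed with the projection \<open>t\<close> of all functions onto the first
    \<open>d\<close> coordinates.\<close>
  define t where "t x = (\<lambda>i. if i < d then x i else (0::'k))" for x
  have t: "t x \<in> ?C d" "t (x + y) = t x + t y" "t (fscale c x) = fscale c (t x)" for x y c
    by (auto simp: t_def C fscale_def fun_eq_iff)
  define h where "h x = g' (f (t x))" for x
  have hC: "h x \<in> ?C e" for x unfolding h_def using gg(2)[OF fV[OF t(1)]] .
  have gh: "g (h x) = f (t x)" for x unfolding h_def using gg(1)[OF fV[OF t(1)]] .
  have hadd: "h (x + y) = h x + h y" for x y
  proof -
    have "h x + h y \<in> ?C e" using hC[of x] hC[of y] by (auto simp: C)
    moreover have "f (t (x + y)) = g (h x + h y)"
      by (simp add: t(2) f(2)[OF t(1) t(1)] g(2)[OF hC hC] gh)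
    ultimately show ?thesis unfolding h_def[of "x + y"] by (simp add: g')
  qed
  have hsc: "h (fscale c x) = fscale c (h x)" for c x
  proof -
    have "fscale c (h x) \<in> ?C e" using hC[of x] by (auto simp: C fscale_def)
    moreover have "f (t (fscale c x)) = g (fscale c (h x))"
      by (simp add: t(3) f(3)[OF t(1)] g(3)[OF hC] gh)
    ultimately show ?thesis unfolding h_def[of "fscale c x"] by (simp add: g')
  qed
  interpret vp: vector_space_pair "fscale :: 'k \<Rightarrow> (nat \<Rightarrow> 'k) \<Rightarrow> _" "fscale :: 'k \<Rightarrow> (nat \<Rightarrow> 'k) \<Rightarrow> _" ..
  have lin: "Vector_Spaces.linear fscale fscale h"
    by unfold_locales (auto simp: hadd hsc)
  define u where "u i = (\<lambda>j. if j = i then 1 else (0::'k))" for i :: nat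
  have u_inj: "inj u" by (auto simp: inj_def u_def fun_eq_iff split: if_splits)
  have span_C: "fun_space.span (u ` {..<m}) = ?C m" for m
  proof (intro equalityI subsetI)
    fix x assume "x \<in> fun_space.span (u ` {..<m})"
    then show "x \<in> ?C m"
      by (induction rule: fun_space.span_induct_alt) (auto simp: C u_def fscale_def)
  next
    fix x assume x: "x \<in> ?C m"
    have "x = (\<Sum>i<m. fscale (x i) (u i))"
    proof
      fix j
      have s: "(\<Sum>i\<in>A. fscale (x i) (u i)) j = (\<Sum>i\<in>A. fscale (x i) (u i) j)" for A
        by (induction A rule: infinite_finite_induct) auto
      have "(\<Sum>i<m. fscale (x i) (u i) j) = (\<Sum>i<m. if i = j then x j else 0)"
        by (intro sum.cong) (auto simp: fscale_def u_def)
      then show "x j = (\<Sum>i<m. fscale (x i) (u i)) j" unfolding s using x by (simp add: C)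
    qed
    also have "\<dots> \<in> fun_space.span (u ` {..<m})"
      by (intro fun_space.span_sum fun_space.span_scale fun_space.span_base) auto
    finally show "x \<in> fun_space.span (u ` {..<m})" .
  qed
  have indep: "fun_space.independent (u ` {..<d})"
    unfolding fun_space.independent_explicit_finite_subsets
  proof (intro allI impI ballI)
    fix S c v assume S: "S \<subseteq> u ` {..<d}" "finite S" "(\<Sum>v\<in>S. fscale (c v) v) = 0" "v \<in> S"
    obtain i where i: "v = u i" using S by auto
    have s: "(\<Sum>v\<in>S. fscale (c v) v) j = (\<Sum>v\<in>S. fscale (c v) v j)" for j
      using S(2) by (induction S) auto
    have "(\<Sum>w\<in>S. fscale (c w) w i) = (\<Sum>w\<in>S. if w = v then c v else 0)"
    proof (intro sum.cong refl)
      fix w assume "w \<in> S"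
      then obtain j where "w = u j" using S(1) by auto
      then show "fscale (c w) w i = (if w = v then c v else 0)"
        using i inj_eq[OF u_inj, of j i] by (auto simp: fscale_apply) (auto simp: u_def)
    qed
    with s[of i] S show "c v = 0" by simp
  qed
  have inj: "inj_on h (fun_space.span (u ` {..<d}))"
  proof (rule inj_onI)
    fix x y assume "x \<in> fun_space.span (u ` {..<d})" "y \<in> fun_space.span (u ` {..<d})" "h x = h y"
    then have xy: "x \<in> ?C d" "y \<in> ?C d" "f (t x) = f (t y)" using gh[of x] gh[of y] by (auto simp: span_C)
    moreover have "t x = x" "t y = y" using xy(1,2) by (auto simp: t_def C fun_eq_iff)
    ultimately show "x = y" using f(1) by (auto simp: bij_betw_def inj_on_def)
  qed
  have "fun_space.independent (h ` u ` {..<d})"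
    by (rule vp.linear_independent_injective_image[OF lin indep inj])
  moreover have "h ` u ` {..<d} \<subseteq> fun_space.span (u ` {..<e})" unfolding span_C using hC by auto
  ultimately have "card (h ` u ` {..<d}) \<le> card (u ` {..<e})"
    using fun_space.independent_span_bound[of "u ` {..<e}"] by blast
  moreover have "card (h ` u ` {..<d}) = d"
    using inj fun_space.span_superset[of "u ` {..<d}"] u_inj
    by (metis card_image card_lessThan inj_on_subset subset_UNIV)
  moreover have "card (u ` {..<e}) = e" using u_inj by (metis card_image card_lessThan inj_on_subset subset_UNIV)
  ultimately show ?thesis by simp
qed

lemma kdim_eq:
  assumes "coord_space d \<cong>\<^sub>k V"
  shows "kdim V = d"
  unfolding kdim_def
  using assms coord_space_le by (intro the_equality) (auto intro: antisym)

text \<open>The rows (direction \<open>p\<close>, maps \<open>h\<close>) are resolutions of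
  \<open>B\<close> by way of \<open>e\<close>; the columns (direction \<open>q\<close>, maps
  \<open>v\<close>) are exact except at \<open>q = 0\<close>. Squares commute instead of
  anticommuting, which changes no kernel or image. In the application \<open>q\<close> counts down
  from the top form degree.\<close>

locale exact_double_complex =
  fixes A :: "nat \<Rightarrow> nat \<Rightarrow> ('w \<Rightarrow> 'k::field) set"
    and h v :: "nat \<Rightarrow> nat \<Rightarrow> ('w \<Rightarrow> 'k) \<Rightarrow> ('w \<Rightarrow> 'k)"
    and B :: "nat \<Rightarrow> ('u \<Rightarrow> 'k) set" and e :: "nat \<Rightarrow> ('u \<Rightarrow> 'k) \<Rightarrow> ('w \<Rightarrow> 'k)"
    and u :: "nat \<Rightarrow> ('u \<Rightarrow> 'k) \<Rightarrow> ('u \<Rightarrow> 'k)"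
  assumes subA: "subspace_fun (A p q)" and subB: "subspace_fun (B q)"
    and h_closed: "x \<in> A p q \<Longrightarrow> h p q x \<in> A (Suc p) q"
    and v_closed: "x \<in> A p q \<Longrightarrow> v p q x \<in> A p (Suc q)"
    and e_closed: "y \<in> B q \<Longrightarrow> e q y \<in> A 0 q"
    and u_closed: "y \<in> B q \<Longrightarrow> u q y \<in> B (Suc q)"
    and h_lin: "h p q (x - x') = h p q x - h p q x'" "h p q (fscale c x) = fscale c (h p q x)"
    and v_lin: "v p q (x - x') = v p q x - v p q x'" "v p q (fscale c x) = fscale c (v p q x)"
    and e_lin: "e q (y - y') = e q y - e q y'" "e q (fscale c y) = fscale c (e q y)"
    and u_lin: "u q (y - y') = u q y - u q y'" "u q (fscale c y) = fscale c (u q y)"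
    and comm: "x \<in> A p q \<Longrightarrow> v (Suc p) q (h p q x) = h p (Suc q) (v p q x)"
    and e_comm: "y \<in> B q \<Longrightarrow> v 0 q (e q y) = e (Suc q) (u q y)"
    and hh: "x \<in> A p q \<Longrightarrow> h (Suc p) q (h p q x) = 0"
    and vv: "x \<in> A p q \<Longrightarrow> v p (Suc q) (v p q x) = 0"
    and he: "y \<in> B q \<Longrightarrow> h 0 q (e q y) = 0"
    and h_exact: "x \<in> A (Suc p) q \<Longrightarrow> h (Suc p) q x = 0 \<Longrightarrow> \<exists>y\<in>A p q. x = h p q y"
    and e_exact: "x \<in> A 0 q \<Longrightarrow> h 0 q x = 0 \<Longrightarrow> \<exists>y\<in>B q. x = e q y"
    and e_inj: "y \<in> B q \<Longrightarrow> e q y = 0 \<Longrightarrow> y = 0"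
    and v_exact: "x \<in> A p (Suc q) \<Longrightarrow> v p (Suc q) x = 0 \<Longrightarrow> \<exists>y\<in>A p q. x = v p q y"
begin

lemma zeros [simp]: "h p q 0 = 0" "v p q 0 = 0" "e q 0 = 0" "u q 0 = 0"
  using h_lin(1)[of p q 0 0] v_lin(1)[of p q 0 0] e_lin(1)[of q 0 0] u_lin(1)[of q 0 0] by simp_all

lemma uu: "y \<in> B q \<Longrightarrow> u (Suc q) (u q y) = 0"
  using e_inj[OF u_closed[OF u_closed]] e_comm u_closed vv[OF e_closed] by simp

definition Z :: "nat \<Rightarrow> nat \<Rightarrow> ('w \<Rightarrow> 'k) set" where
  "Z p q = {x \<in> A p q. h p q x = 0 \<and> v p q x = 0}"

text \<open>\<open>Z p q\<close> modulo \<open>N p q\<close> is the receptor of the salamander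
  lemma: the common kernel of both differentials modulo the image of the diagonal map into the
  position. In the interior this description appears inside the proof of \<open>N_Suc_Suc\<close>;
  for \<open>p = 0\<close> or \<open>q = 0\<close> the diagonal starts outside the quadrant, from
  \<open>B\<close> or from a kernel of \<open>v\<close>.\<close>

definition N :: "nat \<Rightarrow> nat \<Rightarrow> ('w \<Rightarrow> 'k) set" where
  "N p q = (case q of Suc q' \<Rightarrow> v p q' ` {a \<in> A p q'. h p q' a = 0}
     | 0 \<Rightarrow> (case p of 0 \<Rightarrow> {0} | Suc p' \<Rightarrow> h p' 0 ` {a \<in> A p' 0. v p' 0 a = 0}))"

text \<open>Exactness turns both kernels into images, and the two composite images agree by
  commutativity, so \<open>N\<close> may be described by either direction.\<close>

lemma N_Suc_Suc: "N (Suc p) (Suc q) = h p (Suc q) ` {a \<in> A p (Suc q). v p (Suc q) a = 0}"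
proof -
  have "N (Suc p) (Suc q) = v (Suc p) q ` h p q ` A p q"
    unfolding N_def using h_exact[of _ p q] hh h_closed by (auto intro!: arg_cong[of _ _ "(`) _"])
  also have "\<dots> = h p (Suc q) ` v p q ` A p q"
    using comm by (auto simp: image_iff)
  also have "v p q ` A p q = {a \<in> A p (Suc q). v p (Suc q) a = 0}"
    using v_exact[of _ p q] vv v_closed by auto
  finally show ?thesis .
qed

lemma sub_Z: "subspace_fun (Z p q)"
proof -
  have "Z p q = {x \<in> {x \<in> A p q. h p q x = 0}. v p q x = 0}" by (auto simp: Z_def)
  then show ?thesis by (simp only: subspace_fun_ker subA h_lin v_lin)
qed

lemma sub_N: "subspace_fun (N p q)"
  by (auto simp: N_def split: nat.split
    intro!: subspace_fun_zero subspace_fun_image subspace_fun_ker subA h_lin v_lin)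

lemma N_Z: "N p q \<subseteq> Z p q"
  by (auto simp: N_def Z_def hh vv h_closed v_closed subspace_fun_0[OF subA] comm[symmetric] comm
    split: nat.split)

text \<open>The basic zig-zag: an element \<open>a\<close> at \<open>(p, q)\<close> has
  \<open>v a\<close> on one side and \<open>h a\<close> on the other. Exactness of the column at
  \<open>Suc q\<close> and of the row at \<open>Suc p\<close> supplies \<open>a\<close> from either
  end, so the quotient is constant along an antidiagonal.\<close>

lemma step:
  "quotient_space fscale (Z p (Suc q)) (N p (Suc q)) \<cong>\<^sub>k quotient_space fscale (Z (Suc p) q) (N (Suc p) q)"
proof (rule quotient_iso_rel[where R = "\<lambda>x y. \<exists>a\<in>A p q. x = v p q a \<and> y = h p q a"])
  show "subquotient fscale (Z p (Suc q)) (N p (Suc q))" "subquotient fscale (Z (Suc p) q) (N (Suc p) q)"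
    by (rule subquotient_fun[OF sub_Z sub_N N_Z])+
  have N2: "N (Suc p) q = h p q ` {a \<in> A p q. v p q a = 0}"
    by (cases q) (simp_all only: N_Suc_Suc, simp add: N_def)
  have N1: "N p (Suc q) = v p q ` {a \<in> A p q. h p q a = 0}" by (simp add: N_def)
  show "\<exists>z'\<in>Z (Suc p) q. \<exists>a\<in>A p q. z = v p q a \<and> z' = h p q a" if z: "z \<in> Z p (Suc q)" for z
  proof -
    obtain a where a: "a \<in> A p q" "z = v p q a" using v_exact[of z p q] z by (auto simp: Z_def)
    then have "h p q a \<in> Z (Suc p) q" using z by (simp add: Z_def h_closed hh comm)
    with a show ?thesis by blast
  qed
  show "\<exists>z\<in>Z p (Suc q). \<exists>a\<in>A p q. z = v p q a \<and> z' = h p q a" if z: "z' \<in> Z (Suc p) q" for z'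
  proof -
    obtain a where a: "a \<in> A p q" "z' = h p q a" using h_exact[of z' p q] z by (auto simp: Z_def)
    then have "v p q a \<in> Z p (Suc q)" using z by (simp add: Z_def v_closed vv comm)
    with a show ?thesis by blast
  qed
  show "\<exists>a\<in>A p q. x - y = v p q a \<and> x' - y' = h p q a"
    if "\<exists>a\<in>A p q. x = v p q a \<and> x' = h p q a" "\<exists>a\<in>A p q. y = v p q a \<and> y' = h p q a" for x x' y y'
    using that subspace_fun_diff[OF subA, of _ p q] by (auto simp: h_lin(1)[symmetric] v_lin(1)[symmetric])
  show "\<exists>a\<in>A p q. fscale c x = v p q a \<and> fscale c x' = h p q a"
    if "\<exists>a\<in>A p q. x = v p q a \<and> x' = h p q a" for c x x'
    using that subspace_fun_scale[OF subA, of _ p q] by (auto simp: h_lin(2)[symmetric] v_lin(2)[symmetric])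
  show "z \<in> N p (Suc q) \<longleftrightarrow> z' \<in> N (Suc p) q" if zz: "\<exists>a\<in>A p q. z = v p q a \<and> z' = h p q a" for z z'
  proof -
    obtain a where a: "a \<in> A p q" "z = v p q a" "z' = h p q a" using zz by blast
    have "\<exists>b\<in>A p q. v p q b = 0 \<and> z' = h p q b" if zN: "z \<in> N p (Suc q)"
    proof -
      obtain b where "b \<in> A p q" "h p q b = 0" "z = v p q b" using zN unfolding N1 by blast
      \<comment> \<open>Subtracting \<open>b\<close> leaves the \<open>h\<close>-image of
        \<open>a\<close> unchanged and makes its \<open>v\<close>-image zero.\<close>
      then show ?thesis using a subspace_fun_diff[OF subA a(1), of b] by (intro bexI[of _ "a - b"]) (auto simp: h_lin v_lin)
    qed
    moreover have "\<exists>b\<in>A p q. h p q b = 0 \<and> z = v p q b" if zN: "z' \<in> N (Suc p) q"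
    proof -
      obtain b where "b \<in> A p q" "v p q b = 0" "z' = h p q b" using zN unfolding N2 by blast
      then show ?thesis using a subspace_fun_diff[OF subA a(1), of b] by (intro bexI[of _ "a - b"]) (auto simp: h_lin v_lin)
    qed
    ultimately show ?thesis unfolding N1 N2 by blast
  qed
qed

text \<open>The edge where the antidiagonal begins: \<open>e\<close> is an isomorphism onto the
  kernel of \<open>h\<close>, so it matches cocycles of \<open>B\<close> with elements of
  \<open>A 0 q\<close> killed by both differentials, and coboundaries with
  \<open>N 0 q\<close>.\<close>

lemma start:
  "quotient_space fscale {y \<in> B q. u q y = 0} (case q of 0 \<Rightarrow> {0} | Suc q' \<Rightarrow> u q' ` B q')
    \<cong>\<^sub>k quotient_space fscale (Z 0 q) (N 0 q)"
proof (rule quotient_iso_rel[where R = "\<lambda>y x. y \<in> B q \<and> x = e q y"])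
  show "subquotient fscale {y \<in> B q. u q y = 0} (case q of 0 \<Rightarrow> {0} | Suc q' \<Rightarrow> u q' ` B q')"
    by (intro subquotient_fun subspace_fun_ker subB u_lin)
      (auto split: nat.split intro!: subspace_fun_zero subspace_fun_image subB u_lin
        simp: uu u_closed subspace_fun_0[OF subB])
  show "subquotient fscale (Z 0 q) (N 0 q)"
    by (rule subquotient_fun[OF sub_Z sub_N N_Z])
  show "\<exists>z'\<in>Z 0 q. z \<in> B q \<and> z' = e q z" if "z \<in> {y \<in> B q. u q y = 0}" for z
    using that by (auto simp: Z_def e_closed he e_comm)
  show "\<exists>z\<in>{y \<in> B q. u q y = 0}. z \<in> B q \<and> z' = e q z" if z: "z' \<in> Z 0 q" for z'
  proof -
    obtain y where y: "y \<in> B q" "z' = e q y" using e_exact[of z' q] z by (auto simp: Z_def)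
    then have "u q y = 0" using z by (intro e_inj[OF u_closed]) (auto simp: Z_def e_comm[symmetric])
    with y show ?thesis by blast
  qed
  show "z \<in> (case q of 0 \<Rightarrow> {0} | Suc q' \<Rightarrow> u q' ` B q') \<longleftrightarrow> z' \<in> N 0 q" if z: "z \<in> B q \<and> z' = e q z" for z z'
  proof (cases q)
    case 0
    then show ?thesis using z e_inj[of z 0] by (auto simp: N_def)
  next
    case (Suc q')
    have "\<exists>a\<in>A 0 q'. h 0 q' a = 0 \<and> z' = v 0 q' a" if b: "b \<in> B q'" "z = u q' b" for b
      using b z Suc by (intro bexI[of _ "e q' b"]) (auto simp: he e_comm e_closed)
    moreover have "\<exists>b\<in>B q'. z = u q' b" if a: "a \<in> A 0 q'" "h 0 q' a = 0" "z' = v 0 q' a" for a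
    proof -
      obtain b where b: "b \<in> B q'" "a = e q' b" using e_exact[OF a(1,2)] by blast
      have "e q (z - u q' b) = 0" using z a b Suc by (simp add: e_lin e_comm)
      then have "z - u q' b = 0" using e_inj subspace_fun_diff[OF subB] z u_closed[OF b(1)] Suc by blast
      with b show ?thesis by (intro bexI[of _ b]) simp_all
    qed
    ultimately show ?thesis by (auto simp: N_def Suc)
  qed
qed (auto simp: e_lin subspace_fun_diff[OF subB] subspace_fun_scale[OF subB])

text \<open>Walking from \<open>(0, i)\<close> to \<open>(i, 0)\<close> in \<open>i\<close> steps
  links the two edges of the complex.\<close>

theorem balance:
  "quotient_space fscale {y \<in> B i. u i y = 0} (case i of 0 \<Rightarrow> {0} | Suc i' \<Rightarrow> u i' ` B i')
    \<cong>\<^sub>k quotient_space fscale {x \<in> A i 0. h i 0 x = 0 \<and> v i 0 x = 0}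
      (case i of 0 \<Rightarrow> {0} | Suc i' \<Rightarrow> h i' 0 ` {a \<in> A i' 0. v i' 0 a = 0})"
proof -
  have "quotient_space fscale {y \<in> B i. u i y = 0} (case i of 0 \<Rightarrow> {0} | Suc i' \<Rightarrow> u i' ` B i')
    \<cong>\<^sub>k quotient_space fscale (Z p (i - p)) (N p (i - p))" if "p \<le> i" for p
    using that
  proof (induction p)
    case 0
    show ?case unfolding minus_nat.diff_0 by (rule start)
  next
    case (Suc p)
    then have ip: "i - p = Suc (i - Suc p)" by simp
    from Suc have "quotient_space fscale {y \<in> B i. u i y = 0} (case i of 0 \<Rightarrow> {0} | Suc i' \<Rightarrow> u i' ` B i')
      \<cong>\<^sub>k quotient_space fscale (Z p (i - p)) (N p (i - p))" by linarith
    from this step[of p "i - Suc p", folded ip] show ?case by (rule kspace_iso_trans)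
  qed
  from this[OF order_refl] show ?thesis unfolding diff_self_eq_0 by (simp only: Z_def N_def nat.case)
qed

end

section \<open>Linear functionals and graded duals\<close>

locale kmodule =
  fixes V :: "'v::ab_group_add set" and s :: "'k::field \<Rightarrow> 'v \<Rightarrow> 'v"
  assumes V: "add_subgroup V"
    and s_closed: "x \<in> V \<Longrightarrow> s c x \<in> V"
    and s_add: "x \<in> V \<Longrightarrow> y \<in> V \<Longrightarrow> s c (x + y) = s c x + s c y"
    and s_add2: "x \<in> V \<Longrightarrow> s (c + c') x = s c x + s c' x"
    and s_mult: "x \<in> V \<Longrightarrow> s (c * c') x = s c (s c' x)"
    and s_one: "x \<in> V \<Longrightarrow> s 1 x = x"
begin

lemma V0 [simp]: "0 \<in> V" and Vadd: "x \<in> V \<Longrightarrow> y \<in> V \<Longrightarrow> x + y \<in> V" and Vneg: "x \<in> V \<Longrightarrow> - x \<in> V"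
  and Vdiff: "x \<in> V \<Longrightarrow> y \<in> V \<Longrightarrow> x - y \<in> V"
  using V by (auto simp: add_subgroup_def add_subgroup_diff[OF V])

lemma s_0: "s c 0 = 0"
  using s_add[OF V0 V0, of c] by simp

lemma s_02: "x \<in> V \<Longrightarrow> s 0 x = 0"
  using s_add2[of x 0 0] by simp

lemma s_neg1: "x \<in> V \<Longrightarrow> s (- 1) x = - x"
  using s_add2[of x 1 "- 1"] by (simp add: s_one s_02 eq_neg_iff_add_eq_0 add.commute)

end

definition linear_functionals :: "'v::ab_group_add set \<Rightarrow> ('k::field \<Rightarrow> 'v \<Rightarrow> 'v) \<Rightarrow> ('v \<Rightarrow> 'k) set" where
  "linear_functionals V s = {\<phi>. (\<forall>x\<in>V. \<forall>y\<in>V. \<phi> (x + y) = \<phi> x + \<phi> y) \<and>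
     (\<forall>c. \<forall>x\<in>V. \<phi> (s c x) = c * \<phi> x) \<and> (\<forall>x. x \<notin> V \<longrightarrow> \<phi> x = 0)}"

text \<open>Vanishing in almost all degrees is what replaces the full dual by the direct sum of the
  duals of the homogeneous components.\<close>

definition graded_dual :: "'v::ab_group_add set \<Rightarrow> ('k::field \<Rightarrow> 'v \<Rightarrow> 'v) \<Rightarrow> (int \<Rightarrow> 'v \<Rightarrow> 'v) \<Rightarrow>
    ('v \<Rightarrow> 'k) set" where
  "graded_dual V s pr = {\<phi> \<in> linear_functionals V s.
     \<exists>S. finite S \<and> (\<forall>x\<in>V. \<forall>l. l \<notin> S \<longrightarrow> \<phi> (pr l x) = 0)}"

context kmodule
begin

text \<open>Partial linear functionals are encoded as graphs, so that Zorn's lemma applies to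
  inclusion. By linearity, being single valued reduces to the fibre over \<open>0\<close>.\<close>

definition linear_graph :: "('v \<times> 'k) set \<Rightarrow> bool" where
  "linear_graph G \<longleftrightarrow> G \<subseteq> V \<times> UNIV \<and> (0, 0) \<in> G \<and>
     (\<forall>x a y b. (x, a) \<in> G \<longrightarrow> (y, b) \<in> G \<longrightarrow> (x + y, a + b) \<in> G) \<and>
     (\<forall>c x a. (x, a) \<in> G \<longrightarrow> (s c x, c * a) \<in> G) \<and> (\<forall>a. (0, a) \<in> G \<longrightarrow> a = 0)"

lemma linear_graph_unique:
  assumes "linear_graph G" "(x, a) \<in> G" "(x, b) \<in> G"
  shows "a = b"
proof -
  have x: "x \<in> V" using assms unfolding linear_graph_def by blast
  have "(s (- 1) x, (- 1) * b) \<in> G" using assms unfolding linear_graph_def by blast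
  then have "(x + s (- 1) x, a + (- 1) * b) \<in> G" using assms unfolding linear_graph_def by blast
  then have "(0, a - b) \<in> G" using x by (simp add: s_neg1)
  then show ?thesis using assms(1) unfolding linear_graph_def by (metis eq_iff_diff_eq_0)
qed

text \<open>The extension sends the new vector \<open>z\<close> to \<open>0\<close>. It stays single
  valued, since a relation \<open>0 = x + s c z\<close> with \<open>c \<noteq> 0\<close> would put
  \<open>z\<close> into the old domain.\<close>

lemma linear_graph_insert:
  assumes G: "linear_graph G" and z: "z \<in> V" "z \<notin> fst ` G"
  shows "linear_graph {(x + s c z, a) | x c a. (x, a) \<in> G}" (is "linear_graph ?H")
proof -
  have GV: "x \<in> V" if "(x, a) \<in> G" for x a using G that unfolding linear_graph_def by blast
  have zero: "(0, 0) \<in> G" and add: "\<And>x a y b. (x, a) \<in> G \<Longrightarrow> (y, b) \<in> G \<Longrightarrow> (x + y, a + b) \<in> G"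
    and sc: "\<And>c x a. (x, a) \<in> G \<Longrightarrow> (s c x, c * a) \<in> G"
    using G unfolding linear_graph_def by blast+
  show ?thesis
    unfolding linear_graph_def
  proof (intro conjI allI impI)
    show "?H \<subseteq> V \<times> UNIV" using GV z by (auto intro: Vadd s_closed)
    show "(0, 0) \<in> ?H" using zero z by (auto intro!: exI[of _ 0] simp: s_02)
  next
    fix x a y b assume "(x, a) \<in> ?H" "(y, b) \<in> ?H"
    then obtain x' c y' d where xy: "x = x' + s c z" "(x', a) \<in> G" "y = y' + s d z" "(y', b) \<in> G" by blast
    then have "x + y = (x' + y') + s (c + d) z" using z by (simp add: s_add2 algebra_simps)
    with add xy show "(x + y, a + b) \<in> ?H" by blast
  next
    fix c x a assume "(x, a) \<in> ?H"
    then obtain x' d where x: "x = x' + s d z" "(x', a) \<in> G" by blast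
    then have "s c x = s c x' + s (c * d) z" using z GV by (simp add: s_add s_closed s_mult)
    with sc x show "(s c x, c * a) \<in> ?H" by blast
  next
    fix a assume "(0, a) \<in> ?H"
    then obtain x c where x: "0 = x + s c z" "(x, a) \<in> G" by blast
    have "c = 0"
    proof (rule ccontr)
      assume c: "c \<noteq> 0"
      have "x = s (- 1) (s c z)" using x(1) z by (simp add: s_neg1 s_closed eq_neg_iff_add_eq_0)
      then have "s (- inverse c) x = s (- inverse c * - 1 * c) z" using z by (simp only: s_mult s_closed)
      then have "s (- inverse c) x = z" using c z by (simp add: s_one)
      then have "z \<in> fst ` G" using sc[OF x(2), of "- inverse c"] by force
      with z show False by simp
    qed
    then have "(0, a) \<in> G" using x z by (simp add: s_02)
    then show "a = 0" using G unfolding linear_graph_def by blast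
  qed
qed

text \<open>Zorn's lemma on partial functionals: a maximal one has full domain, as it could
  otherwise be extended by one vector.\<close>

lemma extend_functional:
  assumes W: "add_subgroup W" "W \<subseteq> V" "\<And>c x. x \<in> W \<Longrightarrow> s c x \<in> W"
    and f: "\<And>x y. x \<in> W \<Longrightarrow> y \<in> W \<Longrightarrow> f (x + y) = f x + f y" "\<And>c x. x \<in> W \<Longrightarrow> f (s c x) = c * f x"
  shows "\<exists>g\<in>linear_functionals V s. \<forall>x\<in>W. g x = f x"
proof -
  let ?G = "{(x, f x) | x. x \<in> W}"
  define \<G> where "\<G> = {G. linear_graph G \<and> ?G \<subseteq> G}"
  have "0 \<in> W" using W(1) unfolding add_subgroup_def by blast
  then have f0: "f 0 = 0" using f(1)[OF \<open>0 \<in> W\<close> \<open>0 \<in> W\<close>] by (metis add_0 add_cancel_right_right)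
  have "linear_graph ?G"
    unfolding linear_graph_def
  proof (intro conjI allI impI)
    have G: "(x, a) \<in> ?G \<longleftrightarrow> x \<in> W \<and> a = f x" for x a by blast
    show "(0, 0) \<in> ?G" unfolding G using \<open>0 \<in> W\<close> f0 by metis
    show "(x + y, a + b) \<in> ?G" if "(x, a) \<in> ?G" "(y, b) \<in> ?G" for x a y b
      using that W(1) f(1)[of x y] unfolding G add_subgroup_def by metis
    show "(s c x, c * a) \<in> ?G" if "(x, a) \<in> ?G" for c x a
      using that W(3) f(2)[of x c] unfolding G by metis
    show "a = 0" if "(0, a) \<in> ?G" for a using that f0 unfolding G by metis
    show "?G \<subseteq> V \<times> UNIV" using W(2) by blast
  qed
  then have "?G \<in> \<G>" by (simp add: \<G>_def)
  then have ne: "\<G> \<noteq> {}" by blast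
  have "\<Union>C \<in> \<G>" if C: "C \<noteq> {}" "subset.chain \<G> C" for C
  proof -
    have C': "linear_graph G" "?G \<subseteq> G" if "G \<in> C" for G
      using C that unfolding \<G>_def subset.chain_def by blast+
    have dir: "\<exists>K\<in>C. p \<in> K \<and> q \<in> K" if pq: "p \<in> \<Union>C" "q \<in> \<Union>C" for p q
    proof -
      obtain G H where GH: "G \<in> C" "p \<in> G" "H \<in> C" "q \<in> H" using pq by blast
      then have "G \<subseteq> H \<or> H \<subseteq> G" using C(2) unfolding subset.chain_def by blast
      with GH show ?thesis by blast
    qed
    note D = C'(1)[unfolded linear_graph_def]
    have D': "G \<subseteq> V \<times> UNIV" "(0, 0) \<in> G"
      "\<And>x a y b. (x, a) \<in> G \<Longrightarrow> (y, b) \<in> G \<Longrightarrow> (x + y, a + b) \<in> G"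
      "\<And>c x a. (x, a) \<in> G \<Longrightarrow> (s c x, c * a) \<in> G" "\<And>a. (0, a) \<in> G \<Longrightarrow> a = 0" if "G \<in> C" for G
      using D[OF that] by simp_all
    have "linear_graph (\<Union>C)"
      unfolding linear_graph_def
    proof (intro conjI allI impI)
      show "\<Union>C \<subseteq> V \<times> UNIV" using D'(1) by (rule Union_least)
      show "(0, 0) \<in> \<Union>C" using C(1) D'(2) by blast
    next
      fix x a y b assume "(x, a) \<in> \<Union>C" "(y, b) \<in> \<Union>C"
      with dir obtain K where K: "K \<in> C" "(x, a) \<in> K" "(y, b) \<in> K" by blast
      show "(x + y, a + b) \<in> \<Union>C" using K(1) D'(3)[OF K] by (rule UnionI)
    next
      fix c x a assume "(x, a) \<in> \<Union>C"
      then obtain K where K: "K \<in> C" "(x, a) \<in> K" by blast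
      show "(s c x, c * a) \<in> \<Union>C" using K(1) D'(4)[OF K] by (rule UnionI)
    next
      fix a assume "(0, a) \<in> \<Union>C"
      then obtain K where K: "K \<in> C" "(0, a) \<in> K" by blast
      then show "a = 0" by (rule D'(5))
    qed
    moreover have "?G \<subseteq> \<Union>C"
    proof -
      obtain K where "K \<in> C" using C(1) by blast
      then show ?thesis using C'(2)[of K] by (meson Union_upper order_trans)
    qed
    ultimately show ?thesis unfolding \<G>_def by (intro CollectI conjI)
  qed
  from subset_Zorn_nonempty[OF ne this]
  obtain M where M: "M \<in> \<G>" "\<And>X. X \<in> \<G> \<Longrightarrow> M \<subseteq> X \<Longrightarrow> X = M" by blast
  have lg: "linear_graph M" "?G \<subseteq> M" using M(1) by (auto simp: \<G>_def)
  have dom: "x \<in> fst ` M" if x: "x \<in> V" for x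
  proof (rule ccontr)
    assume nx: "x \<notin> fst ` M"
    let ?H = "{(y + s c x, a) | y c a. (y, a) \<in> M}"
    have sub: "M \<subseteq> ?H"
    proof
      fix p assume "p \<in> M"
      then obtain y a where "p = (y + s 0 x, a)" "(y, a) \<in> M" using x by (cases p) (simp add: s_02)
      then show "p \<in> ?H" by blast
    qed
    have "linear_graph ?H" by (rule linear_graph_insert[OF lg(1) x nx])
    then have "?H \<in> \<G>" using sub lg(2) unfolding \<G>_def by (intro CollectI conjI) (assumption, rule order_trans)
    then have "?H = M" using M(2) sub by blast
    moreover have "(0 + s 1 x, 0) \<in> ?H" using lg(1) unfolding linear_graph_def by blast
    ultimately have "(x, 0) \<in> M" using x by (simp add: s_one)
    with nx show False by force
  qed
  define g where "g x = (if x \<in> V then THE a. (x, a) \<in> M else 0)" for x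
  have gM: "(x, g x) \<in> M" if x: "x \<in> V" for x
  proof -
    obtain a where a: "(x, a) \<in> M" using dom[OF x] by force
    have "(THE a. (x, a) \<in> M) = a"
      by (rule the_equality[of "\<lambda>a. (x, a) \<in> M", OF a]) (rule linear_graph_unique[OF lg(1) _ a])
    then have "g x = a" unfolding g_def using x by simp
    with a show ?thesis by metis
  qed
  have ge: "g x = a" if "(x, a) \<in> M" for x a
  proof -
    have "x \<in> V" using lg(1) that unfolding linear_graph_def by blast
    from linear_graph_unique[OF lg(1) gM[OF this] that] show ?thesis .
  qed
  have D: "\<And>x a y b. (x, a) \<in> M \<Longrightarrow> (y, b) \<in> M \<Longrightarrow> (x + y, a + b) \<in> M"
    "\<And>c x a. (x, a) \<in> M \<Longrightarrow> (s c x, c * a) \<in> M"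
    using lg(1)[unfolded linear_graph_def] by simp_all
  have "g \<in> linear_functionals V s"
    unfolding linear_functionals_def
  proof (intro CollectI conjI ballI allI impI)
    fix x y assume "x \<in> V" "y \<in> V"
    then show "g (x + y) = g x + g y" by (intro ge D(1) gM)
  next
    fix c x assume "x \<in> V"
    then show "g (s c x) = c * g x" by (intro ge D(2) gM)
  next
    fix x assume "x \<notin> V"
    then show "g x = 0" by (simp only: g_def if_False)
  qed
  moreover have "\<forall>x\<in>W. g x = f x" using lg(2) ge by blast
  ultimately show ?thesis by blast
qed

end

locale graded_space = kmodule V s for V :: "'v::ab_group_add set" and s :: "'k::field \<Rightarrow> 'v \<Rightarrow> 'v" +
  fixes pr :: "int \<Rightarrow> 'v \<Rightarrow> 'v"
  assumes pr_closed: "x \<in> V \<Longrightarrow> pr l x \<in> V"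
    and pr_add: "x \<in> V \<Longrightarrow> y \<in> V \<Longrightarrow> pr l (x + y) = pr l x + pr l y"
    and pr_scale: "x \<in> V \<Longrightarrow> pr l (s c x) = s c (pr l x)"
    and pr_pr: "x \<in> V \<Longrightarrow> pr l (pr l' x) = (if l = l' then pr l x else 0)"
    and pr_finite: "x \<in> V \<Longrightarrow> finite {l. pr l x \<noteq> 0}"
    and pr_sum: "x \<in> V \<Longrightarrow> (\<Sum>l | pr l x \<noteq> 0. pr l x) = x"
begin

lemma pr_0: "pr l 0 = 0"
  using pr_add[OF V0 V0, of l] by simp

lemma pr_sum_superset:
  assumes "x \<in> V" "finite A" "{l. pr l x \<noteq> 0} \<subseteq> A"
  shows "(\<Sum>l\<in>A. pr l x) = x"
  using sum.mono_neutral_left[OF assms(2,3), of "\<lambda>l. pr l x"] pr_sum[OF assms(1)] by auto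

lemma sum_closed: "(\<And>i. i \<in> A \<Longrightarrow> f i \<in> V) \<Longrightarrow> sum f A \<in> V"
  by (rule add_subgroup_sum[OF V])

lemma s_sum: "(\<And>i. i \<in> A \<Longrightarrow> f i \<in> V) \<Longrightarrow> s c (sum f A) = (\<Sum>i\<in>A. s c (f i))"
  by (induction A rule: infinite_finite_induct) (auto simp: s_0 s_add sum_closed)

lemma functional_0: "\<phi> \<in> linear_functionals V s \<Longrightarrow> \<phi> 0 = 0"
proof -
  assume "\<phi> \<in> linear_functionals V s"
  then have "\<phi> (0 + 0) = \<phi> 0 + \<phi> 0" using V0 unfolding linear_functionals_def by blast
  then show ?thesis by (metis add_0 add_cancel_right_right)
qed

lemma functional_add: "\<phi> \<in> linear_functionals V s \<Longrightarrow> x \<in> V \<Longrightarrow> y \<in> V \<Longrightarrow> \<phi> (x + y) = \<phi> x + \<phi> y"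
  by (simp add: linear_functionals_def)

lemma functional_scale: "\<phi> \<in> linear_functionals V s \<Longrightarrow> x \<in> V \<Longrightarrow> \<phi> (s c x) = c * \<phi> x"
  by (simp add: linear_functionals_def)

lemma functional_sum: "\<phi> \<in> linear_functionals V s \<Longrightarrow> (\<And>i. i \<in> A \<Longrightarrow> f i \<in> V) \<Longrightarrow>
    \<phi> (sum f A) = (\<Sum>i\<in>A. \<phi> (f i))"
proof (induction A rule: infinite_finite_induct)
  case (insert i A)
  have c: "f i \<in> V" "sum f A \<in> V" using insert.prems(2) by (auto intro: sum_closed)
  show ?case unfolding sum.insert[OF insert.hyps]
    by (subst functional_add[OF insert.prems(1) c], subst insert.IH[OF insert.prems]) simp_all
qed (auto simp: functional_0)

lemma functional_neg: "\<phi> \<in> linear_functionals V s \<Longrightarrow> x \<in> V \<Longrightarrow> \<phi> (- x) = - \<phi> x"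
proof -
  assume "\<phi> \<in> linear_functionals V s" "x \<in> V"
  then have "\<phi> (s (- 1) x) = (- 1) * \<phi> x" by (rule functional_scale)
  then show ?thesis using s_neg1[OF \<open>x \<in> V\<close>] by simp
qed

lemma functional_diff: "\<phi> \<in> linear_functionals V s \<Longrightarrow> x \<in> V \<Longrightarrow> y \<in> V \<Longrightarrow> \<phi> (x - y) = \<phi> x - \<phi> y"
  using functional_neg[of \<phi> y] functional_add[of \<phi> x "- y"] by (simp add: Vneg)

lemma subspace_graded_dual: "subspace_fun (graded_dual V s pr)"
proof (rule subspace_funI)
  show "0 \<in> graded_dual V s pr" by (auto simp: graded_dual_def linear_functionals_def)
  fix f g assume f: "f \<in> graded_dual V s pr" and g: "g \<in> graded_dual V s pr"
  obtain S where S: "finite S" "\<And>x l. x \<in> V \<Longrightarrow> l \<notin> S \<Longrightarrow> f (pr l x) = 0"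
    using f unfolding graded_dual_def by blast
  obtain T where T: "finite T" "\<And>x l. x \<in> V \<Longrightarrow> l \<notin> T \<Longrightarrow> g (pr l x) = 0"
    using g unfolding graded_dual_def by blast
  have "finite (S \<union> T) \<and> (\<forall>x\<in>V. \<forall>l. l \<notin> S \<union> T \<longrightarrow> (f + g) (pr l x) = 0)"
    using S T by simp
  moreover have "f + g \<in> linear_functionals V s"
    using f g by (auto simp: graded_dual_def linear_functionals_def algebra_simps)
  ultimately show "f + g \<in> graded_dual V s pr"
    unfolding graded_dual_def by blast
next
  fix c f assume f: "f \<in> graded_dual V s pr"
  then show "fscale c f \<in> graded_dual V s pr"
    by (auto simp: graded_dual_def linear_functionals_def fscale_def algebra_simps)
qed

text \<open>Projecting to the degrees in \<open>S\<close> first turns an arbitrary functional, such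
  as one obtained from \<open>extend_functional\<close>, into a graded one.\<close>

lemma graded_dual_truncate:
  assumes "f \<in> linear_functionals V s" "finite S"
  shows "(\<lambda>x. if x \<in> V then f (\<Sum>l\<in>S. pr l x) else 0) \<in> graded_dual V s pr" (is "?g \<in> _")
proof -
  have f: "f (x + y) = f x + f y" "f (s c x) = c * f x" if "x \<in> V" "y \<in> V" for x y c
    by (rule functional_add[OF assms(1) that] functional_scale[OF assms(1) that(1)])+
  have "?g \<in> linear_functionals V s"
    by (auto simp: linear_functionals_def Vadd s_closed pr_add pr_scale sum.distrib f sum_closed pr_closed
        s_sum[symmetric])
  moreover have "?g (pr l x) = 0" if x: "x \<in> V" "l \<notin> S" for l x
  proof -
    have "(\<Sum>l'\<in>S. pr l' (pr l x)) = 0" using x by (intro sum.neutral) (auto simp: pr_pr)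
    then show ?thesis using x by (simp add: pr_closed functional_0[OF assms(1)])
  qed
  ultimately show ?thesis using assms(2) unfolding graded_dual_def by blast
qed

lemma graded_dual_supported:
  assumes "f \<in> linear_functionals V s" "finite S" "\<And>x l. x \<in> V \<Longrightarrow> l \<notin> S \<Longrightarrow> f (pr l x) = 0" "x \<in> V"
  shows "f (\<Sum>l\<in>S. pr l x) = f x"
proof -
  let ?A = "S \<union> {l. pr l x \<noteq> 0}"
  have "f x = f (\<Sum>l\<in>?A. pr l x)"
    using assms pr_finite by (subst pr_sum_superset) auto
  also have "\<dots> = (\<Sum>l\<in>?A. f (pr l x))"
    using assms by (intro functional_sum) (auto simp: pr_closed)
  also have "\<dots> = (\<Sum>l\<in>S. f (pr l x))"
    using assms pr_finite[OF assms(4)] by (intro sum.mono_neutral_right) auto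
  also have "\<dots> = f (\<Sum>l\<in>S. pr l x)"
    using assms by (intro functional_sum[symmetric]) (auto simp: pr_closed)
  finally show ?thesis by simp
qed

end

text \<open>Extend a functional from the image of \<open>g\<close> and cut it off in the finitely many degrees that
  matter.\<close>

lemma graded_dual_factor:
  assumes "graded_space V s pr" "graded_space V' s' pr'"
    and g: "\<And>x. x \<in> V \<Longrightarrow> g x \<in> V'" "\<And>x y. x \<in> V \<Longrightarrow> y \<in> V \<Longrightarrow> g (x + y) = g x + g y"
      "\<And>c x. x \<in> V \<Longrightarrow> g (s c x) = s' c (g x)" "\<And>l x. x \<in> V \<Longrightarrow> pr' l (g x) = g (pr l x)"
    and f: "f \<in> graded_dual V s pr" "\<And>x. x \<in> V \<Longrightarrow> g x = 0 \<Longrightarrow> f x = 0"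
  shows "\<exists>h\<in>graded_dual V' s' pr'. \<forall>x\<in>V. f x = h (g x)"
proof -
  interpret A: graded_space V s pr by fact
  interpret B: graded_space V' s' pr' by fact
  have fl: "f \<in> linear_functionals V s" using f(1) by (simp add: graded_dual_def)
  obtain S where S: "finite S" "\<And>x l. x \<in> V \<Longrightarrow> l \<notin> S \<Longrightarrow> f (pr l x) = 0"
    using f(1) unfolding graded_dual_def by blast
  have g0: "g 0 = 0" using g(2)[OF A.V0 A.V0] by simp
  have gneg: "g (- x) = - g x" if "x \<in> V" for x
    using g(2)[OF that A.Vneg[OF that]] g0 by (simp add: eq_neg_iff_add_eq_0 add.commute)
  have gsum: "g (sum k I) = (\<Sum>i\<in>I. g (k i))" if "\<And>i. i \<in> I \<Longrightarrow> k i \<in> V" for k and I :: "int set"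
    using that by (induction I rule: infinite_finite_induct) (auto simp: g0 g(2) A.sum_closed)
  \<comment> \<open>The functional induced on the image of \<open>g\<close>; it is well defined
    because \<open>f\<close> kills the kernel of \<open>g\<close>.\<close>
  define f' where "f' y = f (SOME x. x \<in> V \<and> g x = y)" for y
  have f': "f' (g x) = f x" if x: "x \<in> V" for x
  proof -
    define x' where "x' = (SOME x'. x' \<in> V \<and> g x' = g x)"
    have "x' \<in> V \<and> g x' = g x" unfolding x'_def by (rule someI[of _ x]) (simp add: x)
    then have "f (x' - x) = 0" using x g(2)[of x' "- x"] gneg[of x] A.Vneg
      by (intro f(2)) (auto simp: A.Vdiff)
    then show ?thesis using x \<open>x' \<in> V \<and> _\<close> A.functional_diff[OF fl, of x' x]
      by (simp add: f'_def x'_def[symmetric])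
  qed
  have "\<exists>h\<in>linear_functionals V' s'. \<forall>y\<in>g ` V. h y = f' y"
  proof (rule B.extend_functional)
    show "add_subgroup (g ` V)"
      unfolding add_subgroup_def
    proof (intro conjI ballI)
      show "0 \<in> g ` V" using g0 A.V0 by (metis image_eqI)
      fix x assume "x \<in> g ` V"
      then obtain a where a: "a \<in> V" "x = g a" by blast
      then show "- x \<in> g ` V" using gneg[OF a(1)] A.Vneg by (metis image_eqI)
      fix y assume "y \<in> g ` V"
      then obtain b where "b \<in> V" "y = g b" by blast
      then show "x + y \<in> g ` V" using a g(2) A.Vadd by (metis image_eqI)
    qed
    show "s' c y \<in> g ` V" if "y \<in> g ` V" for c y using that g(3) A.s_closed by (metis imageE image_eqI)
    show "f' (x + y) = f' x + f' y" if xy: "x \<in> g ` V" "y \<in> g ` V" for x y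
    proof -
      obtain a b where ab: "a \<in> V" "b \<in> V" "x = g a" "y = g b" using xy by blast
      then have "f' (x + y) = f (a + b)" using f'[of "a + b"] g(2) by (simp add: A.Vadd)
      then show ?thesis using ab f' A.functional_add[OF fl] by simp
    qed
    show "f' (s' c y) = c * f' y" if y: "y \<in> g ` V" for c y
    proof -
      obtain a where a: "a \<in> V" "y = g a" using y by blast
      then have "f' (s' c y) = f (s c a)" using f'[of "s c a"] g(3) by (simp add: A.s_closed)
      then show ?thesis using a f' A.functional_scale[OF fl] by simp
    qed
  qed (use g(1) in auto)
  then obtain h where h: "h \<in> linear_functionals V' s'" "\<And>x. x \<in> V \<Longrightarrow> h (g x) = f x" using f' by auto
  show ?thesis
  proof (intro bexI ballI)
    show "(\<lambda>y. if y \<in> V' then h (\<Sum>l\<in>S. pr' l y) else 0) \<in> graded_dual V' s' pr'"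
      by (rule B.graded_dual_truncate[OF h(1) S(1)])
    fix x assume x: "x \<in> V"
    \<comment> \<open>As \<open>g\<close> preserves degrees, the cut-off does not disturb the values
      on its image.\<close>
    have "(\<Sum>l\<in>S. pr' l (g x)) = g (\<Sum>l\<in>S. pr l x)"
      using x by (subst gsum) (auto simp: A.pr_closed g(4))
    then show "f x = (if g x \<in> V' then h (\<Sum>l\<in>S. pr' l (g x)) else 0)"
      using x g(1) A.graded_dual_supported[OF fl S x] by (simp add: h(2) A.sum_closed A.pr_closed)
  qed
qed

section \<open>Graded modules and their differential forms\<close>

definition component :: "(int \<Rightarrow> 'm::ab_group_add set) \<Rightarrow> 'm \<Rightarrow> int \<Rightarrow> 'm" where
  "component p m = (THE c. (\<forall>l. c l \<in> p l) \<and> finite {l. c l \<noteq> 0} \<and> m = (\<Sum>l | c l \<noteq> 0. c l))"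

lemma component_props:
  assumes "internal_direct_sum p S" "m \<in> S"
  shows "component p m l \<in> p l" "finite {l. component p m l \<noteq> 0}"
    "(\<Sum>l | component p m l \<noteq> 0. component p m l) = m"
proof -
  have "\<exists>!c. (\<forall>l. c l \<in> p l) \<and> finite {l. c l \<noteq> 0} \<and> m = (\<Sum>l | c l \<noteq> 0. c l)"
    using assms unfolding internal_direct_sum_def by blast
  from theI'[OF this, folded component_def]
  show "component p m l \<in> p l" "finite {l. component p m l \<noteq> 0}"
    "(\<Sum>l | component p m l \<noteq> 0. component p m l) = m" by simp_all
qed

lemma component_eqI:
  assumes p: "internal_direct_sum p S" and S: "add_subgroup S"
    and c: "\<And>l. c l \<in> p l" and A: "finite A" "\<And>l. l \<notin> A \<Longrightarrow> c l = 0"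
  shows "component p (\<Sum>l\<in>A. c l) = c"
proof -
  let ?m = "\<Sum>l\<in>A. c l"
  have cS: "c l \<in> S" for l using p c unfolding internal_direct_sum_def by blast
  have "?m \<in> S" by (rule add_subgroup_sum[OF S cS])
  then have ex: "\<exists>!c. (\<forall>l. c l \<in> p l) \<and> finite {l. c l \<noteq> 0} \<and> ?m = (\<Sum>l | c l \<noteq> 0. c l)"
    using p unfolding internal_direct_sum_def by blast
  have sub: "{l. c l \<noteq> 0} \<subseteq> A" using A(2) by blast
  have "?m = (\<Sum>l | c l \<noteq> 0. c l)" using sub A by (intro sum.mono_neutral_right) auto
  then show ?thesis
    unfolding component_def using c finite_subset[OF sub A(1)] by (intro the1_equality[OF ex]) simp
qed

text \<open>A homogeneous map of degree \<open>e\<close> carries the decomposition of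
  \<open>m\<close> to a decomposition of \<open>f m\<close> shifted by \<open>e\<close>, and
  decompositions are unique.\<close>

lemma component_map:
  assumes p: "internal_direct_sum p S" and p': "internal_direct_sum p' S'" "add_subgroup S'"
    and S: "add_subgroup S"
    and f: "\<And>x y. x \<in> S \<Longrightarrow> y \<in> S \<Longrightarrow> f (x + y) = f x + f y" "\<And>l x. x \<in> p l \<Longrightarrow> f x \<in> p' (l + e)"
    and m: "m \<in> S"
  shows "component p' (f m) (l + e) = f (component p m l)"
proof -
  let ?c = "component p m" and ?A = "{l. component p m l \<noteq> 0}"
  note cp = component_props[OF p m]
  have cS: "?c l \<in> S" for l using p cp(1) unfolding internal_direct_sum_def by blast
  have "0 \<in> S" using S by (simp add: add_subgroup_def)
  then have f0: "f 0 = 0" using f(1)[of 0 0] by (metis add.right_neutral add_cancel_right_right)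
  have fs: "f (sum ?c B) = (\<Sum>l\<in>B. f (?c l))" for B
  proof (induction B rule: infinite_finite_induct)
    case (insert x B)
    have "sum ?c B \<in> S" by (rule add_subgroup_sum[OF S cS])
    with insert f(1)[OF cS, of "sum ?c B" x] show ?case by simp
  qed (auto simp: f0)
  have "f m = (\<Sum>l\<in>?A. f (?c l))" using fs[of ?A] cp(3) by simp
  also have "\<dots> = (\<Sum>l\<in>(\<lambda>l. l + e) ` ?A. f (?c (l - e)))"
    by (subst sum.reindex) (auto simp: inj_on_def)
  finally have fm: "f m = (\<Sum>l\<in>(\<lambda>l. l + e) ` ?A. f (?c (l - e)))" .
  have "component p' (f m) = (\<lambda>l. f (?c (l - e)))"
    unfolding fm
  proof (rule component_eqI[OF p'])
    show "f (?c (l - e)) \<in> p' l" for l using f(2)[OF cp(1), of "l - e"] by simp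
    show "finite ((\<lambda>l. l + e) ` ?A)" using cp(2) by simp
    show "f (?c (l - e)) = 0" if "l \<notin> (\<lambda>l. l + e) ` ?A" for l
    proof -
      have "?c (l - e) = 0" using that by (metis (mono_tags, lifting) diff_add_cancel image_eqI mem_Collect_eq)
      then show ?thesis by (simp add: f0)
    qed
  qed
  then show ?thesis by simp
qed

section \<open>Constants and induction in the ring of differential operators\<close>

lemma pconst_add: "pconst (c + c') = pconst c + pconst c'"
  and pconst_mult: "pconst (c * c') = pconst c * pconst c'"
  and pconst_1: "pconst 1 = 1"
  and pconst_0: "pconst 0 = 0"
  unfolding pconst_def by (simp_all add: single_add mult_single flip: single_one)

lemma dop_eqI: "(\<And>f. Rep_dop P f = Rep_dop Q f) \<Longrightarrow> P = Q"
  by (rule Rep_dop_inject[THEN iffD1]) (rule ext)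

lemma dmult_add: "dmult (p + q) = dmult p + dmult q"
  by (rule dop_eqI) (simp add: plus_dop.rep_eq Rep_dmult distrib_right)

lemma dmult_mult: "dmult (p * q) = dmult p * dmult q"
  by (rule dop_eqI) (simp add: times_dop.rep_eq Rep_dmult mult.assoc)

lemma dmult_1: "dmult 1 = 1"
  by (rule dop_eqI) (simp add: one_dop.rep_eq Rep_dmult)

lemma dmult_0: "dmult 0 = 0"
  by (rule dop_eqI) (simp add: zero_dop.rep_eq Rep_dmult)

lemma diffops_linear: "P \<in> diffops \<Longrightarrow> P (pconst c * f) = pconst c * P f"
  by (induction P arbitrary: f rule: diffops.induct) (simp_all add: pdiff_mult distrib_left mult.left_commute)

lemma dconst_commute: "dconst c * P = P * dconst c"
  by (rule dop_eqI) (simp add: times_dop.rep_eq Rep_dmult diffops_linear[OF Rep_dop])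

lemma dop_induct [case_names mult diff add comp]:
  assumes "\<And>p. Q (dmult p)" "\<And>i. Q (dpart i)" "\<And>P P'. Q P \<Longrightarrow> Q P' \<Longrightarrow> Q (P + P')"
    "\<And>P P'. Q P \<Longrightarrow> Q P' \<Longrightarrow> Q (P * P')"
  shows "Q P"
proof -
  have "Q (Abs_dop R)" if "R \<in> diffops" for R
    using that
  proof (induction R rule: diffops.induct)
    case (mult p) then show ?case using assms(1) by (simp add: dmult_def)
  next
    case (diff i) then show ?case using assms(2) by (simp add: dpart_def)
  next
    case (add R R')
    have "Abs_dop (\<lambda>f. R f + R' f) = Abs_dop R + Abs_dop R'"
      using add.hyps by (simp add: plus_dop.abs_eq eq_onp_same_args)
    then show ?case using assms(3)[OF add.IH] by simp
  next
    case (comp R R')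
    have "Abs_dop (\<lambda>f. R (R' f)) = Abs_dop R * Abs_dop R'"
      using comp.hyps by (simp add: times_dop.abs_eq eq_onp_same_args)
    then show ?case using assms(4)[OF comp.IH] by simp
  qed
  then show ?thesis by (metis Rep_dop Rep_dop_inverse)
qed

text \<open>The sign of moving \<open>dx_s\<close> past the smaller elements of \<open>K\<close>. It
  takes the summand as argument, so that it makes sense in any abelian group.\<close>

definition esgn :: "'n::linorder \<Rightarrow> 'n set \<Rightarrow> 'm::ab_group_add \<Rightarrow> 'm" where
  "esgn s K v = (if even (card {j \<in> K. j < s}) then v else - v)"

lemma esgn_add: "esgn s K (v + w) = esgn s K v + esgn s K w"
  and esgn_0 [simp]: "esgn s K 0 = 0"
  and esgn_neg: "esgn s K (- v) = - esgn s K v"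
  and esgn_diff: "esgn s K (v - w) = esgn s K v - esgn s K w"
  and esgn_commute: "esgn s K (esgn t L v) = esgn t L (esgn s K v)"
  and esgn_self [simp]: "esgn s K (esgn s K v) = v"
  and esgn_eq_0 [simp]: "esgn s K v = 0 \<longleftrightarrow> v = 0"
  by (simp_all add: esgn_def)

lemma esgn_sum: "esgn s K (sum f A) = (\<Sum>i\<in>A. esgn s K (f i))"
  by (induction A rule: infinite_finite_induct) (simp_all add: esgn_add)

lemma esgn_remove: "esgn s (K - {s}) v = esgn s K v"
  and esgn_insert_self: "esgn s (insert s K) v = esgn s K v"
proof -
  have "{j \<in> K - {s}. j < s} = {j \<in> K. j < s}" "{j \<in> insert s K. j < s} = {j \<in> K. j < s}" by auto
  then show "esgn s (K - {s}) v = esgn s K v" "esgn s (insert s K) v = esgn s K v" by (simp_all add: esgn_def)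
qed

text \<open>The element \<open>t\<close> counts towards the sign exactly when it precedes
  \<open>s\<close>. Together with \<open>esgn_commute\<close> this is the source of the
  cancellations in \<open>form_diff_diff\<close> and \<open>koszul_homotopy\<close>.\<close>

lemma esgn_insert:
  assumes "finite K" "t \<notin> K"
  shows "esgn s (insert t K) v = (if t < s then - esgn s K v else esgn s K v)"
proof (cases "t < s")
  case True
  then have "{j \<in> insert t K. j < s} = insert t {j \<in> K. j < s}" by auto
  then show ?thesis using True assms by (simp add: esgn_def)
next
  case False
  then have "{j \<in> insert t K. j < s} = {j \<in> K. j < s}" by auto
  then show ?thesis using False by (simp add: esgn_def)
qed

lemma form_diff_esgn: "form_diff M \<omega> K = (\<Sum>s\<in>K. esgn s K (mact M (dpart s) (\<omega> (K - {s}))))"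
  by (simp add: form_diff_def esgn_def Let_def)

text \<open>The terms cancel in pairs \<open>(s, t)\<close> and \<open>(t, s)\<close>. Induction on
  \<open>K\<close> peels off one row and one column at a time and so avoids dividing by two.\<close>

lemma antisymmetric_sum:
  assumes "finite K" "\<And>s t. s \<in> K \<Longrightarrow> t \<in> K \<Longrightarrow> s \<noteq> t \<Longrightarrow> T s t = - (T t s :: 'm::ab_group_add)"
  shows "(\<Sum>s\<in>K. \<Sum>t\<in>K - {s}. T s t) = 0"
  using assms
proof (induction K)
  case (insert x K)
  have "(\<Sum>s\<in>K. \<Sum>t\<in>insert x K - {s}. T s t) = (\<Sum>s\<in>K. T s x + (\<Sum>t\<in>K - {s}. T s t))"
  proof (intro sum.cong refl)
    fix s assume "s \<in> K"
    then have "insert x K - {s} = insert x (K - {s})" using insert.hyps by auto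
    then show "(\<Sum>t\<in>insert x K - {s}. T s t) = T s x + (\<Sum>t\<in>K - {s}. T s t)" using insert.hyps by simp
  qed
  also have "\<dots> = (\<Sum>s\<in>K. T s x)" unfolding sum.distrib
    by (subst insert.IH) (auto intro: insert.prems)
  also have "\<dots> = - (\<Sum>s\<in>K. T x s)"
    unfolding sum_negf[symmetric] using insert.hyps by (intro sum.cong refl insert.prems) auto
  finally have "(\<Sum>s\<in>K. \<Sum>t\<in>insert x K - {s}. T s t) = - (\<Sum>s\<in>K. T x s)" .
  moreover have "insert x K - {x} = K" using insert.hyps by auto
  ultimately show ?case unfolding sum.insert[OF insert.hyps] by (simp only: add.right_inverse)
qed simp

definition form_scale :: "(('n, 'k::comm_ring_1) dop, 'm, 'z) lmod_scheme \<Rightarrow> 'k \<Rightarrow> ('n set \<Rightarrow> 'm) \<Rightarrow> 'n set \<Rightarrow> 'm" where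
  "form_scale M c \<omega> = (\<lambda>J. mact M (dconst c) (\<omega> J))"

definition mod_proj :: "(('n, 'k) dop, 'm::ab_group_add) grmod \<Rightarrow> int \<Rightarrow> 'm \<Rightarrow> 'm" where
  "mod_proj M l m = (if m \<in> mcar M then component (piece M) m l else 0)"

text \<open>The degree of \<open>m dx\<^sub>J\<close> is that of \<open>m\<close> plus the number of elements of \<open>J\<close>; this makes
  the de Rham differential homogeneous of degree \<open>0\<close>.\<close>

definition form_proj :: "(('n, 'k) dop, 'm::ab_group_add) grmod \<Rightarrow> int \<Rightarrow> ('n set \<Rightarrow> 'm) \<Rightarrow> 'n set \<Rightarrow> 'm" where
  "form_proj M l \<omega> = (\<lambda>J. mod_proj M (l - int (card J)) (\<omega> J))"

lemma dpart_commutes: "dpart s * dpart t = dpart t * dpart s"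
  by (rule dop_eqI) (simp add: times_dop.rep_eq Rep_dpart pdiff_commute)

section \<open>Forms with coefficients in a \<D>-module and their gradings\<close>

locale dop_module =
  fixes M :: "(('n::{finite,linorder}, 'k::field_char_0) dop, 'm::ab_group_add) grmod"
  assumes left: "left_module M"
begin

lemma car: "add_subgroup (mcar M)"
  using left by (simp add: left_module_def)

lemma car_0 [simp]: "0 \<in> mcar M" and car_add: "x \<in> mcar M \<Longrightarrow> y \<in> mcar M \<Longrightarrow> x + y \<in> mcar M"
  and car_neg: "x \<in> mcar M \<Longrightarrow> - x \<in> mcar M"
  using car by (simp_all add: add_subgroup_def)

lemma car_diff: "x \<in> mcar M \<Longrightarrow> y \<in> mcar M \<Longrightarrow> x - y \<in> mcar M"
  by (rule add_subgroup_diff[OF car])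

lemma car_sum: "(\<And>i. i \<in> A \<Longrightarrow> f i \<in> mcar M) \<Longrightarrow> sum f A \<in> mcar M"
  by (rule add_subgroup_sum[OF car])

lemma act_closed: "x \<in> mcar M \<Longrightarrow> mact M P x \<in> mcar M"
  and act_add: "x \<in> mcar M \<Longrightarrow> y \<in> mcar M \<Longrightarrow> mact M P (x + y) = mact M P x + mact M P y"
  and act_add2: "x \<in> mcar M \<Longrightarrow> mact M (P + Q) x = mact M P x + mact M Q x"
  and act_mult: "x \<in> mcar M \<Longrightarrow> mact M (P * Q) x = mact M P (mact M Q x)"
  and act_1: "x \<in> mcar M \<Longrightarrow> mact M 1 x = x"
  using left by (simp_all add: left_module_def)

lemma act_0: "mact M P 0 = 0"
  using act_add[OF car_0 car_0, of P] by simp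

lemma act_02: "x \<in> mcar M \<Longrightarrow> mact M 0 x = 0"
  using act_add2[of x 0 0] by simp

lemma act_neg: "x \<in> mcar M \<Longrightarrow> mact M P (- x) = - mact M P x"
  using act_add[of x "- x" P] by (simp add: car_neg act_0 eq_neg_iff_add_eq_0 add.commute)

lemma act_diff: "x \<in> mcar M \<Longrightarrow> y \<in> mcar M \<Longrightarrow> mact M P (x - y) = mact M P x - mact M P y"
  using act_add[of x "- y" P] by (simp add: car_neg act_neg)

lemma act_sum: "(\<And>i. i \<in> A \<Longrightarrow> f i \<in> mcar M) \<Longrightarrow> mact M P (sum f A) = (\<Sum>i\<in>A. mact M P (f i))"
  by (induction A rule: infinite_finite_induct) (simp_all add: act_0 act_add car_sum)

lemma act_esgn: "x \<in> mcar M \<Longrightarrow> mact M P (esgn s K x) = esgn s K (mact M P x)"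
  by (simp add: esgn_def act_neg)

lemma esgn_car: "x \<in> mcar M \<Longrightarrow> esgn s K x \<in> mcar M"
  by (simp add: esgn_def car_neg)

lemma part_commute: "x \<in> mcar M \<Longrightarrow> mact M (dpart s) (mact M (dpart t) x) = mact M (dpart t) (mact M (dpart s) x)"
  using act_mult[of x "dpart s" "dpart t"] act_mult[of x "dpart t" "dpart s"] dpart_commutes[of s t] by metis

lemma scalar_commute: "x \<in> mcar M \<Longrightarrow> mact M P (mact M (dconst c) x) = mact M (dconst c) (mact M P x)"
  using act_mult[of x P "dconst c"] act_mult[of x "dconst c" P] dconst_commute[of c P] by metis

lemma kmodule_car: "kmodule (mcar M) (\<lambda>c. mact M (dconst c))"
  by unfold_locales (simp_all add: car act_closed act_add pconst_add dmult_add act_add2 pconst_mult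
      dmult_mult act_mult pconst_1 dmult_1 act_1)

lemma of_nat_scalar: "x \<in> mcar M \<Longrightarrow> (\<Sum>i\<in>A. x) = mact M (dconst (of_nat (card A))) x"
  by (induction A rule: infinite_finite_induct)
    (simp_all add: act_02 pconst_0 dmult_0 pconst_add dmult_add act_add2 pconst_1 dmult_1 act_1)

lemma forms_car: "\<omega> \<in> forms M q \<Longrightarrow> \<omega> J \<in> mcar M"
  by (simp add: forms_def)

lemma forms_0: "\<omega> \<in> forms M q \<Longrightarrow> int (card J) \<noteq> q \<Longrightarrow> \<omega> J = 0"
  by (simp add: forms_def)

lemma forms_subgroup: "add_subgroup (forms M q)"
  by (auto simp: add_subgroup_def forms_def car_add car_neg)

lemma form_diff_add:
  assumes "\<omega> \<in> forms M q" "\<eta> \<in> forms M q"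
  shows "form_diff M (\<omega> + \<eta>) = form_diff M \<omega> + form_diff M \<eta>"
  by (rule ext) (simp add: form_diff_esgn act_add forms_car[OF assms(1)] forms_car[OF assms(2)] esgn_add sum.distrib)

lemma form_diff_scale:
  assumes "\<omega> \<in> forms M q"
  shows "form_diff M (form_scale M c \<omega>) = form_scale M c (form_diff M \<omega>)"
  by (rule ext) (simp add: form_diff_esgn form_scale_def scalar_commute forms_car[OF assms] act_closed
      act_sum esgn_car act_esgn)

lemma form_diff_forms:
  assumes "\<omega> \<in> forms M q"
  shows "form_diff M \<omega> \<in> forms M (q + 1)"
proof -
  have "form_diff M \<omega> J = 0" if "int (card J) \<noteq> q + 1" for J
    unfolding form_diff_esgn
  proof (rule sum.neutral, rule ballI)
    fix s assume "s \<in> J"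
    then have "int (card (J - {s})) = int (card J) - 1"
      by (metis card_Suc_Diff1 finite_class.finite_code of_nat_Suc add_diff_cancel_left')
    then show "esgn s J (mact M (dpart s) (\<omega> (J - {s}))) = 0"
      using that forms_0[OF assms, of "J - {s}"] by (simp add: act_0)
  qed
  then show ?thesis
    by (simp add: forms_def) (simp add: form_diff_esgn car_sum esgn_car act_closed forms_car[OF assms])
qed

lemma form_diff_diff:
  assumes "\<omega> \<in> forms M q"
  shows "form_diff M (form_diff M \<omega>) = 0"
proof
  fix K :: "'n set"
  note wJ = forms_car[OF assms]
  let ?T = "\<lambda>s t. esgn s K (esgn t (K - {s}) (mact M (dpart s) (mact M (dpart t) (\<omega> (K - {s} - {t})))))"
  have "form_diff M (form_diff M \<omega>) K = (\<Sum>s\<in>K. \<Sum>t\<in>K - {s}. ?T s t)"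
    by (simp add: form_diff_esgn act_sum esgn_car act_closed wJ act_esgn esgn_sum)
  also have "\<dots> = 0"
  proof (rule antisymmetric_sum)
    \<comment> \<open>Partial derivatives commute, so only the signs matter: of the two orders of
      removing \<open>s\<close> and \<open>t\<close>, exactly one sees the other index in
      front.\<close>
    fix s t assume st: "s \<in> K" "t \<in> K" "s \<noteq> t"
    have K: "insert s K = K" "insert t K = K" using st by auto
    have sg: "esgn t K v = (if s < t then - esgn t (K - {s}) v else esgn t (K - {s}) v)"
      "esgn s K v = (if t < s then - esgn s (K - {t}) v else esgn s (K - {t}) v)" for v :: 'm
      using esgn_insert[of "K - {s}" s t v] esgn_insert[of "K - {t}" t s v] by (simp_all add: K)
    have e: "K - {s} - {t} = K - {t} - {s}" by auto
    define v where "v = mact M (dpart s) (mact M (dpart t) (\<omega> (K - {t} - {s})))"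
    have v: "mact M (dpart t) (mact M (dpart s) (\<omega> (K - {t} - {s}))) = v"
      unfolding v_def by (rule part_commute[OF wJ])
    show "?T s t = - ?T t s"
      unfolding e v v_def[symmetric] sg(1)[of "esgn s (K - {t}) v"] sg(2)[of "esgn t (K - {s}) v"]
        esgn_commute[of s "K - {t}" t "K - {s}" v]
      using st(3) by (cases s t rule: linorder_cases) (auto dest: order.asym)
  qed simp
  finally show "form_diff M (form_diff M \<omega>) K = 0 K" by simp
qed

end

locale gr_dmodule = dop_module M for M :: "(('n::{finite,linorder}, 'k::field_char_0) dop, 'm::ab_group_add) grmod" +
  assumes graded: "graded_dmodule M"

lemma gr_dmoduleI: "graded_dmodule M \<Longrightarrow> gr_dmodule M"
  by unfold_locales (simp_all add: graded_dmodule_def)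

context gr_dmodule
begin

lemma direct_sum: "internal_direct_sum (piece M) (mcar M)"
  using graded by (simp add: graded_dmodule_def)

lemma piece_car: "x \<in> piece M l \<Longrightarrow> x \<in> mcar M"
  using direct_sum by (auto simp: internal_direct_sum_def)

lemma piece_subgroup: "add_subgroup (piece M l)"
  using direct_sum by (simp add: internal_direct_sum_def)

lemma act_piece: "dop_homog e P \<Longrightarrow> x \<in> piece M l \<Longrightarrow> mact M P x \<in> piece M (l + e)"
proof (induction e P arbitrary: l x rule: dop_homog.induct)
  case (const c)
  have "pconst c \<in> hom_poly 0" by (simp add: hom_poly_def pconst_def)
  then show ?case using graded const unfolding graded_dmodule_def by fastforce
next
  case (var i)
  have "(pvar i :: ('n, 'k) mpoly) \<in> hom_poly 1"
    by (simp add: hom_poly_def pvar_def lookup_single when_def)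
  then show ?case using graded var unfolding graded_dmodule_def by fastforce
next
  case (part i)
  then show ?case using graded unfolding graded_dmodule_def by simp
next
  case (add e P Q)
  then have "mact M P x \<in> piece M (l + e)" "mact M Q x \<in> piece M (l + e)" by blast+
  then show ?case using piece_car[OF add.prems] piece_subgroup[of "l + e"]
    by (simp add: act_add2 add_subgroup_def)
next
  case (mult e P e' Q)
  have "mact M Q x \<in> piece M (l + e')" using mult by blast
  then have "mact M P (mact M Q x) \<in> piece M (l + e' + e)" using mult by blast
  then show ?case using piece_car[OF mult.prems] by (simp add: act_mult algebra_simps)
qed

lemma proj_act:
  assumes "dop_homog e P" "x \<in> mcar M"
  shows "mod_proj M (l + e) (mact M P x) = mact M P (mod_proj M l x)"
  using component_map[OF direct_sum direct_sum car car, of "mact M P" e x l] assms act_piece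
  by (simp add: mod_proj_def act_closed act_add)

lemma proj_piece: "x \<in> mcar M \<Longrightarrow> mod_proj M l x \<in> piece M l"
  using component_props(1)[OF direct_sum] by (simp add: mod_proj_def)

text \<open>Obtained from \<open>proj_act\<close> for the constant operator \<open>0\<close>, which
  is homogeneous of degree 0.\<close>

lemma proj_0: "mod_proj M l 0 = 0"
proof -
  have "mod_proj M (l + 0) (mact M (dconst 0) 0) = mact M (dconst 0) (mod_proj M l 0)"
    by (rule proj_act[OF dop_homog.const car_0])
  then show ?thesis using act_02[OF piece_car[OF proj_piece[OF car_0, of l]]]
    by (simp only: act_0 pconst_0 dmult_0 add_0_right)
qed

lemma proj_of_piece: "x \<in> piece M l \<Longrightarrow> mod_proj M l' x = (if l' = l then x else 0)"
proof -
  assume x: "x \<in> piece M l"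
  have "component (piece M) (\<Sum>i\<in>{l}. if i = l then x else 0) = (\<lambda>i. if i = l then x else 0)"
    using x piece_subgroup by (intro component_eqI[OF direct_sum car]) (auto simp: add_subgroup_def)
  then show ?thesis using piece_car[OF x] by (simp add: mod_proj_def)
qed

lemma proj_add:
  assumes "x \<in> mcar M" "y \<in> mcar M"
  shows "mod_proj M l (x + y) = mod_proj M l x + mod_proj M l y"
proof -
  let ?c = "component (piece M) x" and ?d = "component (piece M) y"
  let ?A = "{l. ?c l \<noteq> 0} \<union> {l. ?d l \<noteq> 0}"
  note c = component_props[OF direct_sum assms(1)] and d = component_props[OF direct_sum assms(2)]
  have A: "finite ?A" using c(2) d(2) by (rule finite_UnI)
  have "sum ?c {l. ?c l \<noteq> 0} = sum ?c ?A" "sum ?d {l. ?d l \<noteq> 0} = sum ?d ?A"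
    by (rule sum.mono_neutral_left[OF A]; blast)+
  then have "sum ?c ?A = x" "sum ?d ?A = y" by (simp_all only: c(3) d(3))
  then have xy: "x + y = (\<Sum>l\<in>?A. ?c l + ?d l)" by (simp add: sum.distrib)
  have "component (piece M) (x + y) = (\<lambda>l. ?c l + ?d l)"
    unfolding xy
  proof (rule component_eqI[OF direct_sum car _ A])
    show "?c l + ?d l \<in> piece M l" for l
      using piece_subgroup[of l] c(1)[of l] d(1)[of l] unfolding add_subgroup_def by blast
  qed simp
  then show ?thesis using assms by (simp add: mod_proj_def car_add)
qed

lemma graded_space_car: "graded_space (mcar M) (\<lambda>c. mact M (dconst c)) (mod_proj M)"
proof -
  interpret kmodule "mcar M" "\<lambda>c. mact M (dconst c)" by (rule kmodule_car)
  show ?thesis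
  proof
    fix x y l l' c assume x: "x \<in> mcar M"
    show "mod_proj M l x \<in> mcar M" by (rule piece_car[OF proj_piece[OF x]])
    show "mod_proj M l (mact M (dconst c) x) = mact M (dconst c) (mod_proj M l x)"
      using proj_act[OF dop_homog.const x, of l] by simp
    show "mod_proj M l (mod_proj M l' x) = (if l = l' then mod_proj M l x else 0)"
      using proj_of_piece[OF proj_piece[OF x]] by auto
    show "finite {l. mod_proj M l x \<noteq> 0}" "(\<Sum>l | mod_proj M l x \<noteq> 0. mod_proj M l x) = x"
      using component_props[OF direct_sum x] x by (simp_all add: mod_proj_def)
    assume "y \<in> mcar M"
    then show "mod_proj M l (x + y) = mod_proj M l x + mod_proj M l y" by (rule proj_add[OF x])
  qed
qed

lemma graded_space_forms: "graded_space (forms M q) (form_scale M) (form_proj M)"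
proof -
  interpret C: graded_space "mcar M" "\<lambda>c. mact M (dconst c)" "mod_proj M" by (rule graded_space_car)
  show ?thesis
  proof
    fix \<omega> \<eta> :: "'n set \<Rightarrow> 'm" and l l' c c'
    assume w: "\<omega> \<in> forms M q"
    note wJ = forms_car[OF w]
    show "form_scale M c \<omega> \<in> forms M q" using w
      by (auto simp: forms_def form_scale_def act_closed act_0)
    show "form_scale M (c + c') \<omega> = form_scale M c \<omega> + form_scale M c' \<omega>"
      by (rule ext) (simp add: form_scale_def C.s_add2 wJ)
    show "form_scale M (c * c') \<omega> = form_scale M c (form_scale M c' \<omega>)"
      by (rule ext) (simp add: form_scale_def C.s_mult wJ)
    show "form_scale M 1 \<omega> = \<omega>" by (rule ext) (simp add: form_scale_def C.s_one wJ)
    show "form_proj M l \<omega> \<in> forms M q" using w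
      by (auto simp: forms_def form_proj_def C.pr_closed C.pr_0)
    show "form_proj M l (form_scale M c \<omega>) = form_scale M c (form_proj M l \<omega>)"
      by (rule ext) (simp add: form_scale_def form_proj_def C.pr_scale wJ)
    show "form_proj M l (form_proj M l' \<omega>) = (if l = l' then form_proj M l \<omega> else 0)"
      by (rule ext) (simp add: form_proj_def C.pr_pr wJ)
    \<comment> \<open>The degrees in which some coefficient lives, shifted by the size of its index
      set. There are finitely many because there are finitely many index sets.\<close>
    let ?S = "\<Union>J. (\<lambda>l. l + int (card J)) ` {l. mod_proj M l (\<omega> J) \<noteq> 0}"
    have S: "finite ?S" using C.pr_finite[OF wJ] by auto
    have sub: "{l. form_proj M l \<omega> \<noteq> 0} \<subseteq> ?S"
    proof
      fix l assume "l \<in> {l. form_proj M l \<omega> \<noteq> 0}"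
      then obtain J where "mod_proj M (l - int (card J)) (\<omega> J) \<noteq> 0"
        by (auto simp: form_proj_def fun_eq_iff)
      then show "l \<in> ?S" by (auto intro!: exI[of _ J] image_eqI[of _ _ "l - int (card J)"])
    qed
    show fin: "finite {l. form_proj M l \<omega> \<noteq> 0}" by (rule finite_subset[OF sub S])
    show "(\<Sum>l | form_proj M l \<omega> \<noteq> 0. form_proj M l \<omega>) = \<omega>"
    proof
      fix J
      have ap: "(\<Sum>l\<in>A. form_proj M l \<omega>) J = (\<Sum>l\<in>A. form_proj M l \<omega> J)" for A
        by (induction A rule: infinite_finite_induct) auto
      let ?B = "(\<lambda>l. l - int (card J)) ` ?S"
      have "(\<Sum>l | form_proj M l \<omega> \<noteq> 0. form_proj M l \<omega>) = (\<Sum>l\<in>?S. form_proj M l \<omega>)"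
        by (rule sum.mono_neutral_left[OF S sub]) auto
      then have "(\<Sum>l | form_proj M l \<omega> \<noteq> 0. form_proj M l \<omega>) J = (\<Sum>l\<in>?S. form_proj M l \<omega>) J"
        by (rule fun_cong)
      also have "\<dots> = (\<Sum>l\<in>?S. mod_proj M (l - int (card J)) (\<omega> J))"
        unfolding ap by (simp add: form_proj_def)
      also have "\<dots> = (\<Sum>l\<in>?B. mod_proj M l (\<omega> J))"
        by (subst sum.reindex) (auto simp: inj_on_def)
      also have "\<dots> = \<omega> J"
      proof (rule C.pr_sum_superset[OF wJ])
        show "finite ?B" using S by blast
        show "{l. mod_proj M l (\<omega> J) \<noteq> 0} \<subseteq> ?B"
        proof
          fix l assume "l \<in> {l. mod_proj M l (\<omega> J) \<noteq> 0}"
          then have "l + int (card J) \<in> ?S" by blast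
          then show "l \<in> ?B" by (rule image_eqI[rotated]) simp
        qed
      qed
      finally show "(\<Sum>l | form_proj M l \<omega> \<noteq> 0. form_proj M l \<omega>) J = \<omega> J" .
    qed
    assume e: "\<eta> \<in> forms M q"
    show "form_scale M c (\<omega> + \<eta>) = form_scale M c \<omega> + form_scale M c \<eta>"
      by (rule ext) (simp add: form_scale_def C.s_add wJ forms_car[OF e])
    show "form_proj M l (\<omega> + \<eta>) = form_proj M l \<omega> + form_proj M l \<eta>"
      by (rule ext) (simp add: form_proj_def C.pr_add wJ forms_car[OF e])
  qed (rule forms_subgroup)
qed

lemma form_diff_proj:
  assumes "\<omega> \<in> forms M q"
  shows "form_proj M l (form_diff M \<omega>) = form_diff M (form_proj M l \<omega>)"
proof
  fix J :: "'n set"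
  interpret C: graded_space "mcar M" "\<lambda>c. mact M (dconst c)" "mod_proj M" by (rule graded_space_car)
  have psum: "mod_proj M l (sum f A) = (\<Sum>i\<in>A. mod_proj M l (f i))" if "\<And>i. f i \<in> mcar M"
    for l f and A :: "'n set"
    using that by (induction A rule: infinite_finite_induct) (simp_all add: C.pr_0 C.pr_add car_sum)
  have pneg: "mod_proj M l (- x) = - mod_proj M l x" if x: "x \<in> mcar M" for x l
    using C.pr_add[OF x car_neg[OF x], of l] C.pr_0 by (simp add: eq_neg_iff_add_eq_0 add.commute)
  have psgn: "mod_proj M l (esgn s J x) = esgn s J (mod_proj M l x)" if "x \<in> mcar M" for x l s
    using that by (simp add: esgn_def pneg)
  have "form_proj M l (form_diff M \<omega>) J =
      (\<Sum>s\<in>J. esgn s J (mod_proj M (l - int (card J)) (mact M (dpart s) (\<omega> (J - {s})))))"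
    unfolding form_proj_def form_diff_esgn
    by (subst psum) (simp_all add: psgn esgn_car act_closed forms_car[OF assms])
  also have "\<dots> = form_diff M (form_proj M l \<omega>) J"
    unfolding form_proj_def form_diff_esgn
  proof (intro sum.cong refl arg_cong[of _ _ "esgn _ _"])
    fix s assume "s \<in> J"
    then have "int (card (J - {s})) = int (card J) - 1"
      by (metis card_Suc_Diff1 finite_class.finite_code of_nat_Suc add_diff_cancel_left')
    then have "l - int (card J) = l - int (card (J - {s})) + - 1" by simp
    then show "mod_proj M (l - int (card J)) (mact M (dpart s) (\<omega> (J - {s}))) =
        mact M (dpart s) (mod_proj M (l - int (card (J - {s}))) (\<omega> (J - {s})))"
      using proj_act[OF dop_homog.part forms_car[OF assms], of "l - int (card (J - {s}))" s "J - {s}"]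
      by (simp only:)
  qed
  finally show "form_proj M l (form_diff M \<omega>) J = form_diff M (form_proj M l \<omega>) J" .
qed

end

lemma form_diff_map:
  fixes M :: "(('n::{finite,linorder}, 'k::field_char_0) dop, 'm::ab_group_add) grmod"
    and M' :: "(('n, 'k) dop, 'w::ab_group_add) grmod"
  assumes M: "dop_module M" and f: "\<And>x y. x \<in> mcar M \<Longrightarrow> y \<in> mcar M \<Longrightarrow> f (x + y) = f x + f y"
    "\<And>i x. x \<in> mcar M \<Longrightarrow> f (mact M (dpart i) x) = mact M' (dpart i) (f x)" and w: "\<omega> \<in> forms M q"
  shows "form_diff M' (\<lambda>J. f (\<omega> J)) = (\<lambda>J. f (form_diff M \<omega> J))"
proof
  interpret dop_module M by fact
  fix J :: "'n set"
  have f0: "f 0 = 0" using f(1)[OF car_0 car_0] by simp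
  have fneg: "f (- x) = - f x" if "x \<in> mcar M" for x
    using f(1)[OF that car_neg[OF that]] f0 by (simp add: eq_neg_iff_add_eq_0 add.commute)
  have fsum: "f (sum g A) = (\<Sum>i\<in>A. f (g i))" if "\<And>i. g i \<in> mcar M" for g and A :: "'n set"
    using that by (induction A rule: infinite_finite_induct) (simp_all add: f0 f(1) car_sum)
  have fs: "f (esgn s J x) = esgn s J (f x)" if "x \<in> mcar M" for s x
    using that by (simp add: esgn_def fneg)
  show "form_diff M' (\<lambda>J. f (\<omega> J)) J = f (form_diff M \<omega> J)"
    unfolding form_diff_esgn
    by (subst fsum) (simp_all add: esgn_car act_closed forms_car[OF w] fs f(2))
qed

section \<open>Koszul homotopies from a second Weyl algebra action\<close>

context gr_dmodule
begin

text \<open>Contraction of a form with the operators \<open>D\<close>. Below, \<open>euler\<close>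
  is the corresponding number operator, and \<open>weight D j\<close> consists of the elements
  killed by every product of \<open>j\<close> of the operators.\<close>

definition koszul :: "('n \<Rightarrow> 'm \<Rightarrow> 'm) \<Rightarrow> ('n set \<Rightarrow> 'm) \<Rightarrow> 'n set \<Rightarrow> 'm" where
  "koszul D \<eta> J = (\<Sum>t\<in>- J. esgn t J (D t (\<eta> (insert t J))))"

definition euler :: "('n \<Rightarrow> 'm \<Rightarrow> 'm) \<Rightarrow> 'm \<Rightarrow> 'm" where
  "euler D m = (\<Sum>s\<in>UNIV. mact M (dpart s) (D s m))"

primrec weight :: "('n \<Rightarrow> 'm \<Rightarrow> 'm) \<Rightarrow> nat \<Rightarrow> 'm set" where
  "weight D 0 = {0}"
| "weight D (Suc j) = {m \<in> mcar M. \<forall>t. D t m \<in> weight D j}"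

end

text \<open>The operators \<partial>_s and \<open>D t\<close> satisfy the Weyl relations with
  \<partial>_s in the role of the variables and \<open>D\<close> in that of the derivatives. With
  \<open>D\<close> locally nilpotent, such a module behaves like a polynomial ring in the
  \<partial>_s, and its de Rham complex like the Koszul complex of the variables.\<close>

locale weyl_pair = gr_dmodule M for M :: "(('n::{finite,linorder}, 'k::field_char_0) dop, 'm::ab_group_add) grmod" +
  fixes D :: "'n \<Rightarrow> 'm \<Rightarrow> 'm"
  assumes D_closed: "m \<in> mcar M \<Longrightarrow> D t m \<in> mcar M"
    and D_add: "m \<in> mcar M \<Longrightarrow> m' \<in> mcar M \<Longrightarrow> D t (m + m') = D t m + D t m'"
    and D_scale: "m \<in> mcar M \<Longrightarrow> D t (mact M (dconst c) m) = mact M (dconst c) (D t m)"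
    and D_part: "m \<in> mcar M \<Longrightarrow> D t (mact M (dpart s) m) = mact M (dpart s) (D t m) + (if s = t then m else 0)"
    and D_commute: "m \<in> mcar M \<Longrightarrow> D t (D s m) = D s (D t m)"
    and D_nilpotent: "m \<in> mcar M \<Longrightarrow> \<exists>j. m \<in> weight D j"
begin

lemma D_0: "D t 0 = 0"
  using D_add[OF car_0 car_0, of t] by simp

lemma D_neg: "m \<in> mcar M \<Longrightarrow> D t (- m) = - D t m"
  using D_add[of m "- m" t] by (simp add: car_neg D_0 eq_neg_iff_add_eq_0 add.commute)

lemma D_diff: "m \<in> mcar M \<Longrightarrow> m' \<in> mcar M \<Longrightarrow> D t (m - m') = D t m - D t m'"
  using D_add[of m "- m'" t] by (simp add: car_neg D_neg)

lemma D_sum: "(\<And>i. i \<in> A \<Longrightarrow> f i \<in> mcar M) \<Longrightarrow> D t (sum f A) = (\<Sum>i\<in>A. D t (f i))"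
  by (induction A rule: infinite_finite_induct) (simp_all add: D_0 D_add car_sum)

lemma D_esgn: "m \<in> mcar M \<Longrightarrow> D t (esgn s K m) = esgn s K (D t m)"
  by (simp add: esgn_def D_neg)

lemma weight_mono: "j \<le> j' \<Longrightarrow> weight D j \<subseteq> weight D j'"
proof (induction j arbitrary: j')
  case 0
  have "0 \<in> weight D j" for j by (induction j) (simp_all add: D_0)
  then show ?case by simp
next
  case (Suc j)
  then obtain i where i: "j' = Suc i" "j \<le> i" using Suc_le_D by blast
  with Suc.IH show ?case by auto
qed

lemma euler_closed: "m \<in> mcar M \<Longrightarrow> euler D m \<in> mcar M"
  by (simp add: euler_def car_sum act_closed D_closed)

text \<open>Number operator relations: \<open>D t\<close> lowers the Euler eigenvalue by one, and by
  \<open>euler_part\<close> the operator \<partial>_s raises it by one.\<close>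

lemma D_euler:
  assumes m: "m \<in> mcar M"
  shows "D t (euler D m) = euler D (D t m) + D t m"
proof -
  have "D t (euler D m) = (\<Sum>s\<in>UNIV. D t (mact M (dpart s) (D s m)))"
    unfolding euler_def by (rule D_sum) (simp add: act_closed D_closed m)
  also have "\<dots> = (\<Sum>s\<in>UNIV. mact M (dpart s) (D s (D t m)) + (if s = t then D t m else 0))"
    by (intro sum.cong refl) (auto simp: D_part D_closed m D_commute[OF m, of t])
  finally show ?thesis by (simp add: sum.distrib euler_def)
qed

lemma euler_part:
  assumes m: "m \<in> mcar M"
  shows "mact M (dpart s) (euler D m) = euler D (mact M (dpart s) m) - mact M (dpart s) m"
proof -
  have "euler D (mact M (dpart s) m) =
      (\<Sum>t\<in>UNIV. mact M (dpart s) (mact M (dpart t) (D t m)) + (if s = t then mact M (dpart s) m else 0))"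
    unfolding euler_def
    by (intro sum.cong refl) (auto simp: D_part act_add act_closed D_closed m part_commute[of _ s] act_0)
  also have "\<dots> = mact M (dpart s) (euler D m) + mact M (dpart s) m"
    by (simp add: sum.distrib euler_def act_sum act_closed D_closed m)
  finally show ?thesis by simp
qed

text \<open>Elements of weight \<open>Suc j\<close> behave like polynomials of degree at most
  \<open>j\<close> in the \<partial>_s. On the leading part \<open>euler D\<close> is multiplication
  by \<open>j\<close>, so the difference drops in weight.\<close>

lemma euler_weight:
  "m \<in> weight D (Suc j) \<Longrightarrow> euler D m - mact M (dconst (of_nat j)) m \<in> weight D j"
proof (induction j arbitrary: m)
  case 0
  then show ?case by (simp add: euler_def act_0 act_02 pconst_0 dmult_0)
next
  case (Suc j)
  have m: "m \<in> mcar M" using Suc.prems by simp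
  have "D t (euler D m - mact M (dconst (of_nat (Suc j))) m) \<in> weight D j" for t
  proof -
    have "D t (euler D m - mact M (dconst (of_nat (Suc j))) m) =
        euler D (D t m) + D t m - mact M (dconst (of_nat (Suc j))) (D t m)"
      by (simp only: D_diff euler_closed act_closed m D_euler D_scale)
    also have "mact M (dconst (of_nat (Suc j))) (D t m) = D t m + mact M (dconst (of_nat j)) (D t m)"
      by (simp add: pconst_add dmult_add act_add2 D_closed m pconst_1 dmult_1 act_1)
    finally have "D t (euler D m - mact M (dconst (of_nat (Suc j))) m) =
        euler D (D t m) - mact M (dconst (of_nat j)) (D t m)" by simp
    also have "\<dots> \<in> weight D j" using Suc.prems by (intro Suc.IH) simp
    finally show ?thesis .
  qed
  then show ?case using m by (simp add: car_diff euler_closed act_closed del: of_nat_Suc)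
qed

text \<open>A formula of Cartan type. The diagonal terms add up to the Euler operator, each
  \<open>t\<close> outside \<open>K\<close> contributes one extra copy of \<open>\<eta> K\<close>
  from moving \<open>D t\<close> past \<partial>_t, and the mixed terms cancel by their
  signs.\<close>

lemma koszul_homotopy:
  assumes w: "\<eta> \<in> forms M q"
  shows "form_diff M (koszul D \<eta>) K + koszul D (form_diff M \<eta>) K =
    euler D (\<eta> K) + mact M (dconst (of_nat (card (- K)))) (\<eta> K)"
proof -
  note c = forms_car[OF w]
  let ?X = "\<lambda>s t. esgn s K (esgn t (K - {s}) (mact M (dpart s) (D t (\<eta> (insert t (K - {s}))))))"
  let ?Y = "\<lambda>s t. esgn t K (esgn s (insert t K) (D t (mact M (dpart s) (\<eta> (insert t K - {s})))))"
  let ?P = "\<lambda>s. mact M (dpart s) (D s (\<eta> K))"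
  have "form_diff M (koszul D \<eta>) K = (\<Sum>s\<in>K. \<Sum>t\<in>- (K - {s}). ?X s t)"
    by (simp only: form_diff_esgn koszul_def act_sum esgn_car act_closed c D_closed act_esgn esgn_sum)
  also have "\<dots> = (\<Sum>s\<in>K. ?P s + (\<Sum>t\<in>- K. ?X s t))"
  proof (intro sum.cong refl)
    fix s assume s: "s \<in> K"
    then have "- (K - {s}) = insert s (- K)" by auto
    moreover have "insert s (K - {s}) = K" using s by auto
    ultimately show "(\<Sum>t\<in>- (K - {s}). ?X s t) = ?P s + (\<Sum>t\<in>- K. ?X s t)"
      using s by (simp add: esgn_remove)
  qed
  finally have A: "form_diff M (koszul D \<eta>) K = (\<Sum>s\<in>K. ?P s) + (\<Sum>s\<in>K. \<Sum>t\<in>- K. ?X s t)"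
    by (simp add: sum.distrib)
  have "koszul D (form_diff M \<eta>) K = (\<Sum>t\<in>- K. \<Sum>s\<in>insert t K. ?Y s t)"
    by (simp only: form_diff_esgn koszul_def D_sum esgn_car act_closed c D_closed D_esgn esgn_sum)
  also have "\<dots> = (\<Sum>t\<in>- K. ?P t + \<eta> K + (\<Sum>s\<in>K. ?Y s t))"
  proof (intro sum.cong refl)
    fix t assume t: "t \<in> - K"
    then have "insert t K - {t} = K" by auto
    then have "?Y t t = ?P t + \<eta> K" by (simp add: esgn_insert_self D_part c)
    then show "(\<Sum>s\<in>insert t K. ?Y s t) = ?P t + \<eta> K + (\<Sum>s\<in>K. ?Y s t)" using t by simp
  qed
  also have "\<dots> = (\<Sum>t\<in>- K. ?P t) + (\<Sum>t\<in>- K. \<eta> K) + (\<Sum>t\<in>- K. \<Sum>s\<in>K. ?Y s t)"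
    by (simp add: sum.distrib)
  also have "(\<Sum>t\<in>- K. \<Sum>s\<in>K. ?Y s t) = (\<Sum>s\<in>K. \<Sum>t\<in>- K. ?Y s t)" by (rule sum.swap)
  also have "\<dots> = - (\<Sum>s\<in>K. \<Sum>t\<in>- K. ?X s t)"
    unfolding sum_negf[symmetric]
  proof (intro sum.cong refl)
    fix s t assume st: "s \<in> K" "t \<in> - K"
    then have ne: "s \<noteq> t" by auto
    have K: "insert s K = K" using st by auto
    have i: "insert t K - {s} = insert t (K - {s})" using ne by auto
    have sg: "esgn s (insert t K) v = (if t < s then - esgn s K v else esgn s K v)"
      "esgn t K v = (if s < t then - esgn t (K - {s}) v else esgn t (K - {s}) v)" for v :: 'm
      using esgn_insert[of K t s v] esgn_insert[of "K - {s}" s t v] st by (simp_all add: K)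
    define v where "v = mact M (dpart s) (D t (\<eta> (insert t (K - {s}))))"
    have v: "D t (mact M (dpart s) (\<eta> (insert t K - {s}))) = v"
      unfolding v_def i using ne by (simp add: D_part c)
    show "?Y s t = - ?X s t"
      unfolding v v_def[symmetric] sg esgn_commute[of s K t "K - {s}" v]
      using ne by (cases s t rule: linorder_cases) (auto simp: esgn_neg dest: order.asym)
  qed
  finally have B: "koszul D (form_diff M \<eta>) K =
    (\<Sum>t\<in>- K. ?P t) + (\<Sum>t\<in>- K. \<eta> K) - (\<Sum>s\<in>K. \<Sum>t\<in>- K. ?X s t)" by simp
  have "euler D (\<eta> K) = (\<Sum>t\<in>K \<union> - K. ?P t)" by (simp add: euler_def)
  also have "\<dots> = (\<Sum>s\<in>K. ?P s) + (\<Sum>t\<in>- K. ?P t)" by (rule sum.union_disjoint) auto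
  finally show ?thesis unfolding A B of_nat_scalar[OF c] by (simp add: algebra_simps)
qed

lemma koszul_forms:
  assumes w: "\<eta> \<in> forms M q"
  shows "koszul D \<eta> \<in> forms M (q - 1)"
proof -
  have "koszul D \<eta> J = 0" if J: "int (card J) \<noteq> q - 1" for J
    unfolding koszul_def
  proof (rule sum.neutral, rule ballI)
    fix t assume "t \<in> - J"
    then have "int (card (insert t J)) \<noteq> q" using J by simp
    then show "esgn t J (D t (\<eta> (insert t J))) = 0" using forms_0[OF w] by (simp add: D_0)
  qed
  moreover have "koszul D \<eta> J \<in> mcar M" for J
    unfolding koszul_def by (intro car_sum esgn_car D_closed forms_car[OF w])
  ultimately show ?thesis by (simp add: forms_def)
qed

text \<open>By \<open>koszul_homotopy\<close>, applying \<open>euler D\<close> plus the codegree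
  \<open>n - q\<close> to a closed form gives an exact one. On weight \<open>Suc j\<close> this
  operator is the nonzero number \<open>j + n - q\<close> up to smaller weight, and induction on the
  weight absorbs the error.\<close>

theorem forms_exact:
  assumes "q < int CARD('n)" "\<eta> \<in> forms M q" "form_diff M \<eta> = 0"
  shows "\<exists>\<zeta>\<in>forms M (q - 1). \<eta> = form_diff M \<zeta>"
proof -
  have main: "\<exists>\<zeta>\<in>forms M (q - 1). \<eta> = form_diff M \<zeta>"
    if "\<eta> \<in> forms M q" "form_diff M \<eta> = 0" "\<And>J. \<eta> J \<in> weight D j" for \<eta> j
    using that
  proof (induction j arbitrary: \<eta>)
    case 0
    then have "\<eta> = form_diff M 0" by (auto simp: form_diff_esgn act_0)
    moreover have "0 \<in> forms M (q - 1)" by (simp add: forms_def)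
    ultimately show ?case by blast
  next
    case (Suc j)
    note c = forms_car[OF Suc.prems(1)]
    \<comment> \<open>What the eigenvalue \<open>j\<close> does not account for in the Euler
      operator: a closed form of smaller weight, hence exact by induction.\<close>
    define \<eta>' where "\<eta>' = (\<lambda>J. euler D (\<eta> J) - mact M (dconst (of_nat j)) (\<eta> J))"
    have "\<eta>' \<in> forms M q"
      using Suc.prems(1) by (auto simp: forms_def \<eta>'_def car_diff euler_closed act_closed act_0)
        (simp add: euler_def D_0 act_0)
    \<comment> \<open>By \<open>euler_part\<close> the Euler operator commutes with the differential
      up to a multiple of the differential, so closedness passes to \<open>\<eta>'\<close>.\<close>
    moreover have "form_diff M \<eta>' = 0"
    proof
      fix K
      have "form_diff M \<eta>' K = (\<Sum>s\<in>K. esgn s K (mact M (dpart s) (euler D (\<eta> (K - {s})))) -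
          esgn s K (mact M (dpart s) (mact M (dconst (of_nat j)) (\<eta> (K - {s})))))"
        by (simp add: form_diff_esgn \<eta>'_def act_diff euler_closed act_closed c esgn_diff)
      also have "\<dots> = (\<Sum>s\<in>K. esgn s K (euler D (mact M (dpart s) (\<eta> (K - {s}))))) - form_diff M \<eta> K -
          mact M (dconst (of_nat j)) (form_diff M \<eta> K)"
        by (simp add: form_diff_esgn euler_part scalar_commute c esgn_diff sum_subtractf act_sum esgn_car
            act_closed act_esgn)
      also have "(\<Sum>s\<in>K. esgn s K (euler D (mact M (dpart s) (\<eta> (K - {s}))))) =
          euler D (form_diff M \<eta> K)"
      proof -
        have "euler D (form_diff M \<eta> K) =
            (\<Sum>t\<in>UNIV. \<Sum>s\<in>K. esgn s K (mact M (dpart t) (D t (mact M (dpart s) (\<eta> (K - {s}))))))"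
          by (simp only: euler_def form_diff_esgn D_sum esgn_car act_closed c D_esgn act_sum D_closed act_esgn)
        also have "\<dots> = (\<Sum>s\<in>K. \<Sum>t\<in>UNIV. esgn s K (mact M (dpart t) (D t (mact M (dpart s) (\<eta> (K - {s}))))))"
          by (rule sum.swap)
        finally show ?thesis by (simp add: euler_def esgn_sum)
      qed
      finally show "form_diff M \<eta>' K = 0 K"
        using Suc.prems(2) by (simp add: act_0 euler_def D_0)
    qed
    moreover have "\<eta>' J \<in> weight D j" for J
      unfolding \<eta>'_def by (rule euler_weight[OF Suc.prems(3)])
    ultimately obtain \<zeta> where z: "\<zeta> \<in> forms M (q - 1)" "\<eta>' = form_diff M \<zeta>" using Suc.IH by blast
    \<comment> \<open>The total eigenvalue, codegree plus \<open>j\<close>. It is positive because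
      \<open>q\<close> lies below the top degree, and invertible in characteristic zero.\<close>
    define r where "r = nat (int CARD('n) - q) + j"
    have "0 < r" using assms(1) by (simp add: r_def)
    then have r: "(of_nat r :: 'k) \<noteq> 0" by simp
    have eq: "mact M (dconst (of_nat r)) (\<eta> K) = form_diff M (koszul D \<eta> - \<zeta>) K" for K
    proof (cases "int (card K) = q")
      case True
      have k0: "koszul D (form_diff M \<eta>) K = 0" using Suc.prems(2) by (simp add: koszul_def D_0)
      have "nat (int CARD('n) - q) = card (- K)"
        using True card_mono[of UNIV K] unfolding Compl_eq_Diff_UNIV by (simp add: card_Diff_subset nat_diff_distrib')
      then have "mact M (dconst (of_nat r)) (\<eta> K) =
          mact M (dconst (of_nat (card (- K)))) (\<eta> K) + mact M (dconst (of_nat j)) (\<eta> K)"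
        by (simp add: r_def pconst_add dmult_add act_add2 c)
      also have "\<dots> = (euler D (\<eta> K) + mact M (dconst (of_nat (card (- K)))) (\<eta> K)) - \<eta>' K"
        by (simp add: \<eta>'_def)
      also have "\<dots> = form_diff M (koszul D \<eta>) K - form_diff M \<zeta> K"
        unfolding koszul_homotopy[OF Suc.prems(1), symmetric] k0 z(2) by simp
      also have "\<dots> = form_diff M (koszul D \<eta> - \<zeta>) K"
        using form_diff_add[OF add_subgroup_diff[OF forms_subgroup koszul_forms[OF Suc.prems(1)] z(1)] z(1)]
        by (simp add: fun_eq_iff algebra_simps)
      finally show ?thesis .
    next
      case False
      have "form_diff M (koszul D \<eta> - \<zeta>) \<in> forms M (q - 1 + 1)"
        by (intro form_diff_forms add_subgroup_diff[OF forms_subgroup] koszul_forms Suc.prems(1) z(1))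
      then show ?thesis using False Suc.prems(1) by (simp add: forms_def act_0)
    qed
    let ?z = "form_scale M (1 / of_nat r) (koszul D \<eta> - \<zeta>)"
    have kz: "koszul D \<eta> - \<zeta> \<in> forms M (q - 1)"
      by (intro add_subgroup_diff[OF forms_subgroup] koszul_forms Suc.prems(1) z(1))
    then have "?z \<in> forms M (q - 1)" by (auto simp: forms_def form_scale_def act_closed act_0)
    moreover have "\<eta> = form_diff M ?z"
    proof
      fix K
      have "form_diff M ?z K = mact M (dconst (1 / of_nat r)) (mact M (dconst (of_nat r)) (\<eta> K))"
        unfolding form_diff_scale[OF kz] eq by (simp add: form_scale_def)
      also have "\<dots> = mact M (dconst (1 / of_nat r * of_nat r)) (\<eta> K)"
        by (simp only: pconst_mult dmult_mult act_mult c)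
      finally show "\<eta> K = form_diff M ?z K" using r by (simp add: pconst_1 dmult_1 act_1 c)
    qed
    ultimately show ?case by blast
  qed
  \<comment> \<open>There are finitely many index sets, so one weight serves for all
    coefficients.\<close>
  have "\<exists>j. \<forall>J. \<eta> J \<in> weight D j"
  proof -
    have "\<forall>J. \<exists>j. \<eta> J \<in> weight D j" using D_nilpotent forms_car[OF assms(2)] by blast
    then obtain f where f: "\<And>J. \<eta> J \<in> weight D (f J)" by metis
    have "\<eta> J \<in> weight D (Max (range f))" for J
      using f[of J] weight_mono[of "f J" "Max (range f)"] by auto
    then show ?thesis by blast
  qed
  then show ?thesis using main assms(2,3) by blast
qed

end

lemma finite_exponents: "finite {a :: 'n::finite \<Rightarrow>\<^sub>0 nat. (\<Sum>i\<in>UNIV. Poly_Mapping.lookup a i) \<le> N}" (is "finite ?A")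
proof (rule finite_imageD[where f = Poly_Mapping.lookup])
  have "Poly_Mapping.lookup a i \<le> N" if "a \<in> ?A" for a i
    using that member_le_sum[of i UNIV "Poly_Mapping.lookup a"] by simp
  then have "Poly_Mapping.lookup ` ?A \<subseteq> {f. \<forall>i. (i \<in> UNIV \<longrightarrow> f i \<in> {..N}) \<and> (i \<notin> UNIV \<longrightarrow> f i = 0)}" by auto
  then show "finite (Poly_Mapping.lookup ` ?A)" by (rule finite_subset) (intro finite_set_of_finite_funs; simp)
  show "inj_on Poly_Mapping.lookup ?A" by (simp add: inj_on_def lookup_inject)
qed

abbreviation total :: "('n::finite \<Rightarrow>\<^sub>0 nat) \<Rightarrow> nat" where
  "total a \<equiv> \<Sum>i\<in>UNIV. Poly_Mapping.lookup a i"

abbreviation pmonom :: "('n \<Rightarrow>\<^sub>0 nat) \<Rightarrow> ('n, 'k::comm_ring_1) mpoly" where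
  "pmonom a \<equiv> Poly_Mapping.single a 1"

lemma single_pmonom: "Poly_Mapping.single a c = pconst c * pmonom a"
  by (simp add: pconst_def mult_single)

section \<open>Residues\<close>

text \<open>The exponent of the inverse monomial dual to \<open>x^a\<close> under the residue
  pairing; by \<open>inv_exponent_cases\<close> every inverse monomial arises this way.\<close>

definition inv_exp :: "('n::finite \<Rightarrow>\<^sub>0 nat) \<Rightarrow> ('n \<Rightarrow>\<^sub>0 int)" where
  "inv_exp a = Abs_poly_mapping (\<lambda>j. - 1 - int (Poly_Mapping.lookup a j))"

lemma lookup_inv_exp: "Poly_Mapping.lookup (inv_exp a) j = - 1 - int (Poly_Mapping.lookup a j)"
  by (simp add: inv_exp_def)

lemma inv_exp_inject: "inv_exp a = inv_exp b \<longleftrightarrow> a = b"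
proof
  assume "inv_exp a = inv_exp b"
  then have "Poly_Mapping.lookup a j = Poly_Mapping.lookup b j" for j
    using lookup_inv_exp[of a j] lookup_inv_exp[of b j] by simp
  then show "a = b" by (rule poly_mapping_eqI)
qed simp

lemma inv_exponent_inv_exp: "inv_exponent (inv_exp a)"
  by (simp add: inv_exponent_def lookup_inv_exp)

lemma inv_exponent_cases:
  assumes "inv_exponent (b :: 'n::finite \<Rightarrow>\<^sub>0 int)"
  obtains a where "b = inv_exp a"
proof
  show "b = inv_exp (Abs_poly_mapping (\<lambda>j. nat (- 1 - Poly_Mapping.lookup b j)))"
    using assms by (intro poly_mapping_eqI) (simp add: lookup_inv_exp inv_exponent_def)
qed

lemma total_inv_exp: "(\<Sum>i\<in>UNIV. Poly_Mapping.lookup (inv_exp a) i) = - int CARD('n) - int (total a)"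
  for a :: "'n::finite \<Rightarrow>\<^sub>0 nat"
  by (simp add: lookup_inv_exp sum_subtractf)

definition residue :: "('n::finite, 'k::comm_ring_1) inv_poly \<Rightarrow> 'k" where
  "residue e = Poly_Mapping.lookup e (inv_exp 0)"

lemma residue_add: "residue (e + e') = residue e + residue e'"
  by (simp add: residue_def lookup_add)

lemma residue_0 [simp]: "residue 0 = 0"
  by (simp add: residue_def)

lemma residue_diff: "residue (e - e') = residue e - residue e'"
  by (simp add: residue_def lookup_minus)

lemma residue_neg: "residue (- e) = - residue e"
  by (simp add: residue_def)

lemma residue_sum: "residue (sum f A) = (\<Sum>i\<in>A. residue (f i))"
  by (induction A rule: infinite_finite_induct) (simp_all add: residue_add)

text \<open>Only the term of \<open>e\<close> dual to \<open>x^a\<close> is moved to exponent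
  \<open>-1\<close> in every variable. Pairing with monomials therefore reads off all coefficients
  of \<open>e\<close>.\<close>

lemma residue_mult_single:
  "residue (inv_mult (Poly_Mapping.single a c) e) = c * Poly_Mapping.lookup e (inv_exp a)"
proof (induction e rule: mapping_induct)
  case (single b y)
  have "Poly_Mapping.map int a + b = inv_exp 0 \<longleftrightarrow> b = inv_exp a"
  proof
    assume "Poly_Mapping.map int a + b = inv_exp 0"
    then have "Poly_Mapping.lookup (Poly_Mapping.map int a + b) j = Poly_Mapping.lookup (inv_exp 0) j" for j by simp
    then have "Poly_Mapping.lookup b j = Poly_Mapping.lookup (inv_exp a) j" for j
      by (simp add: lookup_add lookup_map_int lookup_inv_exp algebra_simps)
    then show "b = inv_exp a" by (rule poly_mapping_eqI)
  qed (auto intro!: poly_mapping_eqI simp: lookup_add lookup_map_int lookup_inv_exp)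
  then show ?case
    by (auto simp: inv_mult_single residue_def lookup_single when_def inv_exponent_inv_exp)
qed (simp_all add: inv_mult_add2 residue_add lookup_add distrib_left)

lemma residue_scalar: "residue (inv_mult (pconst c) e) = c * residue e"
  unfolding pconst_def residue_mult_single by (simp add: residue_def)

text \<open>A derivative has no term in which some exponent is \<open>-1\<close>.\<close>

lemma residue_inv_diff: "residue (inv_diff i e) = 0"
proof (induction e rule: mapping_induct)
  case (single b y)
  have "Poly_Mapping.lookup b i = 0" if "b - Poly_Mapping.single i 1 = inv_exp 0"
  proof -
    have "Poly_Mapping.lookup (b - Poly_Mapping.single i 1) i = Poly_Mapping.lookup (inv_exp 0) i"
      using that by simp
    then show ?thesis by (simp add: lookup_minus lookup_inv_exp)
  qed
  then show ?case by (auto simp: inv_diff_single residue_def lookup_single when_def)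
qed (simp_all add: inv_diff_add residue_add)

text \<open>Integration by parts: the derivative of a product has no residue.\<close>

lemma residue_mult_diff: "residue (inv_mult p (inv_diff i e)) = - residue (inv_mult (pdiff i p) e)"
  using residue_inv_diff[of i "inv_mult p e"]
  by (simp add: inv_leibniz residue_add eq_neg_iff_add_eq_0 add.commute)

lemma inv_eqI:
  assumes "e \<in> inv_carrier" "e' \<in> inv_carrier"
    "\<And>a. residue (inv_mult (pmonom a) e) = residue (inv_mult (pmonom a) e')"
  shows "e = e'"
proof (rule poly_mapping_eqI)
  fix b
  show "Poly_Mapping.lookup e b = Poly_Mapping.lookup e' b"
  proof (cases "inv_exponent b")
    case True
    then obtain a where "b = inv_exp a" by (rule inv_exponent_cases)
    then show ?thesis using assms(3)[of a] by (simp add: residue_mult_single)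
  next
    case False
    then have "b \<notin> Poly_Mapping.keys e" "b \<notin> Poly_Mapping.keys e'"
      using assms(1,2) by (auto simp: inv_carrier_def)
    then show ?thesis by (simp add: in_keys_iff)
  qed
qed

text \<open>Translates the grading of \<open>E\<close> into residues; the inverse monomial dual to
  \<open>x^a\<close> has degree \<open>- n - total a\<close>.\<close>

lemma inv_piece_iff: "e \<in> piece inv_module l \<longleftrightarrow> e \<in> inv_carrier \<and>
    (\<forall>a. - int CARD('n) - int (total a) \<noteq> l \<longrightarrow> residue (inv_mult (pmonom a) e) = 0)"
  for e :: "('n::finite, 'k::field_char_0) inv_poly"
proof -
  have "e \<in> piece inv_module l \<longleftrightarrow> e \<in> inv_carrier \<and>
      (\<forall>b\<in>Poly_Mapping.keys e. (\<Sum>i\<in>UNIV. Poly_Mapping.lookup b i) = l)"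
    by (simp add: inv_module_def dmodule_of_def)
  also have "\<dots> \<longleftrightarrow> e \<in> inv_carrier \<and>
    (\<forall>a. - int CARD('n) - int (total a) \<noteq> l \<longrightarrow> residue (inv_mult (pmonom a) e) = 0)"
  proof (intro conj_cong refl iffI allI impI ballI)
    fix a :: "'n \<Rightarrow>\<^sub>0 nat"
    assume "\<forall>b\<in>Poly_Mapping.keys e. (\<Sum>i\<in>UNIV. Poly_Mapping.lookup b i) = l"
      "- int CARD('n) - int (total a) \<noteq> l"
    then have "inv_exp a \<notin> Poly_Mapping.keys e" using total_inv_exp[of a] by auto
    then show "residue (inv_mult (pmonom a) e) = 0" by (simp add: residue_mult_single in_keys_iff)
  next
    fix b assume e: "e \<in> inv_carrier" and b: "b \<in> Poly_Mapping.keys e" and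
      h: "\<forall>a. - int CARD('n) - int (total a) \<noteq> l \<longrightarrow> residue (inv_mult (pmonom a) e) = 0"
    have "inv_exponent b" using e b by (simp add: inv_carrier_def)
    then obtain a where a: "b = inv_exp a" by (rule inv_exponent_cases)
    have "residue (inv_mult (pmonom a) e) \<noteq> 0" using b by (simp add: residue_mult_single in_keys_iff a)
    then show "(\<Sum>i\<in>UNIV. Poly_Mapping.lookup b i) = l" using h total_inv_exp[of a] unfolding a by metis
  qed
  finally show ?thesis .
qed

text \<open>Inverse to reading off coefficients. For infinite support it has the junk value
  \<open>0\<close>, hence the finiteness hypothesis in \<open>lookup_inv_of_coeffs\<close>.\<close>

definition inv_of_coeffs :: "(('n::finite \<Rightarrow>\<^sub>0 nat) \<Rightarrow> 'k) \<Rightarrow> ('n, 'k::comm_ring_1) inv_poly" where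
  "inv_of_coeffs g = (\<Sum>a | g a \<noteq> 0. Poly_Mapping.single (inv_exp a) (g a))"

lemma inv_of_coeffs_carrier: "inv_of_coeffs g \<in> inv_carrier"
  unfolding inv_of_coeffs_def
  by (rule inv_carrier_sum) (auto simp: inv_carrier_def inv_exponent_inv_exp)

lemma lookup_inv_of_coeffs:
  assumes "finite {a. g a \<noteq> 0}"
  shows "Poly_Mapping.lookup (inv_of_coeffs g) (inv_exp a) = g a"
proof -
  have "Poly_Mapping.lookup (inv_of_coeffs g) (inv_exp a) = (\<Sum>b | g b \<noteq> 0. if b = a then g a else 0)"
    unfolding inv_of_coeffs_def lookup_sum
    by (intro sum.cong) (auto simp: lookup_single when_def inv_exp_inject)
  then show ?thesis using assms by simp
qed

lemma dpart_dmults: "dpart i * dmult p = dmult (pdiff i p) + dmult p * dpart i"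
  by (rule dop_eqI) (simp add: times_dop.rep_eq plus_dop.rep_eq Rep_dmult Rep_dpart pdiff_mult)

lemma (in dop_module) act_part_mult: "x \<in> mcar M \<Longrightarrow> mact M (dpart i) (mact M (dmult p) x) =
    mact M (dmult (pdiff i p)) x + mact M (dmult p) (mact M (dpart i) x)"
  using act_mult[of x "dpart i" "dmult p"] act_mult[of x "dmult p" "dpart i"]
  by (simp add: dpart_dmults act_add2)

section \<open>Homomorphisms into E as functionals\<close>

context gr_dmodule
begin

interpretation C: graded_space "mcar M" "\<lambda>c. mact M (dconst c)" "mod_proj M"
  by (rule graded_space_car)

abbreviation "gdual \<equiv> graded_dual (mcar M) (\<lambda>c. mact M (dconst c)) (mod_proj M)"

lemma dual_add: "\<phi> \<in> gdual \<Longrightarrow> x \<in> mcar M \<Longrightarrow> y \<in> mcar M \<Longrightarrow> \<phi> (x + y) = \<phi> x + \<phi> y"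
  by (rule C.functional_add) (simp_all add: graded_dual_def)

lemma dual_scale: "\<phi> \<in> gdual \<Longrightarrow> x \<in> mcar M \<Longrightarrow> \<phi> (mact M (dconst c) x) = c * \<phi> x"
  by (rule C.functional_scale) (simp_all add: graded_dual_def)

lemma dual_out: "\<phi> \<in> gdual \<Longrightarrow> x \<notin> mcar M \<Longrightarrow> \<phi> x = 0"
  by (simp add: graded_dual_def linear_functionals_def)

lemma dual_0: "\<phi> \<in> gdual \<Longrightarrow> \<phi> 0 = 0"
  by (rule C.functional_0) (simp add: graded_dual_def)

lemma dual_sum: "\<phi> \<in> gdual \<Longrightarrow> (\<And>i. i \<in> A \<Longrightarrow> f i \<in> mcar M) \<Longrightarrow> \<phi> (sum f A) = (\<Sum>i\<in>A. \<phi> (f i))"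
  by (rule C.functional_sum) (simp_all add: graded_dual_def)

lemma monom_piece: "x \<in> piece M l \<Longrightarrow> mact M (dmult (pmonom a)) x \<in> piece M (l + int (total a))"
proof -
  have "(pmonom a :: ('n, 'k) mpoly) \<in> hom_poly (total a)" by (simp add: hom_poly_def)
  then show "x \<in> piece M l \<Longrightarrow> mact M (dmult (pmonom a)) x \<in> piece M (l + int (total a))"
    using graded unfolding graded_dmodule_def by blast
qed

lemma dual_piece:
  assumes "\<phi> \<in> gdual"
  shows "\<exists>S. finite S \<and> (\<forall>l x. x \<in> piece M l \<longrightarrow> l \<notin> S \<longrightarrow> \<phi> x = 0)"
proof -
  obtain S where S: "finite S" "\<And>x l. x \<in> mcar M \<Longrightarrow> l \<notin> S \<Longrightarrow> \<phi> (mod_proj M l x) = 0"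
    using assms unfolding graded_dual_def by blast
  have "\<phi> x = 0" if "x \<in> piece M l" "l \<notin> S" for l x
    using S(2)[OF piece_car[OF that(1)] that(2)] proj_of_piece[OF that(1), of l] by simp
  then show ?thesis using S(1) by blast
qed

text \<open>The element \<open>x\<close> has finitely many components and \<open>\<phi>\<close> sees
  finitely many degrees. A monomial contributes only if its degree is a difference of these, and
  there are finitely many monomials of bounded degree. Here the graded dual, as opposed to the full
  dual, is essential.\<close>

lemma dual_monom_finite:
  assumes f: "\<phi> \<in> gdual" and x: "x \<in> mcar M"
  shows "finite {a. \<phi> (mact M (dmult (pmonom a)) x) \<noteq> 0}"
proof -
  obtain S where S: "finite S" "\<And>l x. x \<in> piece M l \<Longrightarrow> l \<notin> S \<Longrightarrow> \<phi> x = 0"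
    using dual_piece[OF f] by blast
  let ?T = "{l. mod_proj M l x \<noteq> 0}"
  have T: "finite ?T" by (rule C.pr_finite[OF x])
  have "{a. \<phi> (mact M (dmult (pmonom a)) x) \<noteq> 0} \<subseteq> (\<Union>s\<in>S. \<Union>l\<in>?T. {a. total a \<le> nat (s - l)})"
  proof
    fix a assume "a \<in> {a. \<phi> (mact M (dmult (pmonom a)) x) \<noteq> 0}"
    then have ne: "\<phi> (mact M (dmult (pmonom a)) x) \<noteq> 0" by simp
    have "mact M (dmult (pmonom a)) x = mact M (dmult (pmonom a)) (\<Sum>l\<in>?T. mod_proj M l x)"
      by (simp only: C.pr_sum[OF x])
    also have "\<dots> = (\<Sum>l\<in>?T. mact M (dmult (pmonom a)) (mod_proj M l x))"
      by (rule act_sum) (rule C.pr_closed[OF x])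
    finally have "\<phi> (mact M (dmult (pmonom a)) x) = (\<Sum>l\<in>?T. \<phi> (mact M (dmult (pmonom a)) (mod_proj M l x)))"
      using dual_sum[OF f, of ?T] by (simp add: act_closed C.pr_closed[OF x])
    with ne obtain l where l: "l \<in> ?T" "\<phi> (mact M (dmult (pmonom a)) (mod_proj M l x)) \<noteq> 0"
      by (metis (no_types, lifting) sum.neutral)
    then have "l + int (total a) \<in> S" using S(2) monom_piece[OF proj_piece[OF x]] by blast
    moreover have "total a \<le> nat (l + int (total a) - l)" by (simp del: of_nat_sum)
    ultimately have "\<exists>s\<in>S. total a \<le> nat (s - l)" by blast
    with l show "a \<in> (\<Union>s\<in>S. \<Union>l\<in>?T. {a. total a \<le> nat (s - l)})" by blast
  qed
  then show ?thesis by (rule finite_subset) (intro finite_UN_I S(1) T finite_exponents)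
qed

text \<open>The only candidate for an \<open>R\<close>-linear map with residue
  \<open>\<phi>\<close>: the coefficient at the inverse monomial dual to \<open>x^a\<close> has to
  be the value of \<open>\<phi>\<close> at \<open>x^a\<close> times the argument.\<close>

definition unresidue :: "('m \<Rightarrow> 'k) \<Rightarrow> 'm \<Rightarrow> ('n, 'k) inv_poly" where
  "unresidue \<phi> x = (if x \<in> mcar M then inv_of_coeffs (\<lambda>a. \<phi> (mact M (dmult (pmonom a)) x)) else 0)"

lemma residue_unresidue:
  assumes f: "\<phi> \<in> gdual" and x: "x \<in> mcar M"
  shows "residue (inv_mult p (unresidue \<phi> x)) = \<phi> (mact M (dmult p) x)"
proof (induction p rule: mapping_induct)
  case zero
  then show ?case by (simp add: dmult_0 act_02 x dual_0[OF f])
next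
  case (add p q)
  then show ?case by (simp add: inv_mult_add1 residue_add dmult_add act_add2 x dual_add[OF f] act_closed)
next
  case (single a c)
  have "residue (inv_mult (Poly_Mapping.single a c) (unresidue \<phi> x)) =
      c * \<phi> (mact M (dmult (pmonom a)) x)"
    using x by (simp add: residue_mult_single unresidue_def lookup_inv_of_coeffs[OF dual_monom_finite[OF f x]])
  also have "\<dots> = \<phi> (mact M (dmult (Poly_Mapping.single a c)) x)"
    unfolding single_pmonom[of a c] by (simp only: dmult_mult act_mult x dual_scale[OF f] act_closed)
  finally show ?case .
qed

definition rhom :: "('m \<Rightarrow> ('n, 'k) inv_poly) set" where
  "rhom = {f. (\<forall>x\<in>mcar M. f x \<in> inv_carrier) \<and> (\<forall>x\<in>mcar M. \<forall>y\<in>mcar M. f (x + y) = f x + f y) \<and>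
    (\<forall>p. \<forall>x\<in>mcar M. f (mact M (dmult p) x) = inv_mult p (f x)) \<and> (\<forall>x. x \<notin> mcar M \<longrightarrow> f x = 0)}"

lemma lhom_R: "lhom (restrict_scalars dmult M) (restrict_scalars dmult inv_module) = rhom"
  unfolding lhom_def rhom_def by (auto simp: restrict_scalars_def inv_module_simps)

lemma unresidue_rhom:
  assumes f: "\<phi> \<in> gdual"
  shows "unresidue \<phi> \<in> rhom"
proof -
  have c: "unresidue \<phi> x \<in> inv_carrier" if "x \<in> mcar M" for x
    using that by (simp add: unresidue_def inv_of_coeffs_carrier)
  have "unresidue \<phi> (x + y) = unresidue \<phi> x + unresidue \<phi> y" if "x \<in> mcar M" "y \<in> mcar M" for x y
    using that by (intro inv_eqI inv_carrier_add c)
      (simp_all add: car_add inv_mult_add2 residue_add residue_unresidue[OF f] act_add dual_add[OF f] act_closed)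
  moreover have "unresidue \<phi> (mact M (dmult p) x) = inv_mult p (unresidue \<phi> x)" if "x \<in> mcar M" for p x
    using that by (intro inv_eqI c inv_mult_closed)
      (simp_all add: act_closed inv_mult_mult[symmetric] residue_unresidue[OF f] dmult_mult act_mult)
  ultimately show ?thesis using c by (simp add: rhom_def unresidue_def)
qed

lemma rhom_closed: "f \<in> rhom \<Longrightarrow> f x \<in> inv_carrier"
  by (cases "x \<in> mcar M") (simp_all add: rhom_def inv_carrier_0)

lemma rhom_mult: "f \<in> rhom \<Longrightarrow> x \<in> mcar M \<Longrightarrow> f (mact M (dmult p) x) = inv_mult p (f x)"
  and rhom_add: "f \<in> rhom \<Longrightarrow> x \<in> mcar M \<Longrightarrow> y \<in> mcar M \<Longrightarrow> f (x + y) = f x + f y"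
  and rhom_out: "f \<in> rhom \<Longrightarrow> x \<notin> mcar M \<Longrightarrow> f x = 0"
  by (simp_all add: rhom_def)

text \<open>By \<open>R\<close>-linearity the residues of all monomial multiples of
  \<open>f x\<close> are themselves residues of values of \<open>f\<close>, and these determine
  \<open>f x\<close>.\<close>

lemma rhom_eqI:
  assumes f: "f \<in> rhom" and g: "g \<in> rhom" and fg: "\<And>x. x \<in> mcar M \<Longrightarrow> residue (f x) = residue (g x)"
  shows "f = g"
proof
  fix x
  show "f x = g x"
  proof (cases "x \<in> mcar M")
    case True
    then show ?thesis
      by (intro inv_eqI rhom_closed f g)
        (simp only: rhom_mult[OF f, symmetric] rhom_mult[OF g, symmetric] fg act_closed)
  qed (simp add: rhom_out f g)
qed

lemma residue_unresidue_1: "\<phi> \<in> gdual \<Longrightarrow> residue \<circ> unresidue \<phi> = \<phi>"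
proof
  fix x assume f: "\<phi> \<in> gdual"
  show "(residue \<circ> unresidue \<phi>) x = \<phi> x"
    using residue_unresidue[OF f, of x 1] inv_mult_1[OF rhom_closed[OF unresidue_rhom[OF f]], of x]
    by (cases "x \<in> mcar M") (simp_all add: dmult_1 act_1 unresidue_def dual_out[OF f])
qed

text \<open>Integration by parts turns the residue of \<open>x^a\<close> times the defect of
  \<open>f\<close> in commuting with \<partial>_i at \<open>x\<close> into the residue of
  \<open>f\<close> at \<partial>_i applied to \<open>x^a\<close> times \<open>x\<close>. So
  \<D>-linearity amounts to the functional killing all derivatives.\<close>

lemma lhom_D: "lhom M inv_module = {f \<in> rhom. \<forall>i. \<forall>x\<in>mcar M. residue (f (mact M (dpart i) x)) = 0}"
proof (intro equalityI subsetI)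
  fix f assume f: "f \<in> lhom M inv_module"
  then have "f \<in> rhom" unfolding lhom_def rhom_def by (auto simp: inv_module_simps)
  moreover have "f (mact M (dpart i) x) = inv_diff i (f x)" if "x \<in> mcar M" for i x
    using f that unfolding lhom_def by (auto simp: inv_module_simps)
  ultimately show "f \<in> {f \<in> rhom. \<forall>i. \<forall>x\<in>mcar M. residue (f (mact M (dpart i) x)) = 0}"
    by (simp add: residue_inv_diff)
next
  fix f assume "f \<in> {f \<in> rhom. \<forall>i. \<forall>x\<in>mcar M. residue (f (mact M (dpart i) x)) = 0}"
  then have f: "f \<in> rhom" and k: "\<And>i x. x \<in> mcar M \<Longrightarrow> residue (f (mact M (dpart i) x)) = 0" by auto
  have d: "f (mact M (dpart i) x) = inv_diff i (f x)" if x: "x \<in> mcar M" for i x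
  proof (rule inv_eqI)
    fix a
    have "residue (f (mact M (dmult (pdiff i (pmonom a))) x + mact M (dmult (pmonom a)) (mact M (dpart i) x))) = 0"
      unfolding act_part_mult[OF x, symmetric] by (rule k[OF act_closed[OF x]])
    then show "residue (inv_mult (pmonom a) (f (mact M (dpart i) x))) = residue (inv_mult (pmonom a) (inv_diff i (f x)))"
      unfolding residue_mult_diff
      by (simp add: rhom_add[OF f] rhom_mult[OF f] act_closed x residue_add eq_neg_iff_add_eq_0 add.commute)
  qed (simp_all add: rhom_closed[OF f] inv_diff_closed)
  have il: "left_module (inv_module :: (('n,'k) dop, _) grmod)" "mcar (inv_module :: (('n,'k) dop, _) grmod) = inv_carrier"
    by (rule inv_module_simps)+
  have "f (mact M P x) = mact inv_module P (f x)" if x: "x \<in> mcar M" for P x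
    using x
  proof (induction P arbitrary: x rule: dop_induct)
    case (mult p)
    then show ?case by (simp add: inv_module_simps rhom_closed[OF f] rhom_mult[OF f])
  next
    case (diff i)
    then show ?case by (simp add: inv_module_simps rhom_closed[OF f] d)
  next
    case (add P P')
    have "mact inv_module (P + P') (f x) = mact inv_module P (f x) + mact inv_module P' (f x)"
      using il rhom_closed[OF f, of x] unfolding left_module_def by metis
    with add show ?case by (simp add: act_add2 rhom_add[OF f] act_closed)
  next
    case (comp P P')
    have "mact inv_module (P * P') (f x) = mact inv_module P (mact inv_module P' (f x))"
      using il rhom_closed[OF f, of x] unfolding left_module_def by metis
    with comp show ?case by (simp add: act_mult act_closed)
  qed
  then show "f \<in> lhom M inv_module"
    using f unfolding lhom_def rhom_def by (simp add: inv_module_simps)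
qed

text \<open>Residues live in degree \<open>- n\<close> of \<open>E\<close>, and a map of degree
  \<open>d\<close> reaches it only from degree \<open>- n - d\<close>.\<close>

lemma rhom_piece:
  assumes f: "f \<in> rhom"
  shows "(\<forall>l. f ` piece M l \<subseteq> piece inv_module (l + d)) \<longleftrightarrow>
    (\<forall>l x. x \<in> piece M l \<longrightarrow> l \<noteq> - int CARD('n) - d \<longrightarrow> residue (f x) = 0)"
proof (intro iffI allI impI)
  fix l x assume h: "\<forall>l. f ` piece M l \<subseteq> piece inv_module (l + d)" and x: "x \<in> piece M l" and l: "l \<noteq> - int CARD('n) - d"
  then have "f x \<in> piece inv_module (l + d)" by blast
  then have "residue (inv_mult (pmonom 0) (f x)) = 0"
    using l by (auto simp: inv_piece_iff dest!: spec[of _ 0])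
  then show "residue (f x) = 0" using inv_mult_1[OF rhom_closed[OF f], of x] by simp
next
  fix l assume h: "\<forall>l x. x \<in> piece M l \<longrightarrow> l \<noteq> - int CARD('n) - d \<longrightarrow> residue (f x) = 0"
  show "f ` piece M l \<subseteq> piece inv_module (l + d)"
  proof
    fix y assume "y \<in> f ` piece M l"
    then obtain x where x: "x \<in> piece M l" "y = f x" by blast
    have "residue (inv_mult (pmonom a) y) = 0" if "- int CARD('n) - int (total a) \<noteq> l + d" for a
    proof -
      have "residue (f (mact M (dmult (pmonom a)) x)) = 0"
        using h monom_piece[OF x(1), of a] that by (auto simp: algebra_simps)
      then show ?thesis by (simp only: rhom_mult[OF f piece_car[OF x(1)]] x(2))
    qed
    then show "y \<in> piece inv_module (l + d)"
      unfolding inv_piece_iff by (simp add: x(2) rhom_closed[OF f])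
  qed
qed

text \<open>\<open>N\<close> and \<open>N'\<close> are kept abstract so that graded
  \<open>R\<close>-linear and graded \<D>-linear maps are treated at once.\<close>

lemma star_hom_residue:
  assumes f: "f \<in> star_hom N N'" and
    g: "\<And>d. grhom d N N' \<subseteq> {f \<in> rhom. \<forall>l. f ` piece M l \<subseteq> piece inv_module (l + d)}"
  shows "f \<in> rhom" "residue \<circ> f \<in> gdual"
proof -
  obtain h where h: "\<And>d. h d \<in> grhom d N N'" "finite {d. h d \<noteq> 0}" "f = (\<Sum>d | h d \<noteq> 0. h d)"
    using f unfolding star_hom_def by blast
  have hr: "h d \<in> rhom" for d using h(1) g by blast
  let ?A = "{d. h d \<noteq> 0}"
  have ap: "f x = (\<Sum>d\<in>?A. h d x)" for x
  proof -
    have "(\<Sum>d\<in>B. h d) x = (\<Sum>d\<in>B. h d x)" for B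
      by (induction B rule: infinite_finite_induct) auto
    then show ?thesis unfolding h(3) .
  qed
  have ms: "inv_mult p (sum k B) = (\<Sum>d\<in>B. inv_mult p (k d))" for p k and B :: "int set"
    by (induction B rule: infinite_finite_induct) (auto simp: inv_mult_add2)
  show fr: "f \<in> rhom"
    unfolding rhom_def ap
    using hr by (auto intro!: inv_carrier_sum simp: rhom_closed rhom_add rhom_mult rhom_out sum.distrib ms)
  have "residue \<circ> f \<in> linear_functionals (mcar M) (\<lambda>c. mact M (dconst c))"
    by (auto simp: linear_functionals_def rhom_add[OF fr] residue_add rhom_mult[OF fr] residue_scalar rhom_out[OF fr])
  moreover have "(residue \<circ> f) (mod_proj M l x) = 0"
    if x: "x \<in> mcar M" and l: "l \<notin> (\<lambda>d. - int CARD('n) - d) ` ?A" for x l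
  proof -
    have "residue (h d (mod_proj M l x)) = 0" if d: "d \<in> ?A" for d
    proof -
      have "\<forall>l x. x \<in> piece M l \<longrightarrow> l \<noteq> - int CARD('n) - d \<longrightarrow> residue (h d x) = 0"
        using h(1)[of d] g[of d] rhom_piece[OF hr, of d d] by blast
      then show ?thesis using proj_piece[OF x] l d by blast
    qed
    then show ?thesis by (simp add: ap residue_sum)
  qed
  ultimately show "residue \<circ> f \<in> gdual"
    using h(2) unfolding graded_dual_def by blast
qed

text \<open>The functional is split into its finitely many homogeneous parts, and each is turned
  back into a map. The third premise of \<open>hom\<close> describes the residues of such a part on
  derivatives through \<open>f\<close>; \<D>-linearity of the parts is derived from it.\<close>

lemma residue_star_hom:
  assumes f: "f \<in> rhom" "residue \<circ> f \<in> gdual"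
    and hom: "\<And>d k. k \<in> rhom \<Longrightarrow> (\<forall>l. k ` piece M l \<subseteq> piece inv_module (l + d)) \<Longrightarrow>
      (\<And>i x. x \<in> mcar M \<Longrightarrow> residue (k (mact M (dpart i) x)) = (residue \<circ> f) (mod_proj M (- int CARD('n) - d) (mact M (dpart i) x))) \<Longrightarrow>
      k \<in> grhom d N N'"
    and zero: "\<And>d. 0 \<in> grhom d N N'"
  shows "f \<in> star_hom N N'"
proof -
  let ?n = "- int CARD('n)" and ?f = "residue \<circ> f"
  have fl: "?f \<in> linear_functionals (mcar M) (\<lambda>c. mact M (dconst c))" using f(2) by (simp add: graded_dual_def)
  obtain S where S: "finite S" "\<And>x l. x \<in> mcar M \<Longrightarrow> l \<notin> S \<Longrightarrow> ?f (mod_proj M l x) = 0"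
    using f(2) unfolding graded_dual_def by blast
  define \<phi> where "\<phi> l = (\<lambda>x. if x \<in> mcar M then ?f (\<Sum>l'\<in>{l}. mod_proj M l' x) else 0)" for l
  have \<phi>: "\<phi> l \<in> gdual" for l unfolding \<phi>_def by (rule C.graded_dual_truncate[OF fl]) simp
  define k where "k d = unresidue (\<phi> (?n - d))" for d
  have kr: "k d \<in> rhom" for d unfolding k_def by (rule unresidue_rhom[OF \<phi>])
  have rk: "residue (k d x) = \<phi> (?n - d) x" for d x
    using residue_unresidue_1[OF \<phi>] unfolding k_def by (metis comp_apply)
  have kg: "k d \<in> grhom d N N'" for d
  proof (rule hom[OF kr])
    show "\<forall>l. k d ` piece M l \<subseteq> piece inv_module (l + d)"
      unfolding rhom_piece[OF kr]
      by (auto simp: rk \<phi>_def proj_of_piece C.functional_0[OF fl, unfolded comp_def])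
  qed (simp add: rk \<phi>_def act_closed)
  let ?A = "(\<lambda>l. ?n - l) ` S"
  have ap: "(\<Sum>d\<in>B. k d) x = (\<Sum>d\<in>B. k d x)" for B x
    by (induction B rule: infinite_finite_induct) auto
  have ms: "inv_mult p (sum e B) = (\<Sum>d\<in>B. inv_mult p (e d))" for p e and B :: "int set"
    by (induction B rule: infinite_finite_induct) (auto simp: inv_mult_add2)
  have "f = (\<Sum>d\<in>?A. k d)"
  proof (rule rhom_eqI[OF f(1)])
    show "(\<Sum>d\<in>?A. k d) \<in> rhom"
      unfolding rhom_def mem_Collect_eq ap
      using kr by (auto intro!: inv_carrier_sum simp: rhom_closed rhom_add rhom_mult rhom_out sum.distrib ms)
    fix x assume x: "x \<in> mcar M"
    have "residue (f x) = ?f (\<Sum>l\<in>S. mod_proj M l x)"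
      using C.graded_dual_supported[OF fl S x] by simp
    also have "\<dots> = (\<Sum>l\<in>S. ?f (mod_proj M l x))"
      by (rule C.functional_sum[OF fl C.pr_closed[OF x]])
    also have "\<dots> = (\<Sum>d\<in>?A. residue (k d x))"
      by (subst sum.reindex) (auto simp: inj_on_def rk \<phi>_def x)
    finally show "residue (f x) = residue ((\<Sum>d\<in>?A. k d) x)" by (simp add: ap residue_sum)
  qed
  moreover have "(\<Sum>d\<in>?A. k d) \<in> star_hom N N'"
    by (rule grhom_sum_in_star_hom) (use S(1) kg zero in simp_all)
  ultimately show ?thesis by (simp only:)
qed

lemma zero_rhom: "0 \<in> rhom"
  by (simp add: rhom_def inv_carrier_0)

lemma zero_piece: "0 \<in> piece inv_module l"
  using inv_piece_add_subgroup[unfolded add_subgroup_def] by blast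

lemma star_hom_R: "star_hom (restrict_scalars dmult M) (restrict_scalars dmult inv_module) =
    {f \<in> rhom. residue \<circ> f \<in> gdual}" (is "?L = ?R")
proof -
  have gr: "grhom d (restrict_scalars dmult M) (restrict_scalars dmult inv_module) =
      {f \<in> rhom. \<forall>l. f ` piece M l \<subseteq> piece inv_module (l + d)}" for d
    unfolding grhom_def lhom_R by (simp add: restrict_scalars_def)
  have "f \<in> ?L" if "f \<in> rhom" "residue \<circ> f \<in> gdual" for f
    by (rule residue_star_hom[OF that]) (auto simp: gr zero_rhom zero_piece)
  then show ?thesis using star_hom_residue[of _ "restrict_scalars dmult M" "restrict_scalars dmult inv_module"] gr by blast
qed

lemma star_hom_D: "star_hom M inv_module = {f \<in> lhom M inv_module. residue \<circ> f \<in> gdual}" (is "?L = ?R")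
proof -
  have gr: "grhom d M inv_module =
      {f \<in> lhom M inv_module. \<forall>l. f ` piece M l \<subseteq> piece inv_module (l + d)}" for d
    unfolding grhom_def by simp
  have z: "0 \<in> lhom M inv_module" unfolding lhom_D by (simp add: zero_rhom)
  show ?thesis
  proof (intro equalityI subsetI)
    fix f assume f: "f \<in> ?L"
    have "grhom d M inv_module \<subseteq> {f \<in> rhom. \<forall>l. f ` piece M l \<subseteq> piece inv_module (l + d)}" for d
      unfolding gr lhom_D by blast
    note sr = star_hom_residue[OF f this]
    have "f \<in> lhom M inv_module"
    proof -
      obtain h where h: "\<And>d. h d \<in> grhom d M inv_module" "f = (\<Sum>d | h d \<noteq> 0. h d)"
        using f unfolding star_hom_def by blast
      have "(\<Sum>d\<in>B. h d) x = (\<Sum>d\<in>B. h d x)" for B x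
        by (induction B rule: infinite_finite_induct) auto
      then have "f x = (\<Sum>d | h d \<noteq> 0. h d x)" for x unfolding h(2) .
      moreover have "residue (h d (mact M (dpart i) x)) = 0" if "x \<in> mcar M" for d i x
        using h(1)[of d] that unfolding gr lhom_D by blast
      ultimately show ?thesis unfolding lhom_D using sr(1) by (simp add: residue_sum)
    qed
    with sr(2) show "f \<in> ?R" by blast
  next
    fix f assume "f \<in> ?R"
    then have f: "f \<in> rhom" "residue \<circ> f \<in> gdual" "\<And>i x. x \<in> mcar M \<Longrightarrow> residue (f (mact M (dpart i) x)) = 0"
      unfolding lhom_D by auto
    show "f \<in> ?L"
    proof (rule residue_star_hom[OF f(1,2)])
      fix d k assume k: "k \<in> rhom" "\<forall>l. k ` piece M l \<subseteq> piece inv_module (l + d)"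
        and r: "\<And>i x. x \<in> mcar M \<Longrightarrow> residue (k (mact M (dpart i) x)) =
          (residue \<circ> f) (mod_proj M (- int CARD('n) - d) (mact M (dpart i) x))"
      have "residue (k (mact M (dpart i) x)) = 0" if x: "x \<in> mcar M" for i x
        using proj_act[OF dop_homog.part x, of "- int CARD('n) - d + 1" i] f(3)[OF C.pr_closed[OF x]]
        by (simp add: r[OF x])
      then show "k \<in> grhom d M inv_module" unfolding gr lhom_D using k by blast
    qed (use z zero_piece in \<open>auto simp: gr\<close>)
  qed
qed

end

lemma (in dop_module) form_diff_diff_eq:
  assumes "\<omega> \<in> forms M q" "\<eta> \<in> forms M q"
  shows "form_diff M (\<omega> - \<eta>) = form_diff M \<omega> - form_diff M \<eta>"
  using form_diff_add[OF add_subgroup_diff[OF forms_subgroup assms] assms(2)] by (simp add: eq_diff_eq)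

lemma (in dop_module) forms_zero: "(0 :: 'n set \<Rightarrow> 'm) \<in> forms M q" "form_diff M 0 = 0"
proof -
  show "(0 :: 'n set \<Rightarrow> 'm) \<in> forms M q" for q by (simp add: forms_def)
  from form_diff_diff_eq[OF this this] show "form_diff M 0 = 0" by simp
qed

lemma (in dop_module) form_scale_forms: "\<omega> \<in> forms M q \<Longrightarrow> form_scale M c \<omega> \<in> forms M q"
  by (auto simp: forms_def form_scale_def act_closed act_0)

lemma add_subgroupI:
  assumes "0 \<in> S" "\<And>x y. x \<in> S \<Longrightarrow> y \<in> S \<Longrightarrow> x - y \<in> S"
  shows "add_subgroup S"
proof -
  have neg: "- x \<in> S" if "x \<in> S" for x using assms(2)[OF assms(1) that] by simp
  have "x + y \<in> S" if "x \<in> S" "y \<in> S" for x y using assms(2)[OF that(1) neg[OF that(2)]] by simp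
  with neg assms(1) show ?thesis by (simp add: add_subgroup_def)
qed

lemma (in dop_module) subquotient_forms:
  "subquotient (form_scale M) {\<omega> \<in> forms M q. form_diff M \<omega> = 0} (form_diff M ` forms M (q - 1))"
  unfolding subquotient_def
proof (intro conjI allI ballI)
  note diff = add_subgroup_diff[OF forms_subgroup]
  show "add_subgroup {\<omega> \<in> forms M q. form_diff M \<omega> = 0}"
    by (rule add_subgroupI) (auto simp: forms_zero form_diff_diff_eq[of _ q] diff)
  show "add_subgroup (form_diff M ` forms M (q - 1))"
  proof (rule add_subgroupI)
    show "0 \<in> form_diff M ` forms M (q - 1)" using forms_zero by (metis image_eqI)
    show "x - y \<in> form_diff M ` forms M (q - 1)"
      if xy: "x \<in> form_diff M ` forms M (q - 1)" "y \<in> form_diff M ` forms M (q - 1)" for x y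
    proof -
      obtain a b where ab: "a \<in> forms M (q - 1)" "b \<in> forms M (q - 1)" "x = form_diff M a" "y = form_diff M b"
        using xy by blast
      then have "x - y = form_diff M (a - b)" by (simp add: form_diff_diff_eq[of _ "q - 1"])
      with ab diff show ?thesis by blast
    qed
  qed
  show "form_diff M ` forms M (q - 1) \<subseteq> {\<omega> \<in> forms M q. form_diff M \<omega> = 0}"
    using form_diff_forms[of _ "q - 1"] form_diff_diff by auto
  show "form_scale M c x \<in> {\<omega> \<in> forms M q. form_diff M \<omega> = 0}"
    if "x \<in> {\<omega> \<in> forms M q. form_diff M \<omega> = 0}" for c x
    using that by (auto simp: form_scale_forms form_diff_scale[of _ q]) (auto simp: form_scale_def act_0)
  show "form_scale M c x \<in> form_diff M ` forms M (q - 1)" if x: "x \<in> form_diff M ` forms M (q - 1)" for c x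
  proof -
    obtain a where a: "a \<in> forms M (q - 1)" "x = form_diff M a" using x by blast
    then have "form_scale M c x = form_diff M (form_scale M c a)" by (simp add: form_diff_scale)
    with a form_scale_forms show ?thesis by blast
  qed
  show "form_scale M c (x + y) = form_scale M c x + form_scale M c y"
    if "x \<in> {\<omega> \<in> forms M q. form_diff M \<omega> = 0}" "y \<in> {\<omega> \<in> forms M q. form_diff M \<omega> = 0}" for c x y
    using that by (auto simp: form_scale_def act_add forms_car)
qed

lemma H_dR_eq: "H_dR M q = quotient_space (form_scale M) {\<omega> \<in> forms M q. form_diff M \<omega> = 0} (form_diff M ` forms M (q - 1))"
proof -
  have "form_scale M = (\<lambda>c \<omega> J. mact M (dconst c) (\<omega> J))" by (auto simp: form_scale_def fun_eq_iff)
  then show ?thesis by (simp add: H_dR_def cohomology_def)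
qed

section \<open>The de Rham complex of the Matlis dual\<close>

definition cochains :: "(('n, 'k::field) dop, 'm::ab_group_add) grmod \<Rightarrow> int \<Rightarrow> (('n set \<Rightarrow> 'm) \<Rightarrow> 'k) set" where
  "cochains M q = graded_dual (forms M q) (form_scale M) (form_proj M)"

text \<open>The transpose of the differential on \<open>q\<close>-forms. It takes
  \<open>cochains M (q + 1)\<close> to \<open>cochains M q\<close>, so the index is that of the
  result.\<close>

definition codiff :: "(('n::{finite,linorder}, 'k::field_char_0) dop, 'm::ab_group_add) grmod \<Rightarrow> int \<Rightarrow>
    (('n set \<Rightarrow> 'm) \<Rightarrow> 'k) \<Rightarrow> ('n set \<Rightarrow> 'm) \<Rightarrow> 'k" where
  "codiff M q \<phi> = (\<lambda>\<eta>. if \<eta> \<in> forms M q then \<phi> (form_diff M \<eta>) else 0)"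

lemma codiff_lin: "codiff M q (\<phi> - \<psi>) = codiff M q \<phi> - codiff M q \<psi>"
  "codiff M q (fscale c \<phi>) = fscale c (codiff M q \<phi>)"
  by (auto simp: codiff_def fscale_def)

lemma graded_dual_precompose:
  assumes V: "graded_space V s pr" and V': "graded_space V' s' pr'"
    and g: "\<And>x. x \<in> V \<Longrightarrow> g x \<in> V'" "\<And>x y. x \<in> V \<Longrightarrow> y \<in> V \<Longrightarrow> g (x + y) = g x + g y"
      "\<And>c x. x \<in> V \<Longrightarrow> g (s c x) = s' c (g x)" "\<And>l x. x \<in> V \<Longrightarrow> pr' l (g x) = g (pr l x)"
    and f: "f \<in> graded_dual V' s' pr'"
  shows "(\<lambda>x. if x \<in> V then f (g x) else 0) \<in> graded_dual V s pr"
proof -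
  interpret A: graded_space V s pr by fact
  interpret B: graded_space V' s' pr' by fact
  have fl: "f \<in> linear_functionals V' s'" using f by (simp add: graded_dual_def)
  obtain S where S: "finite S" "\<And>x l. x \<in> V' \<Longrightarrow> l \<notin> S \<Longrightarrow> f (pr' l x) = 0"
    using f unfolding graded_dual_def by blast
  have "(\<lambda>x. if x \<in> V then f (g x) else 0) \<in> linear_functionals V s"
    unfolding linear_functionals_def
    by (auto simp: A.Vadd A.s_closed g(2,3) B.functional_add[OF fl] B.functional_scale[OF fl] g(1))
  moreover have "\<forall>x\<in>V. \<forall>l. l \<notin> S \<longrightarrow> (if pr l x \<in> V then f (g (pr l x)) else 0) = 0"
    using S(2) g(1,4) by (metis A.pr_closed)
  ultimately show ?thesis using S(1) unfolding graded_dual_def by blast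
qed

context gr_dmodule
begin

interpretation C: graded_space "mcar M" "\<lambda>c. mact M (dconst c)" "mod_proj M"
  by (rule graded_space_car)

interpretation F: graded_space "forms M q" "form_scale M" "form_proj M" for q
  by (rule graded_space_forms)

lemma subspace_cochains: "subspace_fun (cochains M q)"
  unfolding cochains_def by (rule F.subspace_graded_dual)

lemma cochains_functional: "\<phi> \<in> cochains M q \<Longrightarrow> \<phi> \<in> linear_functionals (forms M q) (form_scale M)"
  by (simp add: cochains_def graded_dual_def)

lemma codiff_cochains:
  assumes "\<phi> \<in> cochains M (q + 1)"
  shows "codiff M q \<phi> \<in> cochains M q"
  using assms unfolding codiff_def cochains_def
  by (intro graded_dual_precompose[OF graded_space_forms graded_space_forms])
    (rule form_diff_forms form_diff_add form_diff_scale form_diff_proj; assumption)+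

lemma codiff_codiff:
  assumes "\<phi> \<in> cochains M (q + 1 + 1)"
  shows "codiff M q (codiff M (q + 1) \<phi>) = 0"
  using F.functional_0[OF cochains_functional[OF assms]]
  by (auto simp: codiff_def form_diff_diff[of _ q] fun_eq_iff)

lemma matlis_left: "left_module (matlis_dual M)"
  by (rule matlis_dual_simps[OF graded])

lemma matlis_car: "mcar (matlis_dual M) = {f \<in> rhom. residue \<circ> f \<in> gdual}"
  unfolding matlis_dual_simps(2)[OF graded] star_hom_R ..

lemma matlis_part:
  assumes f: "f \<in> mcar (matlis_dual M)" and x: "x \<in> mcar M"
  shows "residue (mact (matlis_dual M) (dpart s) f x) = - residue (f (mact M (dpart s) x))"
proof -
  have "f \<in> rhom" using f by (simp add: matlis_car)
  then have "mact inv_module (dpart s) (f x) = inv_diff s (f x)" by (simp add: inv_module_simps rhom_closed)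
  then show ?thesis
    using matlis_dual_simps(5)[OF graded f[unfolded matlis_dual_simps(2)[OF graded]], of s] x
    by (simp add: residue_diff residue_inv_diff)
qed

lemma matlis_scalar:
  assumes f: "f \<in> mcar (matlis_dual M)"
  shows "residue (mact (matlis_dual M) (dconst c) f x) = c * residue (f x)"
proof -
  have "f \<in> rhom" using f by (simp add: matlis_car)
  then have "mact inv_module (dconst c) (f x) = inv_mult (pconst c) (f x)" by (simp add: inv_module_simps rhom_closed)
  then show ?thesis
    using matlis_dual_simps(4)[OF graded f[unfolded matlis_dual_simps(2)[OF graded]], of "pconst c"]
    by (simp add: residue_scalar restrict_scalars_def)
qed

definition pos_sign :: "'n \<Rightarrow> 'k" where
  "pos_sign s = (if even (card {j. j < s}) then 1 else - 1)"

text \<open>Chosen to make \<open>pairing\<close> a chain map: removing \<open>s\<close> from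
  \<open>K\<close> has to trade the sign of \<open>s\<close> relative to \<open>K\<close> for the
  one relative to the complement, up to the minus sign of integration by parts, as in
  \<open>set_sign_esgn\<close>.\<close>

definition set_sign :: "'n set \<Rightarrow> 'k" where
  "set_sign J = (\<Prod>s\<in>J. - pos_sign s)"

lemma set_sign_sq: "set_sign J * set_sign J = 1"
  unfolding set_sign_def prod.distrib[symmetric] by (rule prod.neutral) (simp add: pos_sign_def)

text \<open>The indices below \<open>s\<close> lie either in \<open>K\<close> or in its complement,
  so the two signs multiply to one that depends on \<open>s\<close> alone.\<close>

lemma esgn_complement: "esgn s K (esgn s (- K) x) = pos_sign s * (x :: 'k)"
proof -
  have "{j. j < s} = {j \<in> K. j < s} \<union> {j \<in> - K. j < s}" by auto
  then have "card {j. j < s} = card {j \<in> K. j < s} + card {j \<in> - K. j < s}"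
    by (metis (no_types, lifting) card_Un_disjoint finite disjoint_iff mem_Collect_eq Compl_iff)
  then show ?thesis by (auto simp: esgn_def pos_sign_def)
qed

lemma mult_esgn: "esgn s K (c * x) = c * esgn s K (x :: 'k)"
  by (simp add: esgn_def)

lemma set_sign_esgn:
  assumes "s \<in> K"
  shows "- (set_sign K * esgn s K x) = set_sign (K - {s}) * esgn s (- (K - {s})) x"
proof -
  have "set_sign K = - pos_sign s * set_sign (K - {s})"
    unfolding set_sign_def by (rule prod.remove) (use assms in auto)
  moreover have "- (K - {s}) = insert s (- K)" using assms by auto
  moreover have "pos_sign s * esgn s K x = esgn s (- K) x"
    using arg_cong[OF esgn_complement[of s K x], of "esgn s K"] by (simp add: mult_esgn)
  ultimately show ?thesis by (simp add: esgn_insert_self)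
qed

text \<open>Up to signs, the residue of the wedge product of a form with values in the dual and a
  form with values in \<open>M\<close>; only complementary index sets reach the top degree.\<close>

definition pairing :: "int \<Rightarrow> ('n set \<Rightarrow> 'm \<Rightarrow> ('n, 'k) inv_poly) \<Rightarrow> ('n set \<Rightarrow> 'm) \<Rightarrow> 'k" where
  "pairing q \<omega> = (\<lambda>\<eta>. if \<eta> \<in> forms M q then (\<Sum>J\<in>UNIV. set_sign J * residue (\<omega> J (\<eta> (- J)))) else 0)"

lemma residue_esgn: "residue (esgn s K e) = esgn s K (residue e)"
  by (simp add: esgn_def residue_neg)

lemma fun_esgn: "esgn s K f x = esgn s K (f x :: 'x::ab_group_add)"
  by (simp add: esgn_def)

lemma fun_sum: "(\<Sum>i\<in>A. f i) x = (\<Sum>i\<in>A. f i x :: 'x::ab_group_add)"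
  by (induction A rule: infinite_finite_induct) auto

lemma pairing_cochains:
  assumes w: "\<omega> \<in> forms (matlis_dual M) i"
  shows "pairing q \<omega> \<in> cochains M q"
proof -
  have m: "\<omega> J \<in> rhom" "residue \<circ> \<omega> J \<in> gdual" for J
    using w by (auto simp: forms_def matlis_car)
  have "\<exists>S. finite S \<and> (\<forall>l x. x \<in> mcar M \<longrightarrow> l \<notin> S \<longrightarrow> residue (\<omega> J (mod_proj M l x)) = 0)" for J
    using m(2)[of J] unfolding graded_dual_def by auto
  then obtain S where S: "\<And>J. finite (S J)" "\<And>J l x. x \<in> mcar M \<Longrightarrow> l \<notin> S J \<Longrightarrow> residue (\<omega> J (mod_proj M l x)) = 0"
    by metis
  have "pairing q \<omega> \<in> linear_functionals (forms M q) (form_scale M)"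
    using F.Vadd[of _ q] by (auto simp: linear_functionals_def pairing_def rhom_add[OF m(1)] forms_car[of _ q]
        residue_add sum.distrib algebra_simps form_scale_forms[unfolded form_scale_def] form_scale_def rhom_mult[OF m(1)]
        residue_scalar sum_distrib_left)
  moreover have "\<forall>\<eta>\<in>forms M q. \<forall>l. l \<notin> (\<Union>J. (\<lambda>l. l + int (card (- J))) ` S J) \<longrightarrow> pairing q \<omega> (form_proj M l \<eta>) = 0"
  proof (intro ballI allI impI)
    fix \<eta> :: "'n set \<Rightarrow> 'm" and l assume e: "\<eta> \<in> forms M q" and l: "l \<notin> (\<Union>J. (\<lambda>l. l + int (card (- J))) ` S J)"
    have "residue (\<omega> J (form_proj M l \<eta> (- J))) = 0" for J
    proof -
      have "l - int (card (- J)) \<notin> S J" using l by (metis (no_types, lifting) UN_iff UNIV_I diff_add_cancel image_eqI)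
      then show ?thesis unfolding form_proj_def by (rule S(2)[OF forms_car[OF e]])
    qed
    then show "pairing q \<omega> (form_proj M l \<eta>) = 0" by (simp add: pairing_def)
  qed
  ultimately show ?thesis
    unfolding cochains_def graded_dual_def using S(1) by (intro CollectI conjI exI[of _ "\<Union>J. (\<lambda>l. l + int (card (- J))) ` S J"]) auto
qed

text \<open>Integration by parts moves each \<partial>_s to the other factor. Terms are matched by
  sending \<open>(K, s)\<close> with \<open>s \<in> K\<close> to
  \<open>(K - {s}, s)\<close>.\<close>

lemma pairing_form_diff:
  assumes w: "\<omega> \<in> forms (matlis_dual M) i"
  shows "pairing q (form_diff (matlis_dual M) \<omega>) = codiff M q (pairing (q + 1) \<omega>)"
proof
  fix \<eta> :: "'n set \<Rightarrow> 'm"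
  interpret N: dop_module "matlis_dual M" by unfold_locales (rule matlis_left)
  show "pairing q (form_diff (matlis_dual M) \<omega>) \<eta> = codiff M q (pairing (q + 1) \<omega>) \<eta>"
  proof (cases "\<eta> \<in> forms M q")
    case e: True
    have m: "\<omega> J \<in> rhom" "\<omega> J \<in> mcar (matlis_dual M)" for J
      using w by (auto simp: forms_def matlis_car)
    let ?r = "\<lambda>J s K. residue (\<omega> J (mact M (dpart s) (\<eta> K)))"
    have rs: "residue (\<omega> J (sum f A)) = (\<Sum>i\<in>A. residue (\<omega> J (f i)))" if "\<And>i. f i \<in> mcar M" for J f and A :: "'n set"
    proof -
      have "\<omega> J 0 = 0" using rhom_add[OF m(1) car_0 car_0, of J] by simp
      then show ?thesis using that
        by (induction A rule: infinite_finite_induct) (simp_all add: rhom_add[OF m(1)] car_sum residue_add)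
    qed
    have re: "residue (\<omega> J (esgn s K x)) = esgn s K (residue (\<omega> J x))" if x: "x \<in> mcar M" for J s K x
    proof -
      have "\<omega> J 0 = 0" using rhom_add[OF m(1) car_0 car_0, of J] by simp
      then have "\<omega> J (- x) = - \<omega> J x" using rhom_add[OF m(1) x car_neg[OF x], of J]
        by (simp add: eq_neg_iff_add_eq_0 add.commute)
      then show ?thesis by (simp add: esgn_def residue_neg)
    qed
    have "pairing q (form_diff (matlis_dual M) \<omega>) \<eta> =
        (\<Sum>K\<in>UNIV. \<Sum>s\<in>K. - (set_sign K * esgn s K (?r (K - {s}) s (- K))))"
      using e by (simp add: pairing_def form_diff_esgn fun_sum fun_esgn residue_sum residue_esgn
          matlis_part[OF m(2) forms_car[OF e]] esgn_neg sum_distrib_left)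
    also have "\<dots> = (\<Sum>(K, s)\<in>(SIGMA K:UNIV. K). - (set_sign K * esgn s K (?r (K - {s}) s (- K))))"
      by (rule sum.Sigma) auto
    also have "\<dots> = (\<Sum>(J, s)\<in>(SIGMA J:UNIV. - J). set_sign J * esgn s (- J) (?r J s (- J - {s})))"
    proof (rule sum.reindex_bij_witness[of _ "\<lambda>(J, s). (insert s J, s)" "\<lambda>(K, s). (K - {s}, s)"])
      fix p :: "'n set \<times> 'n" assume "p \<in> (SIGMA K:UNIV. K)"
      then obtain K s where p: "p = (K, s)" "s \<in> K" by auto
      then have "- (K - {s}) - {s} = - K" by auto
      then show "(case case p of (K, s) \<Rightarrow> (K - {s}, s) of (J, s) \<Rightarrow> set_sign J * esgn s (- J) (?r J s (- J - {s}))) =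
          (case p of (K, s) \<Rightarrow> - (set_sign K * esgn s K (?r (K - {s}) s (- K))))"
        unfolding p(1) prod.case set_sign_esgn[OF p(2)] by (simp only:)
    qed auto
    also have "\<dots> = (\<Sum>J\<in>UNIV. \<Sum>s\<in>- J. set_sign J * esgn s (- J) (?r J s (- J - {s})))"
      by (rule sum.Sigma[symmetric]) auto
    also have "\<dots> = codiff M q (pairing (q + 1) \<omega>) \<eta>"
      using e form_diff_forms[OF e]
      by (simp only: codiff_def pairing_def if_True form_diff_esgn[of M \<eta>] rs re esgn_car act_closed forms_car[OF e]
          sum_distrib_left)
    finally show ?thesis .
  qed (simp add: pairing_def codiff_def)
qed

lemma single_form: "x \<in> mcar M \<Longrightarrow> (\<lambda>J. if J = K then x else 0) \<in> forms M (int (card K))"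
  by (simp add: forms_def)

lemma pairing_single:
  assumes w: "\<omega> \<in> forms (matlis_dual M) i" and x: "x \<in> mcar M"
  shows "pairing (int (card (- J))) \<omega> (\<lambda>K. if K = - J then x else 0) = set_sign J * residue (\<omega> J x)"
proof -
  have m: "\<omega> J \<in> rhom" for J using w by (auto simp: forms_def matlis_car)
  have w0: "\<omega> K 0 = 0" for K using rhom_add[OF m car_0 car_0, of K] by simp
  have t: "set_sign K * residue (\<omega> K (if - K = - J then x else 0)) =
      (if K = J then set_sign J * residue (\<omega> J x) else 0)" for K
    by (simp add: w0)
  show ?thesis
    unfolding pairing_def if_P[OF single_form[OF x, of "- J"]] t by simp
qed

lemma pairing_inject:
  assumes w: "\<omega> \<in> forms (matlis_dual M) i" "\<omega>' \<in> forms (matlis_dual M) i"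
    and p: "pairing (int CARD('n) - i) \<omega> = pairing (int CARD('n) - i) \<omega>'"
  shows "\<omega> = \<omega>'"
proof
  fix J
  have m: "\<omega> J \<in> rhom" "\<omega>' J \<in> rhom" using w by (auto simp: forms_def matlis_car)
  show "\<omega> J = \<omega>' J"
  proof (cases "int (card J) = i")
    case True
    have c: "int (card (- J)) = int CARD('n) - i"
      using True card_mono[of UNIV J] unfolding Compl_eq_Diff_UNIV by (simp add: card_Diff_subset)
    show ?thesis
    proof (rule rhom_eqI[OF m])
      fix x assume x: "x \<in> mcar M"
      have "set_sign J * (set_sign J * residue (\<omega> J x)) = set_sign J * (set_sign J * residue (\<omega>' J x))"
        using pairing_single[OF w(1) x, of J] pairing_single[OF w(2) x, of J] p c by simp
      then show "residue (\<omega> J x) = residue (\<omega>' J x)" by (simp add: mult.assoc[symmetric] set_sign_sq)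
    qed
  next
    case False
    then show ?thesis using w by (simp add: forms_def)
  qed
qed

text \<open>The coefficient \<open>\<omega> J\<close> is recovered from the values of
  \<open>\<phi>\<close> on forms with a single coefficient, placed at the complement of
  \<open>J\<close>. Multiplying by \<open>set_sign J\<close> undoes the sign in the pairing, since
  this sign is its own inverse.\<close>

lemma pairing_surj:
  assumes f: "\<phi> \<in> cochains M (int CARD('n) - i)"
  shows "\<exists>\<omega>\<in>forms (matlis_dual M) i. pairing (int CARD('n) - i) \<omega> = \<phi>"
proof -
  let ?q = "int CARD('n) - i"
  note fl = cochains_functional[OF f]
  let ?s = "\<lambda>J x K. if K = - J then x else 0"
  have c: "int (card (- J)) = ?q \<longleftrightarrow> int (card J) = i" for J :: "'n set"
    using card_mono[of UNIV J] unfolding Compl_eq_Diff_UNIV by (auto simp: card_Diff_subset of_nat_diff)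
  define \<psi> where "\<psi> J = (\<lambda>x. if x \<in> mcar M then \<phi> (?s J x) else 0)" for J
  have \<psi>: "\<psi> J \<in> gdual" if J: "int (card J) = i" for J
  proof -
    have cJ: "int (card (- J)) = ?q" using J c by blast
    have s: "?s J x \<in> forms M ?q" if "x \<in> mcar M" for x using single_form[OF that, of "- J"] cJ by simp
    obtain S where S: "finite S" "\<And>x l. x \<in> forms M ?q \<Longrightarrow> l \<notin> S \<Longrightarrow> \<phi> (form_proj M l x) = 0"
      using f unfolding cochains_def graded_dual_def by blast
    have "\<psi> J \<in> linear_functionals (mcar M) (\<lambda>c. mact M (dconst c))"
      unfolding linear_functionals_def \<psi>_def mem_Collect_eq
    proof (intro conjI ballI allI impI)
      fix x y assume x: "x \<in> mcar M" and y: "y \<in> mcar M"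
      have "?s J (x + y) = ?s J x + ?s J y" by auto
      then show "(if x + y \<in> mcar M then \<phi> (?s J (x + y)) else 0) =
          (if x \<in> mcar M then \<phi> (?s J x) else 0) + (if y \<in> mcar M then \<phi> (?s J y) else 0)"
        using x y F.functional_add[OF fl s[OF x] s[OF y]] by (simp only: car_add if_True)
    next
      fix c x assume x: "x \<in> mcar M"
      have "?s J (mact M (dconst c) x) = form_scale M c (?s J x)" by (auto simp: form_scale_def act_0)
      then show "(if mact M (dconst c) x \<in> mcar M then \<phi> (?s J (mact M (dconst c) x)) else 0) =
          c * (if x \<in> mcar M then \<phi> (?s J x) else 0)"
        using x F.functional_scale[OF fl s[OF x], of c] by (simp only: act_closed if_True)
    qed simp
    moreover have "\<psi> J (mod_proj M l x) = 0" if x: "x \<in> mcar M" and l: "l \<notin> (\<lambda>l. l - ?q) ` S" for l x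
    proof -
      have "l + ?q \<notin> S" using l by (metis add_diff_cancel_right' image_eqI)
      moreover have "?s J (mod_proj M l x) = form_proj M (l + ?q) (?s J x)"
        unfolding form_proj_def using cJ by (auto simp: C.pr_0)
      ultimately show ?thesis using S(2)[OF s[OF x]] by (simp add: \<psi>_def)
    qed
    ultimately show ?thesis using S(1) unfolding graded_dual_def by blast
  qed
  define \<omega> where "\<omega> J = (if int (card J) = i then unresidue (fscale (set_sign J) (\<psi> J)) else 0)" for J
  have u: "fscale (set_sign J) (\<psi> J) \<in> gdual" if "int (card J) = i" for J
    by (rule subspace_fun_scale[OF C.subspace_graded_dual \<psi>[OF that]])
  have z: "0 \<in> mcar (matlis_dual M)"
    using matlis_left unfolding left_module_def add_subgroup_def by blast
  have "\<omega> J \<in> mcar (matlis_dual M)" for J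
    using z unfolding \<omega>_def matlis_car by (simp add: unresidue_rhom[OF u] residue_unresidue_1[OF u] u)
  then have w: "\<omega> \<in> forms (matlis_dual M) i" by (simp add: forms_def \<omega>_def)
  have "pairing ?q \<omega> = \<phi>"
  proof
    fix \<eta> :: "'n set \<Rightarrow> 'm"
    show "pairing ?q \<omega> \<eta> = \<phi> \<eta>"
    proof (cases "\<eta> \<in> forms M ?q")
      case True
      note e = forms_car[OF True]
      have s: "?s J (\<eta> (- J)) \<in> forms M ?q" for J
        using True by (auto simp: forms_def)
      have t: "set_sign J * residue (\<omega> J (\<eta> (- J))) = \<phi> (?s J (\<eta> (- J)))" for J
      proof (cases "int (card J) = i")
        case J: True
        have "residue (\<omega> J (\<eta> (- J))) = fscale (set_sign J) (\<psi> J) (\<eta> (- J))"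
          using J residue_unresidue_1[OF u[OF J]] unfolding \<omega>_def by (simp, metis comp_apply)
        then show ?thesis using e by (simp add: fscale_def \<psi>_def mult.assoc[symmetric] set_sign_sq)
      next
        case False
        then have "\<eta> (- J) = 0" using True c by (simp add: forms_def)
        then have "?s J (\<eta> (- J)) = 0" by auto
        then show ?thesis using False F.functional_0[OF fl] by (simp only: \<omega>_def if_False) simp
      qed
      have "\<eta> = (\<Sum>J\<in>UNIV. ?s J (\<eta> (- J)))"
      proof
        fix K
        have "(\<Sum>J\<in>UNIV. ?s J (\<eta> (- J)) K) = (\<Sum>J\<in>UNIV. if J = - K then \<eta> K else 0)"
          by (intro sum.cong) auto
        then show "\<eta> K = (\<Sum>J\<in>UNIV. ?s J (\<eta> (- J))) K" by (simp add: fun_sum)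
      qed
      then have "\<phi> \<eta> = (\<Sum>J\<in>UNIV. \<phi> (?s J (\<eta> (- J))))"
        using F.functional_sum[OF fl, of UNIV "\<lambda>J. ?s J (\<eta> (- J))"] s by simp
      then show ?thesis using True by (simp add: pairing_def t)
    next
      case False
      then show ?thesis using fl by (simp add: pairing_def linear_functionals_def)
    qed
  qed
  with w show ?thesis by blast
qed

theorem matlis_de_Rham:
  "H_dR (matlis_dual M) i \<cong>\<^sub>k quotient_space fscale
    {\<phi> \<in> cochains M (int CARD('n) - i). codiff M (int CARD('n) - i - 1) \<phi> = 0}
    (codiff M (int CARD('n) - i) ` cochains M (int CARD('n) - i + 1))"
proof -
  let ?q = "int CARD('n) - i" and ?N = "matlis_dual M"
  interpret N: dop_module ?N by unfold_locales (rule matlis_left)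
  have p0: "pairing q 0 = 0" for q by (auto simp: pairing_def)
  have surj: "\<exists>\<omega>\<in>forms ?N (i - 1). pairing (?q + 1) \<omega> = \<phi>" if f: "\<phi> \<in> cochains M (?q + 1)" for \<phi>
  proof -
    have e: "?q + 1 = int CARD('n) - (i - 1)" by simp
    show ?thesis unfolding e by (rule pairing_surj) (use f in \<open>simp add: e\<close>)
  qed
  have cocycle: "form_diff ?N \<omega> = 0 \<longleftrightarrow> codiff M (?q - 1) (pairing ?q \<omega>) = 0" if w: "\<omega> \<in> forms ?N i" for \<omega>
  proof -
    have e: "?q - 1 = int CARD('n) - (i + 1)" by simp
    have pd: "pairing (?q - 1) (form_diff ?N \<omega>) = codiff M (?q - 1) (pairing ?q \<omega>)"
      using pairing_form_diff[OF w, of "?q - 1"] by simp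
    have "pairing (?q - 1) (form_diff ?N \<omega>) = 0 \<longleftrightarrow> form_diff ?N \<omega> = 0"
      using pairing_inject[OF N.form_diff_forms[OF w] N.forms_zero(1)] p0 unfolding e by metis
    then show ?thesis unfolding pd by simp
  qed
  have Q: "subquotient fscale {\<phi> \<in> cochains M ?q. codiff M (?q - 1) \<phi> = 0} (codiff M ?q ` cochains M (?q + 1))"
    using codiff_cochains[of _ ?q] codiff_codiff[of _ "?q - 1"]
    by (intro subquotient_fun subspace_fun_ker subspace_fun_image subspace_cochains codiff_lin) auto
  show ?thesis
    unfolding H_dR_eq
  proof (rule quotient_iso_rel[where R = "\<lambda>\<omega> \<phi>. \<omega> \<in> forms ?N i \<and> \<phi> = pairing ?q \<omega>", OF N.subquotient_forms Q])
    show "\<exists>z'\<in>{\<phi> \<in> cochains M ?q. codiff M (?q - 1) \<phi> = 0}. z \<in> forms ?N i \<and> z' = pairing ?q z"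
      if "z \<in> {\<omega> \<in> forms ?N i. form_diff ?N \<omega> = 0}" for z
      using that pairing_cochains cocycle by auto
    show "\<exists>z\<in>{\<omega> \<in> forms ?N i. form_diff ?N \<omega> = 0}. z \<in> forms ?N i \<and> z' = pairing ?q z"
      if z: "z' \<in> {\<phi> \<in> cochains M ?q. codiff M (?q - 1) \<phi> = 0}" for z'
    proof -
      obtain \<omega> where w: "\<omega> \<in> forms ?N i" "pairing ?q \<omega> = z'" using pairing_surj z by blast
      then show ?thesis using cocycle[OF w(1)] z by blast
    qed
    show "x - y \<in> forms ?N i \<and> x' - y' = pairing ?q (x - y)"
      if "x \<in> forms ?N i \<and> x' = pairing ?q x" "y \<in> forms ?N i \<and> y' = pairing ?q y" for x x' y y'
      using that add_subgroup_diff[OF N.forms_subgroup, of x i y]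
      by (auto simp: pairing_def residue_diff sum_subtractf algebra_simps)
    show "form_scale ?N c x \<in> forms ?N i \<and> fscale c x' = pairing ?q (form_scale ?N c x)"
      if "x \<in> forms ?N i \<and> x' = pairing ?q x" for c x x'
      using that N.form_scale_forms[of x i c]
      by (auto simp: pairing_def fscale_def form_scale_def matlis_scalar N.forms_car[of _ i] sum_distrib_left mult.left_commute)
    show "z \<in> form_diff ?N ` forms ?N (i - 1) \<longleftrightarrow> z' \<in> codiff M ?q ` cochains M (?q + 1)"
      if z: "z \<in> forms ?N i \<and> z' = pairing ?q z" for z z'
    proof
      assume "z \<in> form_diff ?N ` forms ?N (i - 1)"
      then obtain w where "w \<in> forms ?N (i - 1)" "z = form_diff ?N w" by blast
      then show "z' \<in> codiff M ?q ` cochains M (?q + 1)"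
        using z pairing_form_diff[of w "i - 1" ?q] pairing_cochains[of w "i - 1" "?q + 1"] by auto
    next
      assume "z' \<in> codiff M ?q ` cochains M (?q + 1)"
      then obtain w where w: "w \<in> forms ?N (i - 1)" "z' = codiff M ?q (pairing (?q + 1) w)" using surj by blast
      then have "pairing ?q z = pairing ?q (form_diff ?N w)" using z pairing_form_diff[of w "i - 1" ?q] by simp
      moreover have "form_diff ?N w \<in> forms ?N i" using N.form_diff_forms[OF w(1)] by simp
      ultimately have "z = form_diff ?N w" using pairing_inject z by blast
      with w show "z \<in> form_diff ?N ` forms ?N (i - 1)" by blast
    qed
  qed
qed

end

section \<open>Graded free modules\<close>

definition graded_span :: "(int \<Rightarrow> 'm::ab_group_add set) \<Rightarrow> 'm set" where
  "graded_span p = {\<Sum>l\<in>A. c l | A c. finite A \<and> (\<forall>l. c l \<in> p l)}"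

lemma graded_span_piece:
  assumes "\<And>l. add_subgroup (p l)" "x \<in> p l"
  shows "x \<in> graded_span p"
proof -
  have "0 \<in> p i" for i using assms(1)[of i] by (simp add: add_subgroup_def)
  then show ?thesis
    unfolding graded_span_def using assms(2)
    by (intro CollectI exI[of _ "{l}"] exI[of _ "\<lambda>i. if i = l then x else 0"]) simp
qed

lemma graded_span_add:
  assumes p: "\<And>l. add_subgroup (p l)" and x: "x \<in> graded_span p" and y: "y \<in> graded_span p"
  shows "x + y \<in> graded_span p"
proof -
  obtain A c where A: "finite A" "\<And>l. c l \<in> p l" "x = sum c A" using x unfolding graded_span_def by blast
  obtain B d where B: "finite B" "\<And>l. d l \<in> p l" "y = sum d B" using y unfolding graded_span_def by blast
  let ?c = "\<lambda>l. (if l \<in> A then c l else 0) + (if l \<in> B then d l else 0)"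
  have "x = (\<Sum>l\<in>A \<union> B. if l \<in> A then c l else 0)" "y = (\<Sum>l\<in>A \<union> B. if l \<in> B then d l else 0)"
    unfolding A(3) B(3) using A(1) B(1) by (auto intro!: sum.mono_neutral_cong_left)
  then have "x + y = sum ?c (A \<union> B)" by (simp add: sum.distrib)
  moreover have "?c l \<in> p l" for l using p[of l] A(2) B(2) by (auto simp: add_subgroup_def)
  ultimately show ?thesis unfolding graded_span_def using A(1) B(1) by blast
qed

lemma graded_span_sum:
  assumes p: "\<And>l. add_subgroup (p l)" and f: "\<And>i. i \<in> I \<Longrightarrow> f i \<in> graded_span p"
  shows "sum f I \<in> graded_span p"
proof -
  have "0 \<in> p 0" using p[of 0] by (simp add: add_subgroup_def)
  then have "0 \<in> graded_span p" by (rule graded_span_piece[of p, OF p])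
  then show ?thesis using f
    by (induction I rule: infinite_finite_induct) (auto intro: graded_span_add[of p, OF p])
qed

lemma internal_direct_sumI:
  assumes p: "\<And>l. add_subgroup (p l)" "\<And>l. p l \<subseteq> S" and gen: "S \<subseteq> graded_span p"
    and indep: "\<And>A c l. finite A \<Longrightarrow> (\<And>l. c l \<in> p l) \<Longrightarrow> (\<Sum>l\<in>A. c l) = 0 \<Longrightarrow> l \<in> A \<Longrightarrow> c l = 0"
  shows "internal_direct_sum p S"
  unfolding internal_direct_sum_def
proof (intro conjI allI ballI ex_ex1I p)
  fix m assume "m \<in> S"
  then obtain A c where A: "finite A" "\<And>l. c l \<in> p l" "m = sum c A"
    using gen unfolding graded_span_def by blast
  let ?c = "\<lambda>l. if l \<in> A then c l else 0"
  have "{l. ?c l \<noteq> 0} \<subseteq> A" by auto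
  moreover have "(\<Sum>l | ?c l \<noteq> 0. ?c l) = m"
    unfolding A(3) using A(1) by (intro sum.mono_neutral_cong_left) auto
  moreover have "?c l \<in> p l" for l using A(2) p(1)[of l] by (auto simp: add_subgroup_def)
  ultimately show "\<exists>c. (\<forall>l. c l \<in> p l) \<and> finite {l. c l \<noteq> 0} \<and> m = (\<Sum>l | c l \<noteq> 0. c l)"
    using finite_subset[OF _ A(1)] by (intro exI[of _ ?c]) auto
next
  fix m c d
  assume c: "(\<forall>l. c l \<in> p l) \<and> finite {l. c l \<noteq> 0} \<and> m = (\<Sum>l | c l \<noteq> 0. c l)"
    and d: "(\<forall>l. d l \<in> p l) \<and> finite {l. d l \<noteq> 0} \<and> m = (\<Sum>l | d l \<noteq> 0. d l)"
  let ?A = "{l. c l \<noteq> 0} \<union> {l. d l \<noteq> 0}"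
  have A: "finite ?A" using c d by simp
  have "sum c {l. c l \<noteq> 0} = sum c ?A" "sum d {l. d l \<noteq> 0} = sum d ?A"
    by (rule sum.mono_neutral_left[OF A]; blast)+
  then have "sum c ?A = sum d ?A" using c d by simp
  then have "(\<Sum>l\<in>?A. c l - d l) = 0" by (simp add: sum_subtractf)
  moreover have "c l - d l \<in> p l" for l using c d by (intro add_subgroup_diff[OF p(1)]) auto
  ultimately have i: "c l - d l = 0" if "l \<in> ?A" for l
    using indep[OF A, of "\<lambda>l. c l - d l" l] that by blast
  show "c = d"
  proof
    fix l
    show "c l = d l" using i[of l] by (cases "l \<in> ?A") auto
  qed
qed

text \<open>The rules of \<open>dop_homog\<close> do not say that \<open>0\<close> is homogeneous of
  every degree. It is, being \<open>0\<close> times any operator of that degree, and this lemma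
  provides such an operator.\<close>

lemma dop_homog_exists: "\<exists>P :: ('n, 'k::comm_ring_1) dop. dop_homog l P"
proof -
  have "\<exists>P :: ('n, 'k) dop. dop_homog (int m) P" for m
  proof (induction m)
    case 0
    show ?case using dop_homog.const by auto
  next
    case (Suc m)
    then obtain P :: "('n, 'k) dop" where "dop_homog (int m) P" by blast
    from dop_homog.mult[OF dop_homog.var this] show ?case by (auto simp: add.commute)
  qed
  moreover have "\<exists>P :: ('n, 'k) dop. dop_homog (- int m) P" for m
  proof (induction m)
    case 0
    show ?case using dop_homog.const by auto
  next
    case (Suc m)
    then obtain P :: "('n, 'k) dop" where "dop_homog (- int m) P" by blast
    from dop_homog.mult[OF dop_homog.part this] show ?case by (auto simp: algebra_simps)
  qed
  ultimately show ?thesis by (cases l rule: int_cases2) auto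
qed

lemma dop_piece_subgroup: "add_subgroup (dop_piece l :: ('n, 'k::comm_ring_1) dop set)"
proof -
  obtain P :: "('n, 'k) dop" where P: "dop_homog l P" using dop_homog_exists by blast
  have "dconst 0 * P = 0" by (simp add: pconst_0 dmult_0)
  then have "dop_homog l (0 :: ('n, 'k) dop)" using dop_homog.mult[OF dop_homog.const P, of 0] by simp
  moreover have "dop_homog l (- Q)" if Q: "dop_homog l Q" for Q :: "('n, 'k) dop"
  proof -
    have "- Q = dconst (- 1) * Q"
      by (rule dop_eqI) (simp add: uminus_dop.rep_eq times_dop.rep_eq Rep_dmult pconst_def single_uminus)
    then show ?thesis using dop_homog.mult[OF dop_homog.const Q, of "- 1"] by simp
  qed
  ultimately show ?thesis by (simp add: add_subgroup_def dop_piece_def dop_homog.add)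
qed

lemma exponent_decompose:
  assumes "Poly_Mapping.lookup a i \<noteq> (0::nat)"
  shows "Poly_Mapping.single i 1 + (a - Poly_Mapping.single i 1) = a"
  using assms by (intro poly_mapping_eqI) (auto simp: lookup_add lookup_minus lookup_single when_def)

lemma total_add: "total (a + b) = total a + total b"
  by (simp add: lookup_add sum.distrib)

lemma total_single: "total (Poly_Mapping.single i k) = k"
  by (simp add: lookup_single when_def)

lemma total_decompose:
  assumes "Poly_Mapping.lookup a i \<noteq> 0"
  shows "total a = Suc (total (a - Poly_Mapping.single i 1))"
  using arg_cong[OF exponent_decompose[OF assms], of total] unfolding total_add total_single by simp

lemma dmult_monom_homog: "(dmult (pmonom a) :: ('n::finite, 'k::comm_ring_1) dop) \<in> dop_piece (int (total a))"
proof (induction "total a" arbitrary: a)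
  case 0
  then have "a = 0" by (intro poly_mapping_eqI) simp
  then show ?case using dop_homog.const[of 1] by (simp add: dop_piece_def pconst_def)
next
  case (Suc m)
  obtain i where i: "Poly_Mapping.lookup a i \<noteq> 0"
    using Suc.hyps(2) by (metis (no_types, lifting) sum.neutral nat.distinct(1))
  let ?b = "a - Poly_Mapping.single i 1"
  note a = exponent_decompose[OF i] and t = total_decompose[OF i]
  have "dop_homog (int (total ?b)) (dmult (pmonom ?b) :: ('n, 'k) dop)"
    using Suc.hyps(1)[of ?b] Suc.hyps(2) t by (simp add: dop_piece_def)
  from dop_homog.mult[OF dop_homog.var[of i] this]
  have "dop_homog (int (total a)) (dmult (pvar i * pmonom ?b) :: ('n, 'k) dop)" unfolding t by (simp add: dmult_mult)
  also have "pvar i * pmonom ?b = (pmonom a :: ('n, 'k) mpoly)" by (simp add: pvar_def mult_single a[unfolded One_nat_def])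
  finally show ?case by (simp add: dop_piece_def)
qed

lemma dop_piece_mult: "P \<in> dop_piece l \<Longrightarrow> Q \<in> dop_piece l' \<Longrightarrow> P * Q \<in> dop_piece (l + l')"
  by (simp add: dop_piece_def dop_homog.mult)

lemma dmult_single_homog: "dmult (Poly_Mapping.single a c) \<in> dop_piece (int (total a))"
  using dop_piece_mult[of "dconst c" 0 "dmult (pmonom a)"] dmult_monom_homog[of a] dop_homog.const[of c]
  unfolding single_pmonom[of a c] dmult_mult by (simp add: dop_piece_def)

lemma dmult_sum: "dmult (sum f A) = (\<Sum>i\<in>A. dmult (f i))"
  by (induction A rule: infinite_finite_induct) (simp_all add: dmult_0 dmult_add)

lemma dmult_hom_poly: "p \<in> hom_poly j \<Longrightarrow> dmult p \<in> dop_piece (int j)"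
proof -
  assume p: "p \<in> hom_poly j"
  have "dmult p = (\<Sum>a\<in>Poly_Mapping.keys p. dmult (Poly_Mapping.single a (Poly_Mapping.lookup p a)))"
    by (subst mapping_eq_sum) (rule dmult_sum)
  also have "\<dots> \<in> dop_piece (int j)"
  proof (rule add_subgroup_sum[OF dop_piece_subgroup])
    fix a assume "a \<in> Poly_Mapping.keys p"
    then show "dmult (Poly_Mapping.single a (Poly_Mapping.lookup p a)) \<in> dop_piece (int j)"
      using p dmult_single_homog[of a "Poly_Mapping.lookup p a"] by (simp add: hom_poly_def)
  qed
  finally show ?thesis .
qed

lemma dop_graded_span: "(P :: ('n::finite, 'k::comm_ring_1) dop) \<in> graded_span dop_piece"
proof (induction P rule: dop_induct)
  case (mult p)
  have "dmult p = (\<Sum>a\<in>Poly_Mapping.keys p. dmult (Poly_Mapping.single a (Poly_Mapping.lookup p a)))"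
    by (subst mapping_eq_sum) (rule dmult_sum)
  also have "\<dots> \<in> graded_span dop_piece"
    by (rule graded_span_sum[of dop_piece, OF dop_piece_subgroup])
      (rule graded_span_piece[of dop_piece, OF dop_piece_subgroup dmult_single_homog])
  finally show ?case .
next
  case (diff i)
  have "dpart i \<in> dop_piece (- 1)" by (simp add: dop_piece_def dop_homog.part)
  then show ?case by (rule graded_span_piece[of dop_piece, OF dop_piece_subgroup])
next
  case (add P P')
  then show ?case by (rule graded_span_add[of dop_piece, OF dop_piece_subgroup])
next
  case (comp P P')
  obtain A c where A: "\<And>l. c l \<in> dop_piece l" "P = sum c A" using comp unfolding graded_span_def by blast
  obtain B d where B: "\<And>l. d l \<in> dop_piece l" "P' = sum d B" using comp unfolding graded_span_def by blast
  show ?case unfolding A(2) B(2) sum_product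
    by (rule graded_span_sum[of dop_piece, OF dop_piece_subgroup])+
      (rule graded_span_piece[of dop_piece, OF dop_piece_subgroup dop_piece_mult[OF A(1) B(1)]])
qed

text \<open>Indexed by integers, unlike \<open>hom_poly\<close>, since an operator may push the
  degree below zero, where the piece is \<open>{0}\<close>.\<close>

definition poly_piece :: "int \<Rightarrow> ('n::finite, 'k::comm_ring_1) mpoly set" where
  "poly_piece d = {p. \<forall>a\<in>Poly_Mapping.keys p. int (total a) = d}"

lemma poly_piece_add: "p \<in> poly_piece d \<Longrightarrow> q \<in> poly_piece d \<Longrightarrow> p + q \<in> poly_piece d"
  using Poly_Mapping.keys_add[of p q] by (auto simp: poly_piece_def)

lemma poly_piece_0: "0 \<in> poly_piece d"
  by (simp add: poly_piece_def)

lemma poly_piece_sum: "(\<And>i. i \<in> A \<Longrightarrow> f i \<in> poly_piece d) \<Longrightarrow> sum f A \<in> poly_piece d"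
  by (induction A rule: infinite_finite_induct) (auto simp: poly_piece_0 poly_piece_add)

lemma poly_piece_single: "int (total a) = d \<Longrightarrow> Poly_Mapping.single a c \<in> poly_piece d"
  by (simp add: poly_piece_def)

lemma dop_homog_poly_piece: "dop_homog l P \<Longrightarrow> p \<in> poly_piece d \<Longrightarrow> Rep_dop P p \<in> poly_piece (d + l)"
proof (induction l P arbitrary: d p rule: dop_homog.induct)
  case (const c)
  have "pconst c * p = (\<Sum>a\<in>Poly_Mapping.keys p. Poly_Mapping.single a (c * Poly_Mapping.lookup p a))"
    by (subst mapping_eq_sum[of p]) (simp add: sum_distrib_left pconst_def mult_single)
  also have "\<dots> \<in> poly_piece d" using const by (intro poly_piece_sum) (auto simp: poly_piece_def)
  finally show ?case by (simp add: Rep_dmult)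
next
  case (var i)
  have "pvar i * p = (\<Sum>a\<in>Poly_Mapping.keys p. Poly_Mapping.single (Poly_Mapping.single i 1 + a) (Poly_Mapping.lookup p a))"
    by (subst mapping_eq_sum[of p]) (simp add: sum_distrib_left pvar_def mult_single)
  also have "\<dots> \<in> poly_piece (d + 1)" using var
    by (intro poly_piece_sum poly_piece_single) (simp only: total_add total_single, simp add: poly_piece_def)
  finally show ?case by (simp add: Rep_dmult)
next
  case (part i)
  have "Poly_Mapping.single (a - Poly_Mapping.single i 1) (of_nat (Poly_Mapping.lookup a i) * c) \<in> poly_piece (d - 1)"
    if a: "a \<in> Poly_Mapping.keys p" for a and c :: 'b
  proof (cases "Poly_Mapping.lookup a i = 0")
    case False
    have "total a = Suc (total (a - Poly_Mapping.single i 1))" by (rule total_decompose[OF False])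
    moreover have "int (total a) = d" using part a by (auto simp: poly_piece_def)
    ultimately show ?thesis by (intro poly_piece_single) linarith
  qed (simp add: poly_piece_0)
  then show ?case unfolding Rep_dpart pdiff_def by (simp add: poly_piece_sum)
next
  case (add l P Q)
  then show ?case by (simp add: plus_dop.rep_eq poly_piece_add)
next
  case (mult l P l' Q)
  then have "Rep_dop P (Rep_dop Q p) \<in> poly_piece (d + l' + l)" by blast
  then show ?case by (simp add: times_dop.rep_eq algebra_simps)
qed

lemma Rep_dop_sum: "Rep_dop (sum c A) p = (\<Sum>l\<in>A. Rep_dop (c l) p)"
  by (induction A rule: infinite_finite_induct) (simp_all add: zero_dop.rep_eq plus_dop.rep_eq)

lemma Rep_dop_add: "Rep_dop P (p + q) = Rep_dop P p + Rep_dop P q"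
  by (rule diffops_add[OF Rep_dop])

text \<open>Applied to one monomial, operators of different degrees produce monomials of different
  degrees, so each coefficient of the result sees only one summand.\<close>

lemma dop_homog_independent:
  fixes c :: "int \<Rightarrow> ('n::finite, 'k::comm_ring_1) dop"
  assumes A: "finite A" and c: "\<And>l. c l \<in> dop_piece l" and s: "(\<Sum>l\<in>A. c l) = 0" and l: "l \<in> A"
  shows "c l = 0"
proof (rule dop_eqI)
  fix f
  have single: "Rep_dop (c l) (Poly_Mapping.single a x) = 0" for a x
  proof (rule poly_mapping_eqI)
    fix b
    have p: "Rep_dop (c m) (Poly_Mapping.single a x) \<in> poly_piece (int (total a) + m)" for m
      using c[of m] by (intro dop_homog_poly_piece) (auto simp: dop_piece_def poly_piece_def)
    have z: "Poly_Mapping.lookup (Rep_dop (c m) (Poly_Mapping.single a x)) b = 0"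
      if "m \<noteq> int (total b) - int (total a)" for m
    proof -
      have "b \<notin> Poly_Mapping.keys (Rep_dop (c m) (Poly_Mapping.single a x))"
        using p[of m] that unfolding poly_piece_def by auto
      then show ?thesis by (simp add: in_keys_iff)
    qed
    show "Poly_Mapping.lookup (Rep_dop (c l) (Poly_Mapping.single a x)) b = Poly_Mapping.lookup 0 b"
    proof (cases "l = int (total b) - int (total a)")
      case True
      have "(\<Sum>m\<in>A. Rep_dop (c m) (Poly_Mapping.single a x)) = 0"
        unfolding Rep_dop_sum[symmetric] s by (simp add: zero_dop.rep_eq)
      then have "0 = (\<Sum>m\<in>A. Poly_Mapping.lookup (Rep_dop (c m) (Poly_Mapping.single a x)) b)"
        by (metis lookup_sum lookup_zero)
      also have "\<dots> = (\<Sum>m\<in>{l}. Poly_Mapping.lookup (Rep_dop (c m) (Poly_Mapping.single a x)) b)"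
        using A l z True by (intro sum.mono_neutral_right) auto
      finally show ?thesis by simp
    qed (simp add: z)
  qed
  show "Rep_dop (c l) f = Rep_dop 0 f"
    by (induction f rule: mapping_induct) (simp_all add: zero_dop.rep_eq Rep_dop_add single single[of 0 0, simplified])
qed

abbreviation dfree :: "('b \<Rightarrow> int) \<Rightarrow> 'b set \<Rightarrow> (('n, 'k::comm_ring_1) dop, 'b \<Rightarrow>\<^sub>0 ('n, 'k) dop) grmod" where
  "dfree deg B \<equiv> gr_free_module dop_piece deg B"

lemma dfree_simps:
  "mcar (dfree deg B) = {f. Poly_Mapping.keys f \<subseteq> B}"
  "mact (dfree deg B) = free_act"
  "piece (dfree deg B) l = {f. Poly_Mapping.keys f \<subseteq> B \<and> (\<forall>b\<in>Poly_Mapping.keys f. Poly_Mapping.lookup f b \<in> dop_piece (l - deg b))}"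
  by (simp_all add: gr_free_module_def)

lemma dfree_piece: "f \<in> piece (dfree deg B) l \<longleftrightarrow>
    Poly_Mapping.keys f \<subseteq> B \<and> (\<forall>b. Poly_Mapping.lookup f b \<in> dop_piece (l - deg b))"
proof -
  have "0 \<in> dop_piece m" for m using dop_piece_subgroup[of m] unfolding add_subgroup_def by blast
  then have "Poly_Mapping.lookup f b \<in> dop_piece (l - deg b)" if "b \<notin> Poly_Mapping.keys f" for b
    using that by (simp add: in_keys_iff)
  then show ?thesis unfolding dfree_simps by blast
qed

lemma keys_free_act: "Poly_Mapping.keys (free_act a f) \<subseteq> Poly_Mapping.keys f"
  by (auto simp: in_keys_iff lookup_free_act)

lemma free_subgroup: "add_subgroup {f :: 'b \<Rightarrow>\<^sub>0 'a::ab_group_add. Poly_Mapping.keys f \<subseteq> B}"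
proof (rule add_subgroupI)
  fix x y :: "'b \<Rightarrow>\<^sub>0 'a"
  assume "x \<in> {f. Poly_Mapping.keys f \<subseteq> B}" "y \<in> {f. Poly_Mapping.keys f \<subseteq> B}"
  moreover have "Poly_Mapping.keys (x - y) \<subseteq> Poly_Mapping.keys x \<union> Poly_Mapping.keys y"
    by (auto simp: in_keys_iff lookup_minus)
  ultimately show "x - y \<in> {f. Poly_Mapping.keys f \<subseteq> B}" by blast
qed simp

lemma dfree_graded: "graded_dmodule (dfree deg B :: (('n::finite, 'k::field_char_0) dop, 'b \<Rightarrow>\<^sub>0 ('n, 'k) dop) grmod)"
proof -
  let ?F = "dfree deg B :: (('n, 'k) dop, 'b \<Rightarrow>\<^sub>0 ('n, 'k) dop) grmod"
  have left: "left_module ?F"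
    unfolding left_module_def dfree_simps
  proof (intro conjI allI ballI free_subgroup)
    show "free_act a x \<in> {f. Poly_Mapping.keys f \<subseteq> B}" if "x \<in> {f. Poly_Mapping.keys f \<subseteq> B}"
      for a and x :: "'b \<Rightarrow>\<^sub>0 ('n, 'k) dop" using that keys_free_act[of a x] by auto
  qed (simp_all add: free_act_simps)
  have sub: "add_subgroup (piece ?F l)" for l
  proof (rule add_subgroupI)
    have "(0 :: ('n, 'k) dop) \<in> dop_piece m" for m
      using dop_piece_subgroup[of m] unfolding add_subgroup_def by blast
    then show "0 \<in> piece ?F l" unfolding dfree_piece by simp
    fix x y assume xy: "x \<in> piece ?F l" "y \<in> piece ?F l"
    have "x - y \<in> {f. Poly_Mapping.keys f \<subseteq> B}"
      by (rule add_subgroup_diff[OF free_subgroup]) (use xy in \<open>auto simp: dfree_simps\<close>)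
    then show "x - y \<in> piece ?F l"
      using xy unfolding dfree_piece by (auto simp: lookup_minus intro!: add_subgroup_diff[OF dop_piece_subgroup])
  qed
  have ds: "internal_direct_sum (piece ?F) (mcar ?F)"
  proof (rule internal_direct_sumI[OF sub])
    show "piece ?F l \<subseteq> mcar ?F" for l by (auto simp: dfree_simps)
    show "mcar ?F \<subseteq> graded_span (piece ?F)"
    proof
      fix f assume f: "f \<in> mcar ?F"
      have "Poly_Mapping.single b P \<in> graded_span (piece ?F)" if b: "b \<in> B" for b P
      proof -
        obtain A c where A: "\<And>l. c l \<in> dop_piece l" "P = sum c A"
          using dop_graded_span[of P] unfolding graded_span_def by blast
        have "Poly_Mapping.single b (sum c A) = (\<Sum>l\<in>A. Poly_Mapping.single b (c l))"
          by (induction A rule: infinite_finite_induct) (simp_all add: single_add)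
        moreover have "Poly_Mapping.single b (c l) \<in> piece ?F (l + deg b)" for l
          using A(1) b by (auto simp: dfree_simps)
        ultimately show ?thesis unfolding A(2)
          using graded_span_sum[of "piece ?F", OF sub graded_span_piece[of "piece ?F", OF sub],
              of A "\<lambda>l. Poly_Mapping.single b (c l)" "\<lambda>l. l + deg b"] by simp
      qed
      then have "(\<Sum>b\<in>Poly_Mapping.keys f. Poly_Mapping.single b (Poly_Mapping.lookup f b)) \<in> graded_span (piece ?F)"
        using f by (intro graded_span_sum[of "piece ?F", OF sub]) (auto simp: dfree_simps)
      then show "f \<in> graded_span (piece ?F)" by (simp only: mapping_eq_sum[symmetric])
    qed
    show "c l = 0" if A: "finite A" and c: "\<And>l. c l \<in> piece ?F l" and s: "sum c A = 0" and l: "l \<in> A" for A c l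
    proof (rule poly_mapping_eqI)
      fix b
      \<comment> \<open>Shifting by the degree of \<open>b\<close> makes the coordinates at
        \<open>b\<close> a family indexed by the degrees of the operators.\<close>
      let ?d = "\<lambda>m. Poly_Mapping.lookup (c (m + deg b)) b"
      have "(\<Sum>m\<in>(\<lambda>l. l - deg b) ` A. ?d m) = (\<Sum>l\<in>A. Poly_Mapping.lookup (c l) b)"
        by (subst sum.reindex) (auto simp: inj_on_def)
      also have "\<dots> = 0" using s by (metis lookup_sum lookup_zero)
      finally have "?d (l - deg b) = 0"
      proof (rule dop_homog_independent[rotated 2])
        show "?d m \<in> dop_piece m" for m using c[of "m + deg b"] unfolding dfree_piece by (metis add_diff_cancel_right')
      qed (use A l in auto)
      then show "Poly_Mapping.lookup (c l) b = Poly_Mapping.lookup 0 b" by simp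
    qed
  qed
  have act: "mact ?F P m \<in> piece ?F (l + e)" if P: "P \<in> dop_piece e" and m: "m \<in> piece ?F l" for P m e l
  proof -
    have "P * Poly_Mapping.lookup m b \<in> dop_piece (e + (l - deg b))" for b
      using m unfolding dfree_piece by (intro dop_piece_mult P) blast
    then show ?thesis using m keys_free_act[of P m]
      unfolding dfree_piece dfree_simps(2) lookup_free_act by (auto simp: algebra_simps)
  qed
  have "(dpart i :: ('n, 'k) dop) \<in> dop_piece (- 1)" for i by (simp add: dop_piece_def dop_homog.part)
  from act[OF this] show ?thesis
    unfolding graded_dmodule_def using left ds act[OF dmult_hom_poly] by auto
qed

text \<open>A derivation that acts as the formal derivative with respect to \<partial>_t, as
  \<open>var_bracket_dmult\<close> and \<open>var_bracket_dpart\<close> show.\<close>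

definition var_bracket :: "'n \<Rightarrow> ('n, 'k::comm_ring_1) dop \<Rightarrow> ('n, 'k) dop" where
  "var_bracket t P = P * dmult (pvar t) - dmult (pvar t) * P"

lemma var_bracket_0 [simp]: "var_bracket t 0 = 0"
  by (simp add: var_bracket_def)

lemma var_bracket_add: "var_bracket t (P + Q) = var_bracket t P + var_bracket t Q"
  by (simp add: var_bracket_def algebra_simps)

lemma var_bracket_mult: "var_bracket t (P * Q) = var_bracket t P * Q + P * var_bracket t Q"
  by (simp add: var_bracket_def algebra_simps)

lemma dmult_commute: "dmult p * dmult q = dmult q * dmult p"
  by (simp only: dmult_mult[symmetric] mult.commute)

lemma var_bracket_dmult: "var_bracket t (dmult p) = 0"
  using dmult_commute[of p "pvar t"] by (simp add: var_bracket_def)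

lemma var_bracket_dpart: "var_bracket t (dpart s) = (if s = t then 1 else 0)"
  by (simp add: var_bracket_def dpart_dmults pdiff_pvar dmult_1 dmult_0)

lemma var_bracket_commute:
  fixes P :: "('n, 'k::comm_ring_1) dop"
  shows "var_bracket t (var_bracket s P) = var_bracket s (var_bracket t P)"
proof -
  let ?s = "dmult (pvar s) :: ('n, 'k) dop" and ?t = "dmult (pvar t) :: ('n, 'k) dop"
  have st: "P * (?s * ?t) = P * (?t * ?s)" "?s * (?t * P) = ?t * (?s * P)"
    by (simp_all only: mult.assoc[symmetric] dmult_commute[of "pvar s" "pvar t"])
  show ?thesis unfolding var_bracket_def
    by (simp add: left_diff_distrib right_diff_distrib mult.assoc st)
qed

text \<open>Grothendieck's order filtration: \<open>order_weight j\<close> consists of the operators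
  of order less than \<open>j\<close>.\<close>

primrec order_weight :: "nat \<Rightarrow> ('n, 'k::comm_ring_1) dop set" where
  "order_weight 0 = {0}"
| "order_weight (Suc j) = {P. \<forall>t. var_bracket t P \<in> order_weight j}"

lemma order_weight_0: "0 \<in> order_weight j"
  by (induction j) simp_all

lemma order_weight_Suc: "P \<in> order_weight j \<Longrightarrow> P \<in> order_weight (Suc j)"
  by (induction j arbitrary: P) (simp_all add: order_weight_0)

lemma order_weight_mono: "j \<le> j' \<Longrightarrow> P \<in> order_weight j \<Longrightarrow> P \<in> order_weight j'"
  by (induction rule: dec_induct) (blast intro: order_weight_Suc)+

lemma order_weight_add: "P \<in> order_weight j \<Longrightarrow> Q \<in> order_weight j \<Longrightarrow> P + Q \<in> order_weight j"
  by (induction j arbitrary: P Q) (simp_all add: var_bracket_add)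

text \<open>The bracket is a derivation, so bracketing a product lowers the index of one factor in
  each term; hence induction on \<open>i + j\<close>. The bound is not sharp but suffices to reach
  every operator from the generators.\<close>

lemma order_weight_mult: "P \<in> order_weight i \<Longrightarrow> Q \<in> order_weight j \<Longrightarrow> P * Q \<in> order_weight (i + j)"
proof (induction "i + j" arbitrary: i j P Q rule: less_induct)
  case less
  show ?case
  proof (cases i)
    case 0
    then show ?thesis using less.prems by (simp add: order_weight_0)
  next
    case i: (Suc i')
    show ?thesis
    proof (cases j)
      case 0
      then show ?thesis using less.prems by (simp add: order_weight_0)
    next
      case j: (Suc j')
      have "var_bracket t (P * Q) \<in> order_weight (i' + j)" for t
        unfolding var_bracket_mult
      proof (rule order_weight_add)
        show "var_bracket t P * Q \<in> order_weight (i' + j)"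
          using less.prems i by (intro less.hyps) auto
        have "P * var_bracket t Q \<in> order_weight (i + j')"
          using less.prems j by (intro less.hyps) auto
        then show "P * var_bracket t Q \<in> order_weight (i' + j)" using i j by simp
      qed
      then show ?thesis by (simp add: i)
    qed
  qed
qed

lemma order_weight_exists: "\<exists>j. P \<in> order_weight j"
proof (induction P rule: dop_induct)
  case (mult p)
  have "dmult p \<in> order_weight 1" by (simp add: var_bracket_dmult)
  then show ?case by blast
next
  case (diff i)
  have "dpart i \<in> order_weight (Suc (Suc 0))"
    by (simp add: var_bracket_dpart) (simp add: var_bracket_def)
  then show ?case by blast
next
  case (add P P')
  then obtain i j where "P \<in> order_weight i" "P' \<in> order_weight j" by blast
  then have "P + P' \<in> order_weight (max i j)"
    by (intro order_weight_add order_weight_mono[of i "max i j"] order_weight_mono[of j "max i j"]) auto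
  then show ?case by blast
next
  case (comp P P')
  then show ?case using order_weight_mult by blast
qed

definition free_bracket :: "'n \<Rightarrow> ('b \<Rightarrow>\<^sub>0 ('n, 'k::comm_ring_1) dop) \<Rightarrow> ('b \<Rightarrow>\<^sub>0 ('n, 'k) dop)" where
  "free_bracket t f = Poly_Mapping.map (var_bracket t) f"

lemma lookup_free_bracket: "Poly_Mapping.lookup (free_bracket t f) b = var_bracket t (Poly_Mapping.lookup f b)"
  by (simp add: free_bracket_def Poly_Mapping.map.rep_eq when_def)

text \<open>Left multiplication by \<open>x_t\<close> fails to commute with \<partial>_t by one,
  while right multiplication commutes with the whole left action. Their difference is therefore a
  derivative dual to \<partial>_t. Local nilpotency holds because operators have finite
  order.\<close>

lemma dfree_weyl_pair:
  "weyl_pair (dfree deg B :: (('n::{finite,linorder}, 'k::field_char_0) dop, 'b \<Rightarrow>\<^sub>0 ('n, 'k) dop) grmod) free_bracket"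
proof -
  let ?F = "dfree deg B :: (('n, 'k) dop, 'b \<Rightarrow>\<^sub>0 ('n, 'k) dop) grmod"
  interpret gr_dmodule ?F by (rule gr_dmoduleI[OF dfree_graded])
  have dc: "var_bracket t (dconst c) = 0" for t c by (rule var_bracket_dmult)
  have keys: "Poly_Mapping.keys (free_bracket t f) \<subseteq> Poly_Mapping.keys f" for t f
    by (auto simp: in_keys_iff lookup_free_bracket)
  show ?thesis
  proof
    fix m m' t s c assume m: "m \<in> mcar ?F"
    show "free_bracket t m \<in> mcar ?F" using m keys[of t m] by (auto simp: dfree_simps)
    show "free_bracket t (m + m') = free_bracket t m + free_bracket t m'"
      by (rule poly_mapping_eqI) (simp add: lookup_free_bracket lookup_add var_bracket_add)
    show "free_bracket t (mact ?F (dconst c) m) = mact ?F (dconst c) (free_bracket t m)"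
      by (rule poly_mapping_eqI) (simp add: dfree_simps lookup_free_act lookup_free_bracket var_bracket_mult dc)
    show "free_bracket t (mact ?F (dpart s) m) = mact ?F (dpart s) (free_bracket t m) + (if s = t then m else 0)"
      by (rule poly_mapping_eqI)
        (simp add: dfree_simps lookup_free_act lookup_free_bracket var_bracket_mult var_bracket_dpart lookup_add)
    show "free_bracket t (free_bracket s m) = free_bracket s (free_bracket t m)"
      by (rule poly_mapping_eqI) (simp only: lookup_free_bracket var_bracket_commute[of t s])
    have w: "f \<in> weight free_bracket j"
      if "f \<in> mcar ?F" "\<And>b. Poly_Mapping.lookup f b \<in> order_weight j" for f j
      using that
    proof (induction j arbitrary: f)
      case 0
      then show ?case by (simp add: poly_mapping_eqI)
    next
      case (Suc j)
      have "free_bracket t f \<in> weight free_bracket j" for t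
        using Suc.prems keys[of t f] by (intro Suc.IH) (auto simp: dfree_simps lookup_free_bracket)
      then show ?case using Suc.prems(1) by simp
    qed
    have "\<forall>b. \<exists>j. Poly_Mapping.lookup m b \<in> order_weight j" using order_weight_exists by blast
    then obtain k where k: "\<And>b. Poly_Mapping.lookup m b \<in> order_weight (k b)" by metis
    \<comment> \<open>A common bound for the weights of the finitely many nonzero
      coordinates.\<close>
    let ?j = "\<Sum>b\<in>Poly_Mapping.keys m. k b"
    have "Poly_Mapping.lookup m b \<in> order_weight ?j" for b
    proof (cases "b \<in> Poly_Mapping.keys m")
      case True
      then have "k b \<le> ?j" by (intro member_le_sum) auto
      then show ?thesis using k order_weight_mono by blast
    qed (simp add: in_keys_iff order_weight_0)
    from w[OF m this] show "\<exists>j. m \<in> weight free_bracket j" by blast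
  qed
qed

section \<open>De Rham complexes of free resolutions\<close>

definition hom_scale :: "'k \<Rightarrow> ('m \<Rightarrow> ('n::finite, 'k::field_char_0) inv_poly) \<Rightarrow> 'm \<Rightarrow> ('n, 'k) inv_poly" where
  "hom_scale c f = (\<lambda>x. mact inv_module (dconst c) (f x))"

text \<open>A top form has a single coefficient, at the full index set. By \<open>lhom_D\<close>,
  the cocycle condition on this functional expresses the \<D>-linearity of \<open>f\<close>.\<close>

definition top_class :: "(('n::{finite,linorder}, 'k::field_char_0) dop, 'm::ab_group_add) grmod \<Rightarrow>
    ('m \<Rightarrow> ('n, 'k) inv_poly) \<Rightarrow> ('n set \<Rightarrow> 'm) \<Rightarrow> 'k" where
  "top_class M f = (\<lambda>\<eta>. if \<eta> \<in> forms M (int CARD('n)) then residue (f (\<eta> UNIV)) else 0)"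

context gr_dmodule
begin

interpretation C: graded_space "mcar M" "\<lambda>c. mact M (dconst c)" "mod_proj M"
  by (rule graded_space_car)

interpretation F: graded_space "forms M q" "form_scale M" "form_proj M" for q
  by (rule graded_space_forms)

lemma star_hom_iff: "f \<in> star_hom M inv_module \<longleftrightarrow>
    f \<in> mcar (matlis_dual M) \<and> (\<forall>i. \<forall>x\<in>mcar M. residue (f (mact M (dpart i) x)) = 0)"
  unfolding star_hom_D lhom_D matlis_car by blast

lemma rhom_neg: "f \<in> rhom \<Longrightarrow> x \<in> mcar M \<Longrightarrow> f (- x) = - f x"
  using rhom_add[of f x "- x"] rhom_add[of f 0 0]
  by (simp add: car_neg eq_neg_iff_add_eq_0 add.commute)

lemma rhom_sum: "f \<in> rhom \<Longrightarrow> (\<And>i. i \<in> A \<Longrightarrow> g i \<in> mcar M) \<Longrightarrow> f (sum g A) = (\<Sum>i\<in>A. f (g i))"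
  using rhom_add[of f 0 0]
  by (induction A rule: infinite_finite_induct) (simp_all add: rhom_add car_sum)

lemma rhom_esgn: "f \<in> rhom \<Longrightarrow> x \<in> mcar M \<Longrightarrow> f (esgn s K x) = esgn s K (f x)"
  by (simp add: esgn_def rhom_neg)

lemma hom_scale_eq: "f \<in> rhom \<Longrightarrow> hom_scale c f = (\<lambda>x. inv_mult (pconst c) (f x))"
  by (simp add: hom_scale_def inv_module_simps rhom_closed)

lemma top_class_pairing: "top_class M f = pairing (int CARD('n)) (\<lambda>J. if J = {} then f else 0)"
proof
  fix \<eta> :: "'n set \<Rightarrow> 'm"
  have "set_sign J * residue ((if J = {} then f else 0) (\<eta> (- J))) =
      (if J = {} then residue (f (\<eta> UNIV)) else 0)" for J
    by (simp add: set_sign_def)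
  then show "top_class M f \<eta> = pairing (int CARD('n)) (\<lambda>J. if J = {} then f else 0) \<eta>"
    unfolding top_class_def pairing_def by simp
qed

lemma matlis_zero: "0 \<in> mcar (matlis_dual M)"
  using matlis_left unfolding left_module_def add_subgroup_def by blast

lemma single_matlis: "f \<in> mcar (matlis_dual M) \<Longrightarrow> (\<lambda>J. if J = {} then f else 0) \<in> forms (matlis_dual M) 0"
  using matlis_zero by (simp add: forms_def)

lemma top_class_cochain:
  assumes f: "f \<in> star_hom M inv_module"
  shows "top_class M f \<in> cochains M (int CARD('n))" "codiff M (int CARD('n) - 1) (top_class M f) = 0"
proof -
  have m: "f \<in> mcar (matlis_dual M)" "\<And>i x. x \<in> mcar M \<Longrightarrow> residue (f (mact M (dpart i) x)) = 0"
    using f by (auto simp: star_hom_iff)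
  have r: "f \<in> rhom" using m(1) by (simp add: matlis_car)
  show "top_class M f \<in> cochains M (int CARD('n))"
    unfolding top_class_pairing by (rule pairing_cochains[OF single_matlis[OF m(1)]])
  show "codiff M (int CARD('n) - 1) (top_class M f) = 0"
  proof
    fix \<eta> :: "'n set \<Rightarrow> 'm"
    show "codiff M (int CARD('n) - 1) (top_class M f) \<eta> = 0 \<eta>"
    proof (cases "\<eta> \<in> forms M (int CARD('n) - 1)")
      case True
      note c = forms_car[OF True]
      have "residue (f (form_diff M \<eta> UNIV)) = 0"
        unfolding form_diff_esgn
        by (simp add: rhom_sum[OF r] rhom_esgn[OF r] esgn_car act_closed c residue_sum residue_esgn m(2))
      then show ?thesis by (simp add: codiff_def top_class_def)
    qed (simp add: codiff_def)
  qed
qed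

text \<open>By \<open>pairing_surj\<close> a top cochain is the residue of some
  \<open>R\<close>-linear map \<open>f\<close>; testing the cocycle condition on forms with one
  coefficient makes \<open>f\<close> \<D>-linear.\<close>

lemma top_class_surj:
  assumes p: "\<phi> \<in> cochains M (int CARD('n))" "codiff M (int CARD('n) - 1) \<phi> = 0"
  shows "\<exists>f\<in>star_hom M inv_module. top_class M f = \<phi>"
proof -
  have "\<phi> \<in> cochains M (int CARD('n) - 0)" using p(1) by simp
  then obtain \<omega> where w: "\<omega> \<in> forms (matlis_dual M) 0" "pairing (int CARD('n) - 0) \<omega> = \<phi>"
    using pairing_surj by blast
  define f where "f = \<omega> {}"
  have "\<omega> J = (if J = {} then f else 0)" for J
    using forms_0[unfolded forms_def] w(1) by (auto simp: f_def forms_def)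
  then have wf: "\<omega> = (\<lambda>J. if J = {} then f else 0)" by blast
  have \<phi>: "\<phi> = top_class M f" using w(2) unfolding top_class_pairing wf by simp
  have m: "f \<in> mcar (matlis_dual M)" using w(1) by (simp add: forms_def f_def)
  then have r: "f \<in> rhom" by (simp add: matlis_car)
  have "residue (f (mact M (dpart s) x)) = 0" if x: "x \<in> mcar M" for s x
  proof -
    \<comment> \<open>The coefficient of its differential at the full index set is \<partial>_s
      applied to \<open>x\<close>, up to sign.\<close>
    let ?\<eta> = "\<lambda>J. if J = - {s} then x else 0"
    have "int (card (- {s})) = int CARD('n) - 1"
      unfolding Compl_eq_Diff_UNIV by (simp add: card_Diff_subset of_nat_diff Suc_leI)
    then have e: "?\<eta> \<in> forms M (int CARD('n) - 1)" using single_form[OF x, of "- {s}"] by simp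
    have "codiff M (int CARD('n) - 1) \<phi> ?\<eta> = 0" using p(2) by simp
    then have z: "residue (f (form_diff M ?\<eta> UNIV)) = 0"
      using form_diff_forms[OF e] e unfolding codiff_def \<phi> top_class_def by simp
    have "form_diff M ?\<eta> UNIV = (\<Sum>t\<in>UNIV. if t = s then esgn s UNIV (mact M (dpart s) x) else 0)"
      unfolding form_diff_esgn by (intro sum.cong refl) (auto simp: act_0)
    then have "form_diff M ?\<eta> UNIV = esgn s UNIV (mact M (dpart s) x)" by simp
    with z show ?thesis by (simp add: rhom_esgn[OF r] act_closed x residue_esgn)
  qed
  with m \<phi> show ?thesis unfolding Bex_def star_hom_iff by blast
qed

lemma top_class_inject:
  assumes "f \<in> rhom" "g \<in> rhom" "top_class M f = top_class M g"
  shows "f = g"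
proof (rule rhom_eqI[OF assms(1,2)])
  fix x assume x: "x \<in> mcar M"
  have "(\<lambda>J. if J = (UNIV :: 'n set) then x else 0) \<in> forms M (int CARD('n))" using single_form[OF x, of UNIV] by simp
  then show "residue (f x) = residue (g x)"
    using fun_cong[OF assms(3), of "\<lambda>J. if J = UNIV then x else 0"] by (simp add: top_class_def)
qed

lemma top_class_lin: "top_class M (f - g) = top_class M f - top_class M g"
  "f \<in> rhom \<Longrightarrow> top_class M (hom_scale c f) = fscale c (top_class M f)"
  by (auto simp: top_class_def residue_diff fscale_def hom_scale_eq residue_scalar)

lemma star_hom_rhom: "f \<in> star_hom M inv_module \<Longrightarrow> f \<in> rhom"
  by (simp add: star_hom_iff matlis_car)

lemma inv_mult_diffs: "inv_mult p (e - e') = inv_mult p e - inv_mult p e'"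
  using inv_mult_add2[of p "e - e'" e'] by simp

lemma rhom_diff: "f \<in> rhom \<Longrightarrow> g \<in> rhom \<Longrightarrow> f - g \<in> rhom"
  unfolding rhom_def using add_subgroup_diff[of inv_carrier] inv_weyl.mod
  by (auto simp: inv_mult_diffs left_module_def)

lemma star_hom_subgroup: "add_subgroup (star_hom M inv_module)"
proof (rule add_subgroupI)
  show "0 \<in> star_hom M inv_module" using matlis_zero by (simp add: star_hom_iff)
  fix f g assume f: "f \<in> star_hom M inv_module" and g: "g \<in> star_hom M inv_module"
  have "residue \<circ> (f - g) = (residue \<circ> f) - (residue \<circ> g)" by (auto simp: residue_diff)
  then show "f - g \<in> star_hom M inv_module"
    using f g rhom_diff[of f g] subspace_fun_diff[OF C.subspace_graded_dual, of "residue \<circ> f" "residue \<circ> g"]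
    unfolding star_hom_iff matlis_car by (auto simp: residue_diff)
qed

lemma star_hom_scale:
  assumes f: "f \<in> star_hom M inv_module"
  shows "hom_scale c f \<in> star_hom M inv_module"
proof -
  have r: "f \<in> rhom" by (rule star_hom_rhom[OF f])
  have "hom_scale c f \<in> rhom"
    unfolding hom_scale_eq[OF r] rhom_def
    by (auto simp: inv_mult_closed rhom_add[OF r] inv_mult_add2 rhom_mult[OF r] rhom_out[OF r]
        inv_mult_mult[symmetric] mult.commute)
  moreover have "residue \<circ> hom_scale c f = fscale c (residue \<circ> f)"
    by (auto simp: hom_scale_eq[OF r] residue_scalar fscale_def)
  ultimately show ?thesis
    using f subspace_fun_scale[OF C.subspace_graded_dual, of "residue \<circ> f" c]
    unfolding star_hom_iff matlis_car by (auto simp: hom_scale_eq[OF r] residue_scalar)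
qed

end

section \<open>Functoriality of forms and cochains\<close>

locale gr_dmap = A: gr_dmodule M + B: gr_dmodule M'
  for M :: "(('n::{finite,linorder}, 'k::field_char_0) dop, 'm::ab_group_add) grmod"
    and M' :: "(('n, 'k) dop, 'w::ab_group_add) grmod" +
  fixes g :: "'m \<Rightarrow> 'w"
  assumes g_closed: "x \<in> mcar M \<Longrightarrow> g x \<in> mcar M'"
    and g_add: "x \<in> mcar M \<Longrightarrow> y \<in> mcar M \<Longrightarrow> g (x + y) = g x + g y"
    and g_act: "x \<in> mcar M \<Longrightarrow> g (mact M P x) = mact M' P (g x)"
    and g_piece: "x \<in> piece M l \<Longrightarrow> g x \<in> piece M' l"
begin

lemma g_0: "g 0 = 0"
  using g_add[OF A.car_0 A.car_0] by simp

lemma g_proj: "x \<in> mcar M \<Longrightarrow> mod_proj M' l (g x) = g (mod_proj M l x)"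
  using component_map[OF A.direct_sum B.direct_sum B.car A.car g_add, of 0 x l] g_piece
  by (simp add: mod_proj_def g_closed)

definition push :: "('n set \<Rightarrow> 'm) \<Rightarrow> 'n set \<Rightarrow> 'w" where
  "push \<eta> = (\<lambda>J. g (\<eta> J))"

lemma push_forms: "\<eta> \<in> forms M q \<Longrightarrow> push \<eta> \<in> forms M' q"
  by (auto simp: forms_def push_def g_closed g_0)

lemma push_add: "\<eta> \<in> forms M q \<Longrightarrow> \<zeta> \<in> forms M q \<Longrightarrow> push (\<eta> + \<zeta>) = push \<eta> + push \<zeta>"
  by (auto simp: push_def g_add A.forms_car)

lemma push_scale: "\<eta> \<in> forms M q \<Longrightarrow> push (form_scale M c \<eta>) = form_scale M' c (push \<eta>)"
  by (auto simp: push_def form_scale_def g_act A.forms_car)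

lemma push_proj: "\<eta> \<in> forms M q \<Longrightarrow> form_proj M' l (push \<eta>) = push (form_proj M l \<eta>)"
  by (auto simp: push_def form_proj_def g_proj A.forms_car)

lemma push_form_diff: "\<eta> \<in> forms M q \<Longrightarrow> form_diff M' (push \<eta>) = push (form_diff M \<eta>)"
  unfolding push_def by (rule form_diff_map[OF A.dop_module_axioms g_add g_act])

definition pull :: "int \<Rightarrow> (('n set \<Rightarrow> 'w) \<Rightarrow> 'k) \<Rightarrow> ('n set \<Rightarrow> 'm) \<Rightarrow> 'k" where
  "pull q \<phi> = (\<lambda>\<eta>. if \<eta> \<in> forms M q then \<phi> (push \<eta>) else 0)"

lemma pull_lin: "pull q (\<phi> - \<psi>) = pull q \<phi> - pull q \<psi>" "pull q (fscale c \<phi>) = fscale c (pull q \<phi>)"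
  by (auto simp: pull_def fscale_def)

lemma pull_cochains: "\<phi> \<in> cochains M' q \<Longrightarrow> pull q \<phi> \<in> cochains M q"
  unfolding pull_def cochains_def
  by (rule graded_dual_precompose[OF A.graded_space_forms B.graded_space_forms])
    (rule push_forms push_add push_scale push_proj; assumption)+

lemma pull_codiff: "codiff M q (pull (q + 1) \<phi>) = pull q (codiff M' q \<phi>)"
  using A.form_diff_forms[of _ q] push_forms[of _ q]
  by (auto simp: codiff_def pull_def fun_eq_iff push_form_diff[of _ q])

text \<open>An instance of \<open>graded_dual_factor\<close>; through it, exactness of a resolution
  passes to the cochains.\<close>

lemma pull_factor:
  assumes "\<phi> \<in> cochains M q" "\<And>\<eta>. \<eta> \<in> forms M q \<Longrightarrow> push \<eta> = 0 \<Longrightarrow> \<phi> \<eta> = 0"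
  shows "\<exists>\<psi>\<in>cochains M' q. \<phi> = pull q \<psi>"
proof -
  have "\<exists>\<psi>\<in>graded_dual (forms M' q) (form_scale M') (form_proj M'). \<forall>\<eta>\<in>forms M q. \<phi> \<eta> = \<psi> (push \<eta>)"
    by (rule graded_dual_factor[OF A.graded_space_forms[of q] B.graded_space_forms[of q]])
      ((rule push_forms push_add push_scale push_proj; assumption) | (use assms in \<open>simp add: cochains_def\<close>))+
  then obtain \<psi> where p: "\<psi> \<in> cochains M' q" "\<And>\<eta>. \<eta> \<in> forms M q \<Longrightarrow> \<phi> \<eta> = \<psi> (push \<eta>)"
    unfolding cochains_def by blast
  have "\<phi> = pull q \<psi>"
    using p(2) A.cochains_functional[OF assms(1)] by (auto simp: pull_def linear_functionals_def)
  with p(1) show ?thesis by blast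
qed

lemma pull_star_hom:
  assumes f: "f \<in> star_hom M' inv_module"
  shows "(\<lambda>x. if x \<in> mcar M then f (g x) else 0) \<in> star_hom M inv_module"
proof -
  have r: "f \<in> B.rhom" by (rule B.star_hom_rhom[OF f])
  have rf: "residue \<circ> f \<in> B.gdual" using f by (simp only: B.star_hom_iff B.matlis_car mem_Collect_eq)
  let ?h = "\<lambda>x. if x \<in> mcar M then f (g x) else 0"
  have "?h \<in> A.rhom"
    unfolding A.rhom_def
    by (auto simp: B.rhom_closed[OF r] A.car_add g_add B.rhom_add[OF r] g_closed A.act_closed g_act B.rhom_mult[OF r])
  moreover have "residue \<circ> ?h = (\<lambda>x. if x \<in> mcar M then (residue \<circ> f) (g x) else 0)" by auto
  moreover have "(\<lambda>x. if x \<in> mcar M then (residue \<circ> f) (g x) else 0) \<in> A.gdual"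
    by (rule graded_dual_precompose[OF A.graded_space_car B.graded_space_car _ _ _ _ rf])
      (simp_all add: g_closed g_add g_act g_proj)
  moreover have "residue (?h (mact M (dpart i) x)) = 0" if "x \<in> mcar M" for i x
    using f that by (auto simp: g_act A.act_closed g_closed B.star_hom_iff)
  ultimately show ?thesis unfolding A.star_hom_iff A.matlis_car by simp
qed

end

text \<open>Lifting is done coefficient by coefficient. Off degree \<open>q\<close> the lift has to
  be \<open>0\<close>, so that the result is again a \<open>q\<close>-form.\<close>

lemma forms_lift:
  assumes w: "\<eta> \<in> forms M q" and l: "\<And>x. x \<in> mcar M \<Longrightarrow> g x = 0 \<Longrightarrow> \<exists>y\<in>S. h y = x"
    and k: "\<And>J. g (\<eta> J) = 0" and S: "0 \<in> S" "h 0 = 0" "mcar N = S"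
  shows "\<exists>\<zeta>\<in>forms N q. \<eta> = (\<lambda>J. h (\<zeta> J))"
proof -
  have "\<exists>y. y \<in> S \<and> h y = \<eta> J \<and> (int (card J) \<noteq> q \<longrightarrow> y = 0)" for J
  proof (cases "int (card J) = q")
    case True
    then show ?thesis using l[of "\<eta> J"] w k by (auto simp: forms_def)
  next
    case False
    then show ?thesis using w S by (auto simp: forms_def)
  qed
  then obtain \<zeta> where z: "\<And>J. \<zeta> J \<in> S" "\<And>J. h (\<zeta> J) = \<eta> J" "\<And>J. int (card J) \<noteq> q \<Longrightarrow> \<zeta> J = 0" by metis
  then have "\<zeta> \<in> forms N q" using S(3) by (simp add: forms_def)
  with z(2) show ?thesis by (intro bexI[of _ \<zeta>]) auto
qed

text \<open>Kept abstract because it is used twice: for the standard graded resolution and for a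
  resolution by finite bases. The degrees of basis elements are a separate parameter, since the
  cells of the latter carry no degree label.\<close>

locale free_resolution = gr_dmodule M
  for M :: "(('n::{finite,linorder}, 'k::field_char_0) dop, 'm::ab_group_add) grmod" +
  fixes Fr :: "nat \<Rightarrow> (('n, 'k) dop, 'b \<Rightarrow>\<^sub>0 ('n, 'k) dop) grmod"
    and deg :: "nat \<Rightarrow> 'b \<Rightarrow> int" and Bs :: "nat \<Rightarrow> 'b set"
    and bd :: "('b \<Rightarrow>\<^sub>0 ('n, 'k) dop) \<Rightarrow> ('b \<Rightarrow>\<^sub>0 ('n, 'k) dop)" and aug :: "('b \<Rightarrow>\<^sub>0 ('n, 'k) dop) \<Rightarrow> 'm"
  assumes Fr: "Fr p = dfree (deg p) (Bs p)"
    and bd_map: "gr_dmap (Fr (Suc p)) (Fr p) bd"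
    and aug_map: "gr_dmap (Fr 0) M aug"
    and bd_bd: "f \<in> mcar (Fr (Suc (Suc p))) \<Longrightarrow> bd (bd f) = 0"
    and aug_bd: "f \<in> mcar (Fr (Suc 0)) \<Longrightarrow> aug (bd f) = 0"
    and bd_exact: "f \<in> mcar (Fr (Suc p)) \<Longrightarrow> bd f = 0 \<Longrightarrow>
      \<exists>h\<in>mcar (Fr (Suc (Suc p))). bd h = f"
    and aug_exact: "f \<in> mcar (Fr 0) \<Longrightarrow> aug f = 0 \<Longrightarrow>
      \<exists>h\<in>mcar (Fr (Suc 0)). bd h = f"
    and aug_surj: "m \<in> mcar M \<Longrightarrow> \<exists>f\<in>mcar (Fr 0). aug f = m"
begin

interpretation f: gr_dmodule "Fr p" for p
  unfolding Fr by (rule gr_dmoduleI[OF dfree_graded])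

interpretation w: weyl_pair "Fr p" free_bracket for p
  unfolding Fr by (rule dfree_weyl_pair)

interpretation b: gr_dmap "Fr (Suc p)" "Fr p" bd for p
  by (rule bd_map)

interpretation a: gr_dmap "Fr 0" M aug
  by (rule aug_map)

abbreviation "hdiff p q \<equiv> b.pull p (int CARD('n) - int q)"
abbreviation "vdiff p q \<equiv> codiff (Fr p) (int CARD('n) - int q - 1)"

text \<open>Here \<open>q\<close> is the codegree of a form, so that \<open>codiff\<close> raises
  it. Exactness of the rows is dual to that of the resolution, and exactness of the columns away
  from \<open>q = 0\<close> is dual to \<open>forms_exact\<close>.\<close>

lemma double: "exact_double_complex (\<lambda>p q. cochains (Fr p) (int CARD('n) - int q)) hdiff vdiff
    (\<lambda>q. cochains M (int CARD('n) - int q)) (\<lambda>q. a.pull (int CARD('n) - int q)) (\<lambda>q. codiff M (int CARD('n) - int q - 1))"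
proof
  fix p q
  show "subspace_fun (cochains (Fr p) (int CARD('n) - int q))" by (rule f.subspace_cochains)
  show "subspace_fun (cochains M (int CARD('n) - int q))" by (rule subspace_cochains)
next
  fix p q x assume x: "x \<in> cochains (Fr p) (int CARD('n) - int q)"
  show "hdiff p q x \<in> cochains (Fr (Suc p)) (int CARD('n) - int q)" by (rule b.pull_cochains[OF x])
  show "vdiff p q x \<in> cochains (Fr p) (int CARD('n) - int (Suc q))"
    using f.codiff_cochains[of x p "int CARD('n) - int q - 1"] x by (simp add: algebra_simps)
  show "vdiff (Suc p) q (hdiff p q x) = hdiff p (Suc q) (vdiff p q x)"
    using b.pull_codiff[of p "int CARD('n) - int q - 1" x] by (simp add: algebra_simps)
  have "x 0 = 0" by (rule graded_space.functional_0[OF f.graded_space_forms f.cochains_functional[OF x]])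
  moreover have "b.push (b.push \<eta>) = 0" if "\<eta> \<in> forms (Fr (Suc (Suc p))) (int CARD('n) - int q)" for \<eta>
    using bd_bd[OF f.forms_car[OF that]] by (auto simp: b.push_def)
  ultimately show "hdiff (Suc p) q (hdiff p q x) = 0"
    by (intro ext) (simp add: b.pull_def b.push_forms)
  show "vdiff p (Suc q) (vdiff p q x) = 0"
    using f.codiff_codiff[of x p "int CARD('n) - int q - 2"] x by (simp add: algebra_simps)
next
  fix q y assume y: "y \<in> cochains M (int CARD('n) - int q)"
  show "a.pull (int CARD('n) - int q) y \<in> cochains (Fr 0) (int CARD('n) - int q)" by (rule a.pull_cochains[OF y])
  show "codiff M (int CARD('n) - int q - 1) y \<in> cochains M (int CARD('n) - int (Suc q))"
    using codiff_cochains[of y "int CARD('n) - int q - 1"] y by (simp add: algebra_simps)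
  show "vdiff 0 q (a.pull (int CARD('n) - int q) y) = a.pull (int CARD('n) - int (Suc q)) (codiff M (int CARD('n) - int q - 1) y)"
    using a.pull_codiff[of "int CARD('n) - int q - 1" y] by (simp add: algebra_simps)
  have "y 0 = 0" by (rule graded_space.functional_0[OF graded_space_forms cochains_functional[OF y]])
  moreover have "a.push (b.push \<eta>) = 0" if "\<eta> \<in> forms (Fr (Suc 0)) (int CARD('n) - int q)" for \<eta>
    using aug_bd[OF f.forms_car[OF that]] by (auto simp: b.push_def a.push_def)
  ultimately show "hdiff 0 q (a.pull (int CARD('n) - int q) y) = 0"
    by (intro ext) (simp add: b.pull_def a.pull_def b.push_forms)
  assume z: "a.pull (int CARD('n) - int q) y = 0"
  show "y = 0"
  proof
    fix \<eta> :: "'n set \<Rightarrow> 'm"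
    show "y \<eta> = 0 \<eta>"
    proof (cases "\<eta> \<in> forms M (int CARD('n) - int q)")
      case True
      obtain \<zeta> where "\<zeta> \<in> forms (Fr 0) (int CARD('n) - int q)" "\<eta> = (\<lambda>J. aug (\<zeta> J))"
        using forms_lift[OF True, of "\<lambda>_. 0" "mcar (Fr 0)" aug "Fr 0"] aug_surj a.g_0 f.car_0 by blast
      then show ?thesis using fun_cong[OF z, of \<zeta>] by (simp add: a.pull_def a.push_def)
    next
      case False
      then show ?thesis using cochains_functional[OF y] by (simp add: linear_functionals_def)
    qed
  qed
next
  fix p q x assume x: "x \<in> cochains (Fr (Suc p)) (int CARD('n) - int q)" and z: "hdiff (Suc p) q x = 0"
  show "\<exists>y\<in>cochains (Fr p) (int CARD('n) - int q). x = hdiff p q y"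
  proof (rule b.pull_factor[OF x])
    fix \<eta> assume e: "\<eta> \<in> forms (Fr (Suc p)) (int CARD('n) - int q)" "b.push \<eta> = 0"
    have "bd (\<eta> J) = 0" for J using fun_cong[OF e(2), of J] by (simp add: b.push_def)
    then obtain \<zeta> where "\<zeta> \<in> forms (Fr (Suc (Suc p))) (int CARD('n) - int q)" "\<eta> = (\<lambda>J. bd (\<zeta> J))"
      using forms_lift[OF e(1), of bd "mcar (Fr (Suc (Suc p)))" bd "Fr (Suc (Suc p))"] bd_exact b.g_0 f.car_0 by blast
    then show "x \<eta> = 0" using fun_cong[OF z, of \<zeta>] by (simp add: b.pull_def b.push_def)
  qed
next
  fix q x assume x: "x \<in> cochains (Fr 0) (int CARD('n) - int q)" and z: "hdiff 0 q x = 0"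
  show "\<exists>y\<in>cochains M (int CARD('n) - int q). x = a.pull (int CARD('n) - int q) y"
  proof (rule a.pull_factor[OF x])
    fix \<eta> assume e: "\<eta> \<in> forms (Fr 0) (int CARD('n) - int q)" "a.push \<eta> = 0"
    have "aug (\<eta> J) = 0" for J using fun_cong[OF e(2), of J] by (simp add: a.push_def)
    then obtain \<zeta> where "\<zeta> \<in> forms (Fr (Suc 0)) (int CARD('n) - int q)" "\<eta> = (\<lambda>J. bd (\<zeta> J))"
      using forms_lift[OF e(1), of aug "mcar (Fr (Suc 0))" bd "Fr (Suc 0)"] aug_exact b.g_0 f.car_0 by blast
    then show "x \<eta> = 0" using fun_cong[OF z, of \<zeta>] by (simp add: b.pull_def b.push_def)
  qed
next
  fix p q x assume x: "x \<in> cochains (Fr p) (int CARD('n) - int (Suc q))" and z: "vdiff p (Suc q) x = 0"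
  let ?r = "int CARD('n) - int (Suc q)"
  have "\<exists>y\<in>graded_dual (forms (Fr p) (?r + 1)) (form_scale (Fr p)) (form_proj (Fr p)).
      \<forall>\<eta>\<in>forms (Fr p) ?r. x \<eta> = y (form_diff (Fr p) \<eta>)"
  proof (rule graded_dual_factor[OF f.graded_space_forms[of p ?r] f.graded_space_forms[of p "?r + 1"]])
    show "x \<in> graded_dual (forms (Fr p) ?r) (form_scale (Fr p)) (form_proj (Fr p))"
      using x by (simp add: cochains_def)
    fix \<eta> assume e: "\<eta> \<in> forms (Fr p) ?r" "form_diff (Fr p) \<eta> = 0"
    then obtain \<zeta> where "\<zeta> \<in> forms (Fr p) (?r - 1)" "\<eta> = form_diff (Fr p) \<zeta>"
      using w.forms_exact[of ?r \<eta> p] by auto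
    then show "x \<eta> = 0" using fun_cong[OF z, of \<zeta>] by (simp add: codiff_def)
  qed (rule f.form_diff_forms f.form_diff_add f.form_diff_scale f.form_diff_proj; assumption)+
  then obtain y where y: "y \<in> cochains (Fr p) (?r + 1)" "\<And>\<eta>. \<eta> \<in> forms (Fr p) ?r \<Longrightarrow> x \<eta> = y (form_diff (Fr p) \<eta>)"
    unfolding cochains_def by blast
  have "x = codiff (Fr p) ?r y"
    using y(2) f.cochains_functional[OF x] by (auto simp: codiff_def linear_functionals_def)
  then show "\<exists>y\<in>cochains (Fr p) (int CARD('n) - int q). x = vdiff p q y"
    using y(1) by (intro bexI[of _ y]) (simp_all add: algebra_simps)
qed (simp_all add: b.pull_lin a.pull_lin codiff_lin)

definition hom_diff :: "nat \<Rightarrow> (('b \<Rightarrow>\<^sub>0 ('n, 'k) dop) \<Rightarrow> ('n, 'k) inv_poly) \<Rightarrow> ('b \<Rightarrow>\<^sub>0 ('n, 'k) dop) \<Rightarrow> ('n, 'k) inv_poly" where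
  "hom_diff p g = (\<lambda>x. if x \<in> mcar (Fr (Suc p)) then g (bd x) else 0)"

lemma hom_diff_top: "top_class (Fr (Suc p)) (hom_diff p g) = hdiff p 0 (top_class (Fr p) g)"
proof
  fix \<eta> :: "'n set \<Rightarrow> 'b \<Rightarrow>\<^sub>0 ('n, 'k) dop"
  show "top_class (Fr (Suc p)) (hom_diff p g) \<eta> = hdiff p 0 (top_class (Fr p) g) \<eta>"
    using b.push_forms[of \<eta> p "int CARD('n)"] f.forms_car[of \<eta> "Suc p" "int CARD('n)" UNIV]
    by (simp add: top_class_def hom_diff_def b.pull_def) (simp add: b.push_def)
qed

lemma hom_diff_lin: "hom_diff p (g - g') = hom_diff p g - hom_diff p g'"
  "hom_diff p (hom_scale c g) = hom_scale c (hom_diff p g)"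
  using inv_weyl.r_0 by (auto simp: hom_diff_def hom_scale_def inv_module_simps inv_carrier_0)

text \<open>The double complex links the cohomology of \<open>cochains M\<close> to the kernels of
  \<open>vdiff\<close> at \<open>q = 0\<close>, and \<open>top_class\<close> identifies these
  kernels with the graded \<D>-linear maps into \<open>E\<close>.\<close>

theorem star_ext_cochains:
  "quotient_space fscale {\<phi> \<in> cochains M (int CARD('n) - int i). codiff M (int CARD('n) - int i - 1) \<phi> = 0}
      (codiff M (int CARD('n) - int i) ` cochains M (int CARD('n) - int i + 1)) \<cong>\<^sub>k
    quotient_space hom_scale {g \<in> star_hom (Fr i) inv_module. hom_diff i g = 0}
      (case i of 0 \<Rightarrow> {0} | Suc i' \<Rightarrow> hom_diff i' ` star_hom (Fr i') inv_module)"
proof -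
  interpret d: exact_double_complex "\<lambda>p q. cochains (Fr p) (int CARD('n) - int q)" hdiff vdiff
    "\<lambda>q. cochains M (int CARD('n) - int q)" "\<lambda>q. a.pull (int CARD('n) - int q)" "\<lambda>q. codiff M (int CARD('n) - int q - 1)"
    by (rule double)
  let ?H = "\<lambda>p. star_hom (Fr p) inv_module"
  let ?K = "\<lambda>p. {x \<in> cochains (Fr p) (int CARD('n) - int 0). vdiff p 0 x = 0}"
  let ?Z = "{x \<in> cochains (Fr i) (int CARD('n) - int 0). hdiff i 0 x = 0 \<and> vdiff i 0 x = 0}"
  let ?N = "case i of 0 \<Rightarrow> {0} | Suc i' \<Rightarrow> hdiff i' 0 ` ?K i'"
  \<comment> \<open>In \<open>balance\<close> the coboundaries for \<open>i = 0\<close> are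
    \<open>{0}\<close>. This agrees with the left-hand side because there are no forms of degree
    \<open>n + 1\<close>.\<close>
  have image: "codiff M (int CARD('n) - int i) ` cochains M (int CARD('n) - int i + 1) =
      (case i of 0 \<Rightarrow> {0} | Suc i' \<Rightarrow> codiff M (int CARD('n) - int i' - 1) ` cochains M (int CARD('n) - int i'))"
  proof (cases i)
    case 0
    have "codiff M (int CARD('n)) \<phi> = 0" if p: "\<phi> \<in> cochains M (int CARD('n) + 1)" for \<phi>
    proof -
      have "form_diff M \<eta> = 0" if "\<eta> \<in> forms M (int CARD('n))" for \<eta>
      proof
        fix J :: "'n set"
        have "card J \<le> CARD('n)" by (rule card_mono) auto
        then have "int (card J) \<noteq> int CARD('n) + 1" by simp
        then show "form_diff M \<eta> J = 0 J" using forms_0[OF form_diff_forms[OF that]] by simp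
      qed
      then show ?thesis
        using graded_space.functional_0[OF graded_space_forms cochains_functional[OF p]]
        by (intro ext) (simp add: codiff_def)
    qed
    moreover have "0 \<in> codiff M (int CARD('n)) ` cochains M (int CARD('n) + 1)"
      using subspace_fun_0[OF subspace_cochains, of "int CARD('n) + 1"] by (rule image_eqI[rotated]) (auto simp: codiff_def)
    ultimately show ?thesis using 0 by auto
  next
    case (Suc i')
    then show ?thesis by (simp add: algebra_simps)
  qed
  have top: "top_class (Fr p) g \<in> ?K p" if "g \<in> ?H p" for p g
    using f.top_class_cochain[OF that] by simp
  have surj: "\<exists>g\<in>?H p. top_class (Fr p) g = x" if "x \<in> ?K p" for p x
    using f.top_class_surj[of x p] that by simp
  have inj: "g = g'" if "g \<in> ?H p" "g' \<in> ?H p" "top_class (Fr p) g = top_class (Fr p) g'" for p g g'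
    using f.top_class_inject[OF f.star_hom_rhom f.star_hom_rhom] that by blast
  have hd: "hom_diff p g \<in> ?H (Suc p)" if "g \<in> ?H p" for p g
    unfolding hom_diff_def by (rule b.pull_star_hom[OF that])
  have H0: "0 \<in> ?H p" for p using f.star_hom_subgroup[of p] by (simp add: add_subgroup_def)
  have t0: "top_class (Fr p) 0 = 0" for p by (auto simp: top_class_def)
  have hd0: "hom_diff p g = 0 \<longleftrightarrow> hdiff p 0 (top_class (Fr p) g) = 0" if "g \<in> ?H p" for p g
    using inj[OF hd[OF that] H0] t0 hom_diff_top[of p g] by metis
  have hdhd: "hom_diff (Suc p) (hom_diff p g) = 0" if "g \<in> ?H p" for p g
    unfolding hd0[OF hd[OF that]] hom_diff_top using top[OF that] by (intro d.hh) blast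
  have "quotient_space fscale ?Z ?N \<cong>\<^sub>k quotient_space hom_scale {g \<in> ?H i. hom_diff i g = 0}
      (case i of 0 \<Rightarrow> {0} | Suc i' \<Rightarrow> hom_diff i' ` ?H i')"
  proof (rule quotient_iso_rel[where R = "\<lambda>x g. g \<in> ?H i \<and> x = top_class (Fr i) g"])
    show "subquotient fscale ?Z ?N"
      using d.sub_Z[of i 0] d.sub_N[of i 0] d.N_Z[of i 0] subquotient_fun
      unfolding d.Z_def d.N_def nat.case by blast
    show "subquotient hom_scale {g \<in> ?H i. hom_diff i g = 0} (case i of 0 \<Rightarrow> {0} | Suc i' \<Rightarrow> hom_diff i' ` ?H i')"
      unfolding subquotient_def
    proof (intro conjI allI ballI)
      note S = f.star_hom_subgroup
      have h0: "hom_diff p 0 = 0" for p by (auto simp: hom_diff_def)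
      have s0: "hom_scale c 0 = (0 :: ('b \<Rightarrow>\<^sub>0 ('n, 'k) dop) \<Rightarrow> ('n, 'k) inv_poly)" for c
        using inv_weyl.r_0 by (auto simp: hom_scale_def inv_module_simps inv_carrier_0)
      show "add_subgroup {g \<in> ?H i. hom_diff i g = 0}"
        by (rule add_subgroupI) (auto simp: H0 h0 hom_diff_lin add_subgroup_diff[OF S])
      show "add_subgroup (case i of 0 \<Rightarrow> {0} | Suc i' \<Rightarrow> hom_diff i' ` ?H i')"
      proof (cases i)
        case (Suc i')
        have "add_subgroup (hom_diff i' ` ?H i')"
        proof (rule add_subgroupI)
          show "0 \<in> hom_diff i' ` ?H i'" using h0 H0 by (metis image_eqI)
          fix x y assume "x \<in> hom_diff i' ` ?H i'" "y \<in> hom_diff i' ` ?H i'"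
          then show "x - y \<in> hom_diff i' ` ?H i'"
            using add_subgroup_diff[OF S] by (auto simp: hom_diff_lin(1)[symmetric])
        qed
        then show ?thesis using Suc by simp
      qed (simp add: add_subgroup_def)
      show "(case i of 0 \<Rightarrow> {0} | Suc i' \<Rightarrow> hom_diff i' ` ?H i') \<subseteq> {g \<in> ?H i. hom_diff i g = 0}"
        by (cases i) (auto simp: H0 h0 hd hdhd)
      show "hom_scale c g \<in> {g \<in> ?H i. hom_diff i g = 0}" if "g \<in> {g \<in> ?H i. hom_diff i g = 0}" for c g
        using that by (auto simp: f.star_hom_scale hom_diff_lin s0)
      show "hom_scale c g \<in> (case i of 0 \<Rightarrow> {0} | Suc i' \<Rightarrow> hom_diff i' ` ?H i')"
        if "g \<in> (case i of 0 \<Rightarrow> {0} | Suc i' \<Rightarrow> hom_diff i' ` ?H i')" for c g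
        using that by (cases i) (auto simp: s0 hom_diff_lin(2)[symmetric] intro!: imageI f.star_hom_scale)
      show "hom_scale c (g + g') = hom_scale c g + hom_scale c g'"
        if "g \<in> {g \<in> ?H i. hom_diff i g = 0}" "g' \<in> {g \<in> ?H i. hom_diff i g = 0}" for c g g'
        using that f.star_hom_rhom[of g i] f.star_hom_rhom[of g' i]
        by (auto simp: hom_scale_def inv_module_simps f.rhom_closed inv_carrier_add inv_mult_add2)
    qed
    show "\<exists>g\<in>{g \<in> ?H i. hom_diff i g = 0}. g \<in> ?H i \<and> x = top_class (Fr i) g" if x: "x \<in> ?Z" for x
    proof -
      obtain g where "g \<in> ?H i" "top_class (Fr i) g = x" using surj x by blast
      then show ?thesis using hd0 x by blast
    qed
    show "\<exists>x\<in>?Z. g \<in> ?H i \<and> x = top_class (Fr i) g" if "g \<in> {g \<in> ?H i. hom_diff i g = 0}" for g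
      using that top hd0 by blast
    show "x' - y' \<in> ?H i \<and> x - y = top_class (Fr i) (x' - y')"
      if "x' \<in> ?H i \<and> x = top_class (Fr i) x'" "y' \<in> ?H i \<and> y = top_class (Fr i) y'" for x x' y y'
      using that add_subgroup_diff[OF f.star_hom_subgroup, of x' i y'] by (simp add: f.top_class_lin)
    show "hom_scale c x' \<in> ?H i \<and> fscale c x = top_class (Fr i) (hom_scale c x')"
      if "x' \<in> ?H i \<and> x = top_class (Fr i) x'" for c x x'
      using that f.star_hom_scale[of x' i c] f.top_class_lin(2)[OF f.star_hom_rhom[of x' i]] by simp
    show "x \<in> ?N \<longleftrightarrow> g \<in> (case i of 0 \<Rightarrow> {0} | Suc i' \<Rightarrow> hom_diff i' ` ?H i')"
      if g: "g \<in> ?H i \<and> x = top_class (Fr i) g" for x g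
    proof (cases i)
      case 0
      have "top_class (Fr i) g = 0 \<longleftrightarrow> g = 0" using inj[OF conjunct1[OF g] H0] t0 by metis
      then show ?thesis using g 0 by simp
    next
      case (Suc i')
      have "x \<in> hdiff i' 0 ` ?K i' \<longleftrightarrow> g \<in> hom_diff i' ` ?H i'"
      proof
        assume "x \<in> hdiff i' 0 ` ?K i'"
        then obtain y where y: "y \<in> ?K i'" "x = hdiff i' 0 y" by blast
        obtain g' where g': "g' \<in> ?H i'" "top_class (Fr i') g' = y" using surj[OF y(1)] by blast
        then have "top_class (Fr i) g = top_class (Fr i) (hom_diff i' g')"
          using g y(2) hom_diff_top[of i' g'] Suc by simp
        then have "g = hom_diff i' g'" using inj[of g i] g hd[OF g'(1)] Suc by blast
        with g'(1) show "g \<in> hom_diff i' ` ?H i'" by blast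
      next
        assume "g \<in> hom_diff i' ` ?H i'"
        then obtain g' where g': "g' \<in> ?H i'" "g = hom_diff i' g'" by blast
        then have "x = hdiff i' 0 (top_class (Fr i') g')" using g Suc by (simp add: hom_diff_top)
        with top[OF g'(1)] show "x \<in> hdiff i' 0 ` ?K i'" by blast
      qed
      then show ?thesis using Suc by simp
    qed
  qed
  with d.balance[of i] show ?thesis unfolding image by (rule kspace_iso_trans)
qed

end

section \<open>The standard graded resolution\<close>

lemma keys_lin_comb: "Poly_Mapping.keys (lin_comb xs) \<subseteq> snd ` set xs"
proof (induction xs)
  case Nil
  then show ?case by (simp add: lin_comb_def)
next
  case (Cons x xs)
  obtain a b where x: "x = (a, b)" by (cases x)
  have "lin_comb (x # xs) = Poly_Mapping.single b a + lin_comb xs" by (simp add: lin_comb_def x)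
  then have "Poly_Mapping.keys (lin_comb (x # xs)) \<subseteq> {b} \<union> Poly_Mapping.keys (lin_comb xs)"
    using Poly_Mapping.keys_add[of "Poly_Mapping.single b a" "lin_comb xs"] by (auto split: if_splits)
  with Cons show ?case by (auto simp: x)
qed

lemma lin_comb_piece:
  assumes "\<And>a b. (a, b) \<in> set xs \<Longrightarrow> b \<in> B \<and> a \<in> dop_piece (l - deg b)"
  shows "lin_comb xs \<in> piece (dfree deg B :: (('n::{finite,linorder}, 'k::field_char_0) dop, _) grmod) l"
proof -
  interpret gr_dmodule "dfree deg B :: (('n, 'k) dop, _) grmod" by (rule gr_dmoduleI[OF dfree_graded])
  show ?thesis using assms
  proof (induction xs)
    case Nil
    then show ?case using piece_subgroup[of l] by (simp add: lin_comb_def add_subgroup_def)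
  next
    case (Cons x xs)
    obtain a b where x: "x = (a, b)" by (cases x)
    have "Poly_Mapping.single b a \<in> piece (dfree deg B) l"
      using Cons.prems[of a b] by (auto simp: x dfree_simps)
    moreover have "lin_comb xs \<in> piece (dfree deg B) l" by (rule Cons.IH) (use Cons.prems in auto)
    ultimately have "Poly_Mapping.single b a + lin_comb xs \<in> piece (dfree deg B) l"
      using piece_subgroup[of l] by (simp add: add_subgroup_def)
    then show ?case by (simp add: lin_comb_def x)
  qed
qed

lemma dfree_act_piece:
  fixes f :: "'b \<Rightarrow>\<^sub>0 ('n::{finite,linorder}, 'k::field_char_0) dop"
  assumes "P \<in> dop_piece e" "f \<in> piece (dfree deg B) l"
  shows "free_act P f \<in> piece (dfree deg B) (l + e)"
proof -
  interpret gr_dmodule "dfree deg B :: (('n, 'k) dop, _) grmod" by (rule gr_dmoduleI[OF dfree_graded])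
  show ?thesis using act_piece[of e P f l] assms by (simp add: dop_piece_def dfree_simps(2))
qed

lemma boundary_sum: "boundary f = (\<Sum>b\<in>Poly_Mapping.keys f. boundary (Poly_Mapping.single b (Poly_Mapping.lookup f b)))"
proof -
  have "boundary (sum g A) = (\<Sum>b\<in>A. boundary (g b))" for A :: "'x set" and g :: "'x \<Rightarrow> ('a, 'b, 'c) cell \<Rightarrow>\<^sub>0 'b"
    by (induction A rule: infinite_finite_induct) (simp_all add: boundary_add)
  then show ?thesis using mapping_eq_sum[of f] by metis
qed

text \<open>The degree of a cell enters only through the requirement that its syzygy be homogeneous
  of that degree; this covers cells with and without degree labels.\<close>

lemma boundary_map:
  fixes B' B :: "('l, ('n::{finite,linorder}, 'k::field_char_0) dop, 'm) cell set"
  assumes B: "\<And>b. b \<in> B' \<Longrightarrow> \<exists>l xs. b = Syz l xs \<and> lin_comb xs \<in> piece (dfree deg B) (deg' b)"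
  shows "gr_dmap (dfree deg' B') (dfree deg B) boundary"
proof -
  interpret X: gr_dmodule "dfree deg' B' :: (('n, 'k) dop, _) grmod" by (rule gr_dmoduleI[OF dfree_graded])
  interpret Y: gr_dmodule "dfree deg B :: (('n, 'k) dop, _) grmod" by (rule gr_dmoduleI[OF dfree_graded])
  have p: "boundary (Poly_Mapping.single b P) \<in> piece (dfree deg B) (deg' b + e)" if b: "b \<in> B'" and P: "P \<in> dop_piece e" for b P e
  proof -
    obtain l xs where "b = Syz l xs" "lin_comb xs \<in> piece (dfree deg B) (deg' b)" using B[OF b] by blast
    then show ?thesis using dfree_act_piece[OF P] by (simp add: boundary_single)
  qed
  have c: "boundary (Poly_Mapping.single b P) \<in> mcar (dfree deg B)" if b: "b \<in> B'" for b P
  proof -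
    obtain l xs where "b = Syz l xs" "lin_comb xs \<in> piece (dfree deg B) (deg' b)" using B[OF b] by blast
    then show ?thesis using Y.act_closed[OF Y.piece_car, of "lin_comb xs" _ P] by (simp add: boundary_single dfree_simps(2))
  qed
  show ?thesis
  proof
    show "boundary x \<in> mcar (dfree deg B)" if x: "x \<in> mcar (dfree deg' B')" for x
      unfolding boundary_sum[of x] by (rule Y.car_sum, rule c) (use x in \<open>auto simp: dfree_simps\<close>)
    show "boundary x \<in> piece (dfree deg B) l" if x: "x \<in> piece (dfree deg' B') l" for x l
      unfolding boundary_sum[of x]
    proof (rule add_subgroup_sum[OF Y.piece_subgroup])
      fix b assume "b \<in> Poly_Mapping.keys x"
      then have "b \<in> B'" "Poly_Mapping.lookup x b \<in> dop_piece (l - deg' b)" using x by (auto simp: dfree_simps)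
      from p[OF this] show "boundary (Poly_Mapping.single b (Poly_Mapping.lookup x b)) \<in> piece (dfree deg B) l" by simp
    qed
  qed (simp_all add: boundary_add boundary_free_act dfree_simps(2))
qed

lemma (in gr_dmodule) augmentation_map:
  fixes B :: "('l, ('n, 'k) dop, 'm) cell set"
  assumes B: "\<And>b. b \<in> B \<Longrightarrow> \<exists>l m. b = Gen l m \<and> m \<in> piece M (deg b)"
  shows "gr_dmap (dfree deg B) M (augmentation M)"
proof -
  interpret X: gr_dmodule "dfree deg B :: (('n, 'k) dop, _) grmod" by (rule gr_dmoduleI[OF dfree_graded])
  define val where "val b a = (case b of Gen l m \<Rightarrow> mact M a m | Syz l xs \<Rightarrow> 0)"
    for b :: "('l, ('n, 'k) dop, 'm) cell" and a
  have v: "val b a \<in> mcar M" "val b (a + a') = val b a + val b a'" "val b (a * a') = mact M a (val b a')" "val b 0 = 0"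
    if b: "b \<in> B" for b a a'
  proof -
    obtain l m where "b = Gen l m" "m \<in> piece M (deg b)" using B[OF b] by blast
    then show "val b a \<in> mcar M" "val b (a + a') = val b a + val b a'" "val b (a * a') = mact M a (val b a')" "val b 0 = 0"
      by (simp_all add: val_def act_closed act_add2 act_mult act_02 piece_car)
  qed
  have vp: "val b a \<in> piece M (deg b + e)" if b: "b \<in> B" and a: "a \<in> dop_piece e" for b a e
  proof -
    obtain l m where "b = Gen l m" "m \<in> piece M (deg b)" using B[OF b] by blast
    then show ?thesis using act_piece[of e a m "deg b"] a by (simp add: val_def dop_piece_def)
  qed
  \<comment> \<open>\<open>augmentation\<close> sums over the support, which varies with
    \<open>f\<close>. Over a fixed finite superset the sum is visibly additive.\<close>
  have aug: "augmentation M f = (\<Sum>b\<in>A. val b (Poly_Mapping.lookup f b))"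
    if f: "f \<in> mcar (dfree deg B)" and A: "finite A" "Poly_Mapping.keys f \<subseteq> A" "A \<subseteq> B" for f A
  proof -
    have "augmentation M f = (\<Sum>b\<in>Poly_Mapping.keys f. val b (Poly_Mapping.lookup f b))"
      by (simp add: augmentation_def val_def)
    also have "\<dots> = (\<Sum>b\<in>A. val b (Poly_Mapping.lookup f b))"
      using A v(4) by (intro sum.mono_neutral_left) (auto simp: in_keys_iff)
    finally show ?thesis .
  qed
  have kB: "Poly_Mapping.keys f \<subseteq> B" if "f \<in> mcar (dfree deg B)" for f :: "('l, ('n, 'k) dop, 'm) cell \<Rightarrow>\<^sub>0 ('n, 'k) dop"
    using that by (simp add: dfree_simps)
  show ?thesis
  proof
    fix x :: "('l, ('n, 'k) dop, 'm) cell \<Rightarrow>\<^sub>0 ('n, 'k) dop" and P assume x: "x \<in> mcar (dfree deg B)"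
    note ax = aug[OF x finite_keys order_refl kB[OF x]]
    show "augmentation M x \<in> mcar M"
      unfolding ax using kB[OF x] v(1) by (intro car_sum) blast
    have "augmentation M (mact (dfree deg B) P x) = (\<Sum>b\<in>Poly_Mapping.keys x. val b (Poly_Mapping.lookup (free_act P x) b))"
      unfolding dfree_simps(2) using X.act_closed[OF x, of P, unfolded dfree_simps(2)] kB[OF x]
      by (intro aug keys_free_act finite_keys)
    also have "\<dots> = (\<Sum>b\<in>Poly_Mapping.keys x. mact M P (val b (Poly_Mapping.lookup x b)))"
      using kB[OF x] by (intro sum.cong refl) (auto simp: lookup_free_act v(3))
    also have "\<dots> = mact M P (augmentation M x)"
      unfolding ax using kB[OF x] v(1) by (intro act_sum[symmetric]) blast
    finally show "augmentation M (mact (dfree deg B) P x) = mact M P (augmentation M x)" .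
    fix y :: "('l, ('n, 'k) dop, 'm) cell \<Rightarrow>\<^sub>0 ('n, 'k) dop" assume y: "y \<in> mcar (dfree deg B)"
    let ?A = "Poly_Mapping.keys x \<union> Poly_Mapping.keys y"
    have A: "finite ?A" "?A \<subseteq> B" using kB[OF x] kB[OF y] by auto
    have "augmentation M (x + y) = (\<Sum>b\<in>?A. val b (Poly_Mapping.lookup x b + Poly_Mapping.lookup y b))"
      using aug[OF X.car_add[OF x y] A(1) _ A(2)] Poly_Mapping.keys_add[of x y] by (simp add: lookup_add)
    also have "\<dots> = (\<Sum>b\<in>?A. val b (Poly_Mapping.lookup x b) + val b (Poly_Mapping.lookup y b))"
      by (intro sum.cong refl v(2)) (use A(2) in blast)
    also have "\<dots> = augmentation M x + augmentation M y"
      using aug[OF x A(1) _ A(2)] aug[OF y A(1) _ A(2)] by (simp add: sum.distrib)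
    finally show "augmentation M (x + y) = augmentation M x + augmentation M y" .
  next
    fix x :: "('l, ('n, 'k) dop, 'm) cell \<Rightarrow>\<^sub>0 ('n, 'k) dop" and l assume x: "x \<in> piece (dfree deg B) l"
    have "val b (Poly_Mapping.lookup x b) \<in> piece M l" if b: "b \<in> Poly_Mapping.keys x" for b
    proof -
      have "b \<in> B" "Poly_Mapping.lookup x b \<in> dop_piece (l - deg b)" using x b by (auto simp: dfree_simps)
      from vp[OF this] show ?thesis by simp
    qed
    then show "augmentation M x \<in> piece M l"
      unfolding aug[OF X.piece_car[OF x] finite_keys order_refl kB[OF X.piece_car[OF x]]]
      by (intro add_subgroup_sum[OF piece_subgroup])
  qed
qed

text \<open>The standard graded resolution provides preimages of homogeneous elements. A general
  element of the kernel is lifted component by component, since its components lie in the kernel as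
  well.\<close>

lemma exact_from_pieces:
  assumes h: "gr_dmap N M h" and g: "gr_dmap M M' g"
    and ex: "\<And>l x. x \<in> piece M l \<Longrightarrow> g x = 0 \<Longrightarrow> \<exists>y\<in>mcar N. h y = x"
    and x: "x \<in> mcar M" "g x = 0"
  shows "\<exists>y\<in>mcar N. h y = x"
proof -
  interpret H: gr_dmap N M h by fact
  interpret G: gr_dmap M M' g by fact
  interpret C: graded_space "mcar M" "\<lambda>c. mact M (dconst c)" "mod_proj M" by (rule H.B.graded_space_car)
  interpret C': graded_space "mcar M'" "\<lambda>c. mact M' (dconst c)" "mod_proj M'" by (rule G.B.graded_space_car)
  have "\<exists>y\<in>mcar N. h y = mod_proj M l x" for l
    by (rule ex[OF H.B.proj_piece[OF x(1)]]) (simp add: G.g_proj[OF x(1), symmetric] x(2) C'.pr_0)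
  then obtain y where y: "\<And>l. y l \<in> mcar N" "\<And>l. h (y l) = mod_proj M l x" by metis
  have "h (\<Sum>l\<in>A. y l) = (\<Sum>l\<in>A. h (y l))" for A
    by (induction A rule: infinite_finite_induct) (simp_all add: H.g_0 H.g_add y(1) H.A.car_sum)
  then have "h (\<Sum>l | mod_proj M l x \<noteq> 0. y l) = x" using C.pr_sum[OF x(1)] y(2) by simp
  moreover have "(\<Sum>l | mod_proj M l x \<noteq> 0. y l) \<in> mcar N" by (rule H.A.car_sum) (rule y(1))
  ultimately show ?thesis by blast
qed

lemma gr_res_dfree: "gr_res dop_piece M p = dfree cell_deg (gr_res_basis dop_piece M p)"
  by (simp add: gr_res_def)

context gr_dmodule
begin

lemma gr_res_boundary_map:
  "gr_dmap (gr_res dop_piece M (Suc p)) (gr_res dop_piece M p) boundary"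
  unfolding gr_res_dfree by (rule boundary_map) (auto intro!: lin_comb_piece)

lemma gr_res_augmentation_map: "gr_dmap (gr_res dop_piece M 0) M (augmentation M)"
  unfolding gr_res_dfree by (rule augmentation_map) auto

lemma gr_res_resolution:
  "free_resolution M (gr_res dop_piece M) (\<lambda>_. cell_deg) (gr_res_basis dop_piece M) boundary (augmentation M)"
proof (intro free_resolution.intro free_resolution_axioms.intro)
  show "gr_dmodule M" by (rule gr_dmodule_axioms)
  show "gr_res dop_piece M p = dfree cell_deg (gr_res_basis dop_piece M p)" for p by (rule gr_res_dfree)
  show b: "gr_dmap (gr_res dop_piece M (Suc p)) (gr_res dop_piece M p) boundary" for p
    by (rule gr_res_boundary_map)
  show a: "gr_dmap (gr_res dop_piece M 0) M (augmentation M)" by (rule gr_res_augmentation_map)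
  show "boundary (boundary f) = 0" if "f \<in> mcar (gr_res dop_piece M (Suc (Suc p)))" for f p
    by (rule boundary_boundary_gr_res[OF that])
  interpret A: gr_dmap "gr_res dop_piece M 0" M "augmentation M" by (rule a)
  show "augmentation M (boundary f) = 0" if f: "f \<in> mcar (gr_res dop_piece M (Suc 0))" for f
  proof -
    have s: "augmentation M (boundary (Poly_Mapping.single b P)) = 0" "boundary (Poly_Mapping.single b P) \<in> mcar (gr_res dop_piece M 0)"
      if b: "b \<in> gr_res_basis dop_piece M (Suc 0)" for b P
    proof -
      obtain l xs where xs: "b = Syz l xs" "\<forall>(a, c)\<in>set xs. c \<in> gr_res_basis dop_piece M 0 \<and> a \<in> dop_piece (l - cell_deg c)"
          "augmentation M (lin_comb xs) = 0" using b by auto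
      have "lin_comb xs \<in> piece (gr_res dop_piece M 0) l"
        unfolding gr_res_dfree by (rule lin_comb_piece) (use xs(2) in blast)
      then have c: "lin_comb xs \<in> mcar (gr_res dop_piece M 0)" by (rule A.A.piece_car)
      have e: "boundary (Poly_Mapping.single b P) = mact (gr_res dop_piece M 0) P (lin_comb xs)"
        by (simp add: xs(1) boundary_single gr_res_dfree dfree_simps)
      show "augmentation M (boundary (Poly_Mapping.single b P)) = 0"
        unfolding e A.g_act[OF c] xs(3) by (rule act_0)
      show "boundary (Poly_Mapping.single b P) \<in> mcar (gr_res dop_piece M 0)"
        unfolding e by (rule A.A.act_closed[OF c])
    qed
    have k: "b \<in> Poly_Mapping.keys f \<Longrightarrow> b \<in> gr_res_basis dop_piece M (Suc 0)" for b
      using f unfolding gr_res_dfree dfree_simps by blast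
    have "augmentation M (\<Sum>b\<in>A. boundary (Poly_Mapping.single b (Poly_Mapping.lookup f b))) = 0"
      if "A \<subseteq> Poly_Mapping.keys f" for A
      using that
    proof (induction A rule: infinite_finite_induct)
      case (insert b A)
      have "augmentation M (boundary (Poly_Mapping.single b (Poly_Mapping.lookup f b)) +
          (\<Sum>b\<in>A. boundary (Poly_Mapping.single b (Poly_Mapping.lookup f b)))) = 0"
        using insert s k by (subst A.g_add) (auto intro!: A.A.car_sum simp del: gr_res_basis.simps)
      then show ?case using insert.hyps by simp
    qed (simp_all add: A.g_0)
    from this[OF order_refl] show ?thesis unfolding boundary_sum[of f, symmetric] .
  qed
  show "\<exists>h\<in>mcar (gr_res dop_piece M (Suc (Suc p))). boundary h = f"
    if "f \<in> mcar (gr_res dop_piece M (Suc p))" "boundary f = 0" for f p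
  proof (rule exact_from_pieces[OF b b _ that])
    interpret X: gr_dmap "gr_res dop_piece M (Suc (Suc p))" "gr_res dop_piece M (Suc p)" boundary by (rule b)
    fix l x assume "x \<in> piece (gr_res dop_piece M (Suc p)) l" "boundary x = 0"
    then have "\<exists>g\<in>piece (gr_res dop_piece M (Suc (Suc p))) l. boundary g = x"
      using gr_res_exact_Suc[of dop_piece x M "Suc p" l] one_dop_piece by simp
    then show "\<exists>y\<in>mcar (gr_res dop_piece M (Suc (Suc p))). boundary y = x" using X.A.piece_car by blast
  qed
  show "\<exists>h\<in>mcar (gr_res dop_piece M (Suc 0)). boundary h = f"
    if "f \<in> mcar (gr_res dop_piece M 0)" "augmentation M f = 0" for f
  proof (rule exact_from_pieces[OF b a _ that])
    interpret X: gr_dmap "gr_res dop_piece M (Suc 0)" "gr_res dop_piece M 0" boundary by (rule b)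
    fix l x assume "x \<in> piece (gr_res dop_piece M 0) l" "augmentation M x = 0"
    then have "\<exists>g\<in>piece (gr_res dop_piece M (Suc 0)) l. boundary g = x"
      using gr_res_exact_Suc[of dop_piece x M 0 l] one_dop_piece by simp
    then show "\<exists>y\<in>mcar (gr_res dop_piece M (Suc 0)). boundary y = x" using X.A.piece_car by blast
  qed
  show "\<exists>f\<in>mcar (gr_res dop_piece M 0). augmentation M f = m" if m: "m \<in> mcar M" for m
  proof -
    interpret C: graded_space "mcar M" "\<lambda>c. mact M (dconst c)" "mod_proj M" by (rule graded_space_car)
    have "\<exists>f\<in>mcar (gr_res dop_piece M 0). augmentation M f = mod_proj M l m" for l
      using gr_res_exact_0[of M dop_piece, OF left one_dop_piece _ proj_piece[OF m, of l]] A.A.piece_car piece_car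
      by blast
    then obtain y where y: "\<And>l. y l \<in> mcar (gr_res dop_piece M 0)" "\<And>l. augmentation M (y l) = mod_proj M l m" by metis
    have "augmentation M (\<Sum>l\<in>S. y l) = (\<Sum>l\<in>S. augmentation M (y l))" for S
      by (induction S rule: infinite_finite_induct) (simp_all add: A.g_0 A.g_add y(1) A.A.car_sum)
    then have "augmentation M (\<Sum>l | mod_proj M l m \<noteq> 0. y l) = m" using C.pr_sum[OF m] y(2) by simp
    moreover have "(\<Sum>l | mod_proj M l m \<noteq> 0. y l) \<in> mcar (gr_res dop_piece M 0)" by (rule A.A.car_sum) (rule y(1))
    ultimately show ?thesis by blast
  qed
qed

text \<open>At index \<open>-1\<close> the complex is \<open>{0}\<close>, so the coboundaries are
  trivial for \<open>i = 0\<close>.\<close>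

lemma cohomology_nat:
  assumes "\<And>f. \<delta> (- 1) 0 = 0"
  shows "cohomology s (\<lambda>j. if j < 0 then {0} else C (nat j)) \<delta> (int i) =
    quotient_space s {x \<in> C i. \<delta> (int i) x = 0} (case i of 0 \<Rightarrow> {0} | Suc i' \<Rightarrow> \<delta> (int i') ` C i')"
  using assms by (cases i) (simp_all add: cohomology_def nat_add_distrib)

theorem matlis_star_Ext: "H_dR (matlis_dual M) (int i) \<cong>\<^sub>k star_Ext_D i M inv_module"
proof -
  interpret R: free_resolution M "gr_res dop_piece M" "\<lambda>_. cell_deg" "gr_res_basis dop_piece M" boundary "augmentation M"
    by (rule gr_res_resolution)
  have "star_Ext_D i M inv_module = quotient_space hom_scale
      {g \<in> star_hom (gr_res dop_piece M i) inv_module. R.hom_diff i g = 0}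
      (case i of 0 \<Rightarrow> {0} | Suc i' \<Rightarrow> R.hom_diff i' ` star_hom (gr_res dop_piece M i') inv_module)"
    unfolding star_Ext_D_def
    by (subst cohomology_nat) (auto simp: R.hom_diff_def hom_scale_def[abs_def] nat_add_distrib fun_eq_iff cong: nat.case_cong)
  with kspace_iso_trans[OF matlis_de_Rham[of "int i"] R.star_ext_cochains[of i]] show ?thesis by simp
qed

end

section \<open>The Noetherian property\<close>

text \<open>With the action as a parameter, one definition serves for left ideals, for submodules of
  free modules and, with constants acting, for spans over \<open>k\<close>.\<close>

inductive_set act_span :: "('a \<Rightarrow> 'm \<Rightarrow> 'm::ab_group_add) \<Rightarrow> 'm set \<Rightarrow> 'm set" for act G where
  zero: "0 \<in> act_span act G"
| step: "x \<in> act_span act G \<Longrightarrow> g \<in> G \<Longrightarrow> x + act P g \<in> act_span act G"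

lemma act_span_add: "y \<in> act_span act G \<Longrightarrow> x \<in> act_span act G \<Longrightarrow> x + y \<in> act_span act G"
proof (induction y rule: act_span.induct)
  case (step y g P)
  have "x + y + act P g \<in> act_span act G" by (rule act_span.step[OF step.IH[OF step.prems] step.hyps(2)])
  then show ?case by (simp add: add.assoc)
qed simp

lemma act_span_act: "g \<in> G \<Longrightarrow> act P g \<in> act_span act G"
  using act_span.step[OF act_span.zero, of g G act P] by simp

lemma act_span_mono: "G \<subseteq> H \<Longrightarrow> x \<in> act_span act G \<Longrightarrow> x \<in> act_span act H"
proof -
  assume G: "G \<subseteq> H" and x: "x \<in> act_span act G"
  from x show "x \<in> act_span act H"
  proof (induction x rule: act_span.induct)
    case (step x g P)
    then show ?case using G by (intro act_span.step) blast+
  qed (rule act_span.zero)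
qed

lemma act_span_map:
  assumes x: "x \<in> act_span act G" and f0: "f 0 \<in> S"
    and f: "\<And>x y. f (x + y) = f x + f y" "\<And>P g. g \<in> G \<Longrightarrow> f (act P g) \<in> S"
    and S: "\<And>x y. x \<in> S \<Longrightarrow> y \<in> S \<Longrightarrow> x + y \<in> S"
  shows "f x \<in> S"
  using x by (induction x rule: act_span.induct) (auto simp: f0 f S)

lemma act_span_sum: "(\<And>i. i \<in> I \<Longrightarrow> f i \<in> act_span act G) \<Longrightarrow> sum f I \<in> act_span act G"
  by (induction I rule: infinite_finite_induct) (auto intro: act_span.zero act_span_add)

lemma act_span_finite: "x \<in> act_span act G \<Longrightarrow> \<exists>A. finite A \<and> A \<subseteq> G \<and> x \<in> act_span act A"
proof (induction x rule: act_span.induct)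
  case zero
  show ?case using act_span.zero by blast
next
  case (step x g P)
  then obtain A where A: "finite A" "A \<subseteq> G" "x \<in> act_span act A" by blast
  have "x + act P g \<in> act_span act (insert g A)"
    by (rule act_span.step[OF act_span_mono[OF subset_insertI A(3)]]) simp
  with A step.hyps(2) show ?case by (intro exI[of _ "insert g A"]) auto
qed

text \<open>Dickson's lemma, by induction on the set of coordinates. Elements whose coordinate
  \<open>k\<close> is at least \<open>N\<close> are dominated by the finite set found for the other
  coordinates; the finitely many slices below \<open>N\<close> are treated separately.\<close>

lemma dickson_aux:
  assumes "finite K"
  shows "\<exists>T. finite T \<and> T \<subseteq> S \<and> (\<forall>s\<in>S. \<exists>t\<in>T. \<forall>i\<in>K. f t i \<le> (f s i :: nat))"
  using assms
proof (induction K arbitrary: S)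
  case empty
  show ?case
  proof (cases "S = {}")
    case False
    then obtain s where "s \<in> S" by blast
    then show ?thesis by (intro exI[of _ "{s}"]) auto
  qed auto
next
  case (insert k K)
  obtain T0 where T0: "finite T0" "T0 \<subseteq> S" "\<And>s. s \<in> S \<Longrightarrow> \<exists>t\<in>T0. \<forall>i\<in>K. f t i \<le> f s i"
    using insert.IH[of S] by blast
  define N where "N = (\<Sum>t\<in>T0. f t k)"
  have N: "f t k \<le> N" if "t \<in> T0" for t unfolding N_def using T0(1) that by (intro member_le_sum) auto
  have "\<forall>j. \<exists>T. finite T \<and> T \<subseteq> {s \<in> S. f s k = j} \<and> (\<forall>s\<in>{s \<in> S. f s k = j}. \<exists>t\<in>T. \<forall>i\<in>K. f t i \<le> f s i)"
    using insert.IH by blast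
  from choice[OF this] obtain T where T': "\<forall>j. finite (T j) \<and> T j \<subseteq> {s \<in> S. f s k = j} \<and>
      (\<forall>s\<in>{s \<in> S. f s k = j}. \<exists>t\<in>T j. \<forall>i\<in>K. f t i \<le> f s i)" by blast
  then have T: "\<And>j. finite (T j)" "\<And>j. T j \<subseteq> {s \<in> S. f s k = j}"
    "\<And>j s. s \<in> S \<Longrightarrow> f s k = j \<Longrightarrow> \<exists>t\<in>T j. \<forall>i\<in>K. f t i \<le> f s i" by blast+
  let ?T = "T0 \<union> (\<Union>j<N. T j)"
  have "\<exists>t\<in>?T. \<forall>i\<in>insert k K. f t i \<le> f s i" if s: "s \<in> S" for s
  proof (cases "f s k < N")
    case True
    obtain t where "t \<in> T (f s k)" "\<forall>i\<in>K. f t i \<le> f s i" using T(3)[OF s refl] by blast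
    moreover from this have "f t k = f s k" using T(2) by blast
    ultimately show ?thesis using True by (intro bexI[of _ t]) auto
  next
    case False
    obtain t where "t \<in> T0" "\<forall>i\<in>K. f t i \<le> f s i" using T0(3)[OF s] by blast
    then show ?thesis using N False by (intro bexI[of _ t]) force+
  qed
  moreover have "finite ?T" using T0 T(1) by simp
  moreover have "?T \<subseteq> S" using T0 T(2) by blast
  ultimately show ?case by blast
qed

text \<open>Exponents of \<open>x^a \<partial>^b\<close>, written as multisets of indices because
  these carry a linear order compatible with sums.\<close>

type_synonym 'n wexp = "'n multiset \<times> 'n multiset"

definition wdeg :: "'n wexp \<Rightarrow> nat" where
  "wdeg e = size (fst e) + size (snd e)"

lemma wexp_dickson:
  fixes S :: "'n::finite wexp set"
  shows "\<exists>T. finite T \<and> T \<subseteq> S \<and> (\<forall>s\<in>S. \<exists>t\<in>T. \<exists>d. s = d + t)"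
proof -
  define f where "f e i = (case i of Inl j \<Rightarrow> count (fst e) j | Inr j \<Rightarrow> count (snd e) j)" for e :: "'n wexp" and i
  obtain T where T: "finite T" "T \<subseteq> S" "\<And>s. s \<in> S \<Longrightarrow> \<exists>t\<in>T. \<forall>i\<in>UNIV. f t i \<le> f s i"
    using dickson_aux[of "UNIV :: ('n + 'n) set" S f] by auto
  have "\<exists>d. s = d + t" if st: "\<forall>i\<in>UNIV. f t i \<le> f s i" for s t
  proof -
    have "fst t \<subseteq># fst s" "snd t \<subseteq># snd s"
      using st[rule_format, of "Inl _"] st[rule_format, of "Inr _"] by (auto simp: subseteq_mset_def f_def)
    then have "s = (fst s - fst t, snd s - snd t) + t" by (simp add: prod_eq_iff)
    then show ?thesis by blast
  qed
  with T show ?thesis by meson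
qed

text \<open>A graded monomial order. Total degree comes first because the corrections from
  commutators have smaller total degree; ties are broken by the multiset order.\<close>

definition prec :: "'n::linorder wexp \<Rightarrow> 'n wexp \<Rightarrow> bool" where
  "prec e e' \<longleftrightarrow> wdeg e < wdeg e' \<or>
     wdeg e = wdeg e' \<and> (fst e < fst e' \<or> fst e = fst e' \<and> snd e < snd e')"

lemma prec_irrefl: "\<not> prec e e"
  by (simp add: prec_def)

lemma prec_trans: "prec e e' \<Longrightarrow> prec e' e'' \<Longrightarrow> prec e e''"
  unfolding prec_def by (elim disjE conjE) (auto dest: less_trans)

lemma prec_total: "e = e' \<or> prec e e' \<or> prec e' e"
  using linorder_less_linear[of "fst e" "fst e'"] linorder_less_linear[of "snd e" "snd e'"]
  by (auto simp: prec_def prod_eq_iff)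

lemma wdeg_add: "wdeg (d + e) = wdeg d + wdeg e"
  by (simp add: wdeg_def)

lemma prec_add: "prec e e' \<Longrightarrow> prec (d + e) (d + e')"
  by (auto simp: prec_def wdeg_add)

lemma finite_msets: "finite {a :: 'n::finite multiset. size a \<le> N}" (is "finite ?A")
proof (rule finite_imageD[where f = count])
  have "count ` ?A \<subseteq> {f. \<forall>i. (i \<in> UNIV \<longrightarrow> f i \<in> {..N}) \<and> (i \<notin> UNIV \<longrightarrow> f i = 0)}"
    by (auto intro: order_trans[OF count_le_size])
  then show "finite (count ` ?A)" by (rule finite_subset) (intro finite_set_of_finite_funs; simp)
  show "inj_on count ?A" by (simp add: inj_on_def count_inject)
qed

text \<open>There are finitely many exponents of bounded total degree. The induction principle
  \<open>prec_induct\<close> rests on this.\<close>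

lemma finite_lower: "finite {e'. prec e' (e :: 'n::{finite,linorder} wexp)}"
proof (rule finite_subset)
  show "{e'. prec e' e} \<subseteq> {a. size a \<le> wdeg e} \<times> {a. size a \<le> wdeg e}"
    by (auto simp: prec_def wdeg_def)
  show "finite ({a :: 'n multiset. size a \<le> wdeg e} \<times> {a :: 'n multiset. size a \<le> wdeg e})"
    by (intro finite_cartesian_product finite_msets)
qed

lemma prec_induct:
  assumes "\<And>e. (\<And>e'. prec e' e \<Longrightarrow> P e') \<Longrightarrow> P (e :: 'n::{finite,linorder} wexp)"
  shows "P e"
proof (induction "card {e'. prec e' e}" arbitrary: e rule: less_induct)
  case less
  show ?case
  proof (rule assms)
    fix e' assume e': "prec e' e"
    have "{f. prec f e'} \<subset> {f. prec f e}" using e' prec_trans prec_irrefl by blast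
    then show "P e'" by (intro less psubset_card_mono finite_lower)
  qed
qed

lemma prec_max:
  assumes "finite A" "A \<noteq> {}"
  shows "\<exists>m\<in>A. \<forall>x\<in>A. x = m \<or> prec x m"
  using assms
proof (induction A rule: finite_ne_induct)
  case (insert x A)
  then obtain m where m: "m \<in> A" "\<forall>y\<in>A. y = m \<or> prec y m" by blast
  show ?case
  proof (cases "prec m x")
    case True
    then have "\<forall>y\<in>A. prec y x" using m prec_trans by metis
    then show ?thesis by (intro bexI[of _ x]) auto
  next
    case False
    then show ?thesis using m prec_total[of x m] by (intro bexI[of _ m]) auto
  qed
qed simp

section \<open>Normally ordered monomials\<close>

definition wx :: "'n multiset \<Rightarrow> ('n, 'k::comm_ring_1) dop" where
  "wx a = dmult (\<Prod>i\<in>#a. pvar i)"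

text \<open>The order of the factors does not matter because the \<partial>_i commute, which is what
  makes the fold over a multiset legitimate.\<close>

definition wd :: "'n multiset \<Rightarrow> ('n, 'k::comm_ring_1) dop" where
  "wd b = fold_mset (\<lambda>i P. dpart i * P) 1 b"

definition wmono :: "'n wexp \<Rightarrow> ('n, 'k::comm_ring_1) dop" where
  "wmono e = wx (fst e) * wd (snd e)"

lemma wd_add: "wd (add_mset i b) = dpart i * wd b"
proof -
  interpret comp_fun_commute "\<lambda>i P. dpart i * (P :: ('a, 'b) dop)"
    by unfold_locales (auto simp: fun_eq_iff mult.assoc[symmetric] dpart_commutes)
  show ?thesis by (simp add: wd_def)
qed

lemma wmono_x: "dmult (pvar i) * wmono (a, b) = wmono (add_mset i a, b)"
  by (simp add: wmono_def wx_def dmult_mult mult.assoc)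

lemma wmono_d: "dpart i * wmono ({#}, b) = wmono ({#}, add_mset i b)"
  by (simp add: wmono_def wx_def wd_add dmult_1)

lemma wmono_0: "wmono ({#}, {#}) = 1"
  by (simp add: wmono_def wx_def wd_def dmult_1)

abbreviation wspan :: "'n wexp set \<Rightarrow> ('n, 'k::comm_ring_1) dop set" where
  "wspan T \<equiv> act_span (\<lambda>c. (*) (dconst c)) (wmono ` T)"

lemma wspan_mono: "e \<in> T \<Longrightarrow> wmono e \<in> wspan T"
  using act_span_act[of "wmono e" "wmono ` T" "\<lambda>c. (*) (dconst c)" 1] by (simp add: pconst_1 dmult_1)

lemma wspan_scale:
  fixes P :: "('n, 'k::comm_ring_1) dop"
  shows "P \<in> wspan T \<Longrightarrow> dconst c * P \<in> wspan T"
proof (rule act_span_map[where f = "\<lambda>P. dconst c * P"])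
  fix c' :: 'k and g :: "('n, 'k) dop" assume "g \<in> wmono ` T"
  then have "dconst (c * c') * g \<in> wspan T" by (rule act_span_act)
  then show "dconst c * (dconst c' * g) \<in> wspan T" by (simp add: pconst_mult dmult_mult mult.assoc)
qed (auto intro: act_span.zero act_span_add simp: distrib_left)

lemma wspan_neg: "P \<in> wspan T \<Longrightarrow> - P \<in> wspan T"
proof -
  assume "P \<in> wspan T"
  then have "dconst (- 1) * P \<in> wspan T" by (rule wspan_scale)
  moreover have "dconst (- 1) * P = - P"
    by (rule dop_eqI) (simp add: uminus_dop.rep_eq times_dop.rep_eq Rep_dmult pconst_def single_uminus)
  ultimately show ?thesis by simp
qed

lemma wspan_diff: "P \<in> wspan T \<Longrightarrow> Q \<in> wspan T \<Longrightarrow> P - Q \<in> wspan T"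
  using act_span_add[OF wspan_neg, of Q T P] by simp

lemma wspan_subset: "P \<in> wspan T \<Longrightarrow> T \<subseteq> T' \<Longrightarrow> P \<in> wspan T'"
  by (rule act_span_mono[OF image_mono])

lemma wspan_mult:
  fixes P :: "('n, 'k::comm_ring_1) dop"
  assumes P: "P \<in> wspan T" and Q: "\<And>e. e \<in> T \<Longrightarrow> Q * wmono e \<in> wspan T'"
  shows "Q * P \<in> wspan T'"
proof (rule act_span_map[where f = "\<lambda>P. Q * P", OF P])
  fix c :: 'k and g :: "('n, 'k) dop" assume "g \<in> wmono ` T"
  then have "dconst c * (Q * g) \<in> wspan T'" using Q by (auto intro: wspan_scale)
  moreover have "Q * (dconst c * g) = dconst c * (Q * g)" by (metis dconst_commute mult.assoc)
  ultimately show "Q * (dconst c * g) \<in> wspan T'" by simp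
qed (auto intro: act_span.zero act_span_add simp: distrib_left)

abbreviation wbelow :: "nat \<Rightarrow> 'n wexp set" where
  "wbelow j \<equiv> {e. wdeg e < j}"

lemma wspan_x: "P \<in> wspan (wbelow j) \<Longrightarrow> dmult (pvar i) * P \<in> wspan (wbelow (Suc j))"
  by (erule wspan_mult) (auto simp: wmono_x wdeg_def intro!: wspan_mono)

text \<open>Moving \<partial>_i to the right through \<open>x^a\<close> only creates terms in which
  one factor x_i has been cancelled, so the correction lies below the leading term in total
  degree.\<close>

lemma part_wmono:
  "(dpart i * wmono (a, b) - wmono (a, add_mset i b) :: ('n, 'k::comm_ring_1) dop) \<in> wspan (wbelow (Suc (size a + size b)))"
proof (induction a)
  case empty
  show ?case by (simp add: wmono_d act_span.zero)
next
  case (add j a)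
  let ?M = "wmono (a, b) :: ('n, 'k) dop"
  have pv: "dpart i * dmult (pvar j) = (if i = j then 1 else 0) + (dmult (pvar j) * dpart i :: ('n, 'k) dop)"
    by (simp add: dpart_dmults pdiff_pvar dmult_1 dmult_0)
  have "dpart i * wmono (add_mset j a, b) - wmono (add_mset j a, add_mset i b) =
      (if i = j then ?M else 0) + dmult (pvar j) * (dpart i * ?M - wmono (a, add_mset i b))"
    unfolding wmono_x[symmetric] by (simp add: mult.assoc[symmetric] pv distrib_right right_diff_distrib)
  moreover have "(if i = j then ?M else 0) \<in> wspan (wbelow (Suc (size (add_mset j a) + size b)))"
  proof (cases "i = j")
    case True
    have "?M \<in> wspan (wbelow (Suc (size (add_mset j a) + size b)))" by (rule wspan_mono) (simp add: wdeg_def)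
    then show ?thesis using True by simp
  qed (simp add: act_span.zero)
  moreover have "dmult (pvar j) * (dpart i * ?M - wmono (a, add_mset i b)) \<in> wspan (wbelow (Suc (size (add_mset j a) + size b)))"
    using wspan_x[OF add.IH, of j] by simp
  ultimately show ?case by (simp add: act_span_add)
qed

lemma wspan_d: "P \<in> wspan (wbelow j) \<Longrightarrow> dpart i * P \<in> wspan (wbelow (Suc j))"
proof (erule wspan_mult)
  fix e :: "'a wexp" assume e: "e \<in> wbelow j"
  obtain a b where ab: "e = (a, b)" by (cases e)
  have "dpart i * wmono (a, b) - wmono (a, add_mset i b) \<in> wspan (wbelow (Suc j))"
    using e by (intro wspan_subset[OF part_wmono]) (auto simp: ab wdeg_def)
  moreover have "wmono (a, add_mset i b) \<in> wspan (wbelow (Suc j))"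
    using e by (intro wspan_mono) (auto simp: ab wdeg_def)
  ultimately show "dpart i * wmono e \<in> wspan (wbelow (Suc j))"
    using act_span_add[of "wmono (a, add_mset i b)" _ _ "dpart i * wmono (a, b) - wmono (a, add_mset i b)"]
    by (simp add: ab)
qed

text \<open>Leading exponents add as in a commutative polynomial ring, because all corrections have
  smaller total degree.\<close>

lemma wmono_mult: "(wmono d * wmono e - wmono (d + e) :: ('n, 'k::comm_ring_1) dop) \<in> wspan (wbelow (wdeg d + wdeg e))"
proof (induction "fst d" arbitrary: d)
  case empty
  then have d: "d = ({#}, snd d)" by (simp add: prod_eq_iff)
  obtain a' b' where e: "e = (a', b')" by (cases e)
  have "(wmono ({#}, b) * wmono e - wmono (({#}, b) + e) :: ('n, 'k) dop) \<in> wspan (wbelow (size b + wdeg e))" for b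
  proof (induction b)
    case empty
    show ?case by (simp add: wmono_0 e act_span.zero)
  next
    case (add i b)
    have "(wmono ({#}, add_mset i b) * wmono e - wmono (({#}, add_mset i b) + e) :: ('n, 'k) dop) =
        dpart i * (wmono ({#}, b) * wmono e - wmono (({#}, b) + e)) +
        (dpart i * wmono (a', b + b') - wmono (a', add_mset i (b + b')))"
      by (simp add: wmono_d[symmetric] mult.assoc right_diff_distrib e)
    moreover have "(dpart i * (wmono ({#}, b) * wmono e - wmono (({#}, b) + e)) :: ('n, 'k) dop) \<in> wspan (wbelow (Suc (size b + wdeg e)))"
      by (rule wspan_d[OF add])
    moreover have "(dpart i * wmono (a', b + b') - wmono (a', add_mset i (b + b')) :: ('n, 'k) dop) \<in> wspan (wbelow (Suc (size b + wdeg e)))"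
      using part_wmono[of i a' "b + b'"] by (simp add: e wdeg_def add_ac)
    ultimately show ?case by (simp add: act_span_add)
  qed
  from this[of "snd d"] d show ?case by (metis wdeg_def fst_conv snd_conv size_empty add_0)
next
  case (add i a)
  then have d: "d = (add_mset i a, snd d)" by (simp add: prod_eq_iff)
  obtain b where b: "d = (add_mset i a, b)" using d by blast
  obtain a' b' where e: "e = (a', b')" by (cases e)
  have "(wmono (a, b) * wmono e - wmono ((a, b) + e) :: ('n, 'k) dop) \<in> wspan (wbelow (wdeg (a, b) + wdeg e))"
    using add.hyps(1)[of "(a, b)"] by simp
  from wspan_x[OF this, of i]
  have "(dmult (pvar i) * (wmono (a, b) * wmono e - wmono ((a, b) + e)) :: ('n, 'k) dop) \<in> wspan (wbelow (Suc (wdeg (a, b) + wdeg e)))" .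
  moreover have "(dmult (pvar i) * (wmono (a, b) * wmono e - wmono ((a, b) + e)) :: ('n, 'k) dop) = wmono d * wmono e - wmono (d + e)"
    by (simp add: right_diff_distrib mult.assoc[symmetric] wmono_x b e)
  moreover have "wdeg d = Suc (wdeg (a, b))" by (simp add: b wdeg_def)
  ultimately show ?case by simp
qed

abbreviation wlower :: "'n::linorder wexp \<Rightarrow> 'n wexp set" where
  "wlower e \<equiv> {e'. prec e' e}"

lemma wbelow_lower: "j \<le> wdeg e \<Longrightarrow> wbelow j \<subseteq> wlower e"
  by (auto simp: prec_def)

lemma wmono_mult_lower: "P \<in> wspan (wlower e) \<Longrightarrow> wmono d * P \<in> wspan (wlower (d + e))"
proof (erule wspan_mult)
  fix e' assume e': "e' \<in> wlower e"
  have "wdeg e' \<le> wdeg e" using e' by (auto simp: prec_def)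
  then have "wmono d * wmono e' - wmono (d + e') \<in> wspan (wlower (d + e))"
    by (intro wspan_subset[OF wmono_mult] wbelow_lower) (simp add: wdeg_add)
  moreover have "wmono (d + e') \<in> wspan (wlower (d + e))" using e' by (intro wspan_mono) (simp add: prec_add)
  ultimately show "wmono d * wmono e' \<in> wspan (wlower (d + e))"
    using act_span_add[of "wmono (d + e')" _ _ "wmono d * wmono e' - wmono (d + e')"] by simp
qed

text \<open>The span of the monomials contains \<open>1\<close> and is stable under left
  multiplication by multiplication operators and derivatives, hence by every operator.\<close>

lemma wspan_UNIV: "(P :: ('n::finite, 'k::comm_ring_1) dop) \<in> wspan UNIV"
proof -
  have "\<forall>Q\<in>wspan UNIV. P * Q \<in> wspan UNIV"
  proof (induction P rule: dop_induct)
    case (mult p)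
    have x: "dmult (pvar i) * Q \<in> wspan UNIV" if "Q \<in> wspan UNIV" for i and Q :: "('n, 'k) dop"
      using that by (rule wspan_mult) (metis UNIV_I prod.collapse wmono_x wspan_mono)
    have m: "\<forall>Q\<in>wspan UNIV. (dmult (pmonom a) * Q :: ('n, 'k) dop) \<in> wspan UNIV" for a
    proof (induction "total a" arbitrary: a)
      case 0
      then have "a = 0" by (intro poly_mapping_eqI) simp
      then show ?case by (simp add: dmult_1)
    next
      case (Suc m)
      obtain i where i: "Poly_Mapping.lookup a i \<noteq> 0"
        using Suc.hyps(2) by (metis (no_types, lifting) sum.neutral nat.distinct(1))
      let ?b = "a - Poly_Mapping.single i 1"
      have "dmult (pmonom a) = (dmult (pvar i) * dmult (pmonom ?b) :: ('n, 'k) dop)"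
        unfolding dmult_mult[symmetric] pvar_def mult_single exponent_decompose[OF i] by simp
      moreover have "\<forall>Q\<in>wspan UNIV. (dmult (pmonom ?b) * Q :: ('n, 'k) dop) \<in> wspan UNIV"
        using Suc.hyps(1)[of ?b] Suc.hyps(2) total_decompose[OF i] by simp
      ultimately show ?case using x by (simp add: mult.assoc)
    qed
    show ?case
    proof (induction p rule: mapping_induct)
      case (single a c)
      show ?case unfolding single_pmonom[of a c] dmult_mult using m[of a] by (simp add: mult.assoc wspan_scale)
    qed (simp_all add: dmult_0 act_span.zero dmult_add distrib_right act_span_add)
  next
    case (diff i)
    have "(dpart i * wmono e :: ('n, 'k) dop) \<in> wspan UNIV" for e
    proof -
      obtain a b where "e = (a, b)" by (cases e)
      then show ?thesis
        using act_span_add[OF wspan_subset[OF part_wmono[of i a b] subset_UNIV] wspan_mono[of "(a, add_mset i b)" UNIV]] by simp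
    qed
    then show ?case by (blast intro: wspan_mult)
  next
    case (add P P')
    then show ?case by (simp add: distrib_right act_span_add)
  next
    case (comp P P')
    then show ?case by (simp add: mult.assoc)
  qed
  moreover have "(1 :: ('n, 'k) dop) \<in> wspan UNIV"
    unfolding wmono_0[symmetric] by (rule wspan_mono) simp
  ultimately have "P * 1 \<in> wspan UNIV" by (rule bspec)
  then show ?thesis by simp
qed

lemma wspan_insert:
  fixes P :: "('n, 'k::comm_ring_1) dop"
  shows "P \<in> wspan (insert m T) \<Longrightarrow> \<exists>c. P - dconst c * wmono m \<in> wspan T"
proof (induction P rule: act_span.induct)
  case zero
  show ?case by (rule exI[of _ 0]) (simp add: pconst_0 dmult_0 act_span.zero)
next
  case (step P g c')
  then obtain c where c: "P - dconst c * wmono m \<in> wspan T" by blast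
  show ?case
  proof (cases "g = wmono m")
    case True
    then have "P + dconst c' * g - dconst (c + c') * wmono m = P - dconst c * wmono m"
      by (simp add: pconst_add dmult_add distrib_right)
    then have "P + dconst c' * g - dconst (c + c') * wmono m \<in> wspan T" using c by (simp only:)
    then show ?thesis by (rule exI)
  next
    case False
    then have "g \<in> wmono ` T" using step.hyps(2) by blast
    then have "(P - dconst c * wmono m) + dconst c' * g \<in> wspan T" by (rule act_span.step[OF c])
    then show ?thesis by (intro exI[of _ c]) (simp add: algebra_simps)
  qed
qed

text \<open>Division with remainder by elements whose leading exponents generate those of the ideal.\<close>

theorem dop_noetherian:
  fixes I :: "('n::{finite,linorder}, 'k::field_char_0) dop set"
  assumes I: "add_subgroup I" "\<And>P Q. Q \<in> I \<Longrightarrow> P * Q \<in> I"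
  shows "\<exists>G. finite G \<and> G \<subseteq> I \<and> I \<subseteq> act_span (*) G"
proof -
  \<comment> \<open>The leading exponents of elements of \<open>I\<close>, normalised to leading
    coefficient one. Dickson's lemma gives finitely many of them that divide all others.\<close>
  define L where "L = {e. \<exists>P\<in>I. P - wmono e \<in> wspan (wlower e)}"
  obtain T where T: "finite T" "T \<subseteq> L" "\<And>s. s \<in> L \<Longrightarrow> \<exists>t\<in>T. \<exists>d. s = d + t"
    using wexp_dickson[of L] by blast
  have "\<forall>t\<in>T. \<exists>P. P \<in> I \<and> P - wmono t \<in> wspan (wlower t)" using T(2) unfolding L_def by blast
  then obtain g where g: "\<And>t. t \<in> T \<Longrightarrow> g t \<in> I" "\<And>t. t \<in> T \<Longrightarrow> g t - wmono t \<in> wspan (wlower t)"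
    by metis
  let ?S = "act_span (*) (g ` T)"
  \<comment> \<open>The exponent \<open>e\<close> is a strict upper bound for those in
    \<open>P\<close>. Subtracting a multiple of a generator that cancels the leading term replaces
    this bound by the leading exponent \<open>m\<close> of \<open>P\<close>, which is
    smaller.\<close>
  have main: "P \<in> ?S" if "P \<in> I" "P \<in> wspan (wlower e)" for P e
    using that
  proof (induction e arbitrary: P rule: prec_induct)
    case (1 e)
    obtain A' where A': "finite A'" "A' \<subseteq> wmono ` wlower e" "P \<in> act_span (\<lambda>c. (*) (dconst c)) A'"
      using act_span_finite[OF 1(3)] by blast
    obtain A where A: "finite A" "A \<subseteq> wlower e" "A' = wmono ` A"
      using finite_subset_image[OF A'(1,2)] by blast
    have PA: "P \<in> wspan A" using A'(3) A(3) by simp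
    show ?case
    proof (cases "A = {}")
      case True
      have "P = 0" using PA unfolding True by (cases rule: act_span.cases) auto
      then show ?thesis by (simp add: act_span.zero)
    next
      case False
      obtain m where m: "m \<in> A" "\<And>x. x \<in> A \<Longrightarrow> x = m \<or> prec x m" using prec_max[OF A(1) False] by blast
      have me: "prec m e" using m(1) A(2) by blast
      have "P \<in> wspan (insert m (wlower m))" using m(2) by (intro wspan_subset[OF PA]) blast
      then obtain c where c: "P - dconst c * wmono m \<in> wspan (wlower m)" using wspan_insert by blast
      show ?thesis
      proof (cases "c = 0")
        case True
        then have "P \<in> wspan (wlower m)" using c by (simp add: pconst_0 dmult_0)
        then show ?thesis using 1(1)[OF me] 1(2) by blast
      next
        case False
        have inv: "dconst (1 / c) * dconst c = (1 :: ('n, 'k) dop)"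
          using False by (simp only: dmult_mult[symmetric] pconst_mult[symmetric]) (simp add: pconst_1 dmult_1)
        have "dconst (1 / c) * (P - dconst c * wmono m) \<in> wspan (wlower m)" by (rule wspan_scale[OF c])
        then have "dconst (1 / c) * P - wmono m \<in> wspan (wlower m)"
          by (simp add: right_diff_distrib mult.assoc[symmetric] inv)
        then have "m \<in> L" unfolding L_def using I(2)[OF 1(2)] by blast
        then obtain t d where t: "t \<in> T" "m = d + t" using T(3) by blast
        have "wmono d * (g t - wmono t) \<in> wspan (wlower m)" unfolding t(2) by (rule wmono_mult_lower[OF g(2)[OF t(1)]])
        moreover have "wmono d * wmono t - wmono m \<in> wspan (wlower m)"
          unfolding t(2) by (rule wspan_subset[OF wmono_mult]) (rule wbelow_lower, simp add: wdeg_add)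
        ultimately have "wmono d * (g t - wmono t) + (wmono d * wmono t - wmono m) \<in> wspan (wlower m)"
          by (rule act_span_add[rotated])
        then have "wmono d * g t - wmono m \<in> wspan (wlower m)" by (simp add: right_diff_distrib)
        from wspan_diff[OF c wspan_scale[OF this, of c]]
        have "(P - dconst c * wmono m) - dconst c * (wmono d * g t - wmono m) \<in> wspan (wlower m)" .
        then have r: "P - dconst c * wmono d * g t \<in> wspan (wlower m)"
          by (simp add: right_diff_distrib mult.assoc)
        have "P - dconst c * wmono d * g t \<in> I"
          using I(2)[OF g(1)[OF t(1)]] by (intro add_subgroup_diff[OF I(1)] 1(2)) blast
        then have "P - dconst c * wmono d * g t \<in> ?S" using 1(1)[OF me] r by blast
        then have "P - dconst c * wmono d * g t + dconst c * wmono d * g t \<in> ?S"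
          using t(1) by (intro act_span_add act_span_act) auto
        then show ?thesis by simp
      qed
    qed
  qed
  have "I \<subseteq> ?S"
  proof
    fix P assume P: "P \<in> I"
    obtain A' where A': "finite A'" "A' \<subseteq> wmono ` UNIV" "P \<in> act_span (\<lambda>c. (*) (dconst c)) A'"
      using act_span_finite[OF wspan_UNIV[of P]] by blast
    obtain A :: "'n wexp set" where A: "finite A" "A' = wmono ` A"
      using finite_subset_image[OF A'(1,2)] by blast
    \<comment> \<open>An exponent above all those occurring in \<open>P\<close>, because its total
      degree is larger; any variable will do.\<close>
    let ?e = "(replicate_mset (Suc (\<Sum>a\<in>A. wdeg a)) (undefined :: 'n), {#})"
    have "A \<subseteq> wlower ?e"
    proof
      fix a assume "a \<in> A"
      then have "wdeg a \<le> (\<Sum>a\<in>A. wdeg a)" using A(1) by (intro member_le_sum) auto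
      moreover have "wdeg ?e = Suc (\<Sum>a\<in>A. wdeg a)" by (simp add: wdeg_def)
      ultimately show "a \<in> wlower ?e" by (simp add: prec_def)
    qed
    then have "P \<in> wspan (wlower ?e)" using A'(3) unfolding A(2) by (rule wspan_subset[rotated])
    then show "P \<in> ?S" by (rule main[OF P])
  qed
  then show ?thesis using T(1) g(1) by (intro exI[of _ "g ` T"]) auto
qed

text \<open>Induction on the basis: the coordinates at \<open>b\<close> form a left ideal, to which
  \<open>dop_noetherian\<close> applies, and the elements with vanishing coordinate at
  \<open>b\<close> live on the smaller basis.\<close>

theorem free_noetherian:
  fixes K :: "('b \<Rightarrow>\<^sub>0 ('n::{finite,linorder}, 'k::field_char_0) dop) set"
  assumes "finite B" "add_subgroup K" "\<And>P f. f \<in> K \<Longrightarrow> free_act P f \<in> K" "\<And>f. f \<in> K \<Longrightarrow> Poly_Mapping.keys f \<subseteq> B"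
  shows "\<exists>G. finite G \<and> G \<subseteq> K \<and> K \<subseteq> act_span free_act G"
  using assms
proof (induction B arbitrary: K)
  case empty
  then have "K \<subseteq> act_span free_act {}" using act_span.zero by (metis keys_eq_empty subset_empty subsetI)
  then show ?case by blast
next
  case (insert b B)
  note K = insert.prems
  let ?I = "(\<lambda>f. Poly_Mapping.lookup f b) ` K"
  have "add_subgroup ?I"
  proof (rule add_subgroupI)
    show "0 \<in> ?I" using K(1) by (auto simp: add_subgroup_def intro!: image_eqI[of _ _ 0])
    fix x y assume "x \<in> ?I" "y \<in> ?I"
    then obtain f h where "f \<in> K" "h \<in> K" "x - y = Poly_Mapping.lookup (f - h) b" by (auto simp: lookup_minus)
    then show "x - y \<in> ?I" using add_subgroup_diff[OF K(1)] by blast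
  qed
  moreover have "P * Q \<in> ?I" if Q: "Q \<in> ?I" for P Q
  proof -
    obtain f where f: "f \<in> K" "Q = Poly_Mapping.lookup f b" using Q by blast
    then have "P * Q = Poly_Mapping.lookup (free_act P f) b" by (simp add: lookup_free_act)
    then show ?thesis using K(2)[OF f(1)] by blast
  qed
  ultimately obtain G0 where G0: "finite G0" "G0 \<subseteq> ?I" "?I \<subseteq> act_span (*) G0" using dop_noetherian[of ?I] by blast
  obtain G1 where G1: "finite G1" "G1 \<subseteq> K" "G0 = (\<lambda>f. Poly_Mapping.lookup f b) ` G1"
    using finite_subset_image[OF G0(1,2)] by blast
  let ?K = "{f \<in> K. Poly_Mapping.lookup f b = 0}"
  have "\<exists>G. finite G \<and> G \<subseteq> ?K \<and> ?K \<subseteq> act_span free_act G"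
  proof (rule insert.IH)
    show "add_subgroup ?K"
      by (rule add_subgroupI) (use K(1) in \<open>auto simp: add_subgroup_def lookup_minus add_subgroup_diff[OF K(1)]\<close>)
    show "free_act P f \<in> ?K" if "f \<in> ?K" for P f using that K(2) by (simp add: lookup_free_act)
    show "Poly_Mapping.keys f \<subseteq> B" if f: "f \<in> ?K" for f
    proof -
      have "b \<notin> Poly_Mapping.keys f" using f by (simp add: in_keys_iff)
      then show ?thesis using K(3)[of f] f by blast
    qed
  qed
  then obtain G2 where G2: "finite G2" "G2 \<subseteq> ?K" "?K \<subseteq> act_span free_act G2" by blast
  have lift: "\<exists>f\<in>act_span free_act G1. f \<in> K \<and> Poly_Mapping.lookup f b = Q" if "Q \<in> act_span (*) G0" for Q
    using that
  proof (induction Q rule: act_span.induct)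
    case zero
    show ?case using K(1) by (intro bexI[of _ 0]) (auto simp: add_subgroup_def act_span.zero)
  next
    case (step Q h P)
    then obtain f where f: "f \<in> act_span free_act G1" "f \<in> K" "Poly_Mapping.lookup f b = Q" by blast
    obtain k where k: "k \<in> G1" "h = Poly_Mapping.lookup k b" using step.hyps(2) G1(3) by blast
    have "f + free_act P k \<in> K" using f(2) k(1) G1(2) K(1,2) by (auto simp: add_subgroup_def)
    then show ?case using act_span.step[OF f(1) k(1), of P] f(3) k(2)
      by (intro bexI[of _ "f + free_act P k"]) (auto simp: lookup_add lookup_free_act)
  qed
  have "K \<subseteq> act_span free_act (G1 \<union> G2)"
  proof
    fix f assume f: "f \<in> K"
    then have "Poly_Mapping.lookup f b \<in> act_span (*) G0" using G0(3) by blast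
    then obtain h where h: "h \<in> act_span free_act G1" "h \<in> K" "Poly_Mapping.lookup h b = Poly_Mapping.lookup f b"
      using lift by blast
    have "f - h \<in> ?K" using f h add_subgroup_diff[OF K(1)] by (simp add: lookup_minus)
    then have "f - h \<in> act_span free_act (G1 \<union> G2)" using G2(3) act_span_mono[of G2 "G1 \<union> G2"] by blast
    moreover have "h \<in> act_span free_act (G1 \<union> G2)" using act_span_mono[of G1 "G1 \<union> G2"] h(1) by blast
    ultimately have "h + (f - h) \<in> act_span free_act (G1 \<union> G2)" by (rule act_span_add)
    then show "f \<in> act_span free_act (G1 \<union> G2)" by simp
  qed
  then show ?case using G1 G2 by (intro exI[of _ "G1 \<union> G2"]) auto
qed

section \<open>Resolutions inside the standard resolution\<close>

definition free_ext :: "('b \<Rightarrow> ('c \<Rightarrow>\<^sub>0 'a::ring_1)) \<Rightarrow> ('b \<Rightarrow>\<^sub>0 'a) \<Rightarrow> ('c \<Rightarrow>\<^sub>0 'a)" where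
  "free_ext \<eta> f = (\<Sum>b\<in>Poly_Mapping.keys f. free_act (Poly_Mapping.lookup f b) (\<eta> b))"

lemma free_ext_add: "free_ext \<eta> (f + g) = free_ext \<eta> f + free_ext \<eta> g"
  unfolding free_ext_def by (rule sum_keys_add) (simp_all add: free_act_simps)

lemma free_ext_single: "free_ext \<eta> (Poly_Mapping.single b a) = free_act a (\<eta> b)"
  by (cases "a = 0") (simp_all add: free_ext_def free_act_simps)

lemma free_ext_0 [simp]: "free_ext \<eta> 0 = 0"
  by (simp add: free_ext_def)

lemma free_ext_act: "free_ext \<eta> (free_act a f) = free_act a (free_ext \<eta> f)"
  by (induction f rule: mapping_induct) (simp_all add: free_act_simps free_ext_add free_ext_single)

lemma free_act_closed: "Poly_Mapping.keys f \<subseteq> B \<Longrightarrow> Poly_Mapping.keys (free_act a f) \<subseteq> B"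
  using keys_free_act by fast

lemma free_ext_closed:
  assumes "\<And>b. b \<in> Poly_Mapping.keys f \<Longrightarrow> Poly_Mapping.keys (\<eta> b) \<subseteq> C"
  shows "Poly_Mapping.keys (free_ext \<eta> f) \<subseteq> C"
proof -
  have "free_ext \<eta> f \<in> {g. Poly_Mapping.keys g \<subseteq> C}"
    unfolding free_ext_def by (rule add_subgroup_sum[OF free_subgroup]) (simp add: free_act_closed assms)
  then show ?thesis by simp
qed

lemma free_act_minus: "free_act a (f - g) = free_act a f - free_act a g"
proof -
  have "free_act a f = free_act a (f - g) + free_act a g" by (simp only: free_act_simps(5)[symmetric] diff_add_cancel)
  then show ?thesis by simp
qed

lemma boundary_diff: "boundary (f - g) = boundary f - boundary g"
  using boundary_add[of "f - g" g] by simp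

locale left_mod =
  fixes M :: "('a::ring_1, 'm::ab_group_add, 'z) lmod_scheme"
  assumes left_module: "left_module M"
begin

lemma car_diff: "x \<in> mcar M \<Longrightarrow> y \<in> mcar M \<Longrightarrow> x - y \<in> mcar M"
  using left_module add_subgroup_diff unfolding left_module_def by blast

lemma augmentation_superset:
  assumes f: "f \<in> mcar (res M 0)" and A: "finite A" "Poly_Mapping.keys f \<subseteq> A" "A \<subseteq> res_basis M 0"
  shows "augmentation M f = (\<Sum>b\<in>A. case b of Gen l m \<Rightarrow> mact M (Poly_Mapping.lookup f b) m | Syz l xs \<Rightarrow> 0)"
proof -
  have z: "mact M 0 m = 0" if "m \<in> mcar M" for m
  proof -
    have "mact M (0 + 0) m = mact M 0 m + mact M 0 m" using left_module that unfolding left_module_def by blast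
    then show ?thesis by simp
  qed
  show ?thesis unfolding augmentation_def
    by (rule sum.mono_neutral_left[OF A(1,2)]) (use A(3) z in \<open>auto simp: in_keys_iff\<close>)
qed

lemma augmentation_lin:
  assumes f: "f \<in> mcar (res M 0)" and g: "g \<in> mcar (res M 0)"
  shows "augmentation M (f + g) = augmentation M f + augmentation M g"
proof -
  let ?A = "Poly_Mapping.keys f \<union> Poly_Mapping.keys g"
  have A: "finite ?A" "?A \<subseteq> res_basis M 0" using f g by (auto simp: res_def free_module_def)
  have fg: "f + g \<in> mcar (res M 0)"
    using f g Poly_Mapping.keys_add[of f g] unfolding res_def free_module_def lmod.simps mem_Collect_eq by blast
  have m: "mact M (a + b) m = mact M a m + mact M b m" if "m \<in> mcar M" for a b m
    using left_module that unfolding left_module_def by blast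
  have "augmentation M (f + g) = (\<Sum>b\<in>?A. case b of Gen l m \<Rightarrow> mact M (Poly_Mapping.lookup (f + g) b) m | Syz l xs \<Rightarrow> 0)"
    by (rule augmentation_superset[OF fg A(1) Poly_Mapping.keys_add A(2)])
  also have "\<dots> = (\<Sum>b\<in>?A. (case b of Gen l m \<Rightarrow> mact M (Poly_Mapping.lookup f b) m | Syz l xs \<Rightarrow> 0) +
      (case b of Gen l m \<Rightarrow> mact M (Poly_Mapping.lookup g b) m | Syz l xs \<Rightarrow> 0))"
    using A(2) by (intro sum.cong refl) (auto simp: lookup_add m)
  also have "\<dots> = augmentation M f + augmentation M g"
    unfolding sum.distrib using augmentation_superset[OF f A(1) _ A(2)] augmentation_superset[OF g A(1) _ A(2)] by simp
  finally show ?thesis .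
qed

lemma augmentation_diff:
  assumes f: "f \<in> mcar (res M 0)" and g: "g \<in> mcar (res M 0)"
  shows "augmentation M (f - g) = augmentation M f - augmentation M g"
proof -
  have "f - g \<in> mcar (res M 0)"
    using add_subgroup_diff[OF free_subgroup, of f "res_basis M 0" g] f g by (simp add: res_def free_module_def)
  from augmentation_lin[OF this g] show ?thesis by simp
qed

lemma augmentation_act:
  assumes f: "f \<in> mcar (res M 0)"
  shows "augmentation M (free_act a f) = mact M a (augmentation M f)"
proof -
  let ?A = "Poly_Mapping.keys f"
  let ?v = "\<lambda>b. case b of Gen l m \<Rightarrow> mact M (Poly_Mapping.lookup f b) m | Syz l xs \<Rightarrow> 0"
  have A: "?A \<subseteq> res_basis M 0" using f by (simp add: res_def free_module_def)
  have m: "mact M (a * b) m = mact M a (mact M b m)" "mact M b m \<in> mcar M" if "m \<in> mcar M" for a b m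
    using left_module that unfolding left_module_def by blast+
  have ma: "mact M a (x + y) = mact M a x + mact M a y" if "x \<in> mcar M" "y \<in> mcar M" for x y
    using left_module that unfolding left_module_def by blast
  have z: "0 \<in> mcar M" "mact M a 0 = 0"
    using left_module ma[of 0 0] unfolding left_module_def add_subgroup_def by auto
  have v: "?v b \<in> mcar M" if "b \<in> ?A" for b using that A m by auto
  have s: "sum ?v C \<in> mcar M" if "C \<subseteq> ?A" for C
    using left_module that v unfolding left_module_def by (intro add_subgroup_sum) blast+
  have "augmentation M (free_act a f) = (\<Sum>b\<in>?A. case b of Gen l m \<Rightarrow> mact M (Poly_Mapping.lookup (free_act a f) b) m | Syz l xs \<Rightarrow> 0)"
    by (rule augmentation_superset) (use A f keys_free_act in \<open>auto simp: res_def free_module_def free_act_closed simp del: res_basis.simps\<close>)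
  also have "\<dots> = (\<Sum>b\<in>?A. mact M a (?v b))"
    using A by (intro sum.cong refl) (auto simp: lookup_free_act m z)
  also have "\<dots> = mact M a (sum ?v C)" if "finite C" "C = ?A" for C
  proof -
    have "C \<subseteq> ?A \<Longrightarrow> (\<Sum>b\<in>C. mact M a (?v b)) = mact M a (sum ?v C)" using that(1)
      by (induction C) (simp_all add: z ma v s)
    then show ?thesis using that by blast
  qed
  finally show ?thesis by (simp add: augmentation_def)
qed

lemma boundary_closed:
  assumes x: "x \<in> mcar (res M (Suc p))"
  shows "boundary x \<in> mcar (res M p)"
proof -
  have "boundary x \<in> {f. Poly_Mapping.keys f \<subseteq> res_basis M p}" unfolding boundary_def
  proof (rule add_subgroup_sum[OF free_subgroup])
    fix b assume "b \<in> Poly_Mapping.keys x"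
    then obtain xs where b: "b = Syz () xs" "\<forall>(a, c)\<in>set xs. c \<in> res_basis M p"
      using x unfolding res_def free_module_def res_basis.simps by auto
    have "Poly_Mapping.keys (lin_comb xs) \<subseteq> res_basis M p" using keys_lin_comb[of xs] b(2) by fastforce
    then show "(case b of Gen l m \<Rightarrow> 0 | Syz l xs \<Rightarrow> free_act (Poly_Mapping.lookup x b) (lin_comb xs))
        \<in> {f. Poly_Mapping.keys f \<subseteq> res_basis M p}"
      by (simp add: b(1) free_act_closed)
  qed
  then show ?thesis by (simp add: res_def free_module_def)
qed

text \<open>In degree \<open>0\<close> the augmentation takes the place of the boundary, so that
  exactness has the same form in all degrees.\<close>

definition cycle :: "nat \<Rightarrow> ((unit, 'a, 'm) cell \<Rightarrow>\<^sub>0 'a) \<Rightarrow> bool" where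
  "cycle p x \<longleftrightarrow> x \<in> mcar (res M p) \<and> (if p = 0 then augmentation M x = 0 else boundary x = 0)"

lemma res_subgroup: "add_subgroup (mcar (res M p))"
  using free_subgroup by (simp add: res_def free_module_def)

lemma cycle_boundary:
  assumes x: "x \<in> mcar (res M (Suc p))"
  shows "cycle p (boundary x)"
proof (cases p)
  case 0
  let ?K = "{f \<in> mcar (res M 0). augmentation M f = 0}"
  have "boundary x \<in> ?K" unfolding boundary_def
  proof (rule add_subgroup_sum)
    have "augmentation M 0 = 0" by (simp add: augmentation_def)
    then show "add_subgroup ?K" using add_subgroup_diff[OF res_subgroup] res_subgroup[of 0]
      by (intro add_subgroupI) (auto simp: augmentation_diff add_subgroup_def)
    fix b assume b: "b \<in> Poly_Mapping.keys x"
    then obtain xs where bs: "b = Syz () xs" "augmentation M (lin_comb xs) = 0" "\<forall>(a, c)\<in>set xs. c \<in> res_basis M 0"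
      using x unfolding res_def free_module_def 0 by (auto simp del: res_basis.simps(1))
    have l: "lin_comb xs \<in> mcar (res M 0)" using keys_lin_comb[of xs] bs(3)
      unfolding res_def free_module_def by fastforce
    have "mact M c 0 = 0" for c
    proof -
      have "mact M c (0 + 0) = mact M c 0 + mact M c 0"
        using left_module unfolding left_module_def add_subgroup_def by blast
      then show ?thesis by simp
    qed
    then show "(case b of Gen l m \<Rightarrow> 0 | Syz l xs \<Rightarrow> free_act (Poly_Mapping.lookup x b) (lin_comb xs)) \<in> ?K"
      using l bs(2) by (simp add: bs(1) augmentation_act, simp add: res_def free_module_def free_act_closed)
  qed
  then show ?thesis by (simp add: cycle_def 0)
next
  case (Suc q)
  then show ?thesis using x boundary_closed[OF x] boundary_boundary_res[of x M q] by (simp add: cycle_def)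
qed

lemma cycle_exact: "cycle p x \<Longrightarrow> \<exists>y\<in>mcar (res M (Suc p)). boundary y = x"
  unfolding cycle_def using res_exact_Suc by blast

end

text \<open>Both complexes are free resolutions of \<open>M\<close>, so the inclusion of the smaller
  one is a homotopy equivalence. Since its basis is part of the larger basis, the homotopy can be
  taken to vanish on it, which gives a retraction.\<close>

locale subresolution = left_mod M
  for M :: "('a::ring_1, 'm::ab_group_add, 'z) lmod_scheme" +
  fixes Bs :: "nat \<Rightarrow> (unit, 'a, 'm) cell set"
  assumes sub: "Bs p \<subseteq> res_basis M p"
    and sub_boundary: "Poly_Mapping.keys x \<subseteq> Bs (Suc p) \<Longrightarrow> Poly_Mapping.keys (boundary x) \<subseteq> Bs p"
    and sub_exact: "Poly_Mapping.keys x \<subseteq> Bs p \<Longrightarrow> cycle p x \<Longrightarrow>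
      \<exists>y. Poly_Mapping.keys y \<subseteq> Bs (Suc p) \<and> boundary y = x"
    and sub_surj: "m \<in> mcar M \<Longrightarrow> \<exists>x. Poly_Mapping.keys x \<subseteq> Bs 0 \<and> augmentation M x = m"
begin

abbreviation R where "R p \<equiv> mcar (res M p)"
definition S where "S p = {x :: (unit, 'a, 'm) cell \<Rightarrow>\<^sub>0 'a. Poly_Mapping.keys x \<subseteq> Bs p}"

lemma S_subgroup: "add_subgroup (S p)" unfolding S_def by (rule free_subgroup)
lemma S_R: "x \<in> S p \<Longrightarrow> x \<in> R p" using sub[of p] by (auto simp: S_def res_def free_module_def)
lemma S_boundary: "x \<in> S (Suc p) \<Longrightarrow> boundary x \<in> S p" using sub_boundary by (simp add: S_def)
lemma S_act: "x \<in> S p \<Longrightarrow> free_act a x \<in> S p" by (simp add: S_def free_act_closed)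
lemma R_act: "x \<in> R p \<Longrightarrow> free_act a x \<in> R p" by (simp add: res_def free_module_def free_act_closed)
lemmas R_diff = add_subgroup_diff[OF res_subgroup]
lemma R_basis: "b \<in> res_basis M p \<Longrightarrow> Poly_Mapping.single b 1 \<in> R p" by (simp add: res_def free_module_def)

lemma R_ext:
  assumes "\<And>b. b \<in> res_basis M p \<Longrightarrow> \<eta> b \<in> R q" "x \<in> R p"
  shows "free_ext \<eta> x \<in> R q"
  using free_ext_closed[of x \<eta> "res_basis M q"] assms by (auto simp: res_def free_module_def)

lemma augmentation_closed:
  assumes x: "x \<in> R 0" shows "augmentation M x \<in> mcar M"
  unfolding augmentation_def
proof (rule add_subgroup_sum)
  show "add_subgroup (mcar M)" using left_module by (simp add: left_module_def)
  fix b assume "b \<in> Poly_Mapping.keys x"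
  then obtain m where "b = Gen () m" "m \<in> mcar M" using x by (auto simp: res_def free_module_def)
  then show "(case b of Gen l m \<Rightarrow> mact M (Poly_Mapping.lookup x b) m | Syz l xs \<Rightarrow> 0) \<in> mcar M"
    using left_module by (simp add: left_module_def)
qed

text \<open>The homotopy is built degree by degree from its values \<open>\<eta>\<close> on basis elements; \<open>state p\<close> describes
  its component from degree \<open>p - 1\<close> to degree \<open>p\<close>, which is zero for \<open>p = 0\<close>.\<close>

definition state :: "nat \<Rightarrow> ((unit, 'a, 'm) cell \<Rightarrow> ((unit, 'a, 'm) cell \<Rightarrow>\<^sub>0 'a)) \<Rightarrow> bool" where
  "state p \<eta> \<longleftrightarrow> (case p of 0 \<Rightarrow> \<eta> = (\<lambda>_. 0) | Suc q \<Rightarrow> (\<forall>b\<in>Bs q. \<eta> b = 0) \<and> (\<forall>b\<in>res_basis M q. \<eta> b \<in> R (Suc q)) \<and>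
    (\<forall>x. cycle q x \<longrightarrow> x - boundary (free_ext \<eta> x) \<in> S q))"

text \<open>Says that the identity minus both homotopy terms lands in the subcomplex; this
  difference becomes the retraction.\<close>

definition next_state where
  "next_state p \<eta> \<eta>' \<longleftrightarrow> (\<forall>x\<in>R p. x - free_ext \<eta> (boundary x) - boundary (free_ext \<eta>' x) \<in> S p)"

lemma state_0: "state 0 (\<lambda>_. 0)" by (simp add: state_def)

lemma free_ext_zero: "free_ext (\<lambda>_. 0) x = 0"
  by (simp add: free_ext_def free_act_simps)

lemma state_sub:
  assumes \<eta>: "state (Suc p) \<eta>" and x: "x \<in> S p" shows "free_ext \<eta> x = 0"
  using \<eta> x unfolding free_ext_def state_def S_def by (intro sum.neutral) (auto simp: free_act_simps subset_iff)

text \<open>For a cell \<open>b\<close> outside the subcomplex in positive degree, the chain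
  \<open>z b\<close> has its boundary in the subcomplex by the previous state. Exactness of the
  subcomplex gives \<open>g\<close> with the same boundary, and exactness of the whole complex
  writes \<open>z b - g\<close> as the boundary of the value sought for \<open>\<eta>' b\<close>. In
  degree \<open>0\<close> the augmentation is compared instead.\<close>

lemma state_Suc:
  assumes \<eta>: "state p \<eta>"
  shows "\<exists>\<eta>'. state (Suc p) \<eta>' \<and> next_state p \<eta> \<eta>'"
proof -
  \<comment> \<open>What remains of a basis cell after the correction already fixed one degree
    lower.\<close>
  define z where "z b = Poly_Mapping.single b 1 - free_ext \<eta> (boundary (Poly_Mapping.single b 1))"
    for b :: "(unit, 'a, 'm) cell"
  have R0: "0 \<in> R q" for q using res_subgroup[of q] by (simp add: add_subgroup_def)
  have "\<exists>y. y \<in> R (Suc p) \<and> (b \<in> Bs p \<longrightarrow> y = 0) \<and> z b - boundary y \<in> S p" if b: "b \<in> res_basis M p" for b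
  proof (cases "b \<in> Bs p")
    case True
    then have s: "Poly_Mapping.single b 1 \<in> S p" by (simp add: S_def)
    have "free_ext \<eta> (boundary (Poly_Mapping.single b 1)) = 0"
    proof (cases p)
      case 0
      then show ?thesis using \<eta> by (simp add: state_def free_ext_zero)
    next
      case (Suc q)
      then show ?thesis using state_sub[of q \<eta>] \<eta> S_boundary s by blast
    qed
    with s R0 show ?thesis by (intro exI[of _ 0]) (simp add: z_def)
  next
    case False
    have bR: "Poly_Mapping.single b 1 \<in> R p" by (rule R_basis[OF b])
    have "\<exists>g\<in>S p. cycle p (z b - g)"
    proof (cases p)
      case 0
      have zb: "z b = Poly_Mapping.single b 1" using \<eta> 0 by (simp add: z_def state_def free_ext_zero)
      obtain g where g: "g \<in> S 0" "augmentation M g = augmentation M (Poly_Mapping.single b 1)"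
        using sub_surj[OF augmentation_closed] bR 0 by (auto simp: S_def)
      then have "cycle p (z b - g)" using bR R_diff S_R by (auto simp: 0 zb cycle_def augmentation_diff)
      then show ?thesis using g(1) 0 by blast
    next
      case (Suc q)
      have cb: "cycle q (boundary (Poly_Mapping.single b 1))" using cycle_boundary bR Suc by blast
      have \<eta>R: "\<And>b. b \<in> res_basis M q \<Longrightarrow> \<eta> b \<in> R p"
        and w: "boundary (z b) \<in> S q"
        using \<eta> cb unfolding state_def by (auto simp: Suc z_def boundary_diff)
      have zR: "z b \<in> R p" unfolding z_def
        by (rule R_diff[OF bR R_ext[OF \<eta>R]]) (use cb in \<open>auto simp: cycle_def\<close>)
      have "cycle q (boundary (z b))" using cycle_boundary zR Suc by blast
      then obtain g where g: "g \<in> S p" "boundary g = boundary (z b)" using sub_exact w unfolding S_def Suc by blast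
      have "cycle p (z b - g)" using zR g S_R R_diff by (auto simp: cycle_def Suc boundary_diff)
      then show ?thesis using g(1) by blast
    qed
    then obtain g y where "g \<in> S p" "y \<in> R (Suc p)" "boundary y = z b - g" using cycle_exact by blast
    then show ?thesis using False by (intro exI[of _ y]) simp
  qed
  then have "\<forall>b\<in>res_basis M p. \<exists>y. y \<in> R (Suc p) \<and> (b \<in> Bs p \<longrightarrow> y = 0) \<and> z b - boundary y \<in> S p" by blast
  from bchoice[OF this] obtain \<eta>' where \<eta>': "\<And>b. b \<in> res_basis M p \<Longrightarrow> \<eta>' b \<in> R (Suc p)"
    "\<And>b. b \<in> res_basis M p \<Longrightarrow> b \<in> Bs p \<Longrightarrow> \<eta>' b = 0" "\<And>b. b \<in> res_basis M p \<Longrightarrow> z b - boundary (\<eta>' b) \<in> S p" by blast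
  have S: "x - free_ext \<eta> (boundary x) - boundary (free_ext \<eta>' x) \<in> S p" if x: "x \<in> R p" for x
  proof -
    let ?D = "\<lambda>x. x - free_ext \<eta> (boundary x) - boundary (free_ext \<eta>' x)"
    have add: "?D (f + g) = ?D f + ?D g" for f g
      by (simp add: boundary_add free_ext_add)
    have D0: "?D 0 = 0" by simp
    have sm: "?D (sum g A) = (\<Sum>b\<in>A. ?D (g b))" for A :: "(unit, 'a, 'm) cell set" and g
    proof (induction A rule: infinite_finite_induct)
      case (insert b A)
      show ?case unfolding sum.insert[OF insert.hyps] insert.IH[symmetric] by (rule add)
    next
      case (infinite A)
      show ?case unfolding sum.infinite[OF infinite] by (rule D0)
    qed (simp only: sum.empty D0)
    have one: "?D (Poly_Mapping.single b a) = free_act a (z b - boundary (\<eta>' b))" for b a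
    proof -
      have s: "Poly_Mapping.single b a = free_act a (Poly_Mapping.single b 1)" by (simp add: free_act_simps)
      show ?thesis unfolding s boundary_free_act free_ext_act z_def free_act_minus
        by (simp add: free_ext_single free_act_simps)
    qed
    have "?D x = (\<Sum>b\<in>Poly_Mapping.keys x. ?D (Poly_Mapping.single b (Poly_Mapping.lookup x b)))"
      using sm[of "\<lambda>b. Poly_Mapping.single b (Poly_Mapping.lookup x b)" "Poly_Mapping.keys x"]
      by (simp only: mapping_eq_sum[symmetric])
    also have "\<dots> \<in> S p" unfolding one
      by (rule add_subgroup_sum[OF S_subgroup], rule S_act, rule \<eta>'(3)) (use x in \<open>auto simp: res_def free_module_def\<close>)
    finally show ?thesis .
  qed
  have bz: "free_ext \<eta> (boundary x) = 0" if "cycle p x" for x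
    using that \<eta> by (cases p) (auto simp: cycle_def state_def free_ext_zero)
  have "state (Suc p) \<eta>'"
    unfolding state_def using \<eta>'(1,2) sub[of p] S bz by (fastforce simp: cycle_def)
  then show ?thesis using S unfolding next_state_def by blast
qed

text \<open>\<open>h\<close> is the homotopy and \<open>r\<close> the identity minus its boundary
  terms. The components come from dependent choice, since each one is built on the previous
  one.\<close>

lemma retraction:
  obtains h r where "\<And>p x y. h p (x + y) = h p x + h p y" "\<And>p a x. h p (free_act a x) = free_act a (h p x)"
    "\<And>p x. x \<in> R p \<Longrightarrow> h p x \<in> R (Suc p)"
    "\<And>p x y. r p (x + y) = r p x + r p y" "\<And>p a x. r p (free_act a x) = free_act a (r p x)"
    "\<And>p x. x \<in> R p \<Longrightarrow> r p x \<in> S p" "\<And>p x. x \<in> S p \<Longrightarrow> r p x = x"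
    "\<And>p x. x \<in> R (Suc p) \<Longrightarrow> boundary (r (Suc p) x) = r p (boundary x)"
    "\<And>x. x \<in> R 0 \<Longrightarrow> x = r 0 x + boundary (h 0 x)"
    "\<And>p x. x \<in> R (Suc p) \<Longrightarrow> x = r (Suc p) x + h p (boundary x) + boundary (h (Suc p) x)"
proof -
  have "\<exists>\<eta>. \<forall>p. state p (\<eta> p) \<and> next_state p (\<eta> p) (\<eta> (Suc p))"
    by (rule dependent_nat_choice) (use state_0 state_Suc in blast)+
  then obtain \<eta> where \<eta>: "\<And>p. state p (\<eta> p)" "\<And>p. next_state p (\<eta> p) (\<eta> (Suc p))" by blast
  define h where "h p = free_ext (\<eta> (Suc p))" for p
  define r where "r p x = x - free_ext (\<eta> p) (boundary x) - boundary (h p x)" for p x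
  have e0: "free_ext (\<eta> 0) x = 0" for x using \<eta>(1)[of 0] by (simp add: state_def free_ext_zero)
  have hR: "h p x \<in> R (Suc p)" if "x \<in> R p" for p x
    unfolding h_def by (rule R_ext[OF _ that]) (use \<eta>(1)[of "Suc p"] in \<open>simp add: state_def\<close>)
  have bb: "free_ext (\<eta> p) (boundary (boundary x)) = 0" if "x \<in> R (Suc p)" for p x
    using that e0 boundary_boundary_res[of x M] by (cases p) auto
  have hS: "h p x = 0" if "x \<in> S p" for p x unfolding h_def by (rule state_sub[OF \<eta>(1) that])
  show ?thesis
  proof (rule that[of h r])
    show "r p (x + y) = r p x + r p y" for p x y by (simp add: r_def h_def boundary_add free_ext_add)
    show "r p (free_act a x) = free_act a (r p x)" for p a x
      by (simp only: r_def h_def boundary_free_act free_ext_act free_act_minus)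
    show "r p x \<in> S p" if "x \<in> R p" for p x
      using \<eta>(2)[of p] that unfolding next_state_def r_def h_def by blast
    show "r p x = x" if x: "x \<in> S p" for p x
    proof (cases p)
      case 0
      then show ?thesis using x hS[of x 0] by (simp add: r_def e0)
    next
      case (Suc q)
      have "free_ext (\<eta> p) (boundary x) = 0" using hS[of "boundary x" q] S_boundary x unfolding Suc h_def by blast
      then show ?thesis by (simp add: r_def hS[OF x])
    qed
    show "boundary (r (Suc p) x) = r p (boundary x)" if x: "x \<in> R (Suc p)" for p x
      using boundary_boundary_res[OF hR[OF x]]
      by (simp add: r_def boundary_diff bb[OF x] h_def)
    show "x = r 0 x + boundary (h 0 x)" for x by (simp add: r_def e0)
    show "x = r (Suc p) x + h p (boundary x) + boundary (h (Suc p) x)" for p x by (simp add: r_def h_def)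
  qed (simp_all add: h_def free_ext_add free_ext_act hR[unfolded h_def])
qed

end

section \<open>Ext computed from a subresolution\<close>

lemma lhom_0: "left_module N \<Longrightarrow> left_module N' \<Longrightarrow> 0 \<in> lhom N N'"
  unfolding lhom_def left_module_def add_subgroup_def
  by (auto simp: zero_fun_def) (metis add_cancel_right_right)

lemma lhom_diff:
  assumes N': "left_module N'" and f: "f \<in> lhom N N'" and g: "g \<in> lhom N N'"
  shows "f - g \<in> lhom N N'"
proof -
  have d: "x - y \<in> mcar N'" if "x \<in> mcar N'" "y \<in> mcar N'" for x y
    using left_mod.car_diff[OF left_mod.intro[OF N'] that] .
  have m: "mact N' a (x - y) = mact N' a x - mact N' a y" if x: "x \<in> mcar N'" and y: "y \<in> mcar N'" for a x y
  proof -
    have "mact N' a (x - y + y) = mact N' a (x - y) + mact N' a y"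
      using N' d[OF x y] y unfolding left_module_def by blast
    then show ?thesis by simp
  qed
  show ?thesis using f g by (auto simp: lhom_def d m)
qed

lemma lhom_subgroup: "left_module N \<Longrightarrow> left_module N' \<Longrightarrow> add_subgroup (lhom N N')"
  by (rule add_subgroupI) (auto intro: lhom_0 lhom_diff)

lemma lhom_scale:
  fixes N' :: "(('n, 'k::field_char_0) dop, 'w::ab_group_add, 'z) lmod_scheme"
  assumes N': "left_module N'" and f: "f \<in> lhom N N'"
  shows "(\<lambda>x. mact N' (dconst c) (f x)) \<in> lhom N N'"
proof -
  have z: "0 \<in> mcar N'" "mact N' P 0 = 0" for P
  proof -
    show z0: "0 \<in> mcar N'" using N' by (simp add: left_module_def add_subgroup_def)
    have "mact N' P (0 + 0) = mact N' P 0 + mact N' P 0" using N' z0 unfolding left_module_def by blast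
    then show "mact N' P 0 = 0" by simp
  qed
  have m: "mact N' P y \<in> mcar N'" "mact N' P (x + y) = mact N' P x + mact N' P y"
    if "x \<in> mcar N'" "y \<in> mcar N'" for P x y
    using N' that unfolding left_module_def by blast+
  have c: "mact N' (dconst c) (mact N' P x) = mact N' P (mact N' (dconst c) x)" if "x \<in> mcar N'" for P x
  proof -
    have "mact N' (dconst c * P) x = mact N' (dconst c) (mact N' P x)"
      "mact N' (P * dconst c) x = mact N' P (mact N' (dconst c) x)"
      using N' that unfolding left_module_def by blast+
    then show ?thesis by (simp add: dconst_commute)
  qed
  show ?thesis using f by (auto simp: lhom_def z m c)
qed

lemma left_module_free: "left_module (free_module B)"
  using free_subgroup[of B] by (auto simp: left_module_def free_module_def free_act_simps free_act_closed)

locale dop_subresolution = subresolution M Bs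
  for M :: "(('n, 'k::field_char_0) dop, 'm::ab_group_add, 'z) lmod_scheme" and Bs +
  fixes N :: "(('n, 'k) dop, 'w::ab_group_add, 'y) lmod_scheme"
  assumes N: "left_module N"
begin

abbreviation sc :: "'k \<Rightarrow> ('x \<Rightarrow> 'w) \<Rightarrow> 'x \<Rightarrow> 'w" where
  "sc c f \<equiv> \<lambda>x. mact N (dconst c) (f x)"

definition precompose :: "((unit, ('n, 'k) dop, 'm) cell \<Rightarrow>\<^sub>0 ('n, 'k) dop) set \<Rightarrow>
    (((unit, ('n, 'k) dop, 'm) cell \<Rightarrow>\<^sub>0 ('n, 'k) dop) \<Rightarrow> 'w) \<Rightarrow> ((unit, ('n, 'k) dop, 'm) cell \<Rightarrow>\<^sub>0 ('n, 'k) dop) \<Rightarrow> 'w" where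
  "precompose X f x = (if x \<in> X then f (boundary x) else 0)"

lemma N_zero: "0 \<in> mcar N" "mact N P 0 = 0"
proof -
  show z0: "0 \<in> mcar N" using N by (simp add: left_module_def add_subgroup_def)
  have "mact N P (0 + 0) = mact N P 0 + mact N P 0" using N z0 unfolding left_module_def by blast
  then show "mact N P 0 = 0" by simp
qed

text \<open>Stated for any family of cells closed under the boundary, so as to serve for the
  subresolution and for the full basis.\<close>

lemma Ext_subquotient:
  fixes C :: "nat \<Rightarrow> (unit, ('n, 'k) dop, 'm) cell set"
  assumes C: "\<And>p. C p \<subseteq> res_basis M p"
    and bd: "\<And>p x. x \<in> mcar (free_module (C (Suc p))) \<Longrightarrow> boundary x \<in> mcar (free_module (C p))"
  shows "subquotient sc {f \<in> lhom (free_module (C i)) N. precompose (mcar (free_module (C (Suc i)))) f = 0}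
    (case i of 0 \<Rightarrow> {0} | Suc j \<Rightarrow> precompose (mcar (free_module (C i))) ` lhom (free_module (C j)) N)"
    (is "subquotient sc ?Z ?B")
proof -
  let ?F = "\<lambda>p. free_module (C p) :: (('n, 'k) dop, _) lmod"
  have L: "add_subgroup (lhom (?F p) N)" for p by (rule lhom_subgroup[OF left_module_free N])
  have pd: "precompose X (f - g) = precompose X f - precompose X g" for X f g
    by (auto simp: precompose_def fun_eq_iff)
  have ps: "precompose X (sc c f) = sc c (precompose X f)" for X c f
    by (auto simp: precompose_def fun_eq_iff N_zero)
  have p0: "precompose X 0 = 0" for X by (auto simp: precompose_def fun_eq_iff)
  have L0: "0 \<in> lhom (?F p) N" for p using L by (simp add: add_subgroup_def)
  have pl: "precompose (mcar (?F (Suc p))) f \<in> lhom (?F (Suc p)) N" if f: "f \<in> lhom (?F p) N" for f p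
  proof -
    have m: "x + y \<in> mcar (?F q)" "mact (?F q) P x \<in> mcar (?F q)" if "x \<in> mcar (?F q)" "y \<in> mcar (?F q)" for x y q P
      using that left_module_free[of "C q"] unfolding left_module_def add_subgroup_def by blast+
    have ba: "boundary (mact (?F q) P x) = mact (?F q') P (boundary x)" for q q' P x
      by (simp add: free_module_def boundary_free_act)
    show ?thesis using f bd by (auto simp: lhom_def precompose_def m boundary_add ba[of _ _ _ p])
  qed
  have pp: "precompose (mcar (?F (Suc (Suc p)))) (precompose (mcar (?F (Suc p))) f) = 0" if f: "f \<in> lhom (?F p) N" for f p
  proof
    fix x
    have "f 0 = 0"
    proof -
      have "f (0 + 0) = f 0 + f 0" using f left_module_free[of "C p"] unfolding lhom_def left_module_def add_subgroup_def by blast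
      then show ?thesis by simp
    qed
    moreover have "boundary (boundary x) = 0" if "x \<in> mcar (?F (Suc (Suc p)))"
      using that C by (intro boundary_boundary_res[of x M p]) (auto simp: res_def free_module_def simp del: res_basis.simps)
    ultimately show "precompose (mcar (?F (Suc (Suc p)))) (precompose (mcar (?F (Suc p))) f) x = 0 x"
      using bd by (simp add: precompose_def)
  qed
  have Zg: "add_subgroup ?Z"
    using add_subgroup_diff[OF L] by (intro add_subgroupI) (auto simp: pd p0 L0)
  have Zs: "sc c f \<in> ?Z" if f: "f \<in> ?Z" for c f
    using f by (simp add: ps N_zero zero_fun_def lhom_scale[OF N])
  have Zd: "sc c (f + g) = sc c f + sc c g" if "f \<in> ?Z" "g \<in> ?Z" for c f g
  proof
    fix x
    have fx: "f x \<in> mcar N" "g x \<in> mcar N" using that N_zero(1) unfolding lhom_def by fastforce+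
    have "mact N (dconst c) (f x + g x) = mact N (dconst c) (f x) + mact N (dconst c) (g x)"
      using N fx unfolding left_module_def by blast
    then show "sc c (f + g) x = (sc c f + sc c g) x" by simp
  qed
  have "add_subgroup ?B \<and> ?B \<subseteq> ?Z \<and> (\<forall>c. \<forall>f\<in>?B. sc c f \<in> ?B)"
  proof (cases i)
    case 0
    have "add_subgroup ?B" unfolding 0 nat.case by (rule add_subgroupI) auto
    then show ?thesis using L0 p0 by (simp add: 0 N_zero fun_eq_iff)
  next
    case (Suc j)
    have "add_subgroup (precompose (mcar (?F i)) ` lhom (?F j) N)"
    proof (rule add_subgroupI)
      show "0 \<in> precompose (mcar (?F i)) ` lhom (?F j) N" using p0 L0 by (metis image_eqI)
      show "x - y \<in> precompose (mcar (?F i)) ` lhom (?F j) N"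
        if "x \<in> precompose (mcar (?F i)) ` lhom (?F j) N" "y \<in> precompose (mcar (?F i)) ` lhom (?F j) N" for x y
        using that add_subgroup_diff[OF L] pd by (auto simp del: minus_apply) (metis image_eqI)
    qed
    moreover have "sc c f \<in> precompose (mcar (?F i)) ` lhom (?F j) N" if f: "f \<in> precompose (mcar (?F i)) ` lhom (?F j) N" for c f
    proof -
      obtain g where "g \<in> lhom (?F j) N" "f = precompose (mcar (?F i)) g" using f by blast
      then show ?thesis using ps lhom_scale[OF N] by (metis image_eqI)
    qed
    ultimately show ?thesis using pl[of _ j] pp[of _ j] by (auto simp: Suc)
  qed
  then show ?thesis unfolding subquotient_def using Zg Zs Zd by blast
qed

text \<open>Restriction to the subcomplex induces the isomorphism. A cocycle extends by composition
  with the retraction, and the homotopy shows that a cocycle whose restriction is a coboundary is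
  itself one.\<close>

theorem subresolution_Ext:
  "quotient_space sc {g \<in> lhom (free_module (Bs i)) N. precompose (mcar (free_module (Bs (Suc i)))) g = 0}
     (case i of 0 \<Rightarrow> {0} | Suc j \<Rightarrow> precompose (mcar (free_module (Bs i))) ` lhom (free_module (Bs j)) N) \<cong>\<^sub>k
   quotient_space sc {f \<in> lhom (res M i) N. precompose (mcar (res M (Suc i))) f = 0}
     (case i of 0 \<Rightarrow> {0} | Suc j \<Rightarrow> precompose (mcar (res M i)) ` lhom (res M j) N)"
proof -
  have SB: "mcar (free_module (Bs p)) = S p" for p by (simp add: S_def free_module_def)
  have actS: "mact (free_module (Bs p)) = free_act" for p by (simp add: free_module_def)
  have actR: "mact (res M p) = free_act" for p by (simp add: res_def free_module_def)
  obtain h r where h: "\<And>p x y. h p (x + y) = h p x + h p y" "\<And>p a x. h p (free_act a x) = free_act a (h p x)"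
      "\<And>p x. x \<in> R p \<Longrightarrow> h p x \<in> R (Suc p)"
    and r: "\<And>p x y. r p (x + y) = r p x + r p y" "\<And>p a x. r p (free_act a x) = free_act a (r p x)"
      "\<And>p x. x \<in> R p \<Longrightarrow> r p x \<in> S p" "\<And>p x. x \<in> S p \<Longrightarrow> r p x = x"
      "\<And>p x. x \<in> R (Suc p) \<Longrightarrow> boundary (r (Suc p) x) = r p (boundary x)"
    and hr: "\<And>x. x \<in> R 0 \<Longrightarrow> x = r 0 x + boundary (h 0 x)"
      "\<And>p x. x \<in> R (Suc p) \<Longrightarrow> x = r (Suc p) x + h p (boundary x) + boundary (h (Suc p) x)"
    by (rule retraction) blast
  have Radd: "x + y \<in> R p" if "x \<in> R p" "y \<in> R p" for x y p
    using res_subgroup[of p] that by (simp add: add_subgroup_def)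
  have Nadd: "x + y \<in> mcar N" "mact N P x \<in> mcar N" "mact N P (x + y) = mact N P x + mact N P y"
    if "x \<in> mcar N" "y \<in> mcar N" for x y P
    using N that unfolding left_module_def add_subgroup_def by blast+
  let ?LR = "\<lambda>p. lhom (res M p) N" and ?LS = "\<lambda>p. lhom (free_module (Bs p)) N"
  have fR: "f (x + y) = f x + f y" "f (free_act a x) = mact N a (f x)" "f x \<in> mcar N"
    if "f \<in> ?LR p" "x \<in> R p" "y \<in> R p" for f x y a p
    using that by (auto simp: lhom_def actR)
  have fS: "g (x + y) = g x + g y" "g (free_act a x) = mact N a (g x)" "g x \<in> mcar N"
    if "g \<in> ?LS p" "x \<in> S p" "y \<in> S p" for g x y a p
    using that by (auto simp: lhom_def actS SB)
  have f0: "f 0 = 0" if "f \<in> ?LR p" for f p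
    using fR(1)[OF that, of 0 0] res_subgroup[of p] by (simp add: add_subgroup_def)
  have restr: "(\<lambda>x. if x \<in> S p then f x else 0) \<in> ?LS p" if f: "f \<in> ?LR p" for f p
    using fR[OF f S_R S_R] S_subgroup[of p] S_act[of _ p]
    unfolding lhom_def SB actS by (simp add: add_subgroup_def)
  have LRI: "f \<in> ?LR p" if "\<And>x y. x \<in> R p \<Longrightarrow> y \<in> R p \<Longrightarrow> f (x + y) = f x + f y"
    "\<And>x a. x \<in> R p \<Longrightarrow> f (free_act a x) = mact N a (f x)" "\<And>x. x \<in> R p \<Longrightarrow> f x \<in> mcar N" "\<And>x. x \<notin> R p \<Longrightarrow> f x = 0" for f p
    using that by (simp add: lhom_def actR)
  have rZ: "subquotient sc {g \<in> ?LS i. precompose (S (Suc i)) g = 0}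
      (case i of 0 \<Rightarrow> {0} | Suc j \<Rightarrow> precompose (S i) ` ?LS j)"
    using Ext_subquotient[of Bs i, OF sub] S_boundary unfolding SB by blast
  have RZ: "subquotient sc {f \<in> ?LR i. precompose (R (Suc i)) f = 0}
      (case i of 0 \<Rightarrow> {0} | Suc j \<Rightarrow> precompose (R i) ` ?LR j)"
    using Ext_subquotient[of "res_basis M" i, folded res_def, OF order_refl boundary_closed] by blast
  have cyc: "f (boundary x) = 0" if "precompose X f = 0" "x \<in> X" for f X x
    using that unfolding precompose_def fun_eq_iff by (metis zero_fun_apply)
  have cycI: "precompose X f = 0" if "\<And>x. x \<in> X \<Longrightarrow> f (boundary x) = 0" for f X
    using that by (auto simp: precompose_def fun_eq_iff)
  show ?thesis unfolding SB
  proof (rule quotient_iso_rel[OF rZ RZ, where R = "\<lambda>g f. \<forall>x\<in>S i. g x = f x"])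
    fix g assume g: "g \<in> {g \<in> ?LS i. precompose (S (Suc i)) g = 0}"
    then have gL: "g \<in> ?LS i" by blast
    let ?f = "\<lambda>x. if x \<in> R i then g (r i x) else 0"
    have "?f \<in> ?LR i"
      by (rule LRI) (simp_all add: Radd R_act r(1,2,3) fS[OF gL r(3) r(3)] N_zero(1))
    moreover have "precompose (R (Suc i)) ?f = 0"
    proof (rule cycI)
      fix x assume x: "x \<in> R (Suc i)"
      have "g (boundary (r (Suc i) x)) = 0" by (rule cyc[of "S (Suc i)"]) (use g r(3)[OF x] in auto)
      then show "?f (boundary x) = 0" by (simp add: r(5)[OF x])
    qed
    moreover have "\<forall>x\<in>S i. g x = ?f x" using r(4) S_R by simp
    ultimately show "\<exists>f\<in>{f \<in> ?LR i. precompose (R (Suc i)) f = 0}. \<forall>x\<in>S i. g x = f x"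
      by - (rule bexI[of _ ?f], assumption, rule CollectI, rule conjI, assumption+)
  next
    fix f assume f: "f \<in> {f \<in> ?LR i. precompose (R (Suc i)) f = 0}"
    let ?g = "\<lambda>x. if x \<in> S i then f x else 0"
    have "precompose (S (Suc i)) ?g = 0"
      by (rule cycI) (use f cyc[of "R (Suc i)" f] S_R S_boundary in auto)
    moreover have "?g \<in> ?LS i" by (rule restr) (use f in blast)
    ultimately show "\<exists>g\<in>{g \<in> ?LS i. precompose (S (Suc i)) g = 0}. \<forall>x\<in>S i. g x = f x"
      by (intro bexI[of _ ?g]) simp_all
  next
    fix g f assume g: "g \<in> {g \<in> ?LS i. precompose (S (Suc i)) g = 0}"
      and f: "f \<in> {f \<in> ?LR i. precompose (R (Suc i)) f = 0}" and gf: "\<forall>x\<in>S i. g x = f x"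
    have gL: "g \<in> ?LS i" and fL: "f \<in> ?LR i" using g f by auto
    have fb: "f (boundary x) = 0" if "x \<in> R (Suc i)" for x by (rule cyc[OF _ that]) (use f in blast)
    have gout: "g x = 0" if "x \<notin> S i" for x using gL that by (simp add: lhom_def SB)
    have fout: "f x = 0" if "x \<notin> R i" for x using fL that by (simp add: lhom_def)
    have hb: "boundary (h i x) \<in> R i" if "x \<in> R i" for x by (rule boundary_closed[OF h(3)[OF that]])
    show "g \<in> (case i of 0 \<Rightarrow> {0} | Suc j \<Rightarrow> precompose (S i) ` ?LS j) \<longleftrightarrow>
        f \<in> (case i of 0 \<Rightarrow> {0} | Suc j \<Rightarrow> precompose (R i) ` ?LR j)"
    proof (cases i)
      case 0
      have "g = 0 \<longleftrightarrow> f = 0"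
      proof
        assume g0: "g = 0"
        show "f = 0"
        proof
          fix x show "f x = 0 x"
          proof (cases "x \<in> R i")
            case True
            have "f x = f (r i x + boundary (h i x))" using hr(1)[of x] True 0 by simp
            also have "\<dots> = f (r i x) + f (boundary (h i x))" by (rule fR(1)[OF fL S_R[OF r(3)[OF True]] hb[OF True]])
            also have "\<dots> = 0" using fb[OF h(3)[OF True]] bspec[OF gf r(3)[OF True]] g0 by simp
            finally show ?thesis by simp
          qed (simp add: fout)
        qed
      next
        assume "f = 0"
        then show "g = 0" using gf gout by (intro ext) (metis zero_fun_apply)
      qed
      then show ?thesis by (simp add: 0)
    next
      case (Suc j)
      have "g \<in> precompose (S i) ` ?LS j \<longleftrightarrow> f \<in> precompose (R i) ` ?LR j"
      proof
        assume "f \<in> precompose (R i) ` ?LR j"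
        then obtain f' where f': "f' \<in> ?LR j" "f = precompose (R i) f'" by blast
        have "g = precompose (S i) (\<lambda>x. if x \<in> S j then f' x else 0)"
        proof
          fix x
          show "g x = precompose (S i) (\<lambda>x. if x \<in> S j then f' x else 0) x"
          proof (cases "x \<in> S i")
            case True
            then show ?thesis using bspec[OF gf True] S_R[OF True] S_boundary[of x j]
              by (simp add: f'(2) precompose_def Suc)
          qed (simp add: gout precompose_def)
        qed
        then show "g \<in> precompose (S i) ` ?LS j" using restr[OF f'(1)] by blast
      next
        assume "g \<in> precompose (S i) ` ?LS j"
        then obtain g' where g': "g' \<in> ?LS j" "g = precompose (S i) g'" by blast
        \<comment> \<open>The cocycle \<open>f\<close> kills the boundary of \<open>h i x\<close>,
          so the homotopy formula expresses \<open>f x\<close> through the boundary of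
          \<open>x\<close> alone; this is the primitive that results.\<close>
        let ?f = "\<lambda>x. if x \<in> R j then g' (r j x) + f (h j x) else 0"
        have hR: "h j x \<in> R i" if "x \<in> R j" for x using h(3)[OF that] Suc by simp
        have "?f \<in> ?LR j"
          by (rule LRI) (simp_all add: Radd R_act h(1,2) hR r(1,2,3) fS[OF g'(1) r(3) r(3)] fR[OF fL hR hR] Nadd N_zero(1))
        moreover have "f = precompose (R i) ?f"
        proof
          fix x
          show "f x = precompose (R i) ?f x"
          proof (cases "x \<in> R i")
            case True
            then have x: "x \<in> R (Suc j)" by (simp add: Suc)
            have b: "boundary x \<in> R j" by (rule boundary_closed[OF x])
            have "f x = f (r i x + h j (boundary x) + boundary (h i x))" using hr(2)[OF x] by (simp add: Suc)
            also have "\<dots> = f (r i x) + f (h j (boundary x)) + f (boundary (h i x))"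
              using S_R[OF r(3)[OF True]] hR[OF b] hb[OF True] by (simp add: fR(1)[OF fL] Radd)
            also have "\<dots> = g (r i x) + f (h j (boundary x))"
              using fb[OF h(3)[OF True]] bspec[OF gf r(3)[OF True]] by simp
            also have "g (r i x) = g' (r j (boundary x))"
              using r(3)[OF True] r(5)[OF x] by (simp add: g'(2) precompose_def Suc)
            finally show ?thesis using True b by (simp add: precompose_def)
          qed (simp add: fout precompose_def)
        qed
        ultimately show "f \<in> precompose (R i) ` ?LR j" by blast
      qed
      then show ?thesis by (simp add: Suc)
    qed
  qed auto
qed

end

section \<open>Finite-dimensional cohomology\<close>

lemma coord_space_simps:
  "vcar (coord_space d) = {v :: nat \<Rightarrow> 'k::field. \<forall>i\<ge>d. v i = 0}"
  "vadd (coord_space d) = ((+) :: (nat \<Rightarrow> 'k) \<Rightarrow> _)" "vscale (coord_space d) = (fscale :: 'k \<Rightarrow> (nat \<Rightarrow> 'k) \<Rightarrow> _)"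
  by (auto simp: coord_space_def fscale_def fun_eq_iff)

text \<open>Puts coordinate spaces into the form that \<open>quotient_iso_rel\<close> works
  with.\<close>

lemma coord_space_quotient:
  "coord_space d \<cong>\<^sub>k quotient_space fscale (vcar (coord_space d :: ('k::field, nat \<Rightarrow> 'k) kspace)) {0}"
  unfolding kspace_iso_def
proof (intro exI[of _ "\<lambda>v. {v}"] conjI ballI allI)
  show "bij_betw (\<lambda>v. {v}) (vcar (coord_space d :: ('k, nat \<Rightarrow> 'k) kspace))
      (vcar (quotient_space fscale (vcar (coord_space d :: ('k, nat \<Rightarrow> 'k) kspace)) {0}))"
    by (auto simp: bij_betw_def inj_on_def quotient_space_def)
qed (auto simp: quotient_space_def coord_space_simps)

text \<open>Replaces an isomorphism on cosets by coordinates \<open>cz\<close> on closed forms,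
  which are easier to combine with functionals.\<close>

lemma (in dop_module) H_dR_coordinates:
  fixes q :: int
  defines "Z \<equiv> {\<omega> \<in> forms M q. form_diff M \<omega> = 0}" and "B \<equiv> form_diff M ` forms M (q - 1)"
  assumes iso: "coord_space d \<cong>\<^sub>k H_dR M q"
  obtains cz where "\<And>z. z \<in> Z \<Longrightarrow> cz z \<in> vcar (coord_space d)"
    "\<And>z w. z \<in> Z \<Longrightarrow> w \<in> Z \<Longrightarrow> cz (z + w) = cz z + cz w"
    "\<And>c z. z \<in> Z \<Longrightarrow> cz (form_scale M c z) = fscale c (cz z)"
    "\<And>z. z \<in> Z \<Longrightarrow> cz z = 0 \<longleftrightarrow> z \<in> B"
    "\<And>v. v \<in> vcar (coord_space d) \<Longrightarrow> \<exists>z\<in>Z. cz z = v"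
proof -
  have Q: "subquotient (form_scale M) Z B" unfolding Z_def B_def by (rule subquotient_forms)
  have H: "H_dR M q = quotient_space (form_scale M) Z B" unfolding Z_def B_def by (rule H_dR_eq)
  have S: "add_subgroup Z" "add_subgroup B" "B \<subseteq> Z" using Q by (auto simp: subquotient_def)
  let ?C = "vcar (coord_space d :: ('k, nat \<Rightarrow> 'k) kspace)"
  obtain F where F: "bij_betw F ?C (vcar (quotient_space (form_scale M) Z B))"
    "\<And>x y. x \<in> ?C \<Longrightarrow> y \<in> ?C \<Longrightarrow> F (x + y) = vadd (quotient_space (form_scale M) Z B) (F x) (F y)"
    "\<And>c x. x \<in> ?C \<Longrightarrow> F (fscale c x) = vscale (quotient_space (form_scale M) Z B) c (F x)"
    using iso unfolding H kspace_iso_def coord_space_simps(2,3) by metis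
  define cz where "cz z = inv_into ?C F ((+) z ` B)" for z
  have mem: "(+) z ` B \<in> F ` ?C" if "z \<in> Z" for z
    using F(1) that unfolding bij_betw_def by (auto simp: quotient_space_def)
  have cC: "cz z \<in> ?C" and Fc: "F (cz z) = (+) z ` B" if "z \<in> Z" for z
    unfolding cz_def using inv_into_into[OF mem[OF that]] f_inv_into_f[OF mem[OF that]] by blast+
  have inj: "v = cz z" if "v \<in> ?C" "F v = (+) z ` B" "z \<in> Z" for v z
    using F(1) that cC[OF that(3)] Fc[OF that(3)] by (auto simp: bij_betw_def inj_on_def)
  have sub: "x + y \<in> ?C" "fscale c x \<in> ?C" "0 \<in> ?C" if "x \<in> ?C" "y \<in> ?C" for x y c
    using that by (auto simp: coord_space_simps fscale_def)
  have add: "cz (z + w) = cz z + cz w" if z: "z \<in> Z" "w \<in> Z" for z w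
  proof (rule inj[symmetric])
    show "cz z + cz w \<in> ?C" by (rule sub(1)[OF cC[OF z(1)] cC[OF z(2)]])
    show "F (cz z + cz w) = (+) (z + w) ` B"
      unfolding F(2)[OF cC[OF z(1)] cC[OF z(2)]] Fc[OF z(1)] Fc[OF z(2)]
      by (simp add: quotient_space_def coset_add[OF S(2)])
    show "z + w \<in> Z" using S(1) z by (simp add: add_subgroup_def)
  qed
  have scale: "cz (form_scale M c z) = fscale c (cz z)" if z: "z \<in> Z" for c z
  proof (rule inj[symmetric])
    show "fscale c (cz z) \<in> ?C" by (rule sub(2)[OF cC[OF z] cC[OF z]])
    show "F (fscale c (cz z)) = (+) (form_scale M c z) ` B"
      unfolding F(3)[OF cC[OF z]] Fc[OF z] by (simp add: quotient_space_def coset_scale[OF Q z])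
    show "form_scale M c z \<in> Z" using Q z by (simp add: subquotient_def)
  qed
  have Z0: "0 \<in> Z" using S(1) by (simp add: add_subgroup_def)
  have c0: "cz 0 = 0" using add[OF Z0 Z0] by simp
  have null: "cz z = 0 \<longleftrightarrow> z \<in> B" if z: "z \<in> Z" for z
  proof -
    have "cz z = 0 \<longleftrightarrow> (+) z ` B = (+) 0 ` B"
      using Fc[OF z] Fc[OF Z0] c0 inj[OF cC[OF z] _ Z0] by metis
    then show ?thesis unfolding coset_eq_iff[OF S(2)] by simp
  qed
  have surj: "\<exists>z\<in>Z. cz z = v" if v: "v \<in> ?C" for v
  proof -
    have "F v \<in> vcar (quotient_space (form_scale M) Z B)" using F(1) v by (auto simp: bij_betw_def)
    then obtain z where "z \<in> Z" "F v = (+) z ` B" by (auto simp: quotient_space_def)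
    then show ?thesis using inj[OF v] by metis
  qed
  show ?thesis by (rule that[of cz]) (fact cC add scale null surj)+
qed

text \<open>Graded dualising is exact, so it commutes with cohomology, and a finite-dimensional
  space has the dimension of its dual. A vector \<open>v\<close> corresponds to those cocycles whose
  values on closed forms are given by the linear form with coefficients \<open>v\<close> in the
  coordinates \<open>cz\<close>.\<close>

theorem (in gr_dmodule) de_Rham_duality:
  assumes iso: "coord_space d \<cong>\<^sub>k H_dR M q"
  shows "coord_space d \<cong>\<^sub>k quotient_space fscale {\<phi> \<in> cochains M q. codiff M (q - 1) \<phi> = 0}
    (codiff M q ` cochains M (q + 1))"
proof -
  interpret F: graded_space "forms M r" "form_scale M" "form_proj M" for r by (rule graded_space_forms)
  let ?C = "vcar (coord_space d :: ('k, nat \<Rightarrow> 'k) kspace)"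
  let ?Z = "{\<omega> \<in> forms M q. form_diff M \<omega> = 0}" and ?B = "form_diff M ` forms M (q - 1)"
  obtain cz where cz: "\<And>z. z \<in> ?Z \<Longrightarrow> cz z \<in> ?C"
    "\<And>z w. z \<in> ?Z \<Longrightarrow> w \<in> ?Z \<Longrightarrow> cz (z + w) = cz z + cz w"
    "\<And>c z. z \<in> ?Z \<Longrightarrow> cz (form_scale M c z) = fscale c (cz z)"
    "\<And>z. z \<in> ?Z \<Longrightarrow> cz z = 0 \<longleftrightarrow> z \<in> ?B"
    "\<And>v. v \<in> ?C \<Longrightarrow> \<exists>z\<in>?Z. cz z = v"
    by (rule H_dR_coordinates[OF iso]) blast
  note SQ = subquotient_forms[of q, unfolded subquotient_def]
  have Z: "add_subgroup ?Z" "?B \<subseteq> ?Z" "\<And>c x. x \<in> ?Z \<Longrightarrow> form_scale M c x \<in> ?Z" using SQ by blast+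
  have Zf: "z \<in> forms M q" if "z \<in> ?Z" for z using that by blast
  define u where "u j = (\<lambda>i. if i = j then 1 else (0::'k))" for j :: nat
  have "\<forall>j\<in>{..<d}. \<exists>z. z \<in> ?Z \<and> cz z = u j"
    using cz(5) by (auto simp: coord_space_simps u_def)
  \<comment> \<open>Closed forms representing the standard basis of the cohomology.\<close>
  from bchoice[OF this] obtain z where "\<forall>j\<in>{..<d}. z j \<in> ?Z \<and> cz (z j) = u j" ..
  then have z: "z j \<in> ?Z" "cz (z j) = u j" if "j < d" for j using that by blast+
  have Z0: "0 \<in> ?Z" using Z(1) unfolding add_subgroup_def by blast
  have cz0: "cz 0 = 0" using cz(2)[OF Z0 Z0] by simp
  have sumZ: "(\<Sum>j\<in>A. form_scale M (c j) (z j)) \<in> ?Z" if "A \<subseteq> {..<d}" for A c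
    using z(1) that by (intro add_subgroup_sum[OF Z(1)] Z(3)) auto
  have czsum: "cz (\<Sum>j\<in>A. form_scale M (c j) (z j)) = (\<Sum>j\<in>A. fscale (c j) (u j))" if "finite A" "A \<subseteq> {..<d}" for A c
    using that
  proof (induction A)
    case (insert j A)
    have j: "z j \<in> ?Z" "form_scale M (c j) (z j) \<in> ?Z" using insert.prems z(1) Z(3) by auto
    have A: "A \<subseteq> {..<d}" "j < d" using insert.prems by auto
    have s: "(\<Sum>j\<in>A. form_scale M (c j) (z j)) \<in> ?Z" by (rule sumZ[OF A(1)])
    show ?case unfolding sum.insert[OF insert.hyps] cz(2)[OF j(2) s] cz(3)[OF j(1)] insert.IH[OF A(1)] z(2)[OF A(2)] ..
  qed (simp only: sum.empty cz0)
  have decomp: "x - (\<Sum>j<d. form_scale M (cz x j) (z j)) \<in> ?B" if x: "x \<in> ?Z" for x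
  proof -
    let ?y = "\<Sum>j<d. form_scale M (cz x j) (z j)"
    have y: "?y \<in> ?Z" by (rule sumZ) simp
    have "cz ?y = cz x"
    proof
      fix i
      have "(\<Sum>j<d. fscale (cz x j) (u j) i) = (\<Sum>j<d. if j = i then cz x i else 0)"
        by (intro sum.cong) (auto simp: fscale_def u_def)
      then show "cz ?y i = cz x i"
        using cz(1)[OF x] by (simp add: czsum fun_sum coord_space_simps)
    qed
    moreover have "cz x = cz (x - ?y) + cz ?y"
      using cz(2)[OF add_subgroup_diff[OF Z(1) x y] y] by simp
    ultimately have "cz (x - ?y) = 0" by simp
    then show ?thesis using cz(4)[OF add_subgroup_diff[OF Z(1) x y]] by blast
  qed
  have val: "\<phi> x = (\<Sum>j<d. \<phi> (z j) * cz x j)"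
    if \<phi>: "\<phi> \<in> cochains M q" and k: "\<And>b. b \<in> ?B \<Longrightarrow> \<phi> b = 0" and x: "x \<in> ?Z" for \<phi> x
  proof -
    let ?y = "\<Sum>j<d. form_scale M (cz x j) (z j)"
    note l = cochains_functional[OF \<phi>]
    have y: "?y \<in> ?Z" by (rule sumZ) simp
    have "\<phi> (x - ?y) = 0" by (rule k[OF decomp[OF x]])
    then have "\<phi> x = \<phi> ?y" using F.functional_diff[OF l Zf[OF x] Zf[OF y]] by simp
    also have "\<dots> = (\<Sum>j<d. \<phi> (form_scale M (cz x j) (z j)))"
      by (rule F.functional_sum[OF l]) (use z(1) Z(3) in blast)
    also have "\<dots> = (\<Sum>j<d. \<phi> (z j) * cz x j)"
      using z(1) by (intro sum.cong refl) (simp add: F.functional_scale[OF l] mult.commute)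
    finally show ?thesis .
  qed
  have killB: "codiff M (q - 1) \<phi> = 0 \<longleftrightarrow> (\<forall>b\<in>?B. \<phi> b = 0)" for \<phi>
  proof -
    have "codiff M (q - 1) \<phi> = 0 \<longleftrightarrow> (\<forall>\<eta>. codiff M (q - 1) \<phi> \<eta> = 0)" unfolding fun_eq_iff zero_fun_apply ..
    then show ?thesis by (auto simp: codiff_def)
  qed
  have Q: "subquotient fscale {\<phi> \<in> cochains M q. codiff M (q - 1) \<phi> = 0} (codiff M q ` cochains M (q + 1))"
    using codiff_cochains[of _ q] codiff_codiff[of _ "q - 1"]
    by (intro subquotient_fun subspace_fun_ker subspace_fun_image subspace_cochains codiff_lin) auto
  have C: "subquotient fscale ?C {0}"
    by (intro subquotient_fun subspace_fun_zero subspace_funI) (auto simp: coord_space_simps fscale_def)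
  have czz: "(\<Sum>j<d. v j * cz (z i) j) = v i" if "i < d" for v i
  proof -
    have "(\<Sum>j<d. v j * cz (z i) j) = (\<Sum>j<d. if j = i then v i else 0)"
      using that by (intro sum.cong) (auto simp: z(2) u_def)
    then show ?thesis using that by simp
  qed
  have "quotient_space fscale ?C {0} \<cong>\<^sub>k quotient_space fscale {\<phi> \<in> cochains M q. codiff M (q - 1) \<phi> = 0}
      (codiff M q ` cochains M (q + 1))"
  proof (rule quotient_iso_rel[OF C Q, where R = "\<lambda>v \<phi>. \<forall>x\<in>?Z. \<phi> x = (\<Sum>j<d. v j * cz x j)"])
    fix v assume v: "v \<in> ?C"
    define f where "f x = (\<Sum>j<d. v j * cz x j)" for x
    have "\<exists>g\<in>linear_functionals (forms M q) (form_scale M). \<forall>x\<in>?Z. g x = f x"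
      by (rule F.extend_functional)
        (use Z in \<open>auto simp: f_def cz(2,3) fscale_def sum.distrib algebra_simps sum_distrib_left\<close>)
    then obtain g where g: "g \<in> linear_functionals (forms M q) (form_scale M)" "\<And>x. x \<in> ?Z \<Longrightarrow> g x = f x" by blast
    \<comment> \<open>The degrees of the representatives \<open>z j\<close>. Cutting off there keeps
      the values at these forms and, since the differential preserves degrees, still kills exact
      forms.\<close>
    let ?S = "\<Union>j<d. {l. form_proj M l (z j) \<noteq> 0}"
    have S: "finite ?S" using z(1) by (intro finite_UN_I F.pr_finite[OF Zf]) auto
    define \<phi> where "\<phi> = (\<lambda>x. if x \<in> forms M q then g (\<Sum>l\<in>?S. form_proj M l x) else 0)"
    have \<phi>: "\<phi> \<in> cochains M q" unfolding \<phi>_def cochains_def by (rule F.graded_dual_truncate[OF g(1) S])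
    have kB: "\<phi> b = 0" if b: "b \<in> ?B" for b
    proof -
      obtain w where w: "w \<in> forms M (q - 1)" "b = form_diff M w" using b by blast
      have ds: "form_diff M (\<Sum>l\<in>A. form_proj M l w) = (\<Sum>l\<in>A. form_diff M (form_proj M l w))" for A
      proof (induction A rule: infinite_finite_induct)
        case (insert l A)
        have "(\<Sum>l\<in>A. form_proj M l w) \<in> forms M (q - 1)" by (rule F.sum_closed) (rule F.pr_closed[OF w(1)])
        from form_diff_add[OF F.pr_closed[OF w(1)] this, of l]
        show ?case unfolding sum.insert[OF insert.hyps] insert.IH .
      next
        case (infinite A)
        show ?case unfolding sum.infinite[OF infinite] by (rule forms_zero)
      qed (simp only: sum.empty forms_zero)
      have "(\<Sum>l\<in>?S. form_proj M l b) = form_diff M (\<Sum>l\<in>?S. form_proj M l w)"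
        unfolding ds w(2) by (simp add: form_diff_proj[OF w(1)])
      then have bB: "(\<Sum>l\<in>?S. form_proj M l b) \<in> ?B"
        using F.sum_closed[of ?S "\<lambda>l. form_proj M l w" "q - 1"] F.pr_closed[OF w(1)] by blast
      then have "g (\<Sum>l\<in>?S. form_proj M l b) = 0"
        using g(2)[of "\<Sum>l\<in>?S. form_proj M l b"] cz(4)[of "\<Sum>l\<in>?S. form_proj M l b"] Z(2) by (auto simp: f_def)
      then show ?thesis by (simp add: \<phi>_def)
    qed
    have "\<phi> (z j) = v j" if j: "j < d" for j
    proof -
      have "(\<Sum>l\<in>?S. form_proj M l (z j)) = z j"
        by (rule F.pr_sum_superset[OF Zf[OF z(1)[OF j]] S]) (use j in blast)
      then have "\<phi> (z j) = f (z j)" unfolding \<phi>_def using g(2)[OF z(1)[OF j]] Zf[OF z(1)[OF j]] by simp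
      then show ?thesis unfolding f_def by (simp add: czz[OF j])
    qed
    then have "\<forall>x\<in>?Z. \<phi> x = (\<Sum>j<d. v j * cz x j)" using val[OF \<phi> kB] by simp
    then show "\<exists>\<phi>\<in>{\<phi> \<in> cochains M q. codiff M (q - 1) \<phi> = 0}. \<forall>x\<in>?Z. \<phi> x = (\<Sum>j<d. v j * cz x j)"
      using \<phi> kB unfolding killB by blast
  next
    fix \<phi> assume p: "\<phi> \<in> {\<phi> \<in> cochains M q. codiff M (q - 1) \<phi> = 0}"
    then have "\<forall>x\<in>?Z. \<phi> x = (\<Sum>j<d. \<phi> (z j) * cz x j)" using val[of \<phi>] killB by blast
    then show "\<exists>v\<in>?C. \<forall>x\<in>?Z. \<phi> x = (\<Sum>j<d. v j * cz x j)"
      by (intro bexI[of _ "\<lambda>j. if j < d then \<phi> (z j) else 0"]) (auto simp: coord_space_simps)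
  next
    fix v \<phi> assume p: "\<phi> \<in> {\<phi> \<in> cochains M q. codiff M (q - 1) \<phi> = 0}" and v: "v \<in> ?C"
      and r: "\<forall>x\<in>?Z. \<phi> x = (\<Sum>j<d. v j * cz x j)"
    show "v \<in> {0} \<longleftrightarrow> \<phi> \<in> codiff M q ` cochains M (q + 1)"
    proof
      assume "v \<in> {0}"
      then have kill: "\<phi> x = 0" if "x \<in> forms M q" "form_diff M x = 0" for x using r that by simp
      \<comment> \<open>A cochain that vanishes on all closed forms factors through the
        differential.\<close>
      have "\<exists>h\<in>graded_dual (forms M (q + 1)) (form_scale M) (form_proj M). \<forall>x\<in>forms M q. \<phi> x = h (form_diff M x)"
        by (rule graded_dual_factor[OF graded_space_forms[of q] graded_space_forms[of "q + 1"]])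
          ((rule form_diff_forms form_diff_add form_diff_scale form_diff_proj; assumption)
            | (use p kill in \<open>simp add: cochains_def\<close>))+
      then obtain h where h: "h \<in> cochains M (q + 1)" "\<And>x. x \<in> forms M q \<Longrightarrow> \<phi> x = h (form_diff M x)"
        unfolding cochains_def by blast
      have "\<phi> = codiff M q h"
        using h(2) p cochains_functional[of \<phi> q] by (auto simp: codiff_def linear_functionals_def)
      with h(1) show "\<phi> \<in> codiff M q ` cochains M (q + 1)" by blast
    next
      assume "\<phi> \<in> codiff M q ` cochains M (q + 1)"
      then obtain h where h: "h \<in> cochains M (q + 1)" "\<phi> = codiff M q h" by blast
      have h0: "h 0 = 0" by (rule F.functional_0[OF cochains_functional[OF h(1)]])
      have "v i = 0" for i
      proof (cases "i < d")
        case True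
        have "\<phi> (z i) = 0" using z(1)[OF True] h0 by (simp add: h(2) codiff_def)
        moreover have "\<phi> (z i) = v i" unfolding bspec[OF r z(1)[OF True]] by (rule czz[OF True])
        ultimately show ?thesis by simp
      qed (use v in \<open>simp add: coord_space_simps\<close>)
      then show "v \<in> {0}" by auto
    qed
  qed (auto simp: fscale_def algebra_simps sum_subtractf sum_distrib_left)
  then show ?thesis by (rule kspace_iso_trans[OF coord_space_quotient])
qed

section \<open>Finitely generated modules\<close>

lemma inv_module_act:
  fixes P Q :: "('n::finite, 'k::field_char_0) dop"
  assumes "x \<in> inv_carrier" "y \<in> inv_carrier"
  shows "mact inv_module (P + Q) x = mact inv_module P x + mact inv_module Q x"
    "mact inv_module (P * Q) x = mact inv_module P (mact inv_module Q x)"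
    "mact inv_module P (x + y) = mact inv_module P x + mact inv_module P y"
proof -
  have lm: "left_module (inv_module :: (('n, 'k) dop, _) grmod)" "mcar (inv_module :: (('n, 'k) dop, _) grmod) = inv_carrier"
    by (rule inv_module_simps)+
  show "mact inv_module (P + Q) x = mact inv_module P x + mact inv_module Q x"
    "mact inv_module (P * Q) x = mact inv_module P (mact inv_module Q x)"
    "mact inv_module P (x + y) = mact inv_module P x + mact inv_module P y"
    using lm(1) assms unfolding left_module_def lm(2) by blast+
qed

lemma inv_module_act_piece:
  "dop_homog d P \<Longrightarrow> e \<in> piece inv_module l \<Longrightarrow> mact inv_module P e \<in> piece inv_module (l + d)"
  for P :: "('n::finite, 'k::field_char_0) dop"
proof (induction d P arbitrary: l e rule: dop_homog.induct)
  case (const c)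
  then have "e \<in> inv_carrier" using inv_piece_subset by blast
  then show ?case using inv_piece_mult[OF const, of 0 c] by (simp add: inv_module_simps(3) pconst_def)
next
  case (var i)
  have e: "e \<in> inv_carrier" using var inv_piece_subset by blast
  have "inv_mult (pvar i) e \<in> piece inv_module (l + int (total (Poly_Mapping.single i 1)))"
    unfolding pvar_def by (rule inv_piece_mult[OF var])
  then show ?case unfolding total_single by (simp add: inv_module_simps(3)[OF e])
next
  case (part i)
  have "e \<in> inv_carrier" using part inv_piece_subset by blast
  then show ?case using inv_piece_diff[OF part, of i] by (simp add: inv_module_simps(4))
next
  case (add d P Q)
  have "e \<in> inv_carrier" using add.prems inv_piece_subset by blast
  then have "mact inv_module (P + Q) e = mact inv_module P e + mact inv_module Q e" by (intro inv_module_act(1))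
  moreover have "x + y \<in> S" if "add_subgroup S" "x \<in> S" "y \<in> S" for S and x y :: "('n, 'k) inv_poly"
    using that by (simp add: add_subgroup_def)
  ultimately show ?case using inv_piece_add_subgroup add.IH[OF add.prems] by metis
next
  case (mult d P d' Q)
  have "e \<in> inv_carrier" using mult.prems inv_piece_subset by blast
  then have "mact inv_module (P * Q) e = mact inv_module P (mact inv_module Q e)" by (intro inv_module_act(2))
  then show ?case using mult.IH(1)[OF mult.IH(2)[OF mult.prems]] by (simp add: algebra_simps)
qed

text \<open>The residue sees only degree \<open>- n\<close>, and an operator of degree
  \<open>d\<close> has to move one of the finitely many degrees of \<open>e\<close> exactly
  there.\<close>

lemma residue_degrees_finite:
  fixes e :: "('n::finite, 'k::field_char_0) inv_poly"
  assumes e: "e \<in> inv_carrier"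
  shows "\<exists>S. finite S \<and> (\<forall>d P. P \<in> dop_piece d \<longrightarrow> d \<notin> S \<longrightarrow> residue (mact inv_module P e) = 0)"
proof -
  let ?t = "\<lambda>b. \<Sum>i\<in>UNIV. Poly_Mapping.lookup b i"
  let ?s = "\<lambda>b. Poly_Mapping.single b (Poly_Mapping.lookup e b)"
  let ?S = "(\<lambda>b. - int CARD('n) - ?t b) ` Poly_Mapping.keys e"
  have add: "mact inv_module P (x + y) = mact inv_module P x + mact inv_module P y"
    if "x \<in> inv_carrier" "y \<in> inv_carrier" for P :: "('n, 'k) dop" and x y
    by (rule inv_module_act(3)[OF that])
  have "residue (mact inv_module P e) = 0" if P: "P \<in> dop_piece d" and d: "d \<notin> ?S" for d P
  proof -
    have p: "?s b \<in> piece inv_module (?t b)" if "b \<in> Poly_Mapping.keys e" for b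
      using e that by (simp add: inv_module_def dmodule_of_def inv_carrier_def)
    have r: "residue (mact inv_module P (?s b)) = 0" if b: "b \<in> Poly_Mapping.keys e" for b
    proof -
      have m: "mact inv_module P (?s b) \<in> piece inv_module (?t b + d)"
        using P by (intro inv_module_act_piece[OF _ p[OF b]]) (simp add: dop_piece_def)
      have "- int CARD('n) - int (total 0) \<noteq> ?t b + d" using d b by force
      then have "residue (inv_mult (pmonom 0) (mact inv_module P (?s b))) = 0" using m unfolding inv_piece_iff by blast
      moreover have c: "mact inv_module P (?s b) \<in> inv_carrier" using m inv_piece_subset by blast
      ultimately show ?thesis using inv_mult_1[OF c] by simp
    qed
    have c: "sum ?s A \<in> inv_carrier" if "A \<subseteq> Poly_Mapping.keys e" for A
      using p that inv_piece_subset by (intro inv_carrier_sum) blast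
    have z: "mact inv_module P 0 = 0" using add[OF inv_carrier_0 inv_carrier_0, of P] by simp
    have "residue (mact inv_module P (sum ?s A)) = 0" if "finite A" "A \<subseteq> Poly_Mapping.keys e" for A
      using that
    proof (induction A)
      case (insert b A)
      have "?s b \<in> inv_carrier" using c[of "{b}"] insert.prems by simp
      then show ?case using insert r[of b] by (simp add: add c residue_add)
    qed (simp add: z)
    from this[OF finite_keys order_refl] show ?thesis by (simp only: mapping_eq_sum[symmetric])
  qed
  then show ?thesis by (intro exI[of _ ?S]) auto
qed

text \<open>A \<D>-linear map is determined by its values on the finitely many basis elements, and
  for each of these values only operators of finitely many degrees produce a residue.\<close>

lemma finite_free_lhom:
  fixes B :: "'b set"
  assumes B: "finite B"
  shows "lhom (dfree deg B :: (('n::{finite,linorder}, 'k::field_char_0) dop, _) grmod) inv_module =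
    star_hom (dfree deg B) inv_module"
proof -
  let ?F = "dfree deg B :: (('n, 'k) dop, 'b \<Rightarrow>\<^sub>0 ('n, 'k) dop) grmod"
  interpret gr_dmodule ?F by (rule gr_dmoduleI[OF dfree_graded])
  have "residue \<circ> f \<in> gdual" if f: "f \<in> lhom ?F inv_module" for f
  proof -
    have r: "f \<in> rhom" using f unfolding lhom_D by blast
    have fa: "f (mact ?F P x) = mact inv_module P (f x)" if "x \<in> mcar ?F" for P x
      using f that by (simp add: lhom_def)
    let ?u = "\<lambda>b. Poly_Mapping.single b 1 :: 'b \<Rightarrow>\<^sub>0 ('n, 'k) dop"
    have "\<forall>b. \<exists>S. finite S \<and> (\<forall>d P. P \<in> dop_piece d \<longrightarrow> d \<notin> S \<longrightarrow> residue (mact inv_module P (f (?u b))) = 0)"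
      using residue_degrees_finite[OF rhom_closed[OF r]] by blast
    then obtain S where S: "\<And>b. finite (S b)"
      "\<And>b d P. P \<in> dop_piece d \<Longrightarrow> d \<notin> S b \<Longrightarrow> residue (mact inv_module P (f (?u b))) = 0" by metis
    let ?T = "\<Union>b\<in>B. (\<lambda>d. d + deg b) ` S b"
    have lin: "residue \<circ> f \<in> linear_functionals (mcar ?F) (\<lambda>c. mact ?F (dconst c))"
      by (auto simp: linear_functionals_def rhom_add[OF r] residue_add rhom_mult[OF r] residue_scalar rhom_out[OF r])
    have van: "(residue \<circ> f) (mod_proj ?F l x) = 0" if x: "x \<in> mcar ?F" and l: "l \<notin> ?T" for l x
    proof -
      let ?y = "mod_proj ?F l x"
      have y: "?y \<in> piece ?F l" by (rule proj_piece[OF x])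
      have k: "b \<in> B" "Poly_Mapping.lookup ?y b \<in> dop_piece (l - deg b)" if "b \<in> Poly_Mapping.keys ?y" for b
        using y that unfolding dfree_simps by blast+
      have s: "Poly_Mapping.single b (Poly_Mapping.lookup ?y b) = mact ?F (Poly_Mapping.lookup ?y b) (?u b)" for b
        by (simp add: dfree_simps free_act_simps)
      have uB: "?u b \<in> mcar ?F" if "b \<in> B" for b using that by (simp add: dfree_simps)
      have "f ?y = f (\<Sum>b\<in>Poly_Mapping.keys ?y. mact ?F (Poly_Mapping.lookup ?y b) (?u b))"
        unfolding s[symmetric] by (simp only: mapping_eq_sum[symmetric])
      also have "\<dots> = (\<Sum>b\<in>Poly_Mapping.keys ?y. mact inv_module (Poly_Mapping.lookup ?y b) (f (?u b)))"
        by (subst rhom_sum[OF r]) (auto simp: fa uB k(1) intro!: act_closed)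
      finally have "residue (f ?y) = (\<Sum>b\<in>Poly_Mapping.keys ?y. residue (mact inv_module (Poly_Mapping.lookup ?y b) (f (?u b))))"
        by (simp add: residue_sum)
      also have "\<dots> = 0"
      proof (intro sum.neutral ballI S(2)[OF k(2)])
        fix b assume b: "b \<in> Poly_Mapping.keys ?y"
        show "l - deg b \<notin> S b"
        proof
          assume "l - deg b \<in> S b"
          then have "l - deg b + deg b \<in> (\<lambda>d. d + deg b) ` S b" by (rule imageI)
          then have "l \<in> (\<lambda>d. d + deg b) ` S b" by (simp only: diff_add_cancel)
          with k(1)[OF b] l show False by blast
        qed
      qed
      finally show ?thesis by simp
    qed
    have fin: "finite ?T" using S(1) B by (intro finite_UN_I finite_imageI)
    show ?thesis unfolding graded_dual_def mem_Collect_eq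
      by (intro conjI exI[of _ ?T] ballI allI impI lin fin van)
  qed
  then show ?thesis unfolding star_hom_D by blast
qed

text \<open>The components of generators generate as well, and they stay in \<open>K\<close> because
  \<open>K\<close> is closed under the projections.\<close>

lemma homogeneous_generators:
  assumes N: "gr_dmodule N" and G: "finite G" "G \<subseteq> K" "K \<subseteq> act_span (mact N) G"
    and K: "K \<subseteq> mcar N" "\<And>l x. x \<in> K \<Longrightarrow> mod_proj N l x \<in> K"
  shows "\<exists>H. finite H \<and> H \<subseteq> K \<and> (\<forall>h\<in>H. \<exists>l. h \<in> piece N l) \<and> K \<subseteq> act_span (mact N) H"
proof -
  interpret gr_dmodule N by fact
  interpret C: graded_space "mcar N" "\<lambda>c. mact N (dconst c)" "mod_proj N" by (rule graded_space_car)
  let ?H = "\<Union>g\<in>G. (\<lambda>l. mod_proj N l g) ` {l. mod_proj N l g \<noteq> 0}"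
  have GN: "g \<in> mcar N" if "g \<in> G" for g using that G(2) K(1) by blast
  have "x \<in> act_span (mact N) ?H" if "x \<in> act_span (mact N) G" for x
    using that
  proof (induction x rule: act_span.induct)
    case (step x g P)
    have "mact N P g = (\<Sum>l | mod_proj N l g \<noteq> 0. mact N P (mod_proj N l g))"
      using act_sum[of "{l. mod_proj N l g \<noteq> 0}" "\<lambda>l. mod_proj N l g" P] C.pr_sum[OF GN[OF step.hyps(2)]]
        C.pr_closed[OF GN[OF step.hyps(2)]] by simp
    also have "\<dots> \<in> act_span (mact N) ?H"
      using step.hyps(2) by (intro act_span_sum act_span_act) blast
    finally show ?case using step.IH by (rule act_span_add)
  qed (rule act_span.zero)
  moreover have "finite ?H" using G(1) C.pr_finite[OF GN] by (intro finite_UN_I finite_imageI) auto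
  moreover have "?H \<subseteq> K" using G(2) K(2) by blast
  moreover have "\<exists>l. h \<in> piece N l" if "h \<in> ?H" for h using that proj_piece[OF GN] by blast
  ultimately show ?thesis using G(3) by (intro exI[of _ ?H]) blast
qed

text \<open>The kernel is graded and, by \<open>free_noetherian\<close>, finitely generated, so
  finitely many homogeneous elements generate it. Each of them becomes a cell of the ungraded
  standard resolution.\<close>

lemma finite_syzygies:
  fixes B :: "(unit, ('n::{finite,linorder}, 'k::field_char_0) dop, 'm::ab_group_add) cell set"
  assumes B: "finite B" and f: "gr_dmap (dfree deg B) N f"
  shows "\<exists>B' deg'. finite B' \<and> (\<forall>b\<in>B'. \<exists>xs. b = Syz () xs \<and> lin_comb xs \<in> piece (dfree deg B) (deg' b) \<and>
      f (lin_comb xs) = 0 \<and> (\<forall>(a, c)\<in>set xs. c \<in> B)) \<and>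
    (\<forall>x\<in>mcar (dfree deg B). f x = 0 \<longrightarrow> (\<exists>y\<in>mcar (dfree deg' B'). boundary y = x))"
proof -
  let ?F = "dfree deg B :: (('n, 'k) dop, _) grmod"
  interpret f: gr_dmap ?F N f by fact
  let ?K = "{x \<in> mcar ?F. f x = 0}"
  have fdiff: "f (x - y) = f x - f y" if "x \<in> mcar ?F" "y \<in> mcar ?F" for x y
    using f.g_add[OF f.A.car_diff[OF that] that(2)] by simp
  have "\<exists>G. finite G \<and> G \<subseteq> ?K \<and> ?K \<subseteq> act_span free_act G"
  proof (rule free_noetherian[OF B])
    show "add_subgroup ?K" by (rule add_subgroupI) (auto simp: f.g_0 fdiff f.A.car_diff)
    show "free_act P x \<in> ?K" if "x \<in> ?K" for P x
      using that f.A.act_closed[of x P] f.g_act[of x P] f.B.act_0 by (simp add: dfree_simps(2))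
  qed (simp add: dfree_simps)
  then obtain G where "finite G" "G \<subseteq> ?K" "?K \<subseteq> act_span (mact ?F) G" unfolding dfree_simps(2) by blast
  then have "\<exists>H. finite H \<and> H \<subseteq> ?K \<and> (\<forall>h\<in>H. \<exists>l. h \<in> piece ?F l) \<and> ?K \<subseteq> act_span (mact ?F) H"
  proof (rule homogeneous_generators[OF f.A.gr_dmodule_axioms])
    show "mod_proj ?F l x \<in> ?K" if x: "x \<in> ?K" for l x
    proof -
      have "f (mod_proj ?F l x) = mod_proj N l (f x)" using f.g_proj[of x l] x by simp
      then show ?thesis using x f.B.proj_0 f.A.piece_car[OF f.A.proj_piece] by simp
    qed
  qed auto
  then obtain H where H: "finite H" "H \<subseteq> ?K" "\<And>h. h \<in> H \<Longrightarrow> \<exists>l. h \<in> piece ?F l" "?K \<subseteq> act_span (mact ?F) H" by blast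
  \<comment> \<open>One fixed list per generator, so that the cell is a function of
    \<open>h\<close>.\<close>
  define xs where "xs h = (SOME xs. lin_comb xs = h \<and> set xs = (\<lambda>b. (Poly_Mapping.lookup h b, b)) ` Poly_Mapping.keys h)"
    for h :: "(unit, ('n, 'k) dop, 'm) cell \<Rightarrow>\<^sub>0 ('n, 'k) dop"
  have xs: "lin_comb (xs h) = h" "set (xs h) = (\<lambda>b. (Poly_Mapping.lookup h b, b)) ` Poly_Mapping.keys h" for h
    using someI_ex[OF lin_comb_keys[of h]] unfolding xs_def by blast+
  \<comment> \<open>Cells with label \<open>()\<close> record no degree, so it is recovered from the
    syzygy; where several degrees fit, as for \<open>h = 0\<close>, one of them is picked.\<close>
  define deg' where "deg' b = (SOME l. \<exists>ys. b = Syz () ys \<and> lin_comb ys \<in> piece ?F l)" for b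
  let ?B = "(\<lambda>h. Syz () (xs h)) ` H"
  have deg': "lin_comb (xs h) \<in> piece ?F (deg' (Syz () (xs h)))" if h: "h \<in> H" for h
  proof -
    obtain l where "h \<in> piece ?F l" using H(3)[OF h] by blast
    then have "\<exists>l ys. Syz () (xs h) = Syz () ys \<and> lin_comb ys \<in> piece ?F l" using xs(1) by auto
    from someI_ex[OF this] show ?thesis unfolding deg'_def by auto
  qed
  have gens: "\<exists>ys. b = Syz () ys \<and> lin_comb ys \<in> piece ?F (deg' b) \<and> f (lin_comb ys) = 0 \<and> (\<forall>(a, c)\<in>set ys. c \<in> B)"
    if b: "b \<in> ?B" for b
  proof -
    obtain h where h: "h \<in> H" "b = Syz () (xs h)" using b by blast
    have "f h = 0" "Poly_Mapping.keys h \<subseteq> B" using h(1) H(2) by (auto simp: dfree_simps)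
    then show ?thesis using h(2) deg'[OF h(1)] xs[of h] by (intro exI[of _ "xs h"]) auto
  qed
  have bm: "gr_dmap (dfree deg' ?B) ?F boundary" by (rule boundary_map) (use gens in blast)
  interpret b: gr_dmap "dfree deg' ?B" ?F boundary by (rule bm)
  have "\<exists>y\<in>mcar (dfree deg' ?B). boundary y = x" if "x \<in> act_span (mact ?F) H" for x
    using that
  proof (induction x rule: act_span.induct)
    case zero
    show ?case by (intro bexI[of _ 0]) simp_all
  next
    case (step x h P)
    then obtain y where y: "y \<in> mcar (dfree deg' ?B)" "boundary y = x" by blast
    let ?s = "Poly_Mapping.single (Syz () (xs h)) P"
    have s: "?s \<in> mcar (dfree deg' ?B)" using step.hyps(2) by (auto simp: dfree_simps)
    have "boundary (y + ?s) = x + mact ?F P h"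
      by (simp add: boundary_add y(2) boundary_single xs(1) dfree_simps(2))
    then show ?case using b.A.car_add[OF y(1) s] by blast
  qed
  then have "\<forall>x\<in>mcar ?F. f x = 0 \<longrightarrow> (\<exists>y\<in>mcar (dfree deg' ?B). boundary y = x)" using H(4) by blast
  then show ?thesis using gens H(1) by (intro exI[of _ ?B] exI[of _ deg']) blast
qed

text \<open>Built by dependent choice: \<open>ok\<close> describes one stage, a finite set of cells
  with their degrees, and \<open>step\<close> relates consecutive stages. \<open>ok\<close> also
  keeps a map out of the stage, since \<open>finite_syzygies\<close> needs its kernel to form the
  next one.\<close>

lemma (in gr_dmodule) finite_resolution:
  assumes fg: "finitely_generated M"
  shows "\<exists>deg Bs. free_resolution M (\<lambda>p. dfree (deg p) (Bs p)) deg Bs boundary (augmentation M) \<and>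
    (\<forall>p. finite (Bs p) \<and> Bs p \<subseteq> res_basis M p)"
proof -
  interpret L: left_mod M by (rule left_mod.intro[OF left])
  interpret C: graded_space "mcar M" "\<lambda>c. mact M (dconst c)" "mod_proj M" by (rule graded_space_car)
  obtain G where G: "finite G" "G \<subseteq> mcar M" "\<And>m. m \<in> mcar M \<Longrightarrow> \<exists>a. m = (\<Sum>g\<in>G. mact M (a g) g)"
    using fg unfolding finitely_generated_def by blast
  have span: "mcar M \<subseteq> act_span (mact M) G"
  proof
    fix m assume "m \<in> mcar M"
    then obtain a where m: "m = (\<Sum>g\<in>G. mact M (a g) g)" using G(3) by blast
    show "m \<in> act_span (mact M) G" unfolding m by (intro act_span_sum act_span_act)
  qed
  obtain H where H: "finite H" "H \<subseteq> mcar M" "\<And>h. h \<in> H \<Longrightarrow> \<exists>l. h \<in> piece M l" "mcar M \<subseteq> act_span (mact M) H"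
    using homogeneous_generators[OF gr_dmodule_axioms G(1,2) span order_refl C.pr_closed] by blast
  let ?D = "\<lambda>s. dfree (snd s) (fst s) :: (('n, 'k) dop, (unit, ('n, 'k) dop, 'm) cell \<Rightarrow>\<^sub>0 ('n, 'k) dop) grmod"
  let ?cond = "\<lambda>p x. if p = 0 then augmentation M x = 0 else boundary x = 0"
  define ok where "ok p s \<longleftrightarrow> finite (fst s) \<and> fst s \<subseteq> res_basis M p \<and>
    (if p = 0 then gr_dmap (?D s) M (augmentation M) \<and> (\<forall>m\<in>mcar M. \<exists>x\<in>mcar (?D s). augmentation M x = m)
     else \<exists>s0. gr_dmap (?D s) (?D s0) boundary)" for p :: nat and s
  define step where "step p s s' \<longleftrightarrow> gr_dmap (?D s') (?D s) boundary \<and>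
    (\<forall>x\<in>mcar (?D s). ?cond p x \<longrightarrow> (\<exists>y\<in>mcar (?D s'). boundary y = x))" for p :: nat and s s'
  have start: "\<exists>s. ok 0 s"
  proof -
    define deg :: "(unit, ('n, 'k) dop, 'm) cell \<Rightarrow> int" where "deg b = (SOME l. \<exists>m. b = Gen () m \<and> m \<in> piece M l)" for b
    let ?B = "Gen () ` H :: (unit, ('n, 'k) dop, 'm) cell set"
    have deg: "h \<in> piece M (deg (Gen () h))" if h: "h \<in> H" for h
    proof -
      have "\<exists>l m. Gen () h = (Gen () m :: (unit, ('n, 'k) dop, 'm) cell) \<and> m \<in> piece M l" using H(3)[OF h] by auto
      from someI_ex[OF this] show ?thesis unfolding deg_def by auto
    qed
    have am: "gr_dmap (dfree deg ?B) M (augmentation M)" by (rule augmentation_map) (use deg in blast)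
    interpret a: gr_dmap "dfree deg ?B" M "augmentation M" by (rule am)
    have surj: "\<exists>x\<in>mcar (dfree deg ?B). augmentation M x = m" if "m \<in> act_span (mact M) H" for m
      using that
    proof (induction m rule: act_span.induct)
      case zero
      show ?case by (intro bexI[of _ 0]) (simp_all add: a.g_0)
    next
      case (step x h P)
      then obtain y where y: "y \<in> mcar (dfree deg ?B)" "augmentation M y = x" by blast
      let ?s = "Poly_Mapping.single (Gen () h) P :: (unit, ('n, 'k) dop, 'm) cell \<Rightarrow>\<^sub>0 ('n, 'k) dop"
      have s: "?s \<in> mcar (dfree deg ?B)" using step.hyps(2) by (auto simp: dfree_simps)
      have "h \<in> mcar M" using step.hyps(2) H(2) by blast
      then have "augmentation M (y + ?s) = x + mact M P h"
        using a.g_add[OF y(1) s] by (simp add: y(2) augmentation_single[OF left])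
      then show ?case using a.A.car_add[OF y(1) s] by blast
    qed
    have "ok 0 (?B, deg)" unfolding ok_def using H(1,2,4) am surj by auto
    then show ?thesis by blast
  qed
  have next_ok: "\<exists>s'. ok (Suc p) s' \<and> step p s s'" if ok: "ok p s" for p s
  proof -
    have fs: "finite (fst s)" "fst s \<subseteq> res_basis M p" using ok by (auto simp: ok_def)
    have "\<exists>B' deg'. finite B' \<and> (\<forall>b\<in>B'. \<exists>xs. b = Syz () xs \<and> lin_comb xs \<in> piece (?D s) (deg' b) \<and>
        ?cond p (lin_comb xs) \<and> (\<forall>(a, c)\<in>set xs. c \<in> fst s)) \<and>
      (\<forall>x\<in>mcar (?D s). ?cond p x \<longrightarrow> (\<exists>y\<in>mcar (dfree deg' B'). boundary y = x))"
    proof (cases p)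
      case 0
      then show ?thesis using finite_syzygies[OF fs(1), of "snd s" M "augmentation M"] ok by (simp add: ok_def)
    next
      case (Suc q)
      obtain s0 where "gr_dmap (?D s) (?D s0) boundary" using ok by (auto simp: ok_def Suc)
      from finite_syzygies[OF fs(1) this] show ?thesis by (simp add: Suc)
    qed
    then obtain B' deg' where B': "finite B'"
      "\<And>b. b \<in> B' \<Longrightarrow> \<exists>xs. b = Syz () xs \<and> lin_comb xs \<in> piece (?D s) (deg' b) \<and>
        ?cond p (lin_comb xs) \<and> (\<forall>(a, c)\<in>set xs. c \<in> fst s)"
      "\<And>x. x \<in> mcar (?D s) \<Longrightarrow> ?cond p x \<Longrightarrow> \<exists>y\<in>mcar (dfree deg' B'). boundary y = x" by blast
    have m: "gr_dmap (dfree deg' B') (?D s) boundary" by (rule boundary_map) (use B'(2) in blast)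
    have "B' \<subseteq> res_basis M (Suc p)"
    proof
      fix b assume "b \<in> B'"
      then obtain xs where "b = Syz () xs" "?cond p (lin_comb xs)" "\<forall>(a, c)\<in>set xs. c \<in> fst s" using B'(2) by blast
      then show "b \<in> res_basis M (Suc p)" unfolding res_basis.simps using fs(2) by blast
    qed
    then have "ok (Suc p) (B', deg')" unfolding ok_def using B'(1) m by auto
    moreover have "step p s (B', deg')" unfolding step_def using m B'(3) by simp
    ultimately show ?thesis by blast
  qed
  have "\<exists>f. \<forall>p. ok p (f p) \<and> step p (f p) (f (Suc p))"
    by (rule dependent_nat_choice) (use start next_ok in blast)+
  then obtain f where f: "\<And>p. ok p (f p)" "\<And>p. step p (f p) (f (Suc p))" by blast
  have sub: "finite (fst (f p))" "fst (f p) \<subseteq> res_basis M p" for p using f(1)[of p] by (auto simp: ok_def)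
  have inR: "x \<in> mcar (res M p)" if "x \<in> mcar (?D (f p))" for x p
    using that sub(2)[of p] by (auto simp: dfree_simps res_def free_module_def simp del: res_basis.simps)
  have "free_resolution M (\<lambda>p. ?D (f p)) (\<lambda>p. snd (f p)) (\<lambda>p. fst (f p)) boundary (augmentation M)"
  proof (intro free_resolution.intro free_resolution_axioms.intro)
    show "gr_dmodule M" by (rule gr_dmodule_axioms)
    show "gr_dmap (?D (f (Suc p))) (?D (f p)) boundary" for p using f(2)[of p] by (simp add: step_def)
    show "gr_dmap (?D (f 0)) M (augmentation M)" using f(1)[of 0] by (simp add: ok_def)
    show "boundary (boundary x) = 0" if "x \<in> mcar (?D (f (Suc (Suc p))))" for x p
      by (rule boundary_boundary_res[OF inR[OF that]])
    show "augmentation M (boundary x) = 0" if "x \<in> mcar (?D (f (Suc 0)))" for x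
      using L.cycle_boundary[OF inR[OF that]] by (simp add: L.cycle_def)
    show "\<exists>h\<in>mcar (?D (f (Suc (Suc p)))). boundary h = x" if "x \<in> mcar (?D (f (Suc p)))" "boundary x = 0" for x p
      using f(2)[of "Suc p"] that by (simp add: step_def)
    show "\<exists>h\<in>mcar (?D (f (Suc 0))). boundary h = x" if "x \<in> mcar (?D (f 0))" "augmentation M x = 0" for x
      using f(2)[of 0] that by (simp add: step_def)
    show "\<exists>x\<in>mcar (?D (f 0)). augmentation M x = m" if "m \<in> mcar M" for m
      using f(1)[of 0] that by (simp add: ok_def)
  qed (rule refl)
  then show ?thesis using sub by (intro exI[of _ "\<lambda>p. snd (f p)"] exI[of _ "\<lambda>p. fst (f p)"]) simp
qed

text \<open>Four comparisons in a row: duality for the de Rham complex of \<open>M\<close>, the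
  double complex of the finite resolution, the passage from graded to all \<D>-linear maps on its
  finite bases, and the passage to the standard resolution.\<close>

theorem (in gr_dmodule) de_Rham_Ext:
  assumes fg: "finitely_generated M" and iso: "coord_space d \<cong>\<^sub>k H_dR M (int CARD('n) - int i)"
  shows "coord_space d \<cong>\<^sub>k Ext_D i M inv_module"
proof -
  obtain deg Bs where fr: "free_resolution M (\<lambda>p. dfree (deg p) (Bs p)) deg Bs boundary (augmentation M)"
    and B: "\<And>p. finite (Bs p)" "\<And>p. Bs p \<subseteq> res_basis M p"
    using finite_resolution[OF fg] by blast
  interpret F: free_resolution M "\<lambda>p. dfree (deg p) (Bs p)" deg Bs boundary "augmentation M" by (rule fr)
  interpret L: left_mod M by (rule left_mod.intro[OF left])
  interpret E: dop_subresolution M Bs "inv_module :: (('n, 'k) dop, _) grmod"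
  proof (intro dop_subresolution.intro subresolution.intro subresolution_axioms.intro dop_subresolution_axioms.intro)
    show "left_mod M" by (rule L.left_mod_axioms)
    show "Bs p \<subseteq> res_basis M p" for p by (rule B(2))
    show "Poly_Mapping.keys (boundary x) \<subseteq> Bs p" if "Poly_Mapping.keys x \<subseteq> Bs (Suc p)" for x p
      using gr_dmap.g_closed[OF F.bd_map[of p], of x] that by (simp add: dfree_simps)
    show "\<exists>y. Poly_Mapping.keys y \<subseteq> Bs (Suc p) \<and> boundary y = x"
      if "Poly_Mapping.keys x \<subseteq> Bs p" "L.cycle p x" for x p
      using F.aug_exact[of x] F.bd_exact[of x] that unfolding L.cycle_def by (cases p) (auto simp: dfree_simps)
    show "\<exists>x. Poly_Mapping.keys x \<subseteq> Bs 0 \<and> augmentation M x = m" if "m \<in> mcar M" for m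
      using F.aug_surj[OF that] by (auto simp: dfree_simps)
    show "left_module (inv_module :: (('n, 'k) dop, _) grmod)" by (rule inv_module_simps)
  qed
  have hom: "star_hom (dfree (deg p) (Bs p)) inv_module = lhom (free_module (Bs p)) (inv_module :: (('n, 'k) dop, _) grmod)" for p
    unfolding finite_free_lhom[OF B(1)[of p], symmetric] by (simp add: lhom_def dfree_simps free_module_def)
  have hd: "F.hom_diff p = E.precompose (mcar (free_module (Bs (Suc p))))" for p
    by (intro ext) (simp add: F.hom_diff_def E.precompose_def dfree_simps free_module_def)
  have sc: "hom_scale = E.sc" by (intro ext) (simp add: hom_scale_def)
  have "Ext_D i M inv_module = quotient_space E.sc
      {f \<in> lhom (res M i) inv_module. E.precompose (mcar (res M (Suc i))) f = 0}
      (case i of 0 \<Rightarrow> {0} | Suc j \<Rightarrow> E.precompose (mcar (res M i)) ` lhom (res M j) inv_module)"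
    unfolding Ext_D_def
    by (subst cohomology_nat) (auto simp: E.precompose_def[abs_def] nat_add_distrib fun_eq_iff split: nat.split)
  moreover have "coord_space d \<cong>\<^sub>k quotient_space E.sc
      {g \<in> lhom (free_module (Bs i)) inv_module. E.precompose (mcar (free_module (Bs (Suc i)))) g = 0}
      (case i of 0 \<Rightarrow> {0} | Suc j \<Rightarrow> E.precompose (mcar (free_module (Bs i))) ` lhom (free_module (Bs j)) inv_module)"
    using kspace_iso_trans[OF de_Rham_duality[OF iso] F.star_ext_cochains[of i], unfolded hom hd sc]
    by (cases i) simp_all
  ultimately show ?thesis using kspace_iso_trans[OF _ E.subresolution_Ext[of i]] by simp
qed

theorem theorem5p3:
  fixes M :: "(('n::{finite, linorder}, 'k::field_char_0) dop, 'm::ab_group_add) grmod"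
  assumes "graded_dmodule M"
  shows "(\<forall>i::nat. H_dR (matlis_dual M) (int i) \<cong>\<^sub>k star_Ext_D i M inv_module) \<and>
    (finitely_generated M \<and> (\<forall>j. fin_dim (H_dR M j)) \<longrightarrow>
      (\<forall>i::nat. fin_dim (Ext_D i M inv_module) \<and>
        kdim (H_dR M (int CARD('n) - int i)) = kdim (Ext_D i M inv_module)))"
proof -
  interpret gr_dmodule M by (rule gr_dmoduleI[OF assms])
  have "fin_dim (Ext_D i M inv_module) \<and> kdim (H_dR M (int CARD('n) - int i)) = kdim (Ext_D i M inv_module)"
    if fg: "finitely_generated M" and fin: "\<forall>j. fin_dim (H_dR M j)" for i
  proof -
    obtain d where d: "coord_space d \<cong>\<^sub>k H_dR M (int CARD('n) - int i)" using fin unfolding fin_dim_def by blast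
    have e: "coord_space d \<cong>\<^sub>k Ext_D i M inv_module" by (rule de_Rham_Ext[OF fg d])
    show ?thesis unfolding kdim_eq[OF d] kdim_eq[OF e] using e by (auto simp: fin_dim_def)
  qed
  with matlis_star_Ext show ?thesis by blast
qed

end
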